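(* Let $1<p<\infty$, $\ell\in\mathbb{N}$, $\alpha>0$ and $b\in H^{\infty,\ell}_\alpha$. (1) Let $\Lambda^\ell_{b,\alpha}$ be the Hankel bilinear form defined by $\Lambda^\ell_{b,\alpha}(f,g):=\langle fg,b\rangle^\ell_\alpha$ for $f,g\in E$. Then $\Lambda^\ell_{b,\alpha}$ extends to a bounded bilinear form on $F^{p,\ell}_\alpha\times F^{p',\ell}_\alpha$ if and only if $b\in F^{\infty,\ell}_{\alpha/2}$; likewise, $\Lambda^\ell_{b,\alpha}$ extends to a bounded bilinear form on $F^{1,\ell}_\alpha\times\mathfrak{f}^{\infty,\ell}_\alpha$ if and only if $b\in F^{\infty,\ell}_{\alpha/2}$. (2) The space $F^{\infty,\ell}_{\alpha/2}$ coincides with $P^\ell_\alpha(L^\infty)$ and also with the dual of $F^{1,\ell}_{2\alpha}$ with respect to the pairing $\langle\cdot,\cdot\rangle^\ell_\alpha$. (3) $F^{p,\ell}_\alpha\odot F^{p',\ell}_\alpha=F^{1,\ell}_\alpha\odot\mathfrak{f}^{\infty,\ell}_\alpha=F^{1,\ell}_\alpha\odot F^{\infty,\ell}_\alpha=F^{1,\ell}_{2\alpha}$.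
   Context: $\mathbb{N}=\{1,2,3,\dots\}$, $p'$ is the conjugate exponent of $p$, $\nu$ is Lebesgue measure on $\mathbb{C}$, $L^\infty=L^\infty(\mathbb{C},d\nu)$, $H(\mathbb{C})$ is the space of entire functions. For $\alpha>0$ and $\ell\in\mathbb{N}$: for $1\le p<\infty$, $L^{p,\ell}_\alpha$ is the space of measurable $f$ on $\mathbb{C}$ with $\|f\|_{L^{p,\ell}_\alpha}^p:=\int_{\mathbb{C}}|f(z)e^{-\alpha|z|^{2\ell}/2}|^p\,d\nu(z)<\infty$; $L^{\infty,\ell}_\alpha$ is the space of measurable $f$ with $\|f\|_{L^{\infty,\ell}_\alpha}:=\operatorname{ess\,sup}_{z\in\mathbb{C}}|f(z)|e^{-\alpha|z|^{2\ell}/2}<\infty$. For $1\le p\le\infty$, $F^{p,\ell}_\alpha:=H(\mathbb{C})\cap L^{p,\ell}_\alpha$ with the norm of $L^{p,\ell}_\alpha$. $\mathfrak{f}^{\infty,\ell}_\alpha:=\{f\in H(\mathbb{C}):\lim_{|z|\to\infty}|f(z)|e^{-\alpha|z|^{2\ell}/2}=0\}$, normed as a subspace of $F^{\infty,\ell}_\alpha$. $H^{\infty,\ell}_\alpha:=\{b\in H(\mathbb{C}):|b(z)|=O((1+|z|)^{2\ell-2}e^{\alpha|z|^{2\ell}/2})\}$. $E:=\{f\in H(\mathbb{C}):|f(z)|=O(e^{\beta|z|^\ell})\text{ for some }\beta>0\}$; it is closed under products and is a dense subspace of $F^{p,\ell}_\alpha$ ($1\le p<\infty$) and of $\mathfrak{f}^{\infty,\ell}_\alpha$,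 for every $\alpha>0$. The pairing is $\langle f,g\rangle^\ell_\alpha:=\int_{\mathbb{C}}f(z)\overline{g(z)}\,e^{-\alpha|z|^{2\ell}}\,d\nu(z)$. The Bergman kernel of $F^{2,\ell}_\alpha$ is $K^\ell_\alpha(z,w)=\frac{\ell\alpha^{1/\ell}}{\pi}\sum_{m=0}^\infty\frac{\alpha^{m/\ell}z^m\overline{w}^m}{\Gamma((m+1)/\ell)}$ and $P^\ell_\alpha f(z):=\int_{\mathbb{C}}K^\ell_\alpha(z,w)f(w)e^{-\alpha|w|^{2\ell}}d\nu(w)$. That $F^{\infty,\ell}_{\alpha/2}$ is the dual of $F^{1,\ell}_{2\alpha}$ with respect to $\langle\cdot,\cdot\rangle^\ell_\alpha$ means: for each $g\in F^{\infty,\ell}_{\alpha/2}$ the functional $f\mapsto\langle f,g\rangle^\ell_\alpha$, $f\in E$, extends to a bounded linear functional on $F^{1,\ell}_{2\alpha}$, and every bounded linear functional on $F^{1,\ell}_{2\alpha}$ arises in this way from a unique $g\in F^{\infty,\ell}_{\alpha/2}$, with norm equivalent to that of $g$. For two such spaces $X,Y$ of entire functions, the weak product $X\odot Y$ consists of all entire functions $h=\sum_{j=1}^\infty f_jg_j$ with $f_j\in X$, $g_j\in Y$ such that $\|h\|_{X\odot Y}:=\inf\{\sum_{j=1}^\infty\|f_j\|_X\|g_j\|_Y:h=\sum_{j=1}^\infty f_jg_j\}<\infty$. *)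

theory Defs
  imports
    "HOL-Analysis.Analysis"
    "HOL-Library.Landau_Symbols"
    "HOL-Probability.Essential_Supremum"
begin

text \<open>A space of functions on the complex plane together with its norm. The value of
  \<open>nrm X\<close> outside \<open>elts X\<close> carries no meaning.\<close>

record fspace =
  elts :: "(complex \<Rightarrow> complex) set"
  nrm :: "(complex \<Rightarrow> complex) \<Rightarrow> real"

definition weighted :: "nat \<Rightarrow> real \<Rightarrow> (complex \<Rightarrow> complex) \<Rightarrow> complex \<Rightarrow> real" where
  "weighted l \<alpha> f z = cmod (f z) * exp (- \<alpha> * cmod z ^ (2 * l) / 2)"

text \<open>The exponent \<open>p\<close> is meant to range over \<open>1 \<le> p \<le> \<infinity>\<close>. Finite exponents are real powers
  (\<open>0 powr p = 0\<close>).\<close>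

definition L_space :: "ereal \<Rightarrow> nat \<Rightarrow> real \<Rightarrow> fspace" where
  "L_space p l \<alpha> =
    (if p = \<infinity> then
       \<lparr> elts = {f \<in> borel_measurable lebesgue.
                   esssup lebesgue (\<lambda>z. ereal (weighted l \<alpha> f z)) < \<infinity>},
         nrm = (\<lambda>f. real_of_ereal (esssup lebesgue (\<lambda>z. ereal (weighted l \<alpha> f z)))) \<rparr>
     else
       \<lparr> elts = {f \<in> borel_measurable lebesgue.
                   integrable lebesgue (\<lambda>z. weighted l \<alpha> f z powr real_of_ereal p)},
         nrm = (\<lambda>f. (LINT z|lebesgue. weighted l \<alpha> f z powr real_of_ereal p)
                      powr (1 / real_of_ereal p)) \<rparr>)"

definition entire :: "(complex \<Rightarrow> complex) set" where
  "entire = {f. f holomorphic_on UNIV}"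

definition F_space :: "ereal \<Rightarrow> nat \<Rightarrow> real \<Rightarrow> fspace" where
  "F_space p l \<alpha> =
    \<lparr> elts = entire \<inter> elts (L_space p l \<alpha>), nrm = nrm (L_space p l \<alpha>) \<rparr>"

definition f_inf_space :: "nat \<Rightarrow> real \<Rightarrow> fspace" where
  "f_inf_space l \<alpha> =
    \<lparr> elts = {f \<in> entire. (weighted l \<alpha> f \<longlongrightarrow> 0) at_infinity},
      nrm = nrm (F_space \<infinity> l \<alpha>) \<rparr>"

definition H_inf :: "nat \<Rightarrow> real \<Rightarrow> (complex \<Rightarrow> complex) set" where
  "H_inf l \<alpha> = {b \<in> entire. (\<lambda>z. cmod (b z)) \<in>
      O[at_infinity](\<lambda>z. (1 + cmod z) ^ (2 * l - 2) * exp (\<alpha> * cmod z ^ (2 * l) / 2))}"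

definition E_class :: "nat \<Rightarrow> (complex \<Rightarrow> complex) set" where
  "E_class l = {f \<in> entire. \<exists>\<beta>>0. (\<lambda>z. cmod (f z)) \<in>
      O[at_infinity](\<lambda>z. exp (\<beta> * cmod z ^ l))}"

definition L_inf :: "(complex \<Rightarrow> complex) set" where
  "L_inf = {f \<in> borel_measurable lebesgue. esssup lebesgue (\<lambda>z. ereal (cmod (f z))) < \<infinity>}"

definition pairing :: "nat \<Rightarrow> real \<Rightarrow> (complex \<Rightarrow> complex) \<Rightarrow> (complex \<Rightarrow> complex) \<Rightarrow> complex" where
  "pairing l \<alpha> f g =
    (LINT z|lebesgue. f z * cnj (g z) * of_real (exp (- \<alpha> * cmod z ^ (2 * l))))"

definition bergman_kernel :: "nat \<Rightarrow> real \<Rightarrow> complex \<Rightarrow> complex \<Rightarrow> complex" where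
  "bergman_kernel l \<alpha> z w =
    of_real (real l * \<alpha> powr (1 / real l) / pi) *
    (\<Sum>m. of_real (\<alpha> powr (real m / real l)) * z ^ m * cnj w ^ m /
          of_real (Gamma ((real m + 1) / real l)))"

definition bergman_proj :: "nat \<Rightarrow> real \<Rightarrow> (complex \<Rightarrow> complex) \<Rightarrow> complex \<Rightarrow> complex" where
  "bergman_proj l \<alpha> f z =
    (LINT w|lebesgue. bergman_kernel l \<alpha> z w * f w * of_real (exp (- \<alpha> * cmod w ^ (2 * l))))"

definition hankel_form ::
    "nat \<Rightarrow> real \<Rightarrow> (complex \<Rightarrow> complex) \<Rightarrow> (complex \<Rightarrow> complex) \<Rightarrow> (complex \<Rightarrow> complex) \<Rightarrow> complex" where
  "hankel_form l \<alpha> b f g = pairing l \<alpha> (\<lambda>z. f z * g z) b"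

definition linear_form_on ::
    "(complex \<Rightarrow> complex) set \<Rightarrow> ((complex \<Rightarrow> complex) \<Rightarrow> complex) \<Rightarrow> bool" where
  "linear_form_on V u \<longleftrightarrow>
    (\<forall>f\<in>V. \<forall>g\<in>V. u (\<lambda>z. f z + g z) = u f + u g) \<and>
    (\<forall>c. \<forall>f\<in>V. u (\<lambda>z. c * f z) = c * u f)"

definition bounded_functional :: "fspace \<Rightarrow> ((complex \<Rightarrow> complex) \<Rightarrow> complex) \<Rightarrow> bool" where
  "bounded_functional X u \<longleftrightarrow>
    linear_form_on (elts X) u \<and> (\<exists>C. \<forall>f\<in>elts X. cmod (u f) \<le> C * nrm X f)"

definition functional_norm :: "fspace \<Rightarrow> ((complex \<Rightarrow> complex) \<Rightarrow> complex) \<Rightarrow> real" where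
  "functional_norm X u = (SUP f\<in>{f \<in> elts X. nrm X f \<le> 1}. cmod (u f))"

definition bounded_bilinear_form ::
    "fspace \<Rightarrow> fspace \<Rightarrow> ((complex \<Rightarrow> complex) \<Rightarrow> (complex \<Rightarrow> complex) \<Rightarrow> complex) \<Rightarrow> bool" where
  "bounded_bilinear_form X Y B \<longleftrightarrow>
    (\<forall>g\<in>elts Y. linear_form_on (elts X) (\<lambda>f. B f g)) \<and>
    (\<forall>f\<in>elts X. linear_form_on (elts Y) (B f)) \<and>
    (\<exists>C. \<forall>f\<in>elts X. \<forall>g\<in>elts Y. cmod (B f g) \<le> C * nrm X f * nrm Y g)"

definition extends_to_bounded_bilinear_form ::
    "(complex \<Rightarrow> complex) set \<Rightarrow> ((complex \<Rightarrow> complex) \<Rightarrow> (complex \<Rightarrow> complex) \<Rightarrow> complex)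
      \<Rightarrow> fspace \<Rightarrow> fspace \<Rightarrow> bool" where
  "extends_to_bounded_bilinear_form D T X Y \<longleftrightarrow>
    (\<exists>B. bounded_bilinear_form X Y B \<and> (\<forall>f\<in>D. \<forall>g\<in>D. B f g = T f g))"

definition represents ::
    "(complex \<Rightarrow> complex) set \<Rightarrow> ((complex \<Rightarrow> complex) \<Rightarrow> (complex \<Rightarrow> complex) \<Rightarrow> complex)
      \<Rightarrow> ((complex \<Rightarrow> complex) \<Rightarrow> complex) \<Rightarrow> (complex \<Rightarrow> complex) \<Rightarrow> bool" where
  "represents D P u g \<longleftrightarrow> (\<forall>f\<in>D. u f = P f g)"

text \<open>\<open>Y\<close> is the dual of \<open>X\<close> with respect to the pairing \<open>P\<close>, where \<open>P f g\<close> is considered only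
  for \<open>f\<close> in \<open>D\<close>.\<close>

definition is_dual_wrt ::
    "(complex \<Rightarrow> complex) set \<Rightarrow> ((complex \<Rightarrow> complex) \<Rightarrow> (complex \<Rightarrow> complex) \<Rightarrow> complex)
      \<Rightarrow> fspace \<Rightarrow> fspace \<Rightarrow> bool" where
  "is_dual_wrt D P Y X \<longleftrightarrow>
    (\<forall>g\<in>elts Y. \<exists>u. bounded_functional X u \<and> represents D P u g) \<and>
    (\<forall>u. bounded_functional X u \<longrightarrow> (\<exists>!g. g \<in> elts Y \<and> represents D P u g)) \<and>
    (\<exists>c>0. \<exists>C>0. \<forall>u. \<forall>g\<in>elts Y. bounded_functional X u \<and> represents D P u g \<longrightarrow>
       c * nrm Y g \<le> functional_norm X u \<and> functional_norm X u \<le> C * nrm Y g)"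

text \<open>The series \<open>\<Sum>j. f j * g j\<close> is required to converge pointwise. The infimum is taken in
  \<^typ>\<open>ennreal\<close>, so it is \<open>\<infinity>\<close> if there is no representation.\<close>

definition weak_product_enorm :: "fspace \<Rightarrow> fspace \<Rightarrow> (complex \<Rightarrow> complex) \<Rightarrow> ennreal" where
  "weak_product_enorm X Y h =
    Inf {(\<Sum>j. ennreal (nrm X (f j) * nrm Y (g j))) | f g.
           (\<forall>j. f j \<in> elts X) \<and> (\<forall>j. g j \<in> elts Y) \<and>
           (\<forall>z. (\<lambda>j::nat. f j z * g j z) sums h z)}"

definition weak_product :: "fspace \<Rightarrow> fspace \<Rightarrow> fspace"  (infixl "\<odot>" 70) where
  "X \<odot> Y =
    \<lparr> elts = {h \<in> entire. weak_product_enorm X Y h < \<infinity>},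
      nrm = (\<lambda>h. enn2real (weak_product_enorm X Y h)) \<rparr>"

text \<open>Spaces of functions are identified when they have the same elements and equivalent norms.\<close>

definition same_space :: "fspace \<Rightarrow> fspace \<Rightarrow> bool"  (infix "\<doteq>" 50) where
  "X \<doteq> Y \<longleftrightarrow>
    elts X = elts Y \<and>
    (\<exists>c>0. \<exists>C>0. \<forall>h\<in>elts X. c * nrm X h \<le> nrm Y h \<and> nrm Y h \<le> C * nrm X h)"

end

theory Submission
  imports Defs "HOL-Complex_Analysis.Complex_Analysis" "HOL-Computational_Algebra.Fundamental_Theorem_Algebra"
begin

text \<open>Everything follows from one estimate for the Bergman kernel. Fix two spaces \<open>X\<close>,
\<open>Y\<close> such that Hoelder's inequality maps \<open>X\<close> times \<open>Y\<close> into
\<open>F_space 1 l (2 * \<alpha>)\<close>. A seminorm \<open>N\<close> on the class \<open>E\<close> is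
called controlled by a constant \<open>M\<close> if \<open>N (\<lambda>z. f z * g z) \<le> M * (nrm X f *
nrm Y g)\<close> and if \<open>N\<close> is bounded on Taylor series by weighted absolute sums of the
coefficients. The estimate (\<open>kernel_bound\<close>) says that a controlled \<open>N\<close> is at
most a constant times \<open>M * exp (\<alpha> / 4 * cmod z ^ (2 * l))\<close> at the kernel with
parameter \<open>z\<close>. Since a polynomial \<open>h\<close> is an average of kernels, \<open>N
h\<close> is then at most a constant times \<open>M * nrm (F_space 1 l (2 * \<alpha>)) h\<close>
(\<open>polynomial_bound\<close>).

Three choices of \<open>N\<close> give the theorem. If \<open>N h\<close> is the modulus of the pairing
of \<open>h\<close> with \<open>b\<close>, then \<open>N\<close> at the kernel with parameter
\<open>z\<close> is \<open>cmod (b z)\<close> and \<open>N\<close> is controlled when the Hankel form of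
\<open>b\<close> is bounded; so \<open>b\<close> has the growth that defines \<open>F_space \<infinity> l
(\<alpha> / 2)\<close>. If \<open>N\<close> is the norm of \<open>F_space 1 l (2 * \<alpha>)\<close>, the
estimate bounds the norms of the kernels, from which a bounded functional \<open>u\<close> gets the
symbol \<open>\<lambda>z. cnj (u (kernel_at l \<alpha> z))\<close> and the Bergman projection maps
\<open>L_inf\<close> into \<open>F_space \<infinity> l (\<alpha> / 2)\<close>. If \<open>N\<close> is the
norm of the weak product, then polynomials, and by density all of \<open>F_space 1 l (2 *
\<alpha>)\<close>, lie in the weak product with norm control; the opposite inclusion is Hoelder's
inequality.

The kernel estimate comes from writing the kernel as an average of products. Its Taylor coefficients are
multiples of \<open>1 / Gamma ((m + 1) / l)\<close>. On a residue class \<open>m = l * i + r'\<close>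
this is a constant times \<open>1 / fact i\<close> times a Beta integral over \<open>t\<close> in \<open>{0..1}\<close>, so
the corresponding part of the kernel is an integral over \<open>t\<close> of functions \<open>(w * cnj z)
^ k * exp (\<alpha> * t * (w * cnj z) ^ l)\<close>. Splitting the exponential into two equal square roots
writes such a function as a product of two atoms. The weighted modulus of an atom is \<open>cmod w ^ j *
exp (- \<alpha> / 2 * (cmod (w ^ l - \<zeta> ^ l))\<^sup>2)\<close> up to a factor that does not depend
on \<open>w\<close>, where \<open>\<zeta> ^ l\<close> is \<open>t / 2 * z ^ l\<close>. Near each of the
\<open>l\<close> roots this looks like a Gaussian of width \<open>cmod \<zeta> powr (1 - l)\<close>,
which gives the norms of the atoms in every space. The powers of \<open>cmod z\<close> obtained in this
way add up, by \<open>1 / p + 1 / q = 1\<close>, to exactly the power that the Laplace integral over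
\<open>t\<close> gains at its endpoint \<open>t = 1\<close>, and \<open>exp (\<alpha> / 4 * cmod z ^ (2 *
l))\<close> is left. Because a controlled seminorm need not be continuous for any topology in which the
integrals converge, an average is compared with Riemann sums, coefficient by coefficient
(\<open>controlled_integral\<close>).

For \<open>f\<close> in \<open>F_space 1 l (2 * \<alpha>)\<close> and \<open>g\<close> in \<open>F_space
\<infinity> l (\<alpha> / 2)\<close> the integral that defines the pairing need not converge absolutely.
Dilating \<open>g\<close> by \<open>2 powr (1 / l)\<close> multiplies the \<open>m\<close>-th Taylor
coefficient, up to one constant factor for all \<open>m\<close>, by the quotient of the moments of the
weights at \<open>\<alpha>\<close> and \<open>2 * \<alpha>\<close>; the pairing on \<open>E\<close> is
therefore equal to an absolutely convergent integral (\<open>dual_functional\<close>). This proves the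
sufficiency in the criterion for Hankel forms, one half of the duality, and that every \<open>g\<close>
in \<open>F_space \<infinity> l (\<alpha> / 2)\<close> is the projection of an explicit bounded function.\<close>

section \<open>Integration over the complex plane\<close>

lemma powr_power_eq: "x > 0 \<Longrightarrow> (x powr a) ^ n = x powr (a * real n)" for x :: real
  by (simp add: powr_realpow[symmetric] powr_powr)

lemma borel_measurable_cnj [measurable]: "cnj \<in> borel_measurable borel"
  by (intro borel_measurable_continuous_onI continuous_intros)

lemma borel_measurable_complex_of_real [measurable]:
  "complex_of_real \<in> borel_measurable borel"
  by (intro borel_measurable_continuous_onI continuous_intros)

text \<open>Uniqueness of Haar measure, by the usual double count: integrate the indicator of \<open>{(x, y). x \<in> A
\<and> x + y \<in> B}\<close> against \<open>M\<close> and \<open>lborel\<close> in both orders.\<close>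
lemma translation_invariant_measure_proportional:
  fixes M :: "'a::euclidean_space measure"
  assumes sets: "sets M = sets borel" and fin: "sigma_finite_measure M"
    and inv: "\<And>x. distr M borel ((+) x) = M"
    and A: "A \<in> sets borel" and B: "B \<in> sets borel"
  shows "emeasure M A * emeasure lborel B = emeasure lborel A * emeasure M B"
proof -
  interpret M: sigma_finite_measure M by (rule fin)
  interpret P: pair_sigma_finite M lborel ..
  note [measurable_cong] = sets
  note [measurable] = A B
  have refl: "(\<integral>\<^sup>+y. f (x - y) \<partial>lborel) = (\<integral>\<^sup>+y. f y \<partial>lborel)"
    if [measurable]: "f \<in> borel_measurable borel" for f and x :: 'a
    by (subst (2) lborel_affine[of "-1" x])
      (simp_all add: nn_integral_density nn_integral_distr)
  have shift: "(\<integral>\<^sup>+y. f (x + y) \<partial>lborel) = (\<integral>\<^sup>+y. f y \<partial>lborel)"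
    if [measurable]: "f \<in> borel_measurable borel" for f and x :: 'a
    by (subst (2) lborel_affine[of "1" x])
      (simp_all add: nn_integral_density nn_integral_distr)
  have "emeasure M A * emeasure lborel B
      = (\<integral>\<^sup>+x. indicator A x * (\<integral>\<^sup>+y. indicator B (x + y) \<partial>lborel) \<partial>M)"
    using shift[of "indicator B"] by (simp add: nn_integral_multc)
  also have "\<dots> = (\<integral>\<^sup>+x. (\<integral>\<^sup>+y. indicator A x * indicator B (x + y) \<partial>lborel) \<partial>M)"
    by (simp add: nn_integral_cmult)
  also have "\<dots> = (\<integral>\<^sup>+y. (\<integral>\<^sup>+x. indicator A x * indicator B (x + y) \<partial>M) \<partial>lborel)"
    by (rule P.Fubini'[symmetric]) measurable
  also have "\<dots> = (\<integral>\<^sup>+y. (\<integral>\<^sup>+x. indicator A (x - y) * indicator B x \<partial>M) \<partial>lborel)"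
  proof (rule nn_integral_cong)
    fix y :: 'a
    have "(\<integral>\<^sup>+x. indicator A (x - y) * indicator B x \<partial>M)
       = (\<integral>\<^sup>+x. indicator A (x - y) * indicator B x \<partial>distr M borel ((+) y))"
      by (simp add: inv)
    also have "\<dots> = (\<integral>\<^sup>+x. indicator A x * indicator B (x + y) \<partial>M)"
      by (subst nn_integral_distr) (simp_all add: add.commute)
    finally show "(\<integral>\<^sup>+x. indicator A x * indicator B (x + y) \<partial>M)
      = (\<integral>\<^sup>+x. indicator A (x - y) * indicator B x \<partial>M)" ..
  qed
  also have "\<dots> = (\<integral>\<^sup>+x. (\<integral>\<^sup>+y. indicator A (x - y) * indicator B x \<partial>lborel) \<partial>M)"
    by (rule P.Fubini') measurable
  also have "\<dots> = (\<integral>\<^sup>+x. emeasure lborel A * indicator B x \<partial>M)"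
    using refl[of "indicator A"] by (simp add: nn_integral_multc)
  also have "\<dots> = emeasure lborel A * emeasure M B"
    by (simp add: nn_integral_cmult)
  finally show ?thesis .
qed

text \<open>The rotated measure is again translation invariant, and it gives the unit disc the same mass.\<close>
lemma lborel_distr_rotation:
  assumes u: "cmod u = 1"
  shows "distr lborel borel ((*) u) = (lborel :: complex measure)"
proof -
  define M where "M = distr lborel borel ((*) u)"
  have u0: "u \<noteq> 0" using u by auto
  have sM: "sets M = sets borel" by (simp add: M_def)
  have em: "emeasure M X = emeasure lborel ((*) u -` X)" if "X \<in> sets borel" for X
    using that by (simp add: M_def emeasure_distr)
  have ballinv: "(*) u -` ball 0 r = ball 0 r" for r
    by (auto simp: norm_mult u)
  have sf: "sigma_finite_measure M"
  proof
    have "emeasure M (ball 0 (real n)) \<noteq> \<infinity>" for n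
      using emeasure_lborel_ball_finite[of "0::complex" "real n"] by (simp add: em ballinv)
    moreover have "(\<Union>n. ball 0 (real n)) = (UNIV :: complex set)"
      by (auto simp: reals_Archimedean2)
    ultimately show "\<exists>A. countable A \<and> A \<subseteq> sets M \<and> \<Union> A = space M \<and> (\<forall>a\<in>A. emeasure M a \<noteq> \<infinity>)"
      by (intro exI[of _ "range (\<lambda>n. ball 0 (real n))"]) (auto simp: sM M_def)
  qed
  have inv: "distr M borel ((+) x) = M" for x
  proof -
    have "distr M borel ((+) x) = distr lborel borel ((*) u \<circ> (+) (x / u))"
      unfolding M_def
      by (subst distr_distr) (use u0 in \<open>auto simp: o_def field_simps intro!: distr_cong\<close>)
    also have "\<dots> = distr (distr lborel borel ((+) (x / u))) borel ((*) u)"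
      by (subst distr_distr) auto
    also have "\<dots> = M" by (simp add: M_def lborel_distr_plus)
    finally show ?thesis .
  qed
  have "emeasure M X = emeasure lborel X" if X: "X \<in> sets borel" for X
  proof -
    have eq: "emeasure M X * emeasure lborel (ball (0::complex) 1) = emeasure lborel X * emeasure M (ball 0 1)"
      using translation_invariant_measure_proportional[OF sM sf inv X, of "ball 0 1"] by simp
    have b: "emeasure lborel (ball (0::complex) 1) = ennreal pi"
      by (simp add: emeasure_ball unit_ball_vol_2)
    then have b': "emeasure M (ball 0 1) = ennreal pi"
      by (simp add: em ballinv)
    show ?thesis
      using eq pi_gt_zero by (simp add: b b' mult_right_ennreal_cancel)
  qed
  then show ?thesis
    unfolding M_def[symmetric] by (intro measure_eqI) (auto simp: sM)
qed

lemma integral_rotate: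
  fixes f :: "complex \<Rightarrow> 'b::{banach, second_countable_topology}"
  assumes "cmod u = 1" and [measurable]: "f \<in> borel_measurable borel"
  shows "(LINT z|lborel. f (u * z)) = (LINT z|lborel. f z)"
  by (subst (2) lborel_distr_rotation[OF assms(1), symmetric])
    (simp add: integral_distr)

lemma
  fixes f :: "complex \<Rightarrow> 'b::{banach, second_countable_topology}"
  assumes c: "c > 0" and [measurable]: "f \<in> borel_measurable borel"
  shows integrable_dilate: "integrable lborel (\<lambda>z. f (of_real c * z)) \<longleftrightarrow> integrable lborel f"
    and integral_dilate: "(LINT z|lborel. f (of_real c * z)) = (1 / c\<^sup>2) *\<^sub>R (LINT z|lborel. f z)"
proof -
  have eq: "lborel = density (distr lborel borel (\<lambda>z::complex. of_real c * z)) (\<lambda>_. ennreal (c\<^sup>2))"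
    using lborel_affine[of c "0::complex"] c by (simp add: scaleR_conv_of_real ennreal_power)
  show "integrable lborel (\<lambda>z. f (of_real c * z)) \<longleftrightarrow> integrable lborel f"
    using c integrable_scaleR_right[of "1 / c\<^sup>2" lborel "\<lambda>z. c\<^sup>2 *\<^sub>R f (complex_of_real c * z)"]
    by (subst (2) eq) (auto simp add: integrable_density integrable_distr_eq)
  have "(LINT z|lborel. f z) = c\<^sup>2 *\<^sub>R (LINT z|lborel. f (of_real c * z))"
    using c by (subst eq) (simp add: integral_density integral_distr)
  then show "(LINT z|lborel. f (of_real c * z)) = (1 / c\<^sup>2) *\<^sub>R (LINT z|lborel. f z)"
    using c by simp
qed

lemma
  fixes f :: "'a::euclidean_space \<Rightarrow> 'b::{banach, second_countable_topology}"
  assumes [measurable]: "f \<in> borel_measurable borel"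
  shows integrable_translate: "integrable lborel (\<lambda>z. f (z - a)) \<longleftrightarrow> integrable lborel f"
    and integral_translate: "(LINT z|lborel. f (z - a)) = (LINT z|lborel. f z)"
proof -
  have eq: "distr lborel borel (\<lambda>z. z - a) = lborel"
  proof -
    have "(\<lambda>z. z - a) = (+) (- a)" by auto
    then show ?thesis by (simp only: lborel_distr_plus)
  qed
  show "integrable lborel (\<lambda>z. f (z - a)) \<longleftrightarrow> integrable lborel f"
    by (subst (2) eq[symmetric]) (simp add: integrable_distr_eq)
  show "(LINT z|lborel. f (z - a)) = (LINT z|lborel. f z)"
    by (subst (2) eq[symmetric]) (simp add: integral_distr)
qed

lemma monomials_orthogonal:
  fixes \<psi> :: "real \<Rightarrow> real"
  assumes [measurable]: "\<psi> \<in> borel_measurable borel" and "m \<noteq> n"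
  shows "(LINT z|lborel. z ^ m * cnj z ^ n * of_real (\<psi> (cmod z))) = 0"
proof -
  \<comment> \<open>Rotation by this angle changes the sign of the integrand.\<close>
  define u where "u = cis (pi / (real m - real n))"
  have u: "cmod u = 1" by (simp add: u_def)
  have "u ^ m * cnj u ^ n = cis (real m * (pi / (real m - real n)) - real n * (pi / (real m - real n)))"
    unfolding u_def cis_cnj Complex.DeMoivre cis_mult by (simp add: cis_mult)
  also have "real m * (pi / (real m - real n)) - real n * (pi / (real m - real n))
      = (real m - real n) * (pi / (real m - real n))"
    by (rule left_diff_distrib[symmetric])
  also have "\<dots> = pi"
    using \<open>m \<noteq> n\<close> by simp
  finally have um: "u ^ m * cnj u ^ n = -1" by simp
  let ?F = "\<lambda>z. z ^ m * cnj z ^ n * of_real (\<psi> (cmod z))"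
  have "(LINT z|lborel. ?F z) = (LINT z|lborel. ?F (u * z))"
    by (rule integral_rotate[OF u, symmetric]) measurable
  also have "\<dots> = (LINT z|lborel. - ?F z)"
  proof (rule Bochner_Integration.integral_cong)
    fix z
    have "?F (u * z) = (u ^ m * cnj u ^ n) * ?F z"
      by (simp add: power_mult_distrib norm_mult u)
    then show "?F (u * z) = - ?F z" by (simp add: um)
  qed simp
  finally show ?thesis by simp
qed

section \<open>Radial moments\<close>

text \<open>The preimage of \<open>{..x}\<close> is a disc of area \<open>pi * (x / \<gamma>) powr (1 / l)\<close>. This turns
radial moments into Gamma integrals without polar coordinates.\<close>
lemma distr_power_of_norm:
  assumes l: "l \<ge> 1" and g: "\<gamma> > 0"
  shows "distr lborel borel (\<lambda>z::complex. \<gamma> * cmod z ^ (2 * l))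
    = density lborel (\<lambda>s. ennreal (indicator {0..} s * (pi / l * \<gamma> powr (- 1 / l) * s powr (1 / l - 1))))"
    (is "?M = ?N")
proof (rule measure_eqI_generator_eq[of "range (\<lambda>x::real. {..x})" UNIV _ _ "\<lambda>i. {..real i}"])
  show "Int_stable (range (\<lambda>x::real. {..x}))"
    by (auto simp: Int_stable_def)
  show "sets ?M = sigma_sets UNIV (range (\<lambda>x::real. {..x}))"
    "sets ?N = sigma_sets UNIV (range (\<lambda>x::real. {..x}))"
    by (simp_all add: borel_eq_atMost)
  have M: "emeasure ?M {..x} = ennreal (if x \<ge> 0 then pi * (x / \<gamma>) powr (1 / l) else 0)" for x
  proof -
    have "emeasure ?M {..x} = emeasure lborel {z::complex. \<gamma> * cmod z ^ (2 * l) \<le> x}"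
      by (subst emeasure_distr) (auto simp: vimage_def)
    also have "\<dots> = ennreal (if x \<ge> 0 then pi * (x / \<gamma>) powr (1 / l) else 0)"
    proof (cases "x \<ge> 0")
      case True
      define r where "r = (x / \<gamma>) powr (1 / (2 * l))"
      have r0: "r \<ge> 0" by (simp add: r_def)
      have rp: "r ^ (2 * l) = x / \<gamma>"
      proof (cases "x = 0")
        case False
        then have "x / \<gamma> > 0" using True g by simp
        then show ?thesis using l g True by (simp add: r_def abs_of_pos g powr_power_eq)
      qed (use l in \<open>simp add: r_def\<close>)
      have "{z::complex. \<gamma> * cmod z ^ (2 * l) \<le> x} = cball 0 r"
      proof -
        have "\<gamma> * cmod z ^ (2 * l) \<le> x \<longleftrightarrow> cmod z \<le> r" for z
        proof -
          have "\<gamma> * cmod z ^ (2 * l) \<le> x \<longleftrightarrow> cmod z ^ (2 * l) \<le> x / \<gamma>"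
            using g by (simp add: pos_le_divide_eq mult.commute)
          also have "\<dots> \<longleftrightarrow> cmod z ^ (2 * l) \<le> r ^ (2 * l)"
            by (simp only: rp)
          also have "\<dots> \<longleftrightarrow> cmod z \<le> r"
            using l r0 by (subst power_mono_iff) auto
          finally show ?thesis .
        qed
        then show ?thesis by (simp only: cball_def dist_norm) (simp only: diff_0 norm_minus_cancel)
      qed
      moreover have "r\<^sup>2 = (x / \<gamma>) powr (1 / l)"
      proof (cases "x = 0")
        case False
        then have "x / \<gamma> > 0" using True g by simp
        then show ?thesis using l g True by (simp add: r_def abs_of_pos g powr_power_eq)
      qed (use l in \<open>simp add: r_def\<close>)
      ultimately show ?thesis
        using True r0 by (simp add: emeasure_cball unit_ball_vol_2)
    next
      case False
      then have "{z::complex. \<gamma> * cmod z ^ (2 * l) \<le> x} = {}"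
      proof -
        have "0 \<le> \<gamma> * cmod z ^ (2 * l)" for z :: complex using g by simp
        with False show ?thesis by (smt (verit, best) empty_Collect_eq)
      qed
      with False show ?thesis by simp
    qed
    finally show ?thesis .
  qed
  have N: "emeasure ?N {..x} = ennreal (if x \<ge> 0 then pi * (x / \<gamma>) powr (1 / l) else 0)" for x
  proof (cases "x \<ge> 0")
    case True
    have hi: "((\<lambda>s. s powr (1 / l - 1)) has_integral (x powr (1 / l - 1 + 1) / (1 / l - 1 + 1))) {0..x}"
      using True l by (intro has_integral_powr_from_0) auto
    have "((\<lambda>s. pi / l * \<gamma> powr (- 1 / l) * s powr (1 / l - 1)) has_integral
        (pi / l * \<gamma> powr (- 1 / l) * (x powr (1 / l - 1 + 1) / (1 / l - 1 + 1)))) {0..x}"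
      by (rule has_integral_mult_right[OF hi])
    also have "pi / l * \<gamma> powr (- 1 / l) * (x powr (1 / l - 1 + 1) / (1 / l - 1 + 1))
        = pi * (x / \<gamma>) powr (1 / l)"
      using l g True by (simp add: powr_divide powr_minus field_simps)
    finally have hi2: "((\<lambda>s. pi / l * \<gamma> powr (- 1 / l) * s powr (1 / l - 1)) has_integral
        (pi * (x / \<gamma>) powr (1 / l))) {0..x}" .
    have "emeasure ?N {..x} = (\<integral>\<^sup>+s. ennreal (indicator {0..} s * (pi / l * \<gamma> powr (- 1 / l) * s powr (1 / l - 1))) * indicator {..x} s \<partial>lborel)"
      by (subst emeasure_density) auto
    also have "\<dots> = (\<integral>\<^sup>+s. ennreal (pi / l * \<gamma> powr (- 1 / l) * s powr (1 / l - 1)) * indicator {0..x} s \<partial>lborel)"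
      by (intro nn_integral_cong) (auto simp: indicator_def)
    also have "\<dots> = ennreal (pi * (x / \<gamma>) powr (1 / l))"
      by (intro nn_integral_has_integral_lebesgue' hi2) (auto)
    finally show ?thesis using True by simp
  next
    case False
    have "emeasure ?N {..x} = (\<integral>\<^sup>+s. ennreal (indicator {0..} s * (pi / l * \<gamma> powr (- 1 / l) * s powr (1 / l - 1))) * indicator {..x} s \<partial>lborel)"
      by (subst emeasure_density) auto
    also have "\<dots> = (\<integral>\<^sup>+s. 0 \<partial>(lborel :: real measure))"
      by (rule nn_integral_cong) (use False in \<open>auto simp: indicator_def\<close>)
    finally show ?thesis using False by simp
  qed
  show "emeasure ?M X = emeasure ?N X" if "X \<in> range (\<lambda>x::real. {..x})" for X
    using that M N by auto
  show "emeasure ?M {..real i} \<noteq> \<infinity>" for i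
    by (simp add: M)
  show "(\<Union>i. {..real i}) = UNIV"
    by (auto simp: real_arch_simple)
qed auto

lemma norm_moment:
  assumes l: "l \<ge> 1" and g: "\<gamma> > 0"
  shows "has_bochner_integral lborel (\<lambda>z::complex. cmod z ^ m * exp (- \<gamma> * cmod z ^ (2 * l)))
    (pi / l * \<gamma> powr (- (real m + 2) / (2 * l)) * Gamma ((real m + 2) / (2 * l)))"
proof (rule has_bochner_integral_nn_integral)
  let ?G = "\<lambda>s::real. (s / \<gamma>) powr (m / (2 * l)) * exp (- s)"
  let ?c = "pi / l * \<gamma> powr (- (real m + 2) / (2 * l))"
  let ?x = "(real m + 2) / (2 * l)"
  have x0: "?x > 0" using l by simp
  have "(\<integral>\<^sup>+z. ennreal (cmod z ^ m * exp (- \<gamma> * cmod z ^ (2 * l))) \<partial>lborel)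
      = (\<integral>\<^sup>+z. ennreal (?G (\<gamma> * cmod z ^ (2 * l))) \<partial>lborel)"
  proof (rule nn_integral_cong_AE)
    have "AE z::complex in lborel. z \<noteq> 0"
      by (rule AE_lborel_singleton)
    then show "AE z::complex in lborel. ennreal (cmod z ^ m * exp (- \<gamma> * cmod z ^ (2 * l))) =
        ennreal (?G (\<gamma> * cmod z ^ (2 * l)))"
    proof eventually_elim
      case (elim z)
      have "(cmod z ^ (2 * l)) powr (m / (2 * l)) = (cmod z powr (2 * l)) powr (m / (2 * l))"
        using elim by (subst powr_realpow) auto
      also have "\<dots> = cmod z ^ m"
        using elim l by (simp add: powr_powr powr_realpow)
      finally show ?case using g by simp
    qed
  qed
  also have "\<dots> = (\<integral>\<^sup>+s. ennreal (?G s) \<partial>distr lborel borel (\<lambda>z::complex. \<gamma> * cmod z ^ (2 * l)))"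
    by (subst nn_integral_distr) auto
  also have "\<dots> = (\<integral>\<^sup>+s. ennreal (indicator {0..} s * (pi / l * \<gamma> powr (- 1 / l) * s powr (1 / l - 1)))
      * ennreal (?G s) \<partial>lborel)"
    unfolding distr_power_of_norm[OF l g] by (subst nn_integral_density) auto
  also have "\<dots> = (\<integral>\<^sup>+s. ennreal (?c * (s powr (?x - 1) / exp s)) * indicator {0..} s \<partial>lborel)"
  proof (rule nn_integral_cong)
    fix s :: real
    show "ennreal (indicator {0..} s * (pi / l * \<gamma> powr (- 1 / l) * s powr (1 / l - 1))) * ennreal (?G s)
      = ennreal (?c * (s powr (?x - 1) / exp s)) * indicator {0..} s"
    proof (cases "s > 0")
      case True
      have "\<gamma> powr (- 1 / l) * s powr (1 / l - 1) * (s / \<gamma>) powr (m / (2 * l))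
          = (\<gamma> powr (- 1 / l) * \<gamma> powr (- (m / (2 * l)))) * (s powr (1 / l - 1) * s powr (m / (2 * l)))"
        using True g by (simp add: powr_divide powr_minus field_simps)
      also have "\<gamma> powr (- 1 / l) * \<gamma> powr (- (m / (2 * l))) = \<gamma> powr (- (real m + 2) / (2 * l))"
        using l by (simp add: powr_add[symmetric] add_divide_distrib diff_divide_distrib)
          (metis (no_types) diff_conv_add_uminus add.commute)
      also have "s powr (1 / l - 1) * s powr (m / (2 * l)) = s powr (1 / l - 1 + m / (2 * l))"
        by (simp add: powr_add)
      also have "1 / l - 1 + m / (2 * l) = ?x - 1"
        using l by (simp add: add_divide_distrib)
      finally have "pi / l * \<gamma> powr (- 1 / l) * s powr (1 / l - 1) * ?G s = ?c * (s powr (?x - 1) / exp s)"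
        by (simp add: exp_minus field_simps)
      then show ?thesis using True by (simp add: ennreal_mult'[symmetric])
    next
      case False
      then show ?thesis by (cases "s = 0") (auto simp: indicator_def)
    qed
  qed
  also have "\<dots> = ennreal (?c * Gamma ?x)"
    by (intro nn_integral_has_integral_lebesgue' has_integral_mult_right Gamma_integral_real x0) auto
  finally show "(\<integral>\<^sup>+z. ennreal (cmod z ^ m * exp (- \<gamma> * cmod z ^ (2 * l))) \<partial>lborel)
      = ennreal (?c * Gamma ?x)" .
  show "0 \<le> ?c * Gamma ?x"
    using x0 by (intro mult_nonneg_nonneg) (auto intro: Gamma_real_nonneg)
qed auto

lemma integrable_norm_power_exp:
  assumes "l \<ge> 1" and "\<gamma> > 0"
  shows "integrable lborel (\<lambda>z::complex. cmod z ^ m * exp (- \<gamma> * cmod z ^ (2 * l)))"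
  using norm_moment[OF assms] by (rule integrable.intros)

lemma integrable_norm_exp:
  assumes "l \<ge> 1" and "\<gamma> > 0"
  shows "integrable lborel (\<lambda>z::complex. exp (- \<gamma> * cmod z ^ (2 * l)))"
  using integrable_norm_power_exp[OF assms, of 0] by simp

text \<open>The square of the norm of the \<open>m\<close>-th monomial in the Hilbert space with kernel
\<open>bergman_kernel l \<alpha>\<close>.\<close>
definition power_moment :: "nat \<Rightarrow> real \<Rightarrow> nat \<Rightarrow> real" where
  "power_moment l \<alpha> m = (LINT z|lborel. cmod z ^ (2 * m) * exp (- \<alpha> * cmod z ^ (2 * l)))"

lemma power_moment_eq:
  assumes "l \<ge> 1" and "\<alpha> > 0"
  shows "power_moment l \<alpha> m = pi / l * \<alpha> powr (- (real m + 1) / l) * Gamma ((real m + 1) / l)"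
proof -
  have e: "(real (2 * m) + 2) / (2 * l) = (real m + 1) / l"
    "- (real (2 * m) + 2) / (2 * l) = - (real m + 1) / l"
    using assms by (simp_all add: field_simps)
  show ?thesis
    unfolding power_moment_def
    using norm_moment[OF assms, of "2 * m"] unfolding e by (rule has_bochner_integral_integral_eq)
qed

lemma power_moment_pos:
  assumes "l \<ge> 1" and "\<alpha> > 0"
  shows "power_moment l \<alpha> m > 0"
  using assms by (auto simp: power_moment_eq intro!: mult_pos_pos Gamma_real_pos divide_pos_pos)

section \<open>Entire functions as power series\<close>

definition power_sum :: "(nat \<Rightarrow> complex) \<Rightarrow> (complex \<Rightarrow> complex) \<Rightarrow> bool" where
  "power_sum a f \<longleftrightarrow> (\<forall>z. (\<lambda>m. a m * z ^ m) sums f z)"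

lemma power_sum_summable_norm:
  assumes "power_sum a f"
  shows "summable (\<lambda>m. cmod (a m) * r ^ m)"
proof -
  have "summable (\<lambda>m. a m * of_real (1 + \<bar>r\<bar>) ^ m)"
    using assms by (auto simp: power_sum_def sums_iff)
  then have "summable (\<lambda>m. norm (a m * of_real r ^ m))"
    by (rule powser_insidea) (simp del: of_real_add add: norm_of_real)
  then have "summable (\<lambda>m. norm (cmod (a m) * r ^ m))"
    by (simp add: norm_mult norm_power abs_mult power_abs)
  then show ?thesis by (rule summable_norm_cancel)
qed

lemma power_sum_entire: "power_sum a f \<Longrightarrow> f \<in> entire"
proof -
  assume a: "power_sum a f"
  have "f holomorphic_on ball 0 (real n)" for n
    using a by (intro power_series_holomorphic[of 0 "real n" a]) (auto simp: power_sum_def)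
  then have "f holomorphic_on (\<Union>n. ball 0 (real n))"
    by (intro holomorphic_on_UN_open) auto
  also have "(\<Union>n. ball 0 (real n)) = (UNIV :: complex set)"
    by (auto simp: reals_Archimedean2)
  finally show ?thesis by (simp add: entire_def)
qed

definition taylor :: "(complex \<Rightarrow> complex) \<Rightarrow> nat \<Rightarrow> complex" where
  "taylor f m = (deriv ^^ m) f 0 / fact m"

lemma entire_power_sum:
  assumes "f \<in> entire"
  shows "power_sum (taylor f) f"
  unfolding power_sum_def
proof
  fix z
  have "f holomorphic_on ball 0 (cmod z + 1)"
    using assms by (auto simp: entire_def intro: holomorphic_on_subset)
  from holomorphic_power_series[OF this, of z]
  show "(\<lambda>m. taylor f m * z ^ m) sums f z" by (simp add: taylor_def)
qed

lemma entire_measurable [measurable_dest]: "f \<in> entire \<Longrightarrow> f \<in> borel_measurable borel"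
  by (auto simp: entire_def intro!: borel_measurable_continuous_onI holomorphic_on_imp_continuous_on)

lemma entire_continuous: "f \<in> entire \<Longrightarrow> continuous_on UNIV f"
  by (auto simp: entire_def intro!: holomorphic_on_imp_continuous_on)

text \<open>On a disc the power series converges uniformly and the monomials are orthogonal to each other; the radius
then tends to infinity. The weight \<open>\<psi>\<close> is left arbitrary because the pairing, the
estimate of a coefficient by the norm and the mean value property each need a different one.\<close>
lemma radial_integral_extracts_coefficient:
  fixes \<psi> :: "real \<Rightarrow> real"
  assumes f: "power_sum a f" and [measurable]: "\<psi> \<in> borel_measurable borel"
    and i1: "integrable lborel (\<lambda>z. f z * cnj z ^ m * of_real (\<psi> (cmod z)))"
    and i2: "integrable lborel (\<lambda>z::complex. cmod z ^ m * \<psi> (cmod z))"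
    and i3: "integrable lborel (\<lambda>z::complex. cmod z ^ (2 * m) * \<psi> (cmod z))"
  shows "(LINT z|lborel. f z * cnj z ^ m * of_real (\<psi> (cmod z)))
    = a m * of_real (LINT z|lborel. cmod z ^ (2 * m) * \<psi> (cmod z))"
proof -
  have fm [measurable]: "f \<in> borel_measurable borel"
    using power_sum_entire[OF f] by (rule entire_measurable)
  define cut where "cut n r = (\<psi> r * indicator {..real n} r)" for n r
  have [measurable]: "cut n \<in> borel_measurable borel" for n
    unfolding cut_def by measurable
  have main: "(LINT z|lborel. f z * cnj z ^ m * of_real (cut n (cmod z)))
    = a m * of_real (LINT z|lborel. cmod z ^ (2 * m) * cut n (cmod z))" for n
  proof -
    let ?F = "\<lambda>j z. a j * (z ^ j * cnj z ^ m * of_real (cut n (cmod z)))"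
    have bnd: "norm (?F j z) \<le> (cmod (a j) * real n ^ j) * \<bar>cmod z ^ m * \<psi> (cmod z)\<bar>" for j z
    proof (cases "cmod z \<le> real n")
      case True
      then show ?thesis
        by (simp add: cut_def norm_mult norm_power abs_mult mult.assoc)
          (intro mult_left_mono mult_right_mono power_mono, auto)
    qed (simp add: cut_def)
    have i2': "integrable lborel (\<lambda>z::complex. \<bar>cmod z ^ m * \<psi> (cmod z)\<bar>)"
      using i2 by (rule integrable_abs)
    have intF: "integrable lborel (?F j)" for j
    proof (rule Bochner_Integration.integrable_bound)
      show "integrable lborel (\<lambda>z. (cmod (a j) * real n ^ j) * \<bar>cmod z ^ m * \<psi> (cmod z)\<bar>)"
        using i2' by (rule integrable_mult_right)
      show "AE z in lborel. norm (?F j z) \<le> norm ((cmod (a j) * real n ^ j) * \<bar>cmod z ^ m * \<psi> (cmod z)\<bar>)"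
        by (intro AE_I2 order_trans[OF bnd[of j]]) simp
    qed measurable
    have sm: "summable (\<lambda>j. cmod (a j) * real n ^ j)"
      by (rule power_sum_summable_norm[OF f])
    have "(LINT z|lborel. f z * cnj z ^ m * of_real (cut n (cmod z))) = (LINT z|lborel. (\<Sum>j. ?F j z))"
    proof (rule Bochner_Integration.integral_cong)
      fix z
      have "(\<lambda>j. a j * z ^ j * (cnj z ^ m * of_real (cut n (cmod z)))) sums
          (f z * (cnj z ^ m * of_real (cut n (cmod z))))"
        using f by (intro sums_mult2) (auto simp: power_sum_def)
      then show "f z * cnj z ^ m * of_real (cut n (cmod z)) = (\<Sum>j. ?F j z)"
        by (simp add: sums_iff mult.assoc)
    qed simp
    also have "\<dots> = (\<Sum>j. LINT z|lborel. ?F j z)"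
    proof (rule integral_suminf[OF intF])
      show "AE z in lborel. summable (\<lambda>j. norm (?F j z))"
        by (intro AE_I2 summable_comparison_test'[OF summable_mult2[OF sm], of 0])
          (use bnd in auto)
      show "summable (\<lambda>j. LINT z|lborel. norm (?F j z))"
      proof (rule summable_comparison_test'[OF summable_mult2[OF sm], of 0])
        fix j
        have "(LINT z|lborel. norm (?F j z)) \<le> (LINT z|lborel. (cmod (a j) * real n ^ j) * \<bar>cmod z ^ m * \<psi> (cmod z)\<bar>)"
          by (intro integral_mono integrable_norm intF integrable_mult_right i2' bnd)
        then show "norm (LINT z|lborel. norm (?F j z)) \<le> (cmod (a j) * real n ^ j) * (LINT z|lborel. \<bar>cmod z ^ m * \<psi> (cmod z)\<bar>)"
          by simp
      qed
    qed
    also have "(\<lambda>j. LINT z|lborel. ?F j z) = (\<lambda>j. if j = m then LINT z|lborel. ?F m z else 0)"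
      using monomials_orthogonal[of "cut n" _ m] by auto
    also have "(\<Sum>j. if j = m then LINT z|lborel. ?F m z else 0) = (LINT z|lborel. ?F m z)"
      using sums_single[of m "\<lambda>_. LINT z|lborel. ?F m z"] by (simp add: sums_iff)
    also have "\<dots> = a m * (LINT z|lborel. of_real (cmod z ^ (2 * m) * cut n (cmod z)))"
    proof -
      have "z ^ m * cnj z ^ m * of_real (cut n (cmod z)) = of_real (cmod z ^ (2 * m) * cut n (cmod z))" for z
        by (simp add: power_mult_distrib[symmetric] complex_norm_square[symmetric] power_mult)
      then have "(LINT z|lborel. ?F m z) = (LINT z|lborel. a m * of_real (cmod z ^ (2 * m) * cut n (cmod z)))"
        by (simp only:)
      then show ?thesis by (simp only: integral_mult_right_zero)
    qed
    finally show ?thesis by (simp only: integral_complex_of_real)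
  qed
  have lim1: "(\<lambda>n. LINT z|lborel. f z * cnj z ^ m * of_real (cut n (cmod z)))
    \<longlonglongrightarrow> (LINT z|lborel. f z * cnj z ^ m * of_real (\<psi> (cmod z)))"
  proof (rule integral_dominated_convergence[where w = "\<lambda>z. norm (f z * cnj z ^ m * of_real (\<psi> (cmod z)))"])
    show "AE z in lborel. (\<lambda>n. f z * cnj z ^ m * of_real (cut n (cmod z))) \<longlonglongrightarrow> f z * cnj z ^ m * of_real (\<psi> (cmod z))"
    proof (rule AE_I2)
      fix z
      obtain k where k: "cmod z \<le> real k" using real_arch_simple by blast
      show "(\<lambda>n. f z * cnj z ^ m * of_real (cut n (cmod z))) \<longlonglongrightarrow> f z * cnj z ^ m * of_real (\<psi> (cmod z))"
        by (rule tendsto_eventually)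
          (use k in \<open>auto simp: cut_def eventually_sequentially intro!: exI[of _ k]\<close>)
    qed
    show "integrable lborel (\<lambda>z. norm (f z * cnj z ^ m * of_real (\<psi> (cmod z))))"
      using i1 by (rule integrable_norm)
  qed (auto simp: cut_def norm_mult indicator_def)
  have lim2: "(\<lambda>n. LINT z|lborel. cmod z ^ (2 * m) * cut n (cmod z))
    \<longlonglongrightarrow> (LINT z|lborel. cmod z ^ (2 * m) * \<psi> (cmod z))"
  proof (rule integral_dominated_convergence[where w = "\<lambda>z. norm (cmod z ^ (2 * m) * \<psi> (cmod z))"])
    show "AE z::complex in lborel. (\<lambda>n. cmod z ^ (2 * m) * cut n (cmod z)) \<longlonglongrightarrow> cmod z ^ (2 * m) * \<psi> (cmod z)"
    proof (rule AE_I2)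
      fix z :: complex
      obtain k where k: "cmod z \<le> real k" using real_arch_simple by blast
      show "(\<lambda>n. cmod z ^ (2 * m) * cut n (cmod z)) \<longlonglongrightarrow> cmod z ^ (2 * m) * \<psi> (cmod z)"
        by (rule tendsto_eventually)
          (use k in \<open>auto simp: cut_def eventually_sequentially intro!: exI[of _ k]\<close>)
    qed
    show "integrable lborel (\<lambda>z. norm (cmod z ^ (2 * m) * \<psi> (cmod z)))"
      using i3 by (rule integrable_norm)
  qed (auto simp: cut_def norm_mult indicator_def abs_mult)
  have "(\<lambda>n. a m * of_real (LINT z|lborel. cmod z ^ (2 * m) * cut n (cmod z)))
    \<longlonglongrightarrow> a m * of_real (LINT z|lborel. cmod z ^ (2 * m) * \<psi> (cmod z))"
    by (intro tendsto_intros lim2)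
  with lim1 show ?thesis
    unfolding main by (rule LIMSEQ_unique)
qed

lemma power_sum_unique:
  assumes "power_sum a f"
  shows "a = taylor f"
proof
  fix n
  have "f has_fps_expansion Abs_fps a"
    unfolding has_fps_expansion_def
  proof
    have "conv_radius a \<ge> norm (1::complex)"
    proof (rule conv_radius_geI)
      have "summable (\<lambda>m. a m * 1 ^ m)"
        using assms unfolding power_sum_def sums_iff by blast
      then show "summable (\<lambda>m. a m * 1 ^ m)" .
    qed
    then show "fps_conv_radius (Abs_fps a) > 0"
      by (auto simp: fps_conv_radius_def zero_ereal_def one_ereal_def intro: less_le_trans[of _ 1])
    have "eval_fps (Abs_fps a) z = f z" for z
      using assms by (simp add: eval_fps_def power_sum_def sums_iff)
    then show "\<forall>\<^sub>F z in nhds 0. eval_fps (Abs_fps a) z = f z" by simp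
  qed
  from fps_nth_fps_expansion[OF this, of n] show "a n = taylor f n"
    by (simp add: taylor_def)
qed

lemma coefficient_le:
  assumes f: "power_sum a f" and R: "R \<ge> 0" and B: "\<And>z. cmod z = R \<Longrightarrow> cmod (f z) \<le> B"
  shows "cmod (a m) * R ^ m \<le> B"
proof (cases "R = 0")
  case True
  have "f 0 = a 0"
    using f powser_sums_zero_iff[of a "f 0"] unfolding power_sum_def by metis
  then show ?thesis using True B[of 0] by (cases m) (auto intro: order_trans[OF norm_ge_zero])
next
  case False
  then have R: "R > 0" using R by simp
  have e: "f \<in> entire" using f by (rule power_sum_entire)
  have "cmod ((deriv ^^ m) f 0) \<le> fact m * B / R ^ m"
    using e R B by (intro Cauchy_inequality)
      (auto simp: entire_def intro: holomorphic_on_subset holomorphic_on_imp_continuous_on)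
  then have "cmod (taylor f m) \<le> B / R ^ m"
    by (simp add: taylor_def norm_divide field_simps)
  then show ?thesis
    using R power_sum_unique[OF f] by (simp add: field_simps)
qed

section \<open>The class E\<close>

lemma bigo_at_infinity_global_bound:
  fixes f :: "complex \<Rightarrow> complex"
  assumes f: "continuous_on UNIV f" and h: "continuous_on UNIV h" "\<And>z. h z > 0"
    and O: "(\<lambda>z. cmod (f z)) \<in> O[at_infinity](h)"
  shows "\<exists>C\<ge>0. \<forall>z. cmod (f z) \<le> C * h z"
proof -
  obtain c where c: "c > 0" "eventually (\<lambda>z. norm (cmod (f z)) \<le> c * norm (h z)) at_infinity"
    using O by (elim landau_o.bigE)
  then obtain b where b: "\<And>z. b \<le> norm z \<Longrightarrow> norm (cmod (f z)) \<le> c * norm (h z)"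
    by (auto simp: eventually_at_infinity)
  have "compact ((\<lambda>z. cmod (f z) / h z) ` cball 0 b)"
    using h by (intro compact_continuous_image continuous_intros continuous_on_subset[OF f] continuous_on_subset[OF h(1)])
      (auto simp: less_imp_neq[symmetric] dest: less_imp_neq)
  then have "bounded ((\<lambda>z. cmod (f z) / h z) ` cball 0 b)" by (rule compact_imp_bounded)
  then obtain d where d: "\<And>z. z \<in> cball 0 b \<Longrightarrow> norm (cmod (f z) / h z) \<le> d"
    unfolding bounded_iff by blast
  have "cmod (f z) \<le> max c d * h z" for z
  proof (cases "b \<le> norm z")
    case True
    have "cmod (f z) \<le> c * h z" using b[OF True] h(2)[of z] by simp
    also have "\<dots> \<le> max c d * h z" using h(2)[of z] by (intro mult_right_mono) auto
    finally show ?thesis .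
  next
    case False
    then have "cmod (f z) \<le> d * h z" using d[of z] h(2)[of z] by (simp add: field_simps)
    also have "\<dots> \<le> max c d * h z" using h(2)[of z] by (intro mult_right_mono) auto
    finally show ?thesis .
  qed
  then show ?thesis using c(1) by (intro exI[of _ "max c d"]) auto
qed

lemma E_class_bound:
  assumes "f \<in> E_class l"
  obtains C \<beta> where "C \<ge> 0" "\<beta> > 0" "\<And>z. cmod (f z) \<le> C * exp (\<beta> * cmod z ^ l)"
proof -
  obtain \<beta> where b: "\<beta> > 0" "(\<lambda>z. cmod (f z)) \<in> O[at_infinity](\<lambda>z. exp (\<beta> * cmod z ^ l))" "f \<in> entire"
    using assms by (auto simp: E_class_def)
  have "\<exists>C\<ge>0. \<forall>z. cmod (f z) \<le> C * exp (\<beta> * cmod z ^ l)"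
    by (intro bigo_at_infinity_global_bound entire_continuous b continuous_intros) simp
  then show ?thesis using that b(1) by blast
qed

lemma E_classI:
  assumes "f \<in> entire" "\<And>z. cmod (f z) \<le> C * exp (\<beta> * cmod z ^ l)"
  shows "f \<in> E_class l"
proof -
  have "cmod (f z) \<le> \<bar>C\<bar> * exp (max \<beta> 1 * cmod z ^ l)" for z
    by (rule order_trans[OF assms(2)] , rule mult_mono) (auto intro: mult_right_mono)
  then have "(\<lambda>z. cmod (f z)) \<in> O[at_infinity](\<lambda>z. exp (max \<beta> 1 * cmod z ^ l))"
    by (intro landau_o.bigI[of "\<bar>C\<bar> + 1"] always_eventually) (auto simp: distrib_right intro: add_increasing2)
  then show ?thesis using assms(1) by (auto simp: E_class_def intro!: exI[of _ "max \<beta> 1"])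
qed

lemma E_class_entire: "f \<in> E_class l \<Longrightarrow> f \<in> entire"
  by (simp add: E_class_def)

lemma entire_mult: "f \<in> entire \<Longrightarrow> g \<in> entire \<Longrightarrow> (\<lambda>z. f z * g z) \<in> entire"
  by (auto simp: entire_def intro: holomorphic_intros)

lemma E_class_mult:
  assumes "f \<in> E_class l" "g \<in> E_class l"
  shows "(\<lambda>z. f z * g z) \<in> E_class l"
proof -
  obtain C1 b1 where 1: "C1 \<ge> 0" "b1 > 0" "\<And>z. cmod (f z) \<le> C1 * exp (b1 * cmod z ^ l)"
    by (rule E_class_bound[OF assms(1)]) blast
  obtain C2 b2 where 2: "C2 \<ge> 0" "b2 > 0" "\<And>z. cmod (g z) \<le> C2 * exp (b2 * cmod z ^ l)"
    by (rule E_class_bound[OF assms(2)]) blast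
  show ?thesis
  proof (rule E_classI)
    show "(\<lambda>z. f z * g z) \<in> entire" using assms by (intro entire_mult E_class_entire)
    fix z
    have "cmod (f z * g z) \<le> (C1 * exp (b1 * cmod z ^ l)) * (C2 * exp (b2 * cmod z ^ l))"
      unfolding norm_mult by (intro mult_mono 1 2) (use 1 2 in auto)
    then show "cmod (f z * g z) \<le> C1 * C2 * exp ((b1 + b2) * cmod z ^ l)"
      by (simp add: exp_add distrib_right mult_ac)
  qed
qed

lemma E_class_cmult: "f \<in> E_class l \<Longrightarrow> (\<lambda>z. c * f z) \<in> E_class l"
proof -
  assume f: "f \<in> E_class l"
  obtain C1 b1 where 1: "C1 \<ge> 0" "b1 > 0" "\<And>z. cmod (f z) \<le> C1 * exp (b1 * cmod z ^ l)"
    by (rule E_class_bound[OF f]) blast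
  show ?thesis
  proof (rule E_classI)
    show "(\<lambda>z. c * f z) \<in> entire" using f by (auto simp: E_class_def entire_def intro: holomorphic_intros)
    show "cmod (c * f z) \<le> (cmod c * C1) * exp (b1 * cmod z ^ l)" for z
      using mult_left_mono[OF 1(3)[of z], of "cmod c"] by (simp add: norm_mult mult.assoc)
  qed
qed

lemma E_class_add:
  assumes "f \<in> E_class l" "g \<in> E_class l"
  shows "(\<lambda>z. f z + g z) \<in> E_class l"
proof -
  obtain C1 b1 where 1: "C1 \<ge> 0" "b1 > 0" "\<And>z. cmod (f z) \<le> C1 * exp (b1 * cmod z ^ l)"
    by (rule E_class_bound[OF assms(1)]) blast
  obtain C2 b2 where 2: "C2 \<ge> 0" "b2 > 0" "\<And>z. cmod (g z) \<le> C2 * exp (b2 * cmod z ^ l)"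
    by (rule E_class_bound[OF assms(2)]) blast
  show ?thesis
  proof (rule E_classI)
    show "(\<lambda>z. f z + g z) \<in> entire"
      using assms by (auto simp: E_class_def entire_def intro: holomorphic_intros)
    fix z
    have "cmod (f z + g z) \<le> C1 * exp (b1 * cmod z ^ l) + C2 * exp (b2 * cmod z ^ l)"
      by (intro norm_triangle_le add_mono 1 2)
    also have "\<dots> \<le> C1 * exp ((b1 + b2) * cmod z ^ l) + C2 * exp ((b1 + b2) * cmod z ^ l)"
      using 1(1,2) 2(1,2) by (intro add_mono mult_left_mono) (auto intro: mult_right_mono)
    finally show "cmod (f z + g z) \<le> (C1 + C2) * exp ((b1 + b2) * cmod z ^ l)"
      by (simp add: distrib_right)
  qed
qed

lemma exp_power_le:
  assumes "\<gamma> > (0::real)"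
  shows "exp (b * x) \<le> exp (b\<^sup>2 / (4 * \<gamma>)) * exp (\<gamma> * x\<^sup>2)"
proof -
  have "0 \<le> \<gamma> * (x - b / (2 * \<gamma>))\<^sup>2" using assms by simp
  also have "\<dots> = b\<^sup>2 / (4 * \<gamma>) + \<gamma> * x\<^sup>2 - b * x"
    using assms by (simp add: power2_eq_square field_simps)
  finally show ?thesis by (simp add: exp_add[symmetric])
qed

text \<open>Cauchy's estimate on the circle of radius \<open>2 * \<rho>\<close> produces the geometric factor, and
\<open>exp (b * \<rho> ^ l)\<close> is dominated by a Gaussian in \<open>\<rho> ^ l\<close>.\<close>
lemma E_class_coefficient_decay:
  assumes f: "f \<in> E_class l" and a: "power_sum a f" and g: "\<gamma> > 0"
  obtains C where "C \<ge> 0" "\<And>m \<rho>. \<rho> \<ge> 0 \<Longrightarrow> cmod (a m) * \<rho> ^ m \<le> C * (1/2) ^ m * exp (\<gamma> * \<rho> ^ (2 * l))"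
proof -
  obtain C1 b where 1: "C1 \<ge> 0" "b > 0" "\<And>z. cmod (f z) \<le> C1 * exp (b * cmod z ^ l)"
    by (rule E_class_bound[OF f]) blast
  define C where "C = C1 * exp ((b * 2 ^ l)\<^sup>2 / (4 * \<gamma>))"
  have "cmod (a m) * \<rho> ^ m \<le> C * (1/2) ^ m * exp (\<gamma> * \<rho> ^ (2 * l))" if "\<rho> \<ge> 0" for m \<rho>
  proof -
    have "cmod (a m) * (2 * \<rho>) ^ m \<le> C1 * exp (b * (2 * \<rho>) ^ l)"
    proof (rule coefficient_le[OF a])
      show "cmod (f z) \<le> C1 * exp (b * (2 * \<rho>) ^ l)" if "cmod z = 2 * \<rho>" for z
        using 1(3)[of z] by (simp only: that)
    qed (use that in simp)
    also have "\<dots> = C1 * exp ((b * 2 ^ l) * \<rho> ^ l)" by (simp add: power_mult_distrib)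
    also have "\<dots> \<le> C1 * (exp ((b * 2 ^ l)\<^sup>2 / (4 * \<gamma>)) * exp (\<gamma> * (\<rho> ^ l)\<^sup>2))"
      by (intro mult_left_mono exp_power_le g 1)
    also have "\<dots> = C * exp (\<gamma> * \<rho> ^ (2 * l))"
      by (simp add: C_def power_mult[symmetric] mult.commute)
    finally have "2 ^ m * (cmod (a m) * \<rho> ^ m) \<le> C * exp (\<gamma> * \<rho> ^ (2 * l))"
      by (simp add: power_mult_distrib mult_ac)
    then show ?thesis by (simp add: power_divide field_simps)
  qed
  then show ?thesis using 1(1) by (intro that[of C]) (auto simp: C_def)
qed

lemma E_class_growth:
  assumes f: "f \<in> E_class l" and g: "\<gamma> > 0"
  obtains C where "C \<ge> 0" "\<And>z. cmod (f z) \<le> C * exp (\<gamma> * cmod z ^ (2 * l))"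
proof -
  obtain C1 b where 1: "C1 \<ge> 0" "b > 0" "\<And>z. cmod (f z) \<le> C1 * exp (b * cmod z ^ l)"
    by (rule E_class_bound[OF f]) blast
  have "cmod (f z) \<le> C1 * exp (b\<^sup>2 / (4 * \<gamma>)) * exp (\<gamma> * cmod z ^ (2 * l))" for z
    using order_trans[OF 1(3)[of z] mult_left_mono[OF exp_power_le[OF g] 1(1)]]
    by (simp add: power_mult[symmetric] mult.assoc mult.commute[of _ 2])
  then show ?thesis using 1(1) by (intro that[of "C1 * exp (b\<^sup>2 / (4 * \<gamma>))"]) auto
qed

lemma polynomial_in_E_class:
  assumes l: "l \<ge> 1"
  shows "(\<lambda>z. \<Sum>m<n. c m * z ^ m) \<in> E_class l"
proof -
  have const: "(\<lambda>z. c) \<in> E_class l" for c :: complex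
    by (rule E_classI[of _ "cmod c" 0]) (auto simp: entire_def)
  have id: "(\<lambda>z. z) \<in> E_class l"
  proof (rule E_classI[of _ 1 1])
    show "(\<lambda>z::complex. z) \<in> entire" by (auto simp: entire_def)
    fix z :: complex
    show "cmod z \<le> 1 * exp (1 * cmod z ^ l)"
    proof (cases "cmod z \<le> 1")
      case True
      also have "1 \<le> exp (cmod z ^ l)" by simp
      finally show ?thesis by simp
    next
      case False
      then have "cmod z \<le> cmod z ^ l" using l by (intro self_le_power) auto
      also have "\<dots> \<le> exp (cmod z ^ l)"
        using exp_ge_add_one_self[of "cmod z ^ l"] by linarith
      finally show ?thesis by simp
    qed
  qed
  have pow: "(\<lambda>z. z ^ m) \<in> E_class l" for m
    by (induction m) (use const[of 1] E_class_mult[OF id] in auto)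
  show ?thesis
    by (induction n) (use const[of 0] in \<open>auto intro!: E_class_add E_class_cmult pow\<close>)
qed

lemma monomial_in_E_class: "l \<ge> 1 \<Longrightarrow> (\<lambda>z. c * z ^ m) \<in> E_class l"
  using polynomial_in_E_class[of l "\<lambda>k. if k = m then c else 0" "Suc m"]
  by (simp add: if_distrib[of "\<lambda>x. x * _"] cong: if_cong)

section \<open>The pairing and the Bergman kernel\<close>

lemma pairing_lborel:
  assumes "f \<in> borel_measurable borel" "g \<in> borel_measurable borel"
  shows "pairing l \<alpha> f g = (LINT z|lborel. f z * cnj (g z) * of_real (exp (- \<alpha> * cmod z ^ (2 * l))))"
proof -
  note [measurable] = assms
  show ?thesis unfolding pairing_def by (rule integral_completion) measurable
qed

lemma growth_integrable:
  assumes l: "l \<ge> 1" and g: "\<gamma> < \<alpha>" and [measurable]: "f \<in> borel_measurable borel"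
    and C: "\<And>z. cmod (f z) \<le> C * exp (\<gamma> * cmod z ^ (2 * l))"
  shows "integrable lborel (\<lambda>z. f z * of_real (exp (- \<alpha> * cmod z ^ (2 * l))))"
proof (rule Bochner_Integration.integrable_bound)
  show "integrable lborel (\<lambda>z. C * exp (- (\<alpha> - \<gamma>) * cmod z ^ (2 * l)))"
    using g by (intro integrable_mult_right integrable_norm_exp l) auto
  show "AE z in lborel. norm (f z * of_real (exp (- \<alpha> * cmod z ^ (2 * l)))) \<le> norm (C * exp (- (\<alpha> - \<gamma>) * cmod z ^ (2 * l)))"
  proof (rule AE_I2)
    fix z
    have "norm (f z * of_real (exp (- \<alpha> * cmod z ^ (2 * l)))) \<le> C * exp (\<gamma> * cmod z ^ (2 * l)) * exp (- \<alpha> * cmod z ^ (2 * l))"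
      unfolding norm_mult by (simp add: C)
    also have "\<dots> = C * exp (- (\<alpha> - \<gamma>) * cmod z ^ (2 * l))"
      by (simp add: exp_add[symmetric] algebra_simps)
    also have "\<dots> \<le> norm (C * exp (- (\<alpha> - \<gamma>) * cmod z ^ (2 * l)))" by simp
    finally show "norm (f z * of_real (exp (- \<alpha> * cmod z ^ (2 * l)))) \<le> \<dots>" .
  qed
qed measurable

lemma pairing_monomial:
  assumes l: "l \<ge> 1" and a: "\<alpha> > 0" and g: "power_sum b g" and \<gamma>: "\<gamma> < \<alpha>"
    and C: "\<And>z. cmod (g z) \<le> C * exp (\<gamma> * cmod z ^ (2 * l))"
  shows "pairing l \<alpha> (\<lambda>z. z ^ m) g = cnj (b m) * of_real (power_moment l \<alpha> m)"
proof -
  have [measurable]: "g \<in> borel_measurable borel"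
    using power_sum_entire[OF g] by (rule entire_measurable)
  define d where "d = (\<alpha> - \<gamma>) / 2"
  have d: "d > 0" "\<gamma> + d < \<alpha>" using \<gamma> by (simp_all add: d_def field_simps)
  have "(\<lambda>z. 1 * z ^ m) \<in> E_class l" by (rule monomial_in_E_class[OF l])
  then obtain C1 where C1: "C1 \<ge> 0" "\<And>z. cmod (1 * z ^ m) \<le> C1 * exp (d * cmod z ^ (2 * l))"
    by (rule E_class_growth[OF _ d(1)]) blast
  have "cmod (g z * cnj z ^ m) \<le> C * C1 * exp ((\<gamma> + d) * cmod z ^ (2 * l))" for z
  proof -
    have "cmod (g z * cnj z ^ m) \<le> (C * exp (\<gamma> * cmod z ^ (2 * l))) * (C1 * exp (d * cmod z ^ (2 * l)))"
      unfolding norm_mult using C1(2)[of z]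
      by (intro mult_mono C) (auto simp: norm_power intro: order_trans[OF norm_ge_zero C])
    then show ?thesis by (simp add: exp_add distrib_right mult_ac)
  qed
  then have i: "integrable lborel (\<lambda>z. g z * cnj z ^ m * of_real (exp (- \<alpha> * cmod z ^ (2 * l))))"
    by (intro growth_integrable[OF l d(2)]) auto
  have "(LINT z|lborel. g z * cnj z ^ m * of_real (exp (- \<alpha> * cmod z ^ (2 * l))))
      = b m * of_real (power_moment l \<alpha> m)"
    unfolding power_moment_def
    by (rule radial_integral_extracts_coefficient[where \<psi> = "\<lambda>r. exp (- \<alpha> * r ^ (2 * l))", OF g _ i
        integrable_norm_power_exp[OF l a] integrable_norm_power_exp[OF l a]]) measurable
  then have "cnj (LINT z|lborel. g z * cnj z ^ m * of_real (exp (- \<alpha> * cmod z ^ (2 * l))))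
      = cnj (b m) * of_real (power_moment l \<alpha> m)" by simp
  also have "cnj (LINT z|lborel. g z * cnj z ^ m * of_real (exp (- \<alpha> * cmod z ^ (2 * l))))
      = pairing l \<alpha> (\<lambda>z. z ^ m) g"
    by (subst pairing_lborel) (auto simp: mult_ac simp flip: Bochner_Integration.integral_cnj intro!: Bochner_Integration.integral_cong)
  finally show ?thesis .
qed

text \<open>A function in \<open>E\<close> has a Taylor series that converges geometrically against any Gaussian in
\<open>cmod z ^ l\<close>, so it may be integrated term by term against a weight \<open>h\<close> that
has such a Gaussian to spare. The measure is left open in order to cover both \<open>lborel\<close> and
\<open>lebesgue\<close>.\<close>
lemma E_class_integral_sums:
  assumes f: "f \<in> E_class l" and a: "power_sum a f" and e: "\<epsilon> > 0"
    and hm: "h \<in> borel_measurable M" and sM: "(\<lambda>z. z) \<in> borel_measurable M"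
    and h: "integrable M (\<lambda>z. exp (\<epsilon> * cmod z ^ (2 * l)) * cmod (h z))"
  shows "(\<lambda>m. a m * (LINT z|M. z ^ m * h z)) sums (LINT z|M. f z * h z)"
    and "integrable M (\<lambda>z. f z * h z)"
proof -
  note [measurable] = hm sM
  obtain C where C: "C \<ge> 0" "\<And>m \<rho>. \<rho> \<ge> 0 \<Longrightarrow> cmod (a m) * \<rho> ^ m \<le> C * (1/2) ^ m * exp (\<epsilon> * \<rho> ^ (2 * l))"
    by (rule E_class_coefficient_decay[OF f a e]) blast
  define G where "G z = exp (\<epsilon> * cmod z ^ (2 * l)) * cmod (h z)" for z
  have G: "integrable M G" unfolding G_def by (rule h)
  have bnd: "norm (a m * (z ^ m * h z)) \<le> C * (1/2) ^ m * G z" for m z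
    unfolding norm_mult norm_power G_def mult.assoc[symmetric]
    by (intro mult_right_mono C(2)) auto
  have i: "integrable M (\<lambda>z. a m * (z ^ m * h z))" for m
  proof (rule Bochner_Integration.integrable_bound)
    show "integrable M (\<lambda>z. C * (1/2) ^ m * G z)" using G by (rule integrable_mult_right)
    show "AE z in M. norm (a m * (z ^ m * h z)) \<le> norm (C * (1/2) ^ m * G z)"
      by (intro AE_I2 order_trans[OF bnd]) simp
  qed measurable
  have geo: "summable (\<lambda>m. C * (1/2) ^ m * x)" for x :: real
    by (intro summable_mult summable_mult2 summable_geometric) auto
  have s1: "AE z in M. summable (\<lambda>m. norm (a m * (z ^ m * h z)))"
    by (intro AE_I2 summable_comparison_test'[OF geo, of 0]) (use bnd in auto)
  have s2: "summable (\<lambda>m. LINT z|M. norm (a m * (z ^ m * h z)))"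
  proof (rule summable_comparison_test'[OF geo, of 0])
    fix m
    have "(LINT z|M. norm (a m * (z ^ m * h z))) \<le> (LINT z|M. C * (1/2) ^ m * G z)"
      by (intro integral_mono integrable_norm i integrable_mult_right G bnd)
    then show "norm (LINT z|M. norm (a m * (z ^ m * h z))) \<le> C * (1/2) ^ m * (LINT z|M. G z)"
      by simp
  qed
  have eq: "(\<Sum>m. a m * (z ^ m * h z)) = f z * h z" for z
    using a sums_mult2[of "\<lambda>m. a m * z ^ m" "f z" "h z"]
    by (simp add: power_sum_def sums_iff mult.assoc)
  show "(\<lambda>m. a m * (LINT z|M. z ^ m * h z)) sums (LINT z|M. f z * h z)"
    using sums_integral[OF i s1 s2] by (simp add: eq integral_mult_right_zero)
  show "integrable M (\<lambda>z. f z * h z)"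
    using integrable_suminf[OF i s1 s2] by (simp add: eq)
qed

lemma pairing_sums:
  assumes l: "l \<ge> 1" and a0: "\<alpha> > 0" and f: "f \<in> E_class l" and a: "power_sum a f"
    and b: "power_sum b g" and \<gamma>: "\<gamma> < \<alpha>"
    and C: "\<And>z. cmod (g z) \<le> C * exp (\<gamma> * cmod z ^ (2 * l))"
  shows "(\<lambda>m. a m * (cnj (b m) * of_real (power_moment l \<alpha> m))) sums pairing l \<alpha> f g"
    and "integrable lborel (\<lambda>z. f z * cnj (g z) * of_real (exp (- \<alpha> * cmod z ^ (2 * l))))"
proof -
  have [measurable]: "g \<in> borel_measurable borel" "f \<in> borel_measurable borel"
    using power_sum_entire[OF b] power_sum_entire[OF a] by (auto intro: entire_measurable)
  define d where "d = (\<alpha> - \<gamma>) / 2"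
  have d: "d > 0" "\<gamma> + d < \<alpha>" using \<gamma> by (simp_all add: d_def field_simps)
  define h where "h z = cnj (g z) * of_real (exp (- \<alpha> * cmod z ^ (2 * l)))" for z
  have [measurable]: "h \<in> borel_measurable borel" unfolding h_def by measurable
  have "integrable lborel (\<lambda>z. (of_real (exp (d * cmod z ^ (2 * l))) * g z) * of_real (exp (- \<alpha> * cmod z ^ (2 * l))))"
  proof (rule growth_integrable[OF l d(2)])
    show "cmod (of_real (exp (d * cmod z ^ (2 * l))) * g z) \<le> C * exp ((\<gamma> + d) * cmod z ^ (2 * l))" for z
      using mult_left_mono[OF C[of z], of "exp (d * cmod z ^ (2 * l))"]
      by (simp add: norm_mult exp_add distrib_right mult_ac)
  qed measurable
  then have "integrable lborel (\<lambda>z. norm ((of_real (exp (d * cmod z ^ (2 * l))) * g z) * of_real (exp (- \<alpha> * cmod z ^ (2 * l)))))"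
    by (rule integrable_norm)
  then have i: "integrable lborel (\<lambda>z. exp (d * cmod z ^ (2 * l)) * cmod (h z))"
    by (simp add: h_def norm_mult mult.assoc)
  have m: "h \<in> borel_measurable lborel" "(\<lambda>z::complex. z) \<in> borel_measurable lborel" by measurable
  note E = E_class_integral_sums[OF f a d(1) m i]
  have p: "pairing l \<alpha> u g = (LINT z|lborel. u z * h z)" if [measurable]: "u \<in> borel_measurable borel" for u
    by (subst pairing_lborel) (auto simp: h_def mult.assoc)
  show "(\<lambda>m. a m * (cnj (b m) * of_real (power_moment l \<alpha> m))) sums pairing l \<alpha> f g"
  proof -
    have "(LINT z|lborel. z ^ m * h z) = cnj (b m) * of_real (power_moment l \<alpha> m)" for m
      using pairing_monomial[OF l a0 b \<gamma> C, of m] by (subst (asm) p) auto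
    moreover have "pairing l \<alpha> f g = (LINT z|lborel. f z * h z)" by (rule p) measurable
    ultimately show ?thesis using E(1) by (simp only:)
  qed
  show "integrable lborel (\<lambda>z. f z * cnj (g z) * of_real (exp (- \<alpha> * cmod z ^ (2 * l))))"
    using E(2) by (simp add: h_def mult.assoc)
qed

text \<open>A lower bound for the moment comes from the disc of radius \<open>1\<close> around \<open>R + 1\<close>,
on which \<open>cmod z\<close> lies between \<open>R\<close> and \<open>3 * R\<close>; the choice of
\<open>R\<close> then depends on \<open>x\<close> alone.\<close>
lemma inverse_moment_decay:
  assumes l: "l \<ge> 1" and a: "\<alpha> > 0"
  obtains C \<beta> where "C \<ge> 0" "\<beta> > 0"
    "\<And>m x. x \<ge> 0 \<Longrightarrow> x ^ m / power_moment l \<alpha> m \<le> C * (1/2) ^ m * exp (\<beta> * x ^ l)"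
proof -
  have lower: "R ^ (2 * m) * exp (- \<alpha> * (3 * R) ^ (2 * l)) * pi \<le> power_moment l \<alpha> m" if R: "R \<ge> 1" for R m
  proof -
    let ?B = "ball (of_real (R + 1)) 1 :: complex set"
    have in_B: "R \<le> cmod z \<and> cmod z \<le> 3 * R" if "z \<in> ?B" for z
    proof -
      have n: "cmod (of_real (R + 1)) = R + 1" using R by (simp only: norm_of_real)
      have "cmod (of_real (R + 1) - z) < 1" using that by (simp add: dist_norm)
      then show ?thesis
        using norm_triangle_ineq2[of "of_real (R + 1)" z] norm_triangle_ineq2[of z "of_real (R + 1)"] R
        unfolding n norm_minus_commute[of z] by linarith
    qed
    have mB: "measure lborel ?B = pi" by (simp add: content_ball unit_ball_vol_2)
    have "R ^ (2 * m) * exp (- \<alpha> * (3 * R) ^ (2 * l)) * pi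
      = (LINT z|lborel. indicator ?B z * (R ^ (2 * m) * exp (- \<alpha> * (3 * R) ^ (2 * l))))"
      using mB by simp
    also have "\<dots> \<le> power_moment l \<alpha> m"
      unfolding power_moment_def
    proof (rule integral_mono)
      show "integrable lborel (\<lambda>z. indicator ?B z * (R ^ (2 * m) * exp (- \<alpha> * (3 * R) ^ (2 * l))))"
        by (intro integrable_mult_left integrable_real_indicator emeasure_lborel_ball_finite) simp
      show "integrable lborel (\<lambda>z. cmod z ^ (2 * m) * exp (- \<alpha> * cmod z ^ (2 * l)))"
        by (rule integrable_norm_power_exp[OF l a])
      show "indicator ?B z * (R ^ (2 * m) * exp (- \<alpha> * (3 * R) ^ (2 * l))) \<le> cmod z ^ (2 * m) * exp (- \<alpha> * cmod z ^ (2 * l))" for z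
      proof (cases "z \<in> ?B")
        case True
        have "R ^ (2 * m) * exp (- \<alpha> * (3 * R) ^ (2 * l)) \<le> cmod z ^ (2 * m) * exp (- \<alpha> * cmod z ^ (2 * l))"
        proof (intro mult_mono power_mono)
          have "cmod z ^ (2 * l) \<le> (3 * R) ^ (2 * l)" using in_B[OF True] by (intro power_mono) auto
          then show "exp (- \<alpha> * (3 * R) ^ (2 * l)) \<le> exp (- \<alpha> * cmod z ^ (2 * l))"
            using a by (simp del: power_mult_distrib)
        qed (use in_B[OF True] R in auto)
        then show ?thesis using True by simp
      qed simp
    qed
    finally show ?thesis .
  qed
  define b0 where "b0 = \<alpha> * 9 ^ l * 3 ^ l"
  define C where "C = exp b0 / pi"
  have b0: "b0 > 0" using a by (simp add: b0_def)
  have "x ^ m / power_moment l \<alpha> m \<le> C * (1/2) ^ m * exp (b0 * x ^ l)" if x: "x \<ge> 0" for m x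
  proof -
    \<comment> \<open>\<open>R ^ (2 * m)\<close> exceeds \<open>(2 * x) ^ m\<close>, whence the factor \<open>(1/2) ^ m\<close>; and \<open>R ^ (2 * l)\<close> is only of
      the order of \<open>x ^ l\<close>.\<close>
    define R where "R = sqrt (2 * x + 1)"
    have R: "R \<ge> 1" "R\<^sup>2 = 2 * x + 1" using x by (auto simp: R_def)
    have "(2 * x) ^ m \<le> R ^ (2 * m)"
      using x by (simp only: power_mult R(2)) (intro power_mono, auto)
    then have 1: "(2 * x) ^ m * exp (- \<alpha> * (3 * R) ^ (2 * l)) * pi \<le> power_moment l \<alpha> m"
      by (intro order_trans[OF _ lower[OF R(1), of m]] mult_right_mono) auto
    have "(3 * R) ^ (2 * l) = 9 ^ l * (2 * x + 1) ^ l"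
      by (simp only: power_mult power_mult_distrib R(2)) simp
    also have "(2 * x + 1) ^ l \<le> 3 ^ l * (1 + x ^ l)"
    proof (cases "x \<le> 1")
      case True
      have "(2 * x + 1) ^ l \<le> 3 ^ l" using x True by (intro power_mono) auto
      also have "\<dots> \<le> 3 ^ l * (1 + x ^ l)" using x by simp
      finally show ?thesis .
    next
      case False
      have "(2 * x + 1) ^ l \<le> (3 * x) ^ l" using x False by (intro power_mono) auto
      also have "\<dots> \<le> 3 ^ l * (1 + x ^ l)" using x by (simp add: power_mult_distrib)
      finally show ?thesis .
    qed
    finally have "(3 * R) ^ (2 * l) \<le> 9 ^ l * (3 ^ l * (1 + x ^ l))" by simp
    then have "\<alpha> * (3 * R) ^ (2 * l) \<le> \<alpha> * (9 ^ l * (3 ^ l * (1 + x ^ l)))"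
      using a by (intro mult_left_mono) auto
    also have "\<dots> = b0 + b0 * x ^ l" by (simp add: b0_def algebra_simps)
    finally have e: "exp (- (b0 + b0 * x ^ l)) \<le> exp (- \<alpha> * (3 * R) ^ (2 * l))" by simp
    have "(2 * x) ^ m * exp (- (b0 + b0 * x ^ l)) * pi \<le> power_moment l \<alpha> m"
      by (rule order_trans[OF _ 1]) (use x e in \<open>auto intro!: mult_right_mono mult_left_mono\<close>)
    then have "(2 * x) ^ m / power_moment l \<alpha> m \<le> exp (b0 + b0 * x ^ l) / pi"
    proof -
      have solve: "A / k \<le> exp y / pi" if "A * exp (- y) * pi \<le> k" "k > 0" for A k y :: real
      proof -
        have "A * pi = A * exp (- y) * pi * exp y" by (simp add: exp_minus)
        also have "\<dots> \<le> k * exp y" using that(1) by (intro mult_right_mono) auto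
        finally show ?thesis using that(2) by (simp add: field_simps)
      qed
      from \<open>(2 * x) ^ m * exp (- (b0 + b0 * x ^ l)) * pi \<le> power_moment l \<alpha> m\<close> power_moment_pos[OF l a]
      show ?thesis by (rule solve)
    qed
    also have "\<dots> = C * exp (b0 * x ^ l)" by (simp add: C_def exp_add)
    finally have "2 ^ m * (x ^ m / power_moment l \<alpha> m) \<le> C * exp (b0 * x ^ l)"
      by (simp add: power_mult_distrib)
    then show ?thesis by (simp add: power_divide field_simps)
  qed
  then show ?thesis using b0 by (intro that[of C b0]) (auto simp: C_def)
qed

text \<open>In this argument order the kernel is holomorphic, and in fact an element of \<open>E\<close>.\<close>
definition kernel_at :: "nat \<Rightarrow> real \<Rightarrow> complex \<Rightarrow> complex \<Rightarrow> complex" where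
  "kernel_at l \<alpha> z = (\<lambda>w. bergman_kernel l \<alpha> w z)"

lemma inverse_power_moment:
  assumes l: "l \<ge> 1" and a: "\<alpha> > 0"
  shows "1 / power_moment l \<alpha> m = real l * \<alpha> powr (1 / real l) / pi * (\<alpha> powr (real m / real l) / Gamma ((real m + 1) / real l))"
proof -
  have "\<alpha> powr (- (real m + 1) / l) = 1 / (\<alpha> powr (1 / l) * \<alpha> powr (m / l))"
  proof -
    have "- (real m + 1) / l = - (1 / l + m / l)" by (simp add: add_divide_distrib diff_divide_distrib)
    then show ?thesis by (simp only: powr_minus powr_add) (simp add: field_simps)
  qed
  then show ?thesis unfolding power_moment_eq[OF l a] by simp
qed

lemma kernel_at_power_sum:
  assumes l: "l \<ge> 1" and a: "\<alpha> > 0"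
  shows "power_sum (\<lambda>m. cnj z ^ m / of_real (power_moment l \<alpha> m)) (kernel_at l \<alpha> z)"
  unfolding power_sum_def
proof
  fix w
  obtain C \<beta> where C: "C \<ge> 0" "\<beta> > 0"
    "\<And>m x. x \<ge> 0 \<Longrightarrow> x ^ m / power_moment l \<alpha> m \<le> C * (1/2) ^ m * exp (\<beta> * x ^ l)"
    by (rule inverse_moment_decay[OF l a]) blast
  let ?c = "\<lambda>m. cnj z ^ m / of_real (power_moment l \<alpha> m)"
  let ?k = "real l * \<alpha> powr (1 / real l) / pi"
  have k0: "?k > 0" using l a by (auto intro!: mult_pos_pos divide_pos_pos)
  have "summable (\<lambda>m. C * (1/2) ^ m * exp (\<beta> * (cmod z * cmod w) ^ l))"
    by (intro summable_mult summable_mult2 summable_geometric) auto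
  moreover have "norm (?c m * w ^ m) \<le> C * (1/2) ^ m * exp (\<beta> * (cmod z * cmod w) ^ l)" for m
    using C(3)[of "cmod z * cmod w" m] power_moment_pos[OF l a, of m]
    by (simp add: norm_mult norm_divide norm_power power_mult_distrib)
  ultimately have s: "summable (\<lambda>m. ?c m * w ^ m)"
    by (rule summable_comparison_test'[where N = 0])
  have trm: "of_real ?k * (of_real (\<alpha> powr (real m / real l)) * w ^ m * cnj z ^ m /
          of_real (Gamma ((real m + 1) / real l))) = ?c m * w ^ m" for m
  proof -
    have "?c m = of_real (1 / power_moment l \<alpha> m) * cnj z ^ m" by simp
    then show ?thesis unfolding inverse_power_moment[OF l a] by simp
  qed
  have "summable (\<lambda>m. of_real (\<alpha> powr (real m / real l)) * w ^ m * cnj z ^ m /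
          of_real (Gamma ((real m + 1) / real l)))"
  proof -
    have "summable (\<lambda>m. of_real ?k * (of_real (\<alpha> powr (real m / real l)) * w ^ m * cnj z ^ m /
          of_real (Gamma ((real m + 1) / real l))))"
      using s by (simp only: trm)
    moreover have "of_real ?k \<noteq> (0::complex)" using k0 by (simp only: of_real_eq_0_iff)
    ultimately show ?thesis by (simp only: summable_cmult_iff simp_thms)
  qed
  then have "bergman_kernel l \<alpha> w z = (\<Sum>m. ?c m * w ^ m)"
    unfolding bergman_kernel_def trm[symmetric] by (rule suminf_mult[symmetric])
  then show "(\<lambda>m. ?c m * w ^ m) sums kernel_at l \<alpha> z w"
    using s by (simp add: kernel_at_def sums_iff)
qed

lemma kernel_at_in_E_class:
  assumes l: "l \<ge> 1" and a: "\<alpha> > 0"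
  shows "kernel_at l \<alpha> z \<in> E_class l"
proof -
  obtain C \<beta> where C: "C \<ge> 0" "\<beta> > 0"
    "\<And>m x. x \<ge> 0 \<Longrightarrow> x ^ m / power_moment l \<alpha> m \<le> C * (1/2) ^ m * exp (\<beta> * x ^ l)"
    by (rule inverse_moment_decay[OF l a]) blast
  let ?c = "\<lambda>m. cnj z ^ m / of_real (power_moment l \<alpha> m)"
  note ps = kernel_at_power_sum[OF l a, of z]
  show ?thesis
  proof (rule E_classI)
    show "kernel_at l \<alpha> z \<in> entire" using ps by (rule power_sum_entire)
    fix w
    have bnd: "norm (?c m * w ^ m) \<le> C * exp (\<beta> * (cmod z * cmod w) ^ l) * (1/2) ^ m" for m
      using C(3)[of "cmod z * cmod w" m] power_moment_pos[OF l a, of m]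
      by (simp add: norm_mult norm_divide norm_power power_mult_distrib mult_ac)
    have g: "(\<lambda>m. C * exp (\<beta> * (cmod z * cmod w) ^ l) * (1/2) ^ m) sums (C * exp (\<beta> * (cmod z * cmod w) ^ l) * 2)"
      using geometric_sums[of "1/2::real"] by (intro sums_mult) simp
    have "norm (\<Sum>m. ?c m * w ^ m) \<le> (\<Sum>m. C * exp (\<beta> * (cmod z * cmod w) ^ l) * (1/2) ^ m)"
      by (rule norm_suminf_le[OF bnd]) (rule sums_summable[OF g])
    then show "cmod (kernel_at l \<alpha> z w) \<le> C * 2 * exp ((\<beta> * cmod z ^ l) * cmod w ^ l)"
      using ps g by (simp add: power_sum_def sums_iff power_mult_distrib mult_ac)
  qed
qed

text \<open>The Taylor coefficients of the kernel are the inverse moments, which cancel the moments in the pairing.\<close>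
lemma pairing_kernel_at:
  assumes l: "l \<ge> 1" and a: "\<alpha> > 0" and g: "g \<in> entire" and \<gamma>: "\<gamma> < \<alpha>"
    and C: "\<And>z. cmod (g z) \<le> C * exp (\<gamma> * cmod z ^ (2 * l))"
  shows "pairing l \<alpha> (kernel_at l \<alpha> z) g = cnj (g z)"
proof -
  have b: "power_sum (taylor g) g" by (rule entire_power_sum[OF g])
  have "(\<lambda>m. cnj z ^ m / of_real (power_moment l \<alpha> m) * (cnj (taylor g m) * of_real (power_moment l \<alpha> m)))
      sums pairing l \<alpha> (kernel_at l \<alpha> z) g"
    by (rule pairing_sums(1)[OF l a kernel_at_in_E_class[OF l a] kernel_at_power_sum[OF l a] b \<gamma> C])
  also have "(\<lambda>m. cnj z ^ m / of_real (power_moment l \<alpha> m) * (cnj (taylor g m) * of_real (power_moment l \<alpha> m)))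
      = (\<lambda>m. cnj (taylor g m * z ^ m))"
    using power_moment_pos[OF l a] by (auto simp: fun_eq_iff less_imp_neq[symmetric])
  finally have "(\<lambda>m. cnj (taylor g m * z ^ m)) sums pairing l \<alpha> (kernel_at l \<alpha> z) g" .
  moreover have "(\<lambda>m. cnj (taylor g m * z ^ m)) sums cnj (g z)"
    using b unfolding sums_cnj power_sum_def by blast
  ultimately show ?thesis by (rule sums_unique2)
qed

section \<open>Atoms\<close>

lemma power_le_fact_mult_exp:
  assumes "x \<ge> (0::real)"
  shows "x ^ n \<le> fact n * exp x"
proof -
  have "(\<Sum>k\<in>{n}. x ^ k /\<^sub>R fact k) \<le> (\<Sum>k. x ^ k /\<^sub>R fact k)"
    using assms by (intro sum_le_suminf summable_exp_generic) auto
  also have "\<dots> = exp x" by (simp add: exp_def)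
  finally show ?thesis by (simp add: field_simps)
qed

lemma power_diff_roots_of_unity:
  fixes w \<zeta> :: complex
  assumes l: "l \<ge> 1"
  shows "w ^ l - \<zeta> ^ l = (\<Prod>\<omega> | \<omega> ^ l = 1. w - \<omega> * \<zeta>)"
proof -
  have cardU: "card {\<omega>::complex. \<omega> ^ l = 1} = l"
    using l by (intro card_roots_unity_eq) auto
  show ?thesis
  proof (cases "\<zeta> = 0")
    case True
    then show ?thesis using l by (simp add: cardU power_0_left)
  next
    case False
    define p :: "complex poly" where "p = monom 1 l - 1"
    have pp: "poly p x = x ^ l - 1" for x by (simp add: p_def poly_monom)
    have "rsquarefree p"
      using l by (auto simp: rsquarefree_roots pp) (auto simp: p_def pderiv_diff pderiv_monom poly_monom power_0_left)
    have lc: "lead_coeff p = 1"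
    proof -
      have "degree p = l" unfolding p_def
        using l by (subst diff_conv_add_uminus, subst degree_add_eq_left) (auto simp: degree_monom_eq)
      then show ?thesis using l by (simp add: p_def)
    qed
    have "smult (lead_coeff p) (\<Prod>z|poly p z = 0. [:-z, 1:]) = p"
      by (rule complex_poly_decompose_rsquarefree) fact
    then have "poly p x = (\<Prod>\<omega> | \<omega> ^ l = 1. x - \<omega>)" for x
      by (subst (asm) lc) (simp add: pp, metis (no_types, lifting) pp poly_prod prod.cong poly_pCons poly_0 mult.right_neutral add_uminus_conv_diff mult_zero_right add.right_neutral add.commute)
    then have e: "x ^ l - 1 = (\<Prod>\<omega> | \<omega> ^ l = 1. x - \<omega>)" for x :: complex by (simp add: pp)
    have "w ^ l - \<zeta> ^ l = \<zeta> ^ l * ((w / \<zeta>) ^ l - 1)"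
      using False by (simp add: power_divide field_simps)
    also have "\<dots> = (\<Prod>\<omega> | \<omega> ^ l = 1. \<zeta> * (w / \<zeta> - \<omega>))"
      unfolding e by (simp add: prod.distrib cardU)
    also have "\<dots> = (\<Prod>\<omega> | \<omega> ^ l = 1. w - \<omega> * \<zeta>)"
      using False by (intro prod.cong) (auto simp: field_simps)
    finally show ?thesis .
  qed
qed

text \<open>Factorise \<open>w ^ l - \<zeta> ^ l\<close> over the roots of unity. If \<open>\<omega> *
\<zeta>\<close> is the root nearest to \<open>w\<close>, every other factor is at least a constant times
both the distance from \<open>w\<close> to \<open>\<omega> * \<zeta>\<close> and \<open>cmod
\<zeta>\<close>, because distinct roots of unity are separated.\<close>
lemma nearest_root_estimate:
  assumes l: "l \<ge> 1"
  obtains c where "c > 0" "\<And>w \<zeta> :: complex. \<exists>\<omega>. \<omega> ^ l = 1 \<and>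
    c * (cmod (w - \<omega> * \<zeta>) * max (cmod (w - \<omega> * \<zeta>)) (cmod \<zeta>) ^ (l - 1)) \<le> cmod (w ^ l - \<zeta> ^ l)"
proof -
  let ?U = "{\<omega>::complex. \<omega> ^ l = 1}"
  have finU: "finite ?U" using l by (intro finite_roots_unity) auto
  have cardU: "card ?U = l" using l by (intro card_roots_unity_eq) auto
  have "1 \<in> ?U" by simp
  define D where "D = insert 2 ((\<lambda>(x, y). cmod (x - y)) ` {(x, y). x \<in> ?U \<and> y \<in> ?U \<and> x \<noteq> y})"
  have "{(x, y). x \<in> ?U \<and> y \<in> ?U \<and> x \<noteq> y} \<subseteq> ?U \<times> ?U" by auto
  then have finD: "finite D" using finU unfolding D_def by (blast intro: finite_subset finite_SigmaI)
  define d where "d = Min D / 2"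
  have "Min D \<in> D" using finD by (intro Min_in) (auto simp: D_def)
  then have d0: "d > 0" by (auto simp: D_def d_def)
  have d1: "d \<le> 1" using finD by (auto simp: D_def d_def intro: Min_le)
  have d2: "2 * d \<le> cmod (x - y)" if "x \<in> ?U" "y \<in> ?U" "x \<noteq> y" for x y
  proof -
    have "cmod (x - y) \<in> D" using that by (force simp: D_def)
    then show ?thesis using finD by (simp add: d_def)
  qed
  have "\<exists>\<omega>. \<omega> ^ l = 1 \<and>
    d ^ (l - 1) * (cmod (w - \<omega> * \<zeta>) * max (cmod (w - \<omega> * \<zeta>)) (cmod \<zeta>) ^ (l - 1)) \<le> cmod (w ^ l - \<zeta> ^ l)"
    for w \<zeta> :: complex
  proof -
    define \<omega> where "\<omega> = arg_min_on (\<lambda>\<omega>. cmod (w - \<omega> * \<zeta>)) ?U"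
    have \<omega>: "\<omega> \<in> ?U" unfolding \<omega>_def by (rule arg_min_if_finite[OF finU]) (use \<open>1 \<in> ?U\<close> in blast)
    have near: "cmod (w - \<omega> * \<zeta>) \<le> cmod (w - \<omega>' * \<zeta>)" if "\<omega>' \<in> ?U" for \<omega>'
      unfolding \<omega>_def by (rule arg_min_least[OF finU _ that]) (use \<open>1 \<in> ?U\<close> in blast)
    let ?m = "max (cmod (w - \<omega> * \<zeta>)) (cmod \<zeta>)"
    have far: "d * ?m \<le> cmod (w - \<omega>' * \<zeta>)" if "\<omega>' \<in> ?U - {\<omega>}" for \<omega>'
    proof -
      have "d * cmod (w - \<omega> * \<zeta>) \<le> 1 * cmod (w - \<omega> * \<zeta>)" using d1 by (intro mult_right_mono) auto
      then have 1: "d * cmod (w - \<omega> * \<zeta>) \<le> cmod (w - \<omega>' * \<zeta>)" using near[of \<omega>'] that by simp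
      have "2 * d * cmod \<zeta> \<le> cmod (\<omega> - \<omega>') * cmod \<zeta>"
        using d2[of \<omega> \<omega>'] that \<omega> by (intro mult_right_mono) auto
      also have "\<dots> = cmod ((w - \<omega>' * \<zeta>) - (w - \<omega> * \<zeta>))"
        by (simp add: norm_mult[symmetric] algebra_simps)
      also have "\<dots> \<le> cmod (w - \<omega>' * \<zeta>) + cmod (w - \<omega> * \<zeta>)" by (rule norm_triangle_ineq4)
      also have "\<dots> \<le> 2 * cmod (w - \<omega>' * \<zeta>)" using near[of \<omega>'] that by simp
      finally have 2: "d * cmod \<zeta> \<le> cmod (w - \<omega>' * \<zeta>)" by simp
      show ?thesis using 1 2 by (simp add: max_def)
    qed
    have "(d * ?m) ^ (l - 1) = (\<Prod>\<omega>'\<in>?U - {\<omega>}. d * ?m)"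
      using \<omega> finU by (simp add: cardU)
    also have "\<dots> \<le> (\<Prod>\<omega>'\<in>?U - {\<omega>}. cmod (w - \<omega>' * \<zeta>))"
      using far d0 by (intro prod_mono) (auto intro!: mult_nonneg_nonneg simp: le_max_iff_disj)
    finally have "cmod (w - \<omega> * \<zeta>) * (d * ?m) ^ (l - 1) \<le> cmod (w - \<omega> * \<zeta>) * (\<Prod>\<omega>'\<in>?U - {\<omega>}. cmod (w - \<omega>' * \<zeta>))"
      by (intro mult_left_mono) auto
    also have "\<dots> = cmod (\<Prod>\<omega>'\<in>?U. w - \<omega>' * \<zeta>)"
      using \<omega> finU by (simp add: prod.remove norm_mult prod_norm)
    also have "\<dots> = cmod (w ^ l - \<zeta> ^ l)" by (simp only: power_diff_roots_of_unity[OF l])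
    finally show ?thesis using \<omega> by (intro exI[of _ \<omega>]) (simp add: power_mult_distrib mult_ac)
  qed
  then show ?thesis using d0 by (intro that[of "d ^ (l - 1)"]) auto
qed

text \<open>By the preceding estimate the map \<open>w \<mapsto> w ^ l\<close> expands distances from the nearest
root by a factor of order \<open>cmod \<zeta> ^ (l - 1)\<close>, so the left side is dominated by a
Gaussian of the inverse width around that root. The power of \<open>cmod w\<close> is absorbed at the
cost of part of the Gaussian.\<close>
lemma atom_pointwise_bound:
  assumes l: "l \<ge> 1" and a: "\<alpha> > (0::real)"
  obtains C c where "C > 0" "c > 0" "\<And>w \<zeta> :: complex. \<exists>\<omega>. \<omega> ^ l = 1 \<and>
    cmod w ^ j * exp (- (\<alpha> / 2) * (cmod (w ^ l - \<zeta> ^ l))\<^sup>2)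
      \<le> C * max 1 (cmod \<zeta>) ^ j * exp (- c * (max 1 (cmod \<zeta>) ^ (l - 1) * cmod (w - \<omega> * \<zeta>))\<^sup>2)"
proof -
  obtain c0 where c0: "c0 > 0" "\<And>w \<zeta> :: complex. \<exists>\<omega>. \<omega> ^ l = 1 \<and>
    c0 * (cmod (w - \<omega> * \<zeta>) * max (cmod (w - \<omega> * \<zeta>)) (cmod \<zeta>) ^ (l - 1)) \<le> cmod (w ^ l - \<zeta> ^ l)"
    by (rule nearest_root_estimate[OF l]) blast
  define c where "c = \<alpha> * c0\<^sup>2 / 8"
  have c: "c > 0" using a c0 by (simp add: c_def)
  define C where "C = exp (4 * c) * (fact j * exp 1 * exp (1 / (4 * c)))"
  have C: "C > 0" by (simp add: C_def)
  have "\<exists>\<omega>. \<omega> ^ l = 1 \<and>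
    cmod w ^ j * exp (- (\<alpha> / 2) * (cmod (w ^ l - \<zeta> ^ l))\<^sup>2)
      \<le> C * max 1 (cmod \<zeta>) ^ j * exp (- c * (max 1 (cmod \<zeta>) ^ (l - 1) * cmod (w - \<omega> * \<zeta>))\<^sup>2)"
    for w \<zeta> :: complex
  proof -
    define \<mu> where "\<mu> = max 1 (cmod \<zeta>)"
    obtain \<omega> where \<omega>: "\<omega> ^ l = 1" "c0 * (cmod (w - \<omega> * \<zeta>) * max (cmod (w - \<omega> * \<zeta>)) (cmod \<zeta>) ^ (l - 1)) \<le> cmod (w ^ l - \<zeta> ^ l)"
      using c0(2) by blast
    define v where "v = cmod (w - \<omega> * \<zeta>)"
    define s where "s = \<mu> ^ (l - 1) * v"
    have v0: "v \<ge> 0" by (simp add: v_def)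
    have L: "\<mu> \<ge> 1" by (simp add: \<mu>_def)
    have s0: "s \<ge> 0" using v0 L by (simp add: s_def)
    have vs: "v \<le> s" using mult_right_mono[OF one_le_power[OF L] v0, of "l - 1"] by (simp add: s_def)
    have "s - 1 \<le> v * max v (cmod \<zeta>) ^ (l - 1)"
    proof (cases "cmod \<zeta> \<ge> 1")
      case True
      then have "\<mu> ^ (l - 1) \<le> max v (cmod \<zeta>) ^ (l - 1)" by (intro power_mono) (auto simp: \<mu>_def)
      then have "v * \<mu> ^ (l - 1) \<le> v * max v (cmod \<zeta>) ^ (l - 1)" using v0 by (rule mult_left_mono)
      then show ?thesis by (simp add: s_def mult.commute)
    next
      case False
      then have sv: "s = v" by (simp add: s_def \<mu>_def)
      show ?thesis
      proof (cases "v \<ge> 1")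
        case True
        have "1 \<le> max v (cmod \<zeta>) ^ (l - 1)" using True by (intro one_le_power) auto
        from mult_left_mono[OF this v0] show ?thesis by (simp add: sv)
      next
        case False
        have "0 \<le> v * max v (cmod \<zeta>) ^ (l - 1)" using v0 by (intro mult_nonneg_nonneg zero_le_power) auto
        then show ?thesis using False by (simp add: sv)
      qed
    qed
    then have "c0 * (s - 1) \<le> c0 * (v * max v (cmod \<zeta>) ^ (l - 1))"
      using c0(1) by (intro mult_left_mono) auto
    also have "\<dots> \<le> cmod (w ^ l - \<zeta> ^ l)" using \<omega>(2) by (simp add: v_def)
    finally have low: "c0 * (s - 1) \<le> cmod (w ^ l - \<zeta> ^ l)" .
    have sq: "c0\<^sup>2 * (s\<^sup>2 / 2 - 1) \<le> (cmod (w ^ l - \<zeta> ^ l))\<^sup>2"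
    proof (cases "s \<ge> 1")
      case True
      have "s\<^sup>2 / 2 - 1 \<le> (s - 1)\<^sup>2"
        using zero_le_power2[of "s - 2"] by (simp add: power2_eq_square algebra_simps)
      then have "c0\<^sup>2 * (s\<^sup>2 / 2 - 1) \<le> c0\<^sup>2 * (s - 1)\<^sup>2"
        by (intro mult_left_mono) auto
      also have "\<dots> = (c0 * (s - 1))\<^sup>2" by (simp add: power_mult_distrib)
      also have "\<dots> \<le> (cmod (w ^ l - \<zeta> ^ l))\<^sup>2"
        using low True c0(1) by (intro power_mono) auto
      finally show ?thesis .
    next
      case False
      have "s\<^sup>2 \<le> 1" using False s0 by (simp add: power_le_one)
      then have "c0\<^sup>2 * (s\<^sup>2 / 2 - 1) \<le> 0" by (intro mult_nonneg_nonpos) auto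
      also have "0 \<le> (cmod (w ^ l - \<zeta> ^ l))\<^sup>2" by simp
      finally show ?thesis .
    qed
    have "(\<alpha> / 2) * (c0\<^sup>2 * (s\<^sup>2 / 2 - 1)) \<le> (\<alpha> / 2) * (cmod (w ^ l - \<zeta> ^ l))\<^sup>2"
      using sq a by (intro mult_left_mono) auto
    moreover have "(\<alpha> / 2) * (c0\<^sup>2 * (s\<^sup>2 / 2 - 1)) = 2 * c * s\<^sup>2 - 4 * c"
      by (simp add: c_def field_simps)
    ultimately have e1: "exp (- (\<alpha> / 2) * (cmod (w ^ l - \<zeta> ^ l))\<^sup>2) \<le> exp (4 * c - 2 * c * s\<^sup>2)" by simp
    have nu: "cmod \<omega> = 1" using \<omega>(1) l by (metis norm_one norm_power norm_ge_zero power_eq_1_iff not_one_le_zero)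
    have "cmod w \<le> cmod (\<omega> * \<zeta>) + v" unfolding v_def by (metis norm_triangle_sub)
    also have "\<dots> \<le> \<mu> + s" using vs by (simp add: norm_mult nu \<mu>_def add_mono)
    also have "\<dots> \<le> \<mu> * (1 + s)" using L mult_right_mono[OF L s0] by (simp add: distrib_left)
    finally have "cmod w ^ j \<le> (\<mu> * (1 + s)) ^ j" by (intro power_mono) auto
    also have "\<dots> = \<mu> ^ j * (1 + s) ^ j" by (simp add: power_mult_distrib)
    also have "(1 + s) ^ j \<le> fact j * exp 1 * exp (1 / (4 * c)) * exp (c * s\<^sup>2)"
    proof -
      have "(1 + s) ^ j / fact j \<le> exp (1 + s)"
        using power_le_fact_mult_exp[of "1 + s" j] s0 by (simp add: field_simps)
      then have "(1 + s) ^ j \<le> fact j * (exp 1 * exp s)" by (simp add: field_simps exp_add)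
      also have "exp s \<le> exp (1 / (4 * c)) * exp (c * s\<^sup>2)"
        using exp_power_le[OF c, of 1 s] by simp
      finally show ?thesis by (simp add: mult_ac)
    qed
    finally have w: "cmod w ^ j \<le> \<mu> ^ j * (fact j * exp 1 * exp (1 / (4 * c)) * exp (c * s\<^sup>2))"
      using L by simp
    have "cmod w ^ j * exp (- (\<alpha> / 2) * (cmod (w ^ l - \<zeta> ^ l))\<^sup>2)
      \<le> (\<mu> ^ j * (fact j * exp 1 * exp (1 / (4 * c)) * exp (c * s\<^sup>2))) * exp (4 * c - 2 * c * s\<^sup>2)"
      using L by (intro mult_mono w e1) auto
    also have "\<dots> = C * \<mu> ^ j * (exp (c * s\<^sup>2) * exp (- 2 * c * s\<^sup>2))"
      by (simp add: C_def exp_diff exp_minus field_simps)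
    also have "exp (c * s\<^sup>2) * exp (- 2 * c * s\<^sup>2) = exp (- c * s\<^sup>2)"
      by (simp add: exp_add[symmetric] algebra_simps)
    finally show ?thesis using \<omega>(1) unfolding s_def v_def \<mu>_def by blast
  qed
  then show ?thesis using C c that by blast
qed

text \<open>An elementary function whose product with another of its kind is a monomial times \<open>exp (of_real
(\<alpha> * t) * (w * cnj z) ^ l)\<close>; hence the factor \<open>1 / 2\<close> in the exponent.\<close>
definition atom :: "nat \<Rightarrow> real \<Rightarrow> nat \<Rightarrow> real \<Rightarrow> complex \<Rightarrow> complex \<Rightarrow> complex" where
  "atom l \<alpha> j t z w = w ^ j * exp (of_real (\<alpha> * t / 2) * (w * cnj z) ^ l)"

lemma cmod_diff_power2: "(cmod (a - b))\<^sup>2 = (cmod a)\<^sup>2 + (cmod b)\<^sup>2 - 2 * Re (a * cnj b)"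
  unfolding cmod_power2 by (simp add: power2_eq_square algebra_simps)

text \<open>Completing the square in \<open>w ^ l\<close>.\<close>
lemma weighted_atom:
  assumes \<zeta>: "\<zeta> ^ l = of_real (t / 2) * z ^ l"
  shows "weighted l \<alpha> (atom l \<alpha> j t z) w
    = cmod w ^ j * exp (- (\<alpha> / 2) * (cmod (w ^ l - \<zeta> ^ l))\<^sup>2) * exp (\<alpha> * t\<^sup>2 * cmod z ^ (2 * l) / 8)"
proof -
  have "(cmod (w ^ l - \<zeta> ^ l))\<^sup>2 = cmod w ^ (2 * l) + t\<^sup>2 / 4 * cmod z ^ (2 * l) - t * Re ((w * cnj z) ^ l)"
  proof -
    have "w ^ l * cnj (of_real (t / 2) * z ^ l) = of_real (t / 2) * (w * cnj z) ^ l"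
      by (simp add: power_mult_distrib)
    moreover have "Re (of_real (t / 2) * x) = t / 2 * Re x" for x by simp
    ultimately have "Re (w ^ l * cnj (of_real (t / 2) * z ^ l)) = t / 2 * Re ((w * cnj z) ^ l)"
      by (simp only:)
    then show ?thesis unfolding cmod_diff_power2 \<zeta>
      by (simp add: norm_mult norm_power power_mult_distrib power_mult[symmetric] mult.commute[of l] power_divide)
  qed
  moreover have "- (\<alpha> / 2) * Q + \<alpha> * t\<^sup>2 * Z / 8 = \<alpha> * t / 2 * R - \<alpha> * W / 2"
    if "Q = W + t\<^sup>2 / 4 * Z - t * R" for Q W Z R :: real
    unfolding that by (simp add: field_simps)
  ultimately have "- (\<alpha> / 2) * (cmod (w ^ l - \<zeta> ^ l))\<^sup>2 + \<alpha> * t\<^sup>2 * cmod z ^ (2 * l) / 8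
    = \<alpha> * t / 2 * Re ((w * cnj z) ^ l) - \<alpha> * cmod w ^ (2 * l) / 2"
    by blast
  then have "exp (- (\<alpha> / 2) * (cmod (w ^ l - \<zeta> ^ l))\<^sup>2) * exp (\<alpha> * t\<^sup>2 * cmod z ^ (2 * l) / 8)
    = exp (\<alpha> * t / 2 * Re ((w * cnj z) ^ l) - \<alpha> * cmod w ^ (2 * l) / 2)"
    by (simp only: exp_add[symmetric])
  also have "\<dots> = cmod (exp (of_real (\<alpha> * t / 2) * (w * cnj z) ^ l)) * exp (- \<alpha> * cmod w ^ (2 * l) / 2)"
    unfolding norm_exp_eq_Re by (simp add: exp_add[symmetric] del: of_real_mult of_real_divide)
  finally show ?thesis by (simp add: weighted_def atom_def norm_mult norm_power)
qed

lemma atom_in_E_class: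
  assumes l: "l \<ge> 1" shows "atom l \<alpha> j t z \<in> E_class l"
proof -
  have "(\<lambda>w. 1 * w ^ j) \<in> E_class l" by (rule monomial_in_E_class[OF l])
  moreover have "(\<lambda>w. exp (of_real (\<alpha> * t / 2) * (w * cnj z) ^ l)) \<in> E_class l"
  proof (rule E_classI)
    show "(\<lambda>w. exp (of_real (\<alpha> * t / 2) * (w * cnj z) ^ l)) \<in> entire"
      by (auto simp: entire_def intro!: holomorphic_intros)
    fix w
    have "Re (of_real (\<alpha> * t / 2) * (w * cnj z) ^ l) \<le> cmod (of_real (\<alpha> * t / 2) * (w * cnj z) ^ l)"
      by (rule complex_Re_le_cmod)
    also have "\<dots> = (\<bar>\<alpha> * t / 2\<bar> * cmod z ^ l) * cmod w ^ l"
      by (simp only: norm_mult norm_power norm_of_real complex_mod_cnj power_mult_distrib mult_ac)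
    finally show "cmod (exp (of_real (\<alpha> * t / 2) * (w * cnj z) ^ l)) \<le> 1 * exp ((\<bar>\<alpha> * t / 2\<bar> * cmod z ^ l) * cmod w ^ l)"
      by simp
  qed
  ultimately show ?thesis unfolding atom_def[abs_def] using E_class_mult by fastforce
qed

lemma atom_root_exists:
  assumes l: "l \<ge> 1" and t: "0 \<le> t" "t \<le> 1"
  obtains \<zeta> where "\<zeta> ^ l = of_real (t / 2) * z ^ l" "cmod \<zeta> \<le> cmod z"
proof -
  define r where "r = root l (t / 2)"
  have r: "r \<ge> 0" "r ^ l = t / 2" using l t by (auto simp: r_def)
  have "r \<le> 1" unfolding r_def using l t by (subst real_root_le_1_iff) auto
  show ?thesis
  proof (rule that[of "of_real r * z"])
    show "(of_real r * z) ^ l = of_real (t / 2) * z ^ l"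
      by (simp only: power_mult_distrib of_real_power[symmetric] r(2))
    show "cmod (of_real r * z) \<le> cmod z"
      using r(1) \<open>r \<le> 1\<close> by (simp add: norm_mult mult_left_le_one_le)
  qed
qed

lemma atom_weighted_bound:
  assumes l: "l \<ge> 1" and a: "\<alpha> > 0"
  obtains C where "C > 0" "\<And>t z w. 0 \<le> t \<Longrightarrow> t \<le> 1 \<Longrightarrow>
    weighted l \<alpha> (atom l \<alpha> j t z) w \<le> C * max 1 (cmod z) ^ j * exp (\<alpha> * t\<^sup>2 * cmod z ^ (2 * l) / 8)"
proof -
  obtain C c where C: "C > 0" "c > 0" "\<And>w \<zeta> :: complex. \<exists>\<omega>. \<omega> ^ l = 1 \<and>
    cmod w ^ j * exp (- (\<alpha> / 2) * (cmod (w ^ l - \<zeta> ^ l))\<^sup>2)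
      \<le> C * max 1 (cmod \<zeta>) ^ j * exp (- c * (max 1 (cmod \<zeta>) ^ (l - 1) * cmod (w - \<omega> * \<zeta>))\<^sup>2)"
    by (rule atom_pointwise_bound[OF l a]) blast
  show ?thesis
  proof (rule that[OF C(1)])
    fix t :: real and z w :: complex assume t: "0 \<le> t" "t \<le> 1"
    obtain \<zeta> where \<zeta>: "\<zeta> ^ l = of_real (t / 2) * z ^ l" "cmod \<zeta> \<le> cmod z"
      by (rule atom_root_exists[OF l t])
    obtain \<omega> where "cmod w ^ j * exp (- (\<alpha> / 2) * (cmod (w ^ l - \<zeta> ^ l))\<^sup>2)
      \<le> C * max 1 (cmod \<zeta>) ^ j * exp (- c * (max 1 (cmod \<zeta>) ^ (l - 1) * cmod (w - \<omega> * \<zeta>))\<^sup>2)"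
      using C(3) by blast
    also have "\<dots> \<le> C * max 1 (cmod z) ^ j * 1"
      using \<zeta>(2) C by (intro mult_mono power_mono) auto
    finally show "weighted l \<alpha> (atom l \<alpha> j t z) w \<le> C * max 1 (cmod z) ^ j * exp (\<alpha> * t\<^sup>2 * cmod z ^ (2 * l) / 8)"
      unfolding weighted_atom[OF \<zeta>(1)] by (intro mult_right_mono) auto
  qed
qed

section \<open>Norms on spaces of entire functions\<close>

lemma Hoelder_inequality:
  fixes f g :: "'a \<Rightarrow> real"
  assumes pq: "1 < p" "1 / p + 1 / q = 1"
    and [measurable]: "f \<in> borel_measurable M" "g \<in> borel_measurable M"
    and nonneg: "\<And>x. f x \<ge> 0" "\<And>x. g x \<ge> 0"
    and f: "integrable M (\<lambda>x. f x powr p)" and g: "integrable M (\<lambda>x. g x powr q)"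
  shows "integrable M (\<lambda>x. f x * g x)"
    and "(LINT x|M. f x * g x) \<le> (LINT x|M. f x powr p) powr (1 / p) * (LINT x|M. g x powr q) powr (1 / q)"
proof -
  have q: "1 < q"
  proof -
    have "1 / q = 1 - 1 / p" "1 / p < 1" "0 < 1 / p" using pq by auto
    then have "0 < 1 / q" "1 / q < 1" by linarith+
    then show ?thesis by (simp add: divide_less_eq split: if_splits)
  qed
  note Young = Youngs_inequality[OF pq(1) q pq(2)]
  have int: "integrable M (\<lambda>x. f x powr p / p + g x powr q / q)"
    using f g by (intro Bochner_Integration.integrable_add integrable_divide) auto
  show i: "integrable M (\<lambda>x. f x * g x)"
    by (rule Bochner_Integration.integrable_bound[OF int])
      (use nonneg Young in \<open>auto intro!: AE_I2 order_trans[OF _ abs_ge_self]\<close>)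
  define A where "A = (LINT x|M. f x powr p)"
  define B where "B = (LINT x|M. g x powr q)"
  have AB0: "A \<ge> 0" "B \<ge> 0" by (auto simp: A_def B_def)
  have "(LINT x|M. f x * g x) \<le> A powr (1 / p) * B powr (1 / q)"
  proof (cases "A = 0 \<or> B = 0")
    case True
    have "AE x in M. f x * g x = 0"
    proof (cases "A = 0")
      case True
      then have "AE x in M. f x powr p = 0"
        using f by (subst integral_nonneg_eq_0_iff_AE[symmetric]) (auto simp: A_def)
      then show ?thesis by eventually_elim auto
    next
      case False
      then have "AE x in M. g x powr q = 0"
        using g True by (subst integral_nonneg_eq_0_iff_AE[symmetric]) (auto simp: B_def)
      then show ?thesis by eventually_elim auto
    qed
    then have "(LINT x|M. f x * g x) = (LINT x|M. 0)"
      by (intro integral_cong_AE) auto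
    then show ?thesis using True pq q by auto
  next
    case False
    then have AB: "A > 0" "B > 0" using AB0 by auto
    define a where "a = A powr (1 / p)"
    define b where "b = B powr (1 / q)"
    have ab: "a > 0" "b > 0" using AB by (auto simp: a_def b_def)
    have ap: "a powr p = A" "b powr q = B" using AB pq q by (auto simp: a_def b_def powr_powr)
    have "(LINT x|M. f x * g x) \<le> (LINT x|M. a * b * (f x powr p / (A * p) + g x powr q / (B * q)))"
    proof (rule integral_mono[OF i])
      show "integrable M (\<lambda>x. a * b * (f x powr p / (A * p) + g x powr q / (B * q)))"
        using f g by (intro integrable_mult_right Bochner_Integration.integrable_add integrable_divide) auto
      fix x
      have "(f x / a) * (g x / b) \<le> (f x / a) powr p / p + (g x / b) powr q / q"
        using nonneg[of x] ab by (intro Young) auto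
      also have "\<dots> = f x powr p / (A * p) + g x powr q / (B * q)"
        using nonneg[of x] ab by (simp add: powr_divide ap)
      finally show "f x * g x \<le> a * b * (f x powr p / (A * p) + g x powr q / (B * q))"
        using ab by (simp add: field_simps)
    qed
    also have "\<dots> = a * b * (A / (A * p) + B / (B * q))"
      using f g by (subst integral_mult_right_zero, subst Bochner_Integration.integral_add) (auto simp: A_def B_def)
    also have "A / (A * p) + B / (B * q) = 1" using AB pq by simp
    finally show ?thesis by (simp add: a_def b_def)
  qed
  then show "(LINT x|M. f x * g x) \<le> (LINT x|M. f x powr p) powr (1 / p) * (LINT x|M. g x powr q) powr (1 / q)"
    by (simp add: A_def B_def)
qed

lemma weighted_nonneg [simp]: "weighted l \<alpha> f z \<ge> 0"
  by (simp add: weighted_def)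

lemma weighted_measurable [measurable]:
  "f \<in> borel_measurable borel \<Longrightarrow> weighted l \<alpha> f \<in> borel_measurable borel"
proof -
  assume [measurable]: "f \<in> borel_measurable borel"
  have "(\<lambda>z::complex. exp (- \<alpha> * cmod z ^ (2 * l) / 2)) \<in> borel_measurable borel"
    by (intro borel_measurable_continuous_onI continuous_intros) auto
  then show ?thesis unfolding weighted_def[abs_def] by measurable
qed

lemma weighted_cmult: "weighted l \<alpha> (\<lambda>z. c * f z) z = cmod c * weighted l \<alpha> f z"
  by (simp add: weighted_def norm_mult mult.assoc)

lemma weighted_mult: "weighted l (2 * \<alpha>) (\<lambda>z. f z * g z) z = weighted l \<alpha> f z * weighted l \<alpha> g z"
  by (simp add: weighted_def norm_mult exp_add[symmetric])

lemma weighted_le_iff: "weighted l \<alpha> f z \<le> C \<longleftrightarrow> cmod (f z) \<le> C * exp (\<alpha> / 2 * cmod z ^ (2 * l))"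
proof -
  have "weighted l \<alpha> f z = cmod (f z) / exp (\<alpha> / 2 * cmod z ^ (2 * l))"
    by (simp add: weighted_def exp_minus field_simps)
  then show ?thesis by (simp add: pos_divide_le_eq)
qed

lemma
  shows F_space_elts: "elts (F_space (ereal p) l \<alpha>) = {f \<in> entire. integrable lborel (\<lambda>z. weighted l \<alpha> f z powr p)}"
    and F_space_nrm: "f \<in> entire \<Longrightarrow>
      nrm (F_space (ereal p) l \<alpha>) f = (LINT z|lborel. weighted l \<alpha> f z powr p) powr (1 / p)"
proof -
  have m: "(\<lambda>z. weighted l \<alpha> f z powr p) \<in> borel_measurable lborel" if "f \<in> entire" for f
  proof -
    have [measurable]: "f \<in> borel_measurable borel" using that by (rule entire_measurable)
    show ?thesis by measurable
  qed
  have m': "f \<in> borel_measurable lebesgue" if "f \<in> entire" for f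
    using entire_measurable[OF that] by (simp add: measurable_completion)
  show "elts (F_space (ereal p) l \<alpha>) = {f \<in> entire. integrable lborel (\<lambda>z. weighted l \<alpha> f z powr p)}"
    by (auto simp: F_space_def L_space_def integrable_completion[OF m] m')
  show "nrm (F_space (ereal p) l \<alpha>) f = (LINT z|lborel. weighted l \<alpha> f z powr p) powr (1 / p)" if "f \<in> entire"
    by (simp add: F_space_def L_space_def integral_completion[OF m[OF that]])
qed

lemma
  shows F_one_elts: "elts (F_space 1 l \<alpha>) = {f \<in> entire. integrable lborel (weighted l \<alpha> f)}"
    and F_one_nrm: "f \<in> entire \<Longrightarrow> nrm (F_space 1 l \<alpha>) f = (LINT z|lborel. weighted l \<alpha> f z)"
  using F_space_elts[of 1 l \<alpha>] F_space_nrm[of f 1 l \<alpha>] by (auto simp: one_ereal_def[symmetric])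

lemma F_inf_I:
  assumes f: "f \<in> entire" and C: "\<And>z. weighted l \<alpha> f z \<le> C"
  shows "f \<in> elts (F_space \<infinity> l \<alpha>)" and "nrm (F_space \<infinity> l \<alpha>) f \<le> C"
proof -
  have [measurable]: "f \<in> borel_measurable borel" using f by (rule entire_measurable)
  have m: "(\<lambda>z. ereal (weighted l \<alpha> f z)) \<in> borel_measurable lebesgue"
    by (rule measurable_completion) measurable
  have mf: "f \<in> borel_measurable lebesgue" by (rule measurable_completion) measurable
  have le: "esssup lebesgue (\<lambda>z. ereal (weighted l \<alpha> f z)) \<le> ereal C"
    by (rule esssup_I[OF m]) (use C in auto)
  then have "esssup lebesgue (\<lambda>z. ereal (weighted l \<alpha> f z)) < \<infinity>"
    by (rule le_less_trans) simp
  then show "f \<in> elts (F_space \<infinity> l \<alpha>)"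
    by (simp add: F_space_def L_space_def f mf)
  have "C \<ge> 0" using C[of 0] weighted_nonneg order_trans by blast
  then have "real_of_ereal (esssup lebesgue (\<lambda>z. ereal (weighted l \<alpha> f z))) \<le> C"
    using le by (cases "esssup lebesgue (\<lambda>z. ereal (weighted l \<alpha> f z))") auto
  then show "nrm (F_space \<infinity> l \<alpha>) f \<le> C"
    by (simp add: F_space_def L_space_def)
qed

text \<open>A continuous function that is bounded almost everywhere is bounded everywhere by the same constant, so
the essential supremum is a supremum.\<close>
lemma F_inf_D:
  assumes f: "f \<in> elts (F_space \<infinity> l \<alpha>)"
  shows "f \<in> entire" and "weighted l \<alpha> f z \<le> nrm (F_space \<infinity> l \<alpha>) f"
proof -
  show e: "f \<in> entire" using f by (simp add: F_space_def)
  let ?s = "esssup lebesgue (\<lambda>z. ereal (weighted l \<alpha> f z))"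
  have s: "?s < \<infinity>" using f by (simp add: F_space_def L_space_def)
  have AE: "AE z in lebesgue. ereal (weighted l \<alpha> f z) \<le> ?s" by (rule esssup_AE)
  have cont: "continuous_on UNIV (weighted l \<alpha> f)"
    unfolding weighted_def[abs_def] by (intro continuous_intros entire_continuous[OF e]) auto
  have le: "ereal (weighted l \<alpha> f z) \<le> ?s" for z
  proof (rule ccontr)
    assume "\<not> ereal (weighted l \<alpha> f z) \<le> ?s"
    then obtain r where r: "?s \<le> ereal r" "r < weighted l \<alpha> f z"
      by (metis less_ereal.simps(1) ereal_dense2 not_le order.strict_implies_order)
    let ?S = "{z. r < weighted l \<alpha> f z}"
    have "open ?S" using cont by (intro open_Collect_less continuous_intros) auto
    moreover have "negligible ?S"
    proof -
      have "AE z in lebesgue. z \<notin> ?S"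
        using AE by eventually_elim (use r in \<open>auto simp: not_less dest: order_trans\<close>)
      then show ?thesis using \<open>open ?S\<close>
        by (subst negligible_iff_null_sets, subst AE_iff_null_sets) (auto simp: borel_open)
    qed
    ultimately show False using open_not_negligible[of ?S] r by auto
  qed
  have "0 \<le> ?s" using le[of 0] weighted_nonneg[of l \<alpha> f 0] by (metis ereal_less_eq(5) order_trans)
  then have "ereal (real_of_ereal ?s) = ?s" using s by (cases ?s) auto
  then show "weighted l \<alpha> f z \<le> nrm (F_space \<infinity> l \<alpha>) f"
    using le[of z] by (simp add: F_space_def L_space_def) (metis ereal_less_eq(3))
qed

lemma f_inf_space_subset: "elts (f_inf_space l \<alpha>) \<subseteq> elts (F_space \<infinity> l \<alpha>)"
proof
  fix f assume f: "f \<in> elts (f_inf_space l \<alpha>)"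
  then have e: "f \<in> entire" and lim: "(weighted l \<alpha> f \<longlongrightarrow> 0) at_infinity"
    by (auto simp: f_inf_space_def)
  have "eventually (\<lambda>z. weighted l \<alpha> f z < 1) at_infinity"
    using lim by (rule order_tendstoD) simp
  then have "(\<lambda>z. cmod (f z)) \<in> O[at_infinity](\<lambda>z. exp (\<alpha> / 2 * cmod z ^ (2 * l)))"
    by (intro landau_o.bigI[of 1]) (auto elim!: eventually_mono dest!: less_imp_le simp: weighted_le_iff)
  then have "\<exists>C\<ge>0. \<forall>z. cmod (f z) \<le> C * exp (\<alpha> / 2 * cmod z ^ (2 * l))"
    by (intro bigo_at_infinity_global_bound entire_continuous[OF e] continuous_intros) auto
  then obtain C where "\<And>z. cmod (f z) \<le> C * exp (\<alpha> / 2 * cmod z ^ (2 * l))"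
    by blast
  then show "f \<in> elts (F_space \<infinity> l \<alpha>)"
    by (intro F_inf_I[OF e]) (auto simp: weighted_le_iff)
qed

lemma f_inf_space_nrm: "nrm (f_inf_space l \<alpha>) = nrm (F_space \<infinity> l \<alpha>)"
  by (simp add: f_inf_space_def)

lemma E_class_weighted_decay:
  assumes f: "f \<in> E_class l" and a: "\<alpha> > 0"
  obtains C where "C \<ge> 0" "\<And>z. weighted l \<alpha> f z \<le> C * exp (- (\<alpha> / 4) * cmod z ^ (2 * l))"
proof -
  obtain C where C: "C \<ge> 0" "\<And>z. cmod (f z) \<le> C * exp (\<alpha> / 4 * cmod z ^ (2 * l))"
    by (rule E_class_growth[OF f, of "\<alpha> / 4"]) (use a in auto)
  have "weighted l \<alpha> f z \<le> C * exp (- (\<alpha> / 4) * cmod z ^ (2 * l))" for z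
  proof -
    have "exp (- (\<alpha> / 4) * cmod z ^ (2 * l)) * exp (\<alpha> / 2 * cmod z ^ (2 * l)) = exp (\<alpha> / 4 * cmod z ^ (2 * l))"
      by (simp add: exp_add[symmetric])
    then show ?thesis using C(2)[of z] by (simp only: weighted_le_iff mult.assoc)
  qed
  then show ?thesis using C(1) that by blast
qed

lemma weighted_decay_F_space:
  assumes l: "l \<ge> 1" and a: "\<alpha> > 0" and p: "p \<ge> 1" and g: "g \<in> entire" and D: "D \<ge> 0"
    and W: "\<And>z. weighted l \<alpha> g z \<le> D * exp (- (\<alpha> / 4) * cmod z ^ (2 * l))"
  shows "g \<in> elts (F_space (ereal p) l \<alpha>)"
    and "nrm (F_space (ereal p) l \<alpha>) g \<le> D * (LINT z|lborel. exp (- (p * \<alpha> / 4) * cmod z ^ (2 * l))) powr (1 / p)"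
proof -
  have [measurable]: "g \<in> borel_measurable borel" using g by (rule entire_measurable)
  have i: "integrable lborel (\<lambda>z. exp (- (p * \<alpha> / 4) * cmod z ^ (2 * l)))"
    using a p by (intro integrable_norm_exp l) auto
  have le: "weighted l \<alpha> g z powr p \<le> D powr p * exp (- (p * \<alpha> / 4) * cmod z ^ (2 * l))" for z
  proof -
    have "weighted l \<alpha> g z powr p \<le> (D * exp (- (\<alpha> / 4) * cmod z ^ (2 * l))) powr p"
      using W[of z] p by (intro powr_mono2) auto
    also have "\<dots> = D powr p * exp (- (p * \<alpha> / 4) * cmod z ^ (2 * l))"
      using D by (simp add: powr_mult exp_powr_real mult_ac)
    finally show ?thesis .
  qed
  have ig: "integrable lborel (\<lambda>z. weighted l \<alpha> g z powr p)"
    by (rule Bochner_Integration.integrable_bound[OF integrable_mult_right[OF i]])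
      (use le in \<open>auto intro!: AE_I2 order_trans[OF _ abs_ge_self]\<close>)
  then show "g \<in> elts (F_space (ereal p) l \<alpha>)" using g by (simp add: F_space_elts)
  have "(LINT z|lborel. weighted l \<alpha> g z powr p) \<le> (LINT z|lborel. D powr p * exp (- (p * \<alpha> / 4) * cmod z ^ (2 * l)))"
    by (intro integral_mono ig integrable_mult_right i le)
  then have "(LINT z|lborel. weighted l \<alpha> g z powr p) powr (1 / p)
    \<le> (D powr p * (LINT z|lborel. exp (- (p * \<alpha> / 4) * cmod z ^ (2 * l)))) powr (1 / p)"
    using p by (intro powr_mono2) auto
  also have "\<dots> = D * (LINT z|lborel. exp (- (p * \<alpha> / 4) * cmod z ^ (2 * l))) powr (1 / p)"
    using D p by (simp add: powr_mult powr_powr)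
  finally show "nrm (F_space (ereal p) l \<alpha>) g \<le> D * (LINT z|lborel. exp (- (p * \<alpha> / 4) * cmod z ^ (2 * l))) powr (1 / p)"
    using g by (simp add: F_space_nrm)
qed

lemma E_class_subset_F_space:
  assumes l: "l \<ge> 1" and a: "\<alpha> > 0" and p: "p \<ge> 1"
  shows "E_class l \<subseteq> elts (F_space (ereal p) l \<alpha>)"
proof
  fix f assume f: "f \<in> E_class l"
  obtain C where "C \<ge> 0" "\<And>z. weighted l \<alpha> f z \<le> C * exp (- (\<alpha> / 4) * cmod z ^ (2 * l))"
    by (rule E_class_weighted_decay[OF f a]) blast
  from weighted_decay_F_space(1)[OF l a p E_class_entire[OF f] this]
  show "f \<in> elts (F_space (ereal p) l \<alpha>)" .
qed

lemma E_class_subset_f_inf_space: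
  assumes l: "l \<ge> 1" and a: "\<alpha> > 0"
  shows "E_class l \<subseteq> elts (f_inf_space l \<alpha>)"
proof
  fix f assume f: "f \<in> E_class l"
  obtain C where C: "C \<ge> 0" "\<And>z. weighted l \<alpha> f z \<le> C * exp (- (\<alpha> / 4) * cmod z ^ (2 * l))"
    by (rule E_class_weighted_decay[OF f a]) blast
  have "filterlim (\<lambda>z::complex. cmod z ^ (2 * l)) at_top at_infinity"
    using l by (intro filterlim_compose[OF filterlim_pow_at_top filterlim_norm_at_top] filterlim_ident) auto
  then have "filterlim (\<lambda>z::complex. (\<alpha> / 4) * cmod z ^ (2 * l)) at_top at_infinity"
    using a by (intro filterlim_tendsto_pos_mult_at_top[OF tendsto_const]) auto
  then have "((\<lambda>z::complex. exp (- ((\<alpha> / 4) * cmod z ^ (2 * l)))) \<longlongrightarrow> 0) at_infinity"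
    by (intro filterlim_compose[OF exp_at_bot]) (simp add: filterlim_uminus_at_top)
  then have "((\<lambda>z::complex. C * exp (- (\<alpha> / 4) * cmod z ^ (2 * l))) \<longlongrightarrow> C * 0) at_infinity"
    by (intro tendsto_mult_left) simp
  then have lim: "((\<lambda>z::complex. C * exp (- (\<alpha> / 4) * cmod z ^ (2 * l))) \<longlongrightarrow> 0) at_infinity"
    by (simp only: mult_zero_right)
  have "(weighted l \<alpha> f \<longlongrightarrow> 0) at_infinity"
  proof (rule tendsto_sandwich[OF _ _ tendsto_const lim])
    show "\<forall>\<^sub>F z in at_infinity. 0 \<le> weighted l \<alpha> f z"
      by (intro always_eventually allI weighted_nonneg)
    show "\<forall>\<^sub>F z in at_infinity. weighted l \<alpha> f z \<le> C * exp (- (\<alpha> / 4) * cmod z ^ (2 * l))"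
      by (intro always_eventually allI C)
  qed
  then show "f \<in> elts (f_inf_space l \<alpha>)"
    using E_class_entire[OF f] by (simp add: f_inf_space_def)
qed

text \<open>The estimate of the coefficients holds for all radii at once, so it bounds the weighted monomial
pointwise by a Gaussian, uniformly apart from the factor \<open>(1/2) ^ m\<close>.\<close>
lemma E_class_monomial_norms_summable:
  assumes l: "l \<ge> 1" and a: "\<alpha> > 0" and p: "p \<ge> 1" and f: "f \<in> E_class l" and c: "power_sum c f"
  shows "summable (\<lambda>m. cmod (c m) * nrm (F_space (ereal p) l \<alpha>) (\<lambda>z. z ^ m))"
proof -
  obtain C where C: "C \<ge> 0" "\<And>m \<rho>. \<rho> \<ge> 0 \<Longrightarrow> cmod (c m) * \<rho> ^ m \<le> C * (1/2) ^ m * exp (\<alpha> / 4 * \<rho> ^ (2 * l))"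
    by (rule E_class_coefficient_decay[OF f c, of "\<alpha> / 4"]) (use a in auto)
  let ?I = "(LINT z|lborel. exp (- (p * \<alpha> / 4) * cmod z ^ (2 * l))) powr (1 / p)"
  have ent: "(\<lambda>z::complex. z ^ m) \<in> entire" for m by (auto simp: entire_def intro!: holomorphic_intros)
  have "cmod (c m) * nrm (F_space (ereal p) l \<alpha>) (\<lambda>z. z ^ m) \<le> C * ?I * (1/2) ^ m" for m
  proof (cases "c m = 0")
    case True
    then show ?thesis using C(1) by simp
  next
    case False
    have "weighted l \<alpha> (\<lambda>z. z ^ m) z \<le> C * (1/2) ^ m / cmod (c m) * exp (- (\<alpha> / 4) * cmod z ^ (2 * l))" for z
    proof -
      have "exp (- (\<alpha> / 4) * cmod z ^ (2 * l)) * exp (\<alpha> / 2 * cmod z ^ (2 * l)) = exp (\<alpha> / 4 * cmod z ^ (2 * l))"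
        by (simp add: exp_add[symmetric])
      then show ?thesis
        unfolding weighted_le_iff mult.assoc using C(2)[of "cmod z" m] False
        by (simp add: norm_power field_simps)
    qed
    then have "nrm (F_space (ereal p) l \<alpha>) (\<lambda>z. z ^ m) \<le> C * (1/2) ^ m / cmod (c m) * ?I"
      by (intro weighted_decay_F_space(2)[OF l a p ent]) (use C(1) in auto)
    then show ?thesis using False by (simp add: field_simps)
  qed
  moreover have "nrm (F_space (ereal p) l \<alpha>) (\<lambda>z. z ^ m) \<ge> 0" for m
    by (subst F_space_nrm[OF ent]) simp
  ultimately have "norm (cmod (c m) * nrm (F_space (ereal p) l \<alpha>) (\<lambda>z. z ^ m)) \<le> C * ?I * (1/2) ^ m" for m
    by (simp only: real_norm_def abs_mult abs_norm_cancel abs_of_nonneg)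
  moreover have "summable (\<lambda>m. C * ?I * (1/2::real) ^ m)"
    by (intro summable_mult summable_geometric) simp
  ultimately show ?thesis
    by (rule summable_comparison_test'[rotated])
qed

lemma F_space_cmult:
  assumes "p \<ge> 1" "f \<in> elts (F_space (ereal p) l \<alpha>)"
  shows "(\<lambda>z. c * f z) \<in> elts (F_space (ereal p) l \<alpha>)"
    and "nrm (F_space (ereal p) l \<alpha>) (\<lambda>z. c * f z) = cmod c * nrm (F_space (ereal p) l \<alpha>) f"
proof -
  have e: "f \<in> entire" using assms by (simp add: F_space_elts)
  have ce: "(\<lambda>z. c * f z) \<in> entire" using e by (auto simp: entire_def intro: holomorphic_intros)
  have w: "weighted l \<alpha> (\<lambda>z. c * f z) z powr p = cmod c powr p * weighted l \<alpha> f z powr p" for z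
    by (simp add: weighted_cmult powr_mult)
  show "(\<lambda>z. c * f z) \<in> elts (F_space (ereal p) l \<alpha>)"
    using assms by (auto simp: F_space_elts ce w)
  show "nrm (F_space (ereal p) l \<alpha>) (\<lambda>z. c * f z) = cmod c * nrm (F_space (ereal p) l \<alpha>) f"
    using assms by (simp add: F_space_nrm ce e w powr_mult powr_powr)
qed

section \<open>Norms of atoms\<close>

lemma
  assumes a: "\<Lambda> > 0" and c: "c > 0"
  shows integrable_shifted_Gaussian: "integrable lborel (\<lambda>w::complex. exp (- c * (\<Lambda> * cmod (w - a))\<^sup>2))"
    and integral_shifted_Gaussian: "(LINT w|lborel. exp (- c * (\<Lambda> * cmod (w - a))\<^sup>2))
      = (LINT w|lborel. exp (- c * (cmod w)\<^sup>2)) / \<Lambda>\<^sup>2"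
proof -
  let ?g = "\<lambda>w::complex. exp (- c * (cmod w)\<^sup>2)"
  let ?h = "\<lambda>w::complex. ?g (of_real \<Lambda> * w)"
  have eq: "(\<lambda>w::complex. exp (- c * (\<Lambda> * cmod (w - a))\<^sup>2)) = (\<lambda>w. ?h (w - a))"
    using \<open>\<Lambda> > 0\<close> by (simp add: norm_mult)
  have [measurable]: "?g \<in> borel_measurable borel" by measurable
  have [measurable]: "?h \<in> borel_measurable borel" by measurable
  have "integrable lborel ?g" using integrable_norm_exp[of 1 c] c by simp
  then show "integrable lborel (\<lambda>w::complex. exp (- c * (\<Lambda> * cmod (w - a))\<^sup>2))"
    unfolding eq by (subst integrable_translate, measurable, subst integrable_dilate) (use \<open>\<Lambda> > 0\<close> in auto)
  show "(LINT w|lborel. exp (- c * (\<Lambda> * cmod (w - a))\<^sup>2)) = (LINT w|lborel. exp (- c * (cmod w)\<^sup>2)) / \<Lambda>\<^sup>2"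
    unfolding eq by (subst integral_translate, measurable, subst integral_dilate) (use \<open>\<Lambda> > 0\<close> in \<open>auto simp: field_simps\<close>)
qed

text \<open>The atom is dominated by a sum of \<open>l\<close> Gaussians of height \<open>\<mu> ^ j\<close> and width
\<open>\<mu> powr (1 - l)\<close>, where \<open>\<mu>\<close> is the maximum of \<open>1\<close> and
\<open>cmod \<zeta>\<close>. The \<open>L^p\<close> norm of such a Gaussian is, up to a constant, its
height times the \<open>(2 / p)\<close>-th power of its width.\<close>
lemma atom_norm_bound:
  assumes l: "l \<ge> 1" and a: "\<alpha> > 0" and p: "p \<ge> 1" and j: "j \<ge> 2 * l"
  obtains C where "C > 0" "\<And>t z. 0 \<le> t \<Longrightarrow> t \<le> 1 \<Longrightarrow>
    nrm (F_space (ereal p) l \<alpha>) (atom l \<alpha> j t z)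
      \<le> C * max 1 (cmod z) powr (real j - 2 * (real l - 1) / p) * exp (\<alpha> * t\<^sup>2 * cmod z ^ (2 * l) / 8)"
proof -
  obtain C0 c where C0: "C0 > 0" "c > 0" "\<And>w \<zeta> :: complex. \<exists>\<omega>. \<omega> ^ l = 1 \<and>
    cmod w ^ j * exp (- (\<alpha> / 2) * (cmod (w ^ l - \<zeta> ^ l))\<^sup>2)
      \<le> C0 * max 1 (cmod \<zeta>) ^ j * exp (- c * (max 1 (cmod \<zeta>) ^ (l - 1) * cmod (w - \<omega> * \<zeta>))\<^sup>2)"
    by (rule atom_pointwise_bound[OF l a]) blast
  let ?U = "{\<omega>::complex. \<omega> ^ l = 1}"
  have finU: "finite ?U" using l by (intro finite_roots_unity) auto
  define I where "I = real (card ?U) * (LINT w|lborel. exp (- (p * c) * (cmod w)\<^sup>2))"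
  have I0: "I \<ge> 0" by (auto simp: I_def)
  have pc: "p * c > 0" using p C0 by simp
  define C where "C = C0 * I powr (1 / p) + 1"
  have "nrm (F_space (ereal p) l \<alpha>) (atom l \<alpha> j t z)
      \<le> C * max 1 (cmod z) powr (real j - 2 * (real l - 1) / p) * exp (\<alpha> * t\<^sup>2 * cmod z ^ (2 * l) / 8)"
    if t: "0 \<le> t" "t \<le> 1" for t z
  proof -
    obtain \<zeta> where \<zeta>: "\<zeta> ^ l = of_real (t / 2) * z ^ l" "cmod \<zeta> \<le> cmod z"
      by (rule atom_root_exists[OF l t])
    define \<mu> where "\<mu> = max 1 (cmod \<zeta>)"
    have mu: "\<mu> \<ge> 1" "\<mu> \<le> max 1 (cmod z)" using \<zeta> by (auto simp: \<mu>_def)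
    define ee where "ee = exp (\<alpha> * t\<^sup>2 * cmod z ^ (2 * l) / 8)"
    define K where "K = C0 * \<mu> ^ j * ee"
    have K0: "K > 0" using C0 mu by (simp add: K_def ee_def)
    let ?W = "weighted l \<alpha> (atom l \<alpha> j t z)"
    let ?G = "\<lambda>\<omega> w. exp (- (p * c) * (\<mu> ^ (l - 1) * cmod (w - \<omega> * \<zeta>))\<^sup>2)"
    have ent: "atom l \<alpha> j t z \<in> entire" by (rule E_class_entire[OF atom_in_E_class[OF l]])
    have bnd: "?W w powr p \<le> K powr p * (\<Sum>\<omega>\<in>?U. ?G \<omega> w)" for w
    proof -
      obtain \<omega> where \<omega>: "\<omega> ^ l = 1" "cmod w ^ j * exp (- (\<alpha> / 2) * (cmod (w ^ l - \<zeta> ^ l))\<^sup>2)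
        \<le> C0 * \<mu> ^ j * exp (- c * (\<mu> ^ (l - 1) * cmod (w - \<omega> * \<zeta>))\<^sup>2)"
        using C0(3) unfolding \<mu>_def by blast
      have "?W w \<le> K * exp (- c * (\<mu> ^ (l - 1) * cmod (w - \<omega> * \<zeta>))\<^sup>2)"
        unfolding weighted_atom[OF \<zeta>(1)] K_def ee_def
        using mult_right_mono[OF \<omega>(2), of "exp (\<alpha> * t\<^sup>2 * cmod z ^ (2 * l) / 8)"] by (simp add: mult_ac)
      then have "?W w powr p \<le> (K * exp (- c * (\<mu> ^ (l - 1) * cmod (w - \<omega> * \<zeta>))\<^sup>2)) powr p"
        using p by (intro powr_mono2) auto
      also have "\<dots> = K powr p * ?G \<omega> w"
        using K0 by (simp add: powr_mult exp_powr_real mult_ac)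
      also have "\<dots> \<le> K powr p * (\<Sum>\<omega>\<in>?U. ?G \<omega> w)"
        using \<omega>(1) finU by (intro mult_left_mono member_le_sum) auto
      finally show ?thesis .
    qed
    have L: "\<mu> ^ (l - 1) > 0" using mu by simp
    have iG: "integrable lborel (\<lambda>w. K powr p * (\<Sum>\<omega>\<in>?U. ?G \<omega> w))"
      by (intro integrable_mult_right Bochner_Integration.integrable_sum integrable_shifted_Gaussian[OF L pc])
    have el: "atom l \<alpha> j t z \<in> elts (F_space (ereal p) l \<alpha>)"
      using atom_in_E_class[OF l] E_class_subset_F_space[OF l a p] by blast
    have "(LINT w|lborel. ?W w powr p) \<le> (LINT w|lborel. K powr p * (\<Sum>\<omega>\<in>?U. ?G \<omega> w))"
      using el by (intro integral_mono iG bnd) (auto simp: F_space_elts)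
    also have "\<dots> = K powr p * (\<Sum>\<omega>\<in>?U. (LINT w|lborel. exp (- (p * c) * (cmod w)\<^sup>2)) / (\<mu> ^ (l - 1))\<^sup>2)"
      using integral_shifted_Gaussian[OF L pc] integrable_shifted_Gaussian[OF L pc]
      by (subst integral_mult_right_zero, subst Bochner_Integration.integral_sum) auto
    also have "\<dots> = K powr p * (I / (\<mu> ^ (l - 1))\<^sup>2)" by (simp add: I_def)
    also have "(\<mu> ^ (l - 1))\<^sup>2 = \<mu> powr (2 * (real l - 1))"
      using mu l by (simp add: powr_realpow[symmetric] powr_powr power_mult[symmetric] mult.commute of_nat_diff)
    finally have "(LINT w|lborel. ?W w powr p) powr (1 / p) \<le> (K powr p * (I / \<mu> powr (2 * (real l - 1)))) powr (1 / p)"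
      using p by (intro powr_mono2) auto
    also have "\<dots> = K * I powr (1 / p) / \<mu> powr (2 * (real l - 1) / p)"
      using p K0 I0 mu by (simp add: powr_mult powr_divide powr_powr)
    also have "\<dots> = C0 * I powr (1 / p) * ee * (\<mu> powr real j / \<mu> powr (2 * (real l - 1) / p))"
      using mu by (simp add: K_def powr_realpow)
    also have "\<mu> powr real j / \<mu> powr (2 * (real l - 1) / p) = \<mu> powr (real j - 2 * (real l - 1) / p)"
      by (simp add: powr_diff)
    also have "C0 * I powr (1 / p) * ee * \<mu> powr (real j - 2 * (real l - 1) / p)
      \<le> C * ee * max 1 (cmod z) powr (real j - 2 * (real l - 1) / p)"
    proof (intro mult_mono powr_mono2)
      \<comment> \<open>Since \<open>j \<ge> 2 * l\<close>, the exponent of \<open>\<mu>\<close> is nonnegative, so \<open>\<mu>\<close> may be replaced with the larger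
        \<open>max 1 (cmod z)\<close>, which does not depend on \<open>t\<close>.\<close>
      have "2 * (real l - 1) / p \<le> 2 * (real l - 1) / 1" using p l by (intro divide_left_mono) auto
      also have "\<dots> \<le> real j" using j by simp
      finally show "0 \<le> real j - 2 * (real l - 1) / p" by simp
    qed (use mu C0 in \<open>auto simp: C_def ee_def\<close>)
    finally show ?thesis using ent by (simp add: F_space_nrm ee_def mult_ac)
  qed
  moreover have "C > 0" using C0 by (simp add: C_def add_nonneg_pos)
  ultimately show ?thesis using that by blast
qed

section \<open>Controlled seminorms\<close>

lemma simultaneous_Riemann_sums:
  fixes F :: "nat \<Rightarrow> 'a::euclidean_space \<Rightarrow> complex" and c :: "'a \<Rightarrow> real"
  assumes F: "\<And>m. F m integrable_on cbox a b" and c: "c integrable_on cbox a b" and e: "e > 0"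
  obtains p where "p tagged_division_of cbox a b"
    "\<And>m. m < n \<Longrightarrow> cmod ((\<Sum>(x, K)\<in>p. measure lborel K *\<^sub>R F m x) - integral (cbox a b) (F m)) < e"
    "\<bar>(\<Sum>(x, K)\<in>p. measure lborel K * c x) - integral (cbox a b) c\<bar> < e"
proof -
  have "\<exists>\<gamma>. gauge \<gamma> \<and> (\<forall>p. p tagged_division_of cbox a b \<and> \<gamma> fine p \<longrightarrow>
      norm ((\<Sum>(x, K)\<in>p. measure lborel K *\<^sub>R F m x) - integral (cbox a b) (F m)) < e)" for m
    using integrable_integral[OF F[of m]] e unfolding has_integral by blast
  then obtain \<gamma> where \<gamma>: "\<And>m. gauge (\<gamma> m)"
    "\<And>m p. p tagged_division_of cbox a b \<Longrightarrow> \<gamma> m fine p \<Longrightarrow>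
      norm ((\<Sum>(x, K)\<in>p. measure lborel K *\<^sub>R F m x) - integral (cbox a b) (F m)) < e"
    by metis
  obtain \<delta> where \<delta>: "gauge \<delta>" "\<And>p. p tagged_division_of cbox a b \<Longrightarrow> \<delta> fine p \<Longrightarrow>
      norm ((\<Sum>(x, K)\<in>p. measure lborel K *\<^sub>R c x) - integral (cbox a b) c) < e"
    using integrable_integral[OF c] e unfolding has_integral by meson
  have "gauge (\<lambda>x. (\<Inter>{\<gamma> m x | m. m \<in> {..<n}}) \<inter> \<delta> x)"
    by (intro gauge_Int gauge_Inter \<gamma> \<delta>) auto
  then obtain p where p: "p tagged_division_of cbox a b" "(\<lambda>x. (\<Inter>{\<gamma> m x | m. m \<in> {..<n}}) \<inter> \<delta> x) fine p"
    by (rule fine_division_exists)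
  have f: "\<And>m. m < n \<Longrightarrow> \<gamma> m fine p" "\<delta> fine p"
    using p(2) unfolding fine_Int fine_Inter by auto
  show ?thesis
  proof (rule that[OF p(1)])
    show "cmod ((\<Sum>(x, K)\<in>p. measure lborel K *\<^sub>R F m x) - integral (cbox a b) (F m)) < e" if "m < n" for m
      using \<gamma>(2)[OF p(1) f(1)[OF that]] .
    show "\<bar>(\<Sum>(x, K)\<in>p. measure lborel K * c x) - integral (cbox a b) c\<bar> < e"
      using \<delta>(2)[OF p(1) f(2)] by simp
  qed
qed

lemma E_class_subseries:
  assumes f: "f \<in> E_class l" and a: "power_sum a f" and b: "\<And>m. cmod (b m) \<le> K * cmod (a m)"
  shows "(\<lambda>z. \<Sum>m. b m * z ^ m) \<in> E_class l" and "power_sum b (\<lambda>z. \<Sum>m. b m * z ^ m)"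
proof -
  obtain C1 \<beta> where 1: "C1 \<ge> 0" "\<beta> > 0" "\<And>z. cmod (f z) \<le> C1 * exp (\<beta> * cmod z ^ l)"
    by (rule E_class_bound[OF f]) blast
  have K: "K * cmod (a m) = \<bar>K\<bar> * cmod (a m)" for m
  proof (cases "K < 0")
    case True
    have "0 \<le> K * cmod (a m)" by (rule order_trans[OF norm_ge_zero b])
    then show ?thesis using True by (simp add: zero_le_mult_iff)
  qed simp
  define D where "D z = \<bar>K\<bar> * C1 * exp ((\<beta> * 2 ^ l) * cmod z ^ l)" for z :: complex
  have bnd: "norm (b m * z ^ m) \<le> D z * (1/2) ^ m" for m z
  proof -
    have "cmod (a m) * (2 * cmod z) ^ m \<le> C1 * exp (\<beta> * (2 * cmod z) ^ l)"
    proof (rule coefficient_le[OF a])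
      show "cmod (f w) \<le> C1 * exp (\<beta> * (2 * cmod z) ^ l)" if "cmod w = 2 * cmod z" for w
        using 1(3)[of w] by (simp only: that)
    qed simp
    then have "\<bar>K\<bar> * (cmod (a m) * (2 * cmod z) ^ m) \<le> \<bar>K\<bar> * (C1 * exp (\<beta> * (2 * cmod z) ^ l))"
      by (rule mult_left_mono) simp
    moreover have "cmod (b m) * (2 * cmod z) ^ m \<le> (\<bar>K\<bar> * cmod (a m)) * (2 * cmod z) ^ m"
      using b[of m] unfolding K by (rule mult_right_mono) simp
    ultimately have "cmod (b m) * (2 * cmod z) ^ m \<le> D z"
      unfolding D_def power_mult_distrib[of 2 "cmod z" l] mult.assoc by (rule order_trans[rotated])
    then have "2 ^ m * norm (b m * z ^ m) \<le> D z" by (simp add: norm_mult norm_power power_mult_distrib mult_ac)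
    then show ?thesis by (simp add: power_divide field_simps)
  qed
  have geo: "(\<lambda>m. D z * (1/2) ^ m) sums (D z * 2)" for z
    using geometric_sums[of "1/2::real"] by (intro sums_mult) simp
  have s: "summable (\<lambda>m. b m * z ^ m)" for z
    by (rule summable_comparison_test'[OF sums_summable[OF geo] bnd])
  then show ps: "power_sum b (\<lambda>z. \<Sum>m. b m * z ^ m)" by (simp add: power_sum_def summable_sums)
  show "(\<lambda>z. \<Sum>m. b m * z ^ m) \<in> E_class l"
  proof (rule E_classI[OF power_sum_entire[OF ps]])
    fix z
    have "norm (\<Sum>m. b m * z ^ m) \<le> (\<Sum>m. D z * (1/2) ^ m)"
      by (rule norm_suminf_le[OF bnd sums_summable[OF geo]])
    also have "\<dots> = D z * 2" using geo by (simp only: sums_iff)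
    finally show "norm (\<Sum>m. b m * z ^ m) \<le> (2 * \<bar>K\<bar> * C1) * exp ((\<beta> * 2 ^ l) * cmod z ^ l)"
      by (simp add: D_def mult_ac)
  qed
qed

text \<open>The pairs to which the argument applies. The exponent \<open>2 * l + r + 2\<close> in the last assumption
is what conjugate exponents give: the heights of two atoms contribute \<open>4 * l + r\<close> and their
widths \<open>- 2 * (l - 1)\<close>.\<close>
locale hankel_pair =
  fixes l :: nat and \<alpha> :: real and X Y :: fspace
  assumes l: "l \<ge> 1" and \<alpha>: "\<alpha> > 0"
    and E_X: "E_class l \<subseteq> elts X" and E_Y: "E_class l \<subseteq> elts Y"
    and nrm_X_nonneg: "\<And>f. f \<in> elts X \<Longrightarrow> 0 \<le> nrm X f"
    and nrm_Y_nonneg: "\<And>g. g \<in> elts Y \<Longrightarrow> 0 \<le> nrm Y g"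
    and X_cmult: "\<And>c f. f \<in> elts X \<Longrightarrow> (\<lambda>z. c * f z) \<in> elts X"
    and nrm_X_cmult: "\<And>c f. f \<in> elts X \<Longrightarrow> nrm X (\<lambda>z. c * f z) = cmod c * nrm X f"
    and Hoelder_mem: "\<And>f g. f \<in> elts X \<Longrightarrow> g \<in> elts Y \<Longrightarrow> (\<lambda>z. f z * g z) \<in> elts (F_space 1 l (2 * \<alpha>))"
    and Hoelder_le: "\<And>f g. f \<in> elts X \<Longrightarrow> g \<in> elts Y \<Longrightarrow>
      nrm (F_space 1 l (2 * \<alpha>)) (\<lambda>z. f z * g z) \<le> nrm X f * nrm Y g"
    and monomials_summable: "\<And>f a. f \<in> E_class l \<Longrightarrow> power_sum a f \<Longrightarrow>
      summable (\<lambda>m. cmod (a m) * nrm X (\<lambda>z. z ^ m))"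
    and atoms_bounded: "\<exists>C. \<forall>z t r. 0 \<le> t \<longrightarrow> t \<le> 1 \<longrightarrow> r < l \<longrightarrow>
      nrm X (atom l \<alpha> (2 * l) t z) * nrm Y (atom l \<alpha> (2 * l + r) t z)
        \<le> C * max 1 (cmod z) ^ (2 * l + r + 2) * exp (\<alpha> * t\<^sup>2 * cmod z ^ (2 * l) / 4)"
begin

definition monomial_cost :: "nat \<Rightarrow> real" where
  "monomial_cost m = nrm X (\<lambda>z. z ^ m) * nrm Y (\<lambda>z. 1)"

text \<open>These are the properties shared by the norm of \<open>F_space 1 l (2 * \<alpha>)\<close>, the weak
product norm and the modulus of a bounded Hankel functional. The bound on Taylor series is a weak
substitute for continuity: it holds on \<open>E\<close> with weights \<open>monomial_cost\<close> that
grow too slowly to spoil convergence there.\<close>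
definition controlled_seminorm :: "((complex \<Rightarrow> complex) \<Rightarrow> real) \<Rightarrow> real \<Rightarrow> bool" where
  "controlled_seminorm N M \<longleftrightarrow> M \<ge> 0 \<and>
    (\<forall>f\<in>E_class l. \<forall>g\<in>E_class l. N (\<lambda>z. f z + g z) \<le> N f + N g) \<and>
    (\<forall>c. \<forall>f\<in>E_class l. N (\<lambda>z. c * f z) \<le> cmod c * N f) \<and>
    (\<forall>f\<in>E_class l. \<forall>a. power_sum a f \<longrightarrow> N f \<le> M * (\<Sum>m. cmod (a m) * monomial_cost m)) \<and>
    (\<forall>f\<in>E_class l. \<forall>g\<in>E_class l. N (\<lambda>z. f z * g z) \<le> M * (nrm X f * nrm Y g))"

lemma one_in_E: "(\<lambda>z. 1) \<in> E_class l"
  using monomial_in_E_class[OF l, of 1 0] by simp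

lemma monomial_cost_nonneg: "monomial_cost m \<ge> 0"
  using monomial_in_E_class[OF l, of 1 m] E_X E_Y one_in_E
  by (auto simp: monomial_cost_def intro!: mult_nonneg_nonneg nrm_X_nonneg nrm_Y_nonneg)

lemma monomial_cost_summable:
  "f \<in> E_class l \<Longrightarrow> power_sum a f \<Longrightarrow> summable (\<lambda>m. cmod (a m) * monomial_cost m)"
  using summable_mult2[OF monomials_summable, of f a "nrm Y (\<lambda>z. 1)"]
  by (simp add: monomial_cost_def mult.assoc)

lemma
  assumes "controlled_seminorm N M"
  shows controlled_nonneg: "M \<ge> 0"
    and controlled_add: "f \<in> E_class l \<Longrightarrow> g \<in> E_class l \<Longrightarrow> N (\<lambda>z. f z + g z) \<le> N f + N g"
    and controlled_cmult: "f \<in> E_class l \<Longrightarrow> N (\<lambda>z. c * f z) \<le> cmod c * N f"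
    and controlled_series: "f \<in> E_class l \<Longrightarrow> power_sum a f \<Longrightarrow>
      N f \<le> M * (\<Sum>m. cmod (a m) * monomial_cost m)"
    and controlled_product: "f \<in> E_class l \<Longrightarrow> g \<in> E_class l \<Longrightarrow>
      N (\<lambda>z. f z * g z) \<le> M * (nrm X f * nrm Y g)"
  using assms by (simp_all add: controlled_seminorm_def)

lemma controlled_zero:
  assumes "controlled_seminorm N M"
  shows "N (\<lambda>z. 0) \<le> 0"
  using controlled_cmult[OF assms one_in_E, of 0] by simp

lemma zero_in_E: "(\<lambda>z. 0) \<in> E_class l"
  using monomial_in_E_class[OF l, of 0 0] by simp

lemma controlled_sum:
  assumes N: "controlled_seminorm N M" and "finite I" and "\<And>i. i \<in> I \<Longrightarrow> f i \<in> E_class l"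
  shows "(\<lambda>z. \<Sum>i\<in>I. f i z) \<in> E_class l \<and> N (\<lambda>z. \<Sum>i\<in>I. f i z) \<le> (\<Sum>i\<in>I. N (f i))"
  using assms(2,3)
proof (induction I rule: finite_induct)
  case empty
  then show ?case using controlled_zero[OF N] zero_in_E by simp
next
  case (insert x I)
  then have IH: "(\<lambda>z. \<Sum>i\<in>I. f i z) \<in> E_class l" "N (\<lambda>z. \<Sum>i\<in>I. f i z) \<le> (\<Sum>i\<in>I. N (f i))"
    and x: "f x \<in> E_class l" by auto
  have "N (\<lambda>z. f x z + (\<Sum>i\<in>I. f i z)) \<le> N (f x) + N (\<lambda>z. \<Sum>i\<in>I. f i z)"
    by (rule controlled_add[OF N x IH(1)])
  then show ?case using insert IH E_class_add[OF x IH(1)] by simp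
qed

text \<open>A seminorm of an average is at most the average of the seminorms. The integral is approximated by Riemann
sums \<open>s\<close>. As \<open>N\<close> is controlled only through absolute sums of Taylor
coefficients, the error \<open>h - s\<close> is split: the first \<open>n\<close> coefficients are small
because the Riemann sums converge, and the remaining ones are small uniformly in the partition because of
the summable majorant \<open>B\<close>.\<close>
lemma controlled_integral:
  fixes F :: "nat \<Rightarrow> 'a::euclidean_space \<Rightarrow> complex" and c :: "'a \<Rightarrow> real"
  assumes N: "controlled_seminorm N M"
    and F: "\<And>m. F m integrable_on cbox u v" and c: "c integrable_on cbox u v"
    and B: "\<And>m x. x \<in> cbox u v \<Longrightarrow> cmod (F m x) \<le> B m"
    and sB: "summable (\<lambda>m. B m * monomial_cost m)"
    and f: "\<And>x. x \<in> cbox u v \<Longrightarrow> f x \<in> E_class l" "\<And>x. x \<in> cbox u v \<Longrightarrow> power_sum (\<lambda>m. F m x) (f x)"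
    and Nf: "\<And>x. x \<in> cbox u v \<Longrightarrow> N (f x) \<le> c x"
    and h: "h \<in> E_class l" "power_sum (\<lambda>m. integral (cbox u v) (F m)) h"
  shows "N h \<le> integral (cbox u v) c"
proof (cases "cbox u v = {}")
  case True
  have "N h \<le> M * (\<Sum>m. cmod (integral (cbox u v) (F m)) * monomial_cost m)"
    by (rule controlled_series[OF N h])
  then show ?thesis using True by simp
next
  case False
  let ?S = "cbox u v"
  let ?w = monomial_cost
  define T where "T = measure lborel ?S"
  have T0: "T \<ge> 0" by (simp add: T_def)
  have B0: "B m \<ge> 0" for m using False B[of _ m] by (meson ex_in_conv norm_ge_zero order_trans)
  have M0: "M \<ge> 0" by (rule controlled_nonneg[OF N])
  define K where "K = 1 + M * (2 * T + 1)"
  have K: "K > 0" using M0 T0 by (simp add: K_def add_pos_nonneg)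
  have main: "N h \<le> integral ?S c + K * e" if e: "e > 0" for e
  proof -
    obtain n where n: "(\<Sum>m. B (m + n) * ?w (m + n)) < e"
    proof -
      have "(\<lambda>n. \<Sum>m. B (m + n) * ?w (m + n)) \<longlonglongrightarrow> 0"
        using suminf_exist_split2[OF sB] by simp
      then have "eventually (\<lambda>n. (\<Sum>m. B (m + n) * ?w (m + n)) < e) sequentially"
        using e by (rule order_tendstoD(2))
      then show ?thesis using that eventually_happens'[OF sequentially_bot] by blast
    qed
    \<comment> \<open>An error of \<open>e'\<close> in each of the first \<open>n\<close> coefficients costs at most \<open>e\<close> in the weighted sum.\<close>
    define e' where "e' = min e (e / (1 + (\<Sum>m<n. ?w m)))"
    have W0: "(\<Sum>m<n. ?w m) \<ge> 0" by (intro sum_nonneg monomial_cost_nonneg)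
    have e': "e' > 0" "e' \<le> e" using e W0 by (auto simp: e'_def add_pos_nonneg)
    have e'W: "e' * (\<Sum>m<n. ?w m) \<le> e"
    proof -
      have "e' * (\<Sum>m<n. ?w m) \<le> e / (1 + (\<Sum>m<n. ?w m)) * (\<Sum>m<n. ?w m)"
        using W0 by (intro mult_right_mono) (auto simp: e'_def)
      also have "\<dots> \<le> e" using e W0 by (simp add: divide_le_eq field_simps)
      finally show ?thesis .
    qed
    obtain p where p: "p tagged_division_of ?S"
      "\<And>m. m < n \<Longrightarrow> cmod ((\<Sum>(x, K)\<in>p. measure lborel K *\<^sub>R F m x) - integral ?S (F m)) < e'"
      "\<bar>(\<Sum>(x, K)\<in>p. measure lborel K * c x) - integral ?S c\<bar> < e'"
      using simultaneous_Riemann_sums[where F = F and n = n, OF F c e'(1)] by metis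
    have fin: "finite p" using p(1) by blast
    have tag: "fst i \<in> ?S" if "i \<in> p" for i
      using tag_in_interval[OF p(1), of "fst i" "snd i"] that by simp
    have con: "measure lborel (snd i) \<ge> 0" for i :: "'a \<times> 'a set" by simp
    define g where "g i w = of_real (measure lborel (snd i)) * f (fst i) w" for i :: "'a \<times> 'a set" and w
    have gE: "g i \<in> E_class l" if "i \<in> p" for i
      unfolding g_def[abs_def] by (intro E_class_cmult f(1) tag that)
    define s where "s w = (\<Sum>i\<in>p. g i w)" for w
    have sE: "s \<in> E_class l" and Ns: "N s \<le> (\<Sum>i\<in>p. N (g i))"
      using controlled_sum[OF N fin gE] by (auto simp: s_def[abs_def])
    have Ng: "N (g i) \<le> measure lborel (snd i) * c (fst i)" if i: "i \<in> p" for i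
    proof -
      have "N (g i) \<le> cmod (of_real (measure lborel (snd i))) * N (f (fst i))"
        unfolding g_def[abs_def] by (rule controlled_cmult[OF N f(1)[OF tag[OF i]]])
      also have "\<dots> \<le> measure lborel (snd i) * c (fst i)"
        using Nf[OF tag[OF i]] by (simp add: mult_left_mono)
      finally show ?thesis .
    qed
    have "N s \<le> (\<Sum>i\<in>p. measure lborel (snd i) * c (fst i))"
      using Ns sum_mono[of p "\<lambda>i. N (g i)", OF Ng] by linarith
    also have "\<dots> = (\<Sum>(x, K)\<in>p. measure lborel K * c x)" by (simp add: case_prod_beta)
    also have "\<dots> \<le> integral ?S c + e" using p(3) e'(2) by linarith
    finally have Ns': "N s \<le> integral ?S c + e" .
    define A where "A m = (\<Sum>i\<in>p. of_real (measure lborel (snd i)) * F m (fst i))" for m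
    have sA: "power_sum A s"
      unfolding power_sum_def
    proof
      fix z
      have "(\<lambda>m. \<Sum>i\<in>p. of_real (measure lborel (snd i)) * (F m (fst i) * z ^ m)) sums (\<Sum>i\<in>p. of_real (measure lborel (snd i)) * f (fst i) z)"
        by (intro sums_sum sums_mult) (use f(2) tag in \<open>auto simp: power_sum_def\<close>)
      then show "(\<lambda>m. A m * z ^ m) sums s z"
        by (simp add: A_def s_def g_def sum_distrib_right mult.assoc)
    qed
    define d where "d m = integral ?S (F m) - A m" for m
    have "(\<lambda>w. - 1 * s w) \<in> E_class l" by (rule E_class_cmult[OF sE])
    from E_class_add[OF h(1) this] have dE: "(\<lambda>w. h w - s w) \<in> E_class l" by simp
    have dp: "power_sum d (\<lambda>w. h w - s w)"
      using h(2) sA unfolding power_sum_def d_def left_diff_distrib by (auto intro: sums_diff)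
    have Nd: "N (\<lambda>w. h w - s w) \<le> M * (\<Sum>m. cmod (d m) * ?w m)"
      by (rule controlled_series[OF N dE dp])
    have sumc: "(\<Sum>i\<in>p. measure lborel (snd i)) = T"
      using additive_content_tagged_division[OF p(1)] by (simp add: T_def case_prod_beta)
    have Ab: "cmod (A m) \<le> T * B m" for m
    proof -
      have "cmod (A m) \<le> (\<Sum>i\<in>p. measure lborel (snd i) * B m)"
        unfolding A_def by (rule sum_norm_le) (use B tag in \<open>auto simp: norm_mult intro!: mult_left_mono\<close>)
      then show ?thesis by (simp add: sum_distrib_right[symmetric] sumc)
    qed
    have Ib: "cmod (integral ?S (F m)) \<le> T * B m" for m
      using has_integral_bound[OF B0 integrable_integral[OF F] B] by (simp add: T_def mult.commute)
    have db: "cmod (d m) \<le> 2 * T * B m" for m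
      using norm_triangle_ineq4[of "integral ?S (F m)" "A m"] Ab[of m] Ib[of m] by (simp add: d_def)
    have dn: "cmod (d m) \<le> e'" if "m < n" for m
    proof -
      have "A m = (\<Sum>(x, K)\<in>p. measure lborel K *\<^sub>R F m x)"
        by (simp add: A_def case_prod_beta scaleR_conv_of_real)
      then show ?thesis using p(2)[OF that] by (simp add: d_def norm_minus_commute)
    qed
    have sd: "summable (\<lambda>m. cmod (d m) * ?w m)" by (rule monomial_cost_summable[OF dE dp])
    have sBn: "summable (\<lambda>m. B (m + n) * ?w (m + n))" using sB by (subst summable_iff_shift)
    have "(\<Sum>m. cmod (d m) * ?w m) = (\<Sum>m. cmod (d (m + n)) * ?w (m + n)) + (\<Sum>m<n. cmod (d m) * ?w m)"
      by (rule suminf_split_initial_segment[OF sd])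
    also have "(\<Sum>m. cmod (d (m + n)) * ?w (m + n)) \<le> (\<Sum>m. 2 * T * (B (m + n) * ?w (m + n)))"
    proof (rule suminf_le)
      show "cmod (d (m + n)) * ?w (m + n) \<le> 2 * T * (B (m + n) * ?w (m + n))" for m
        using mult_right_mono[OF db monomial_cost_nonneg, of "m + n" "m + n"] by (simp add: mult.assoc)
      show "summable (\<lambda>m. cmod (d (m + n)) * ?w (m + n))" using sd by (subst summable_iff_shift)
      show "summable (\<lambda>m. 2 * T * (B (m + n) * ?w (m + n)))" by (rule summable_mult[OF sBn])
    qed
    also have "\<dots> = 2 * T * (\<Sum>m. B (m + n) * ?w (m + n))" by (rule suminf_mult[OF sBn])
    also have "\<dots> \<le> 2 * T * e" using n T0 by (intro mult_left_mono) auto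
    also have "(\<Sum>m<n. cmod (d m) * ?w m) \<le> (\<Sum>m<n. e' * ?w m)"
      by (intro sum_mono mult_right_mono dn monomial_cost_nonneg) auto
    also have "\<dots> = e' * (\<Sum>m<n. ?w m)" by (simp add: sum_distrib_left)
    also have "\<dots> \<le> e" by (rule e'W)
    finally have "(\<Sum>m. cmod (d m) * ?w m) \<le> (2 * T + 1) * e" by (simp add: distrib_right)
    then have "M * (\<Sum>m. cmod (d m) * ?w m) \<le> M * ((2 * T + 1) * e)" using M0 by (rule mult_left_mono)
    with Nd have Nd': "N (\<lambda>w. h w - s w) \<le> M * ((2 * T + 1) * e)" by linarith
    have "N (\<lambda>w. s w + (h w - s w)) \<le> N s + N (\<lambda>w. h w - s w)"
      by (rule controlled_add[OF N sE dE])
    then have "N h \<le> N s + N (\<lambda>w. h w - s w)" by simp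
    with Ns' Nd' show ?thesis by (simp add: K_def algebra_simps)
  qed
  show ?thesis
  proof (rule field_le_epsilon)
    fix e :: real assume "e > 0"
    then show "N h \<le> integral ?S c + e" using main[of "e / K"] K by simp
  qed
qed

end

section \<open>The kernel as an average of products of atoms\<close>

lemma has_integral_power_Beta:
  assumes "\<sigma> > 0"
  shows "((\<lambda>t. t ^ i * (1 - t) powr (\<sigma> - 1)) has_integral (fact i * Gamma \<sigma> / Gamma (real i + 1 + \<sigma>))) {0..1}"
proof -
  have "((\<lambda>t. t powr ((real i + 1) - 1) * (1 - t) powr (\<sigma> - 1)) has_integral Beta (real i + 1) \<sigma>) {0..1}"
    by (rule has_integral_Beta_real) (use assms in auto)
  also have "Beta (real i + 1) \<sigma> = fact i * Gamma \<sigma> / Gamma (real i + 1 + \<sigma>)"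
    using Gamma_fact[of i, where ?'a = real] by (simp add: Beta_def add.commute)
  finally show ?thesis
  proof (rule has_integral_spike[of "{0}", rotated 2])
    fix t :: real assume "t \<in> {0..1} - {0}"
    then have "t > 0" by auto
    then show "t ^ i * (1 - t) powr (\<sigma> - 1) = t powr ((real i + 1) - 1) * (1 - t) powr (\<sigma> - 1)"
      by (simp add: powr_realpow)
  qed simp
qed

text \<open>The substitution \<open>v = \<Lambda> * (1 - t)\<close> turns the integral into a part of the Gamma integral.\<close>
lemma
  assumes \<sigma>: "\<sigma> > 1" and lam: "\<Lambda> > 0"
  shows integrable_endpoint_Laplace: "(\<lambda>t::real. (1 - t) powr (\<sigma> - 1) * exp (\<Lambda> * t)) integrable_on {0..1}"
    and integral_endpoint_Laplace: "integral {0..1} (\<lambda>t::real. (1 - t) powr (\<sigma> - 1) * exp (\<Lambda> * t))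
      \<le> exp \<Lambda> * Gamma \<sigma> * \<Lambda> powr (- \<sigma>)"
proof -
  have "continuous_on {0..1} (\<lambda>t::real. (1 - t) powr (\<sigma> - 1) * exp (\<Lambda> * t))"
    using \<sigma> by (intro continuous_intros continuous_on_powr') auto
  then show int: "(\<lambda>t::real. (1 - t) powr (\<sigma> - 1) * exp (\<Lambda> * t)) integrable_on {0..1}"
    by (rule integrable_continuous_interval)
  let ?f = "\<lambda>v::real. v powr (\<sigma> - 1) / exp v"
  have Gam: "(?f has_integral Gamma \<sigma>) {0..}" by (rule Gamma_integral_real) (use \<sigma> in simp)
  have "continuous_on {0..\<Lambda>} ?f"
    using \<sigma> by (intro continuous_intros continuous_on_powr') auto
  then have "?f integrable_on cbox 0 \<Lambda>" by (simp add: integrable_continuous_interval)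
  then obtain I where I: "(?f has_integral I) (cbox 0 \<Lambda>)" by blast
  have le: "I \<le> Gamma \<sigma>"
    by (rule has_integral_subset_le[OF _ I Gam]) auto
  have "((\<lambda>t. ?f ((- \<Lambda>) *\<^sub>R t + \<Lambda>)) has_integral (1 / (\<bar>- \<Lambda>\<bar> ^ DIM(real))) *\<^sub>R I)
      ((\<lambda>x. (1 / (- \<Lambda>)) *\<^sub>R x + - ((1 / (- \<Lambda>)) *\<^sub>R \<Lambda>)) ` cbox 0 \<Lambda>)"
    by (rule has_integral_affinity[OF I]) (use lam in simp)
  also have "(\<lambda>x. (1 / (- \<Lambda>)) *\<^sub>R x + - ((1 / (- \<Lambda>)) *\<^sub>R \<Lambda>)) ` cbox 0 \<Lambda> = {0..1}"
  proof -
    have "x \<in> (\<lambda>x. 1 - x / \<Lambda>) ` {0..\<Lambda>}" if "x \<in> {0..1}" for x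
      using that lam by (intro image_eqI[of _ _ "\<Lambda> * (1 - x)"]) (auto simp: mult_left_le field_simps)
    moreover have "1 - x / \<Lambda> \<in> {0..1}" if "x \<in> {0..\<Lambda>}" for x
      using that lam by auto
    ultimately have "(\<lambda>x. 1 - x / \<Lambda>) ` {0..\<Lambda>} = {0..1}" by blast
    then show ?thesis using lam by (simp add: algebra_simps)
  qed
  finally have 1: "((\<lambda>t. ?f (\<Lambda> * (1 - t))) has_integral I / \<Lambda>) {0..1}"
    using lam by (simp add: algebra_simps)
  have "((\<lambda>t. exp \<Lambda> * \<Lambda> powr (1 - \<sigma>) * ?f (\<Lambda> * (1 - t))) has_integral (exp \<Lambda> * \<Lambda> powr (1 - \<sigma>) * (I / \<Lambda>))) {0..1}"
    by (rule has_integral_mult_right[OF 1])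
  then have "((\<lambda>t. (1 - t) powr (\<sigma> - 1) * exp (\<Lambda> * t)) has_integral (exp \<Lambda> * \<Lambda> powr (1 - \<sigma>) * (I / \<Lambda>))) {0..1}"
  proof (rule has_integral_eq[rotated])
    fix t :: real assume "t \<in> {0..1}"
    then have "(\<Lambda> * (1 - t)) powr (\<sigma> - 1) = \<Lambda> powr (\<sigma> - 1) * (1 - t) powr (\<sigma> - 1)"
      using lam by (simp add: powr_mult)
    moreover have "\<Lambda> powr (1 - \<sigma>) * \<Lambda> powr (\<sigma> - 1) = 1" using lam by (simp add: powr_add[symmetric])
    moreover have "exp \<Lambda> / exp (\<Lambda> * (1 - t)) = exp (\<Lambda> * t)" by (simp add: exp_diff[symmetric] algebra_simps)
    ultimately show "exp \<Lambda> * \<Lambda> powr (1 - \<sigma>) * ?f (\<Lambda> * (1 - t)) = (1 - t) powr (\<sigma> - 1) * exp (\<Lambda> * t)"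
      by (metis (no_types, opaque_lifting) mult.assoc mult.commute mult_1 times_divide_eq_right)
  qed
  then have "integral {0..1} (\<lambda>t. (1 - t) powr (\<sigma> - 1) * exp (\<Lambda> * t)) = exp \<Lambda> * \<Lambda> powr (1 - \<sigma>) * (I / \<Lambda>)"
    by (rule integral_unique)
  also have "\<dots> \<le> exp \<Lambda> * \<Lambda> powr (1 - \<sigma>) * (Gamma \<sigma> / \<Lambda>)"
    using le lam by (intro mult_left_mono divide_right_mono) auto
  also have "\<dots> = exp \<Lambda> * Gamma \<sigma> * \<Lambda> powr (- \<sigma>)"
    using lam by (simp add: powr_diff powr_minus field_simps)
  finally show "integral {0..1} (\<lambda>t. (1 - t) powr (\<sigma> - 1) * exp (\<Lambda> * t)) \<le> exp \<Lambda> * Gamma \<sigma> * \<Lambda> powr (- \<sigma>)" .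
qed

context hankel_pair
begin

text \<open>A residue class modulo \<open>l\<close> without its first four elements. With \<open>m = l * (i + 4) +
r\<close> the number \<open>1 / Gamma ((m + 1) / l)\<close> is \<open>1 / (fact i * Gamma
\<sigma>)\<close> times the Beta integral with parameters \<open>i + 1\<close> and \<open>\<sigma> = 3 +
(r + 1) / l\<close>. The shift by \<open>4\<close> leaves a factor \<open>w ^ (4 * l + r)\<close> that
can be distributed over two atoms of degree at least \<open>2 * l\<close>, as the bound on their norms
requires.\<close>
definition in_tail_class :: "nat \<Rightarrow> nat \<Rightarrow> bool" where
  "in_tail_class r m \<longleftrightarrow> 4 * l \<le> m \<and> m mod l = r"

lemma tail_class_index: "in_tail_class r m \<Longrightarrow> m = l * (m div l - 4 + 4) + r"
proof -
  assume m: "in_tail_class r m"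
  have "4 * l div l \<le> m div l" using m by (intro div_le_mono) (simp add: in_tail_class_def)
  then have "m div l - 4 + 4 = m div l" using l by simp
  then show ?thesis using m by (simp add: in_tail_class_def) (metis mult_div_mod_eq)
qed

lemma index_in_tail_class: "r < l \<Longrightarrow> in_tail_class r (l * (i + 4) + r) \<and> (l * (i + 4) + r) div l - 4 = i"
proof -
  assume r: "r < l"
  have "4 * l \<le> (i + 4) * l" by (rule mult_right_mono) auto
  then have "4 * l \<le> l * (i + 4) + r" by (simp only: mult.commute trans_le_add1)
  moreover have "(l * (i + 4) + r) mod l = r" "(l * (i + 4) + r) div l = i + 4"
    using r by (simp_all add: div_mult_self3)
  ultimately show ?thesis by (simp add: in_tail_class_def)
qed

text \<open>The exponential series of \<open>of_real (\<alpha> * t) * (w * cnj z) ^ l\<close> only hits exponents in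
one residue class.\<close>
lemma product_atom_power_sum:
  assumes r: "r < l"
  shows "power_sum (\<lambda>m. if in_tail_class r m then of_real ((\<alpha> * t) ^ (m div l - 4) / fact (m div l - 4)) * cnj z ^ m else 0)
    (\<lambda>w. cnj z ^ (4 * l + r) * (atom l \<alpha> (2 * l) t z w * atom l \<alpha> (2 * l + r) t z w))"
    (is "power_sum ?c ?f")
  unfolding power_sum_def
proof
  fix w
  let ?x = "of_real (\<alpha> * t) * (w * cnj z) ^ l"
  have "atom l \<alpha> (2 * l) t z w * atom l \<alpha> (2 * l + r) t z w
      = w ^ (4 * l + r) * (exp (?x / 2) * exp (?x / 2))"
    by (simp add: atom_def power_add[symmetric] mult_ac)
  also have "exp (?x / 2) * exp (?x / 2) = exp ?x" by (simp add: exp_add[symmetric] mult.assoc)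
  finally have f: "?f w = (w * cnj z) ^ (4 * l + r) * exp ?x"
    by (simp only: power_mult_distrib mult_ac)
  have "(\<lambda>i. (w * cnj z) ^ (4 * l + r) * (?x ^ i /\<^sub>R fact i)) sums ?f w"
    unfolding f by (intro sums_mult exp_converges)
  moreover have "(w * cnj z) ^ (4 * l + r) * (?x ^ i /\<^sub>R fact i) = ?c (l * (i + 4) + r) * w ^ (l * (i + 4) + r)" for i
  proof -
    have c: "?c (l * (i + 4) + r) = of_real ((\<alpha> * t) ^ i / fact i) * cnj z ^ (l * (i + 4) + r)"
      using index_in_tail_class[OF r, of i] by simp
    have "(w * cnj z) ^ (4 * l + r) * ((w * cnj z) ^ l) ^ i = (w * cnj z) ^ (l * (i + 4) + r)"
      by (simp add: power_mult[symmetric] power_add[symmetric] algebra_simps)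
    then have e: "(w * cnj z) ^ (4 * l + r) * ((w * cnj z) ^ l) ^ i = cnj z ^ (l * (i + 4) + r) * w ^ (l * (i + 4) + r)"
      by (simp only: power_mult_distrib mult.commute)
    have "(w * cnj z) ^ (4 * l + r) * (?x ^ i /\<^sub>R fact i)
       = of_real ((\<alpha> * t) ^ i / fact i) * ((w * cnj z) ^ (4 * l + r) * ((w * cnj z) ^ l) ^ i)"
      by (simp add: scaleR_conv_of_real power_mult_distrib[of "of_real (\<alpha> * t)"] field_simps)
    then show ?thesis unfolding c e by (simp only: mult.assoc)
  qed
  ultimately have s: "(\<lambda>i. ?c (l * (i + 4) + r) * w ^ (l * (i + 4) + r)) sums ?f w" by (simp only:)
  have mono: "strict_mono (\<lambda>i. l * (i + 4) + r)"
    using l by (intro strict_monoI) simp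
  have zero: "?c m * w ^ m = 0" if "m \<notin> range (\<lambda>i. l * (i + 4) + r)" for m
    using that tail_class_index[of r m] by auto
  show "(\<lambda>m. ?c m * w ^ m) sums ?f w"
    using sums_mono_reindex[OF mono, of "\<lambda>m. ?c m * w ^ m", OF zero] s by simp
qed

lemma kernel_part_coefficient:
  assumes r: "r < l" and m: "in_tail_class r m"
  defines "\<sigma> \<equiv> 3 + (real r + 1) / real l"
  shows "((\<lambda>t. (real l * \<alpha> powr (1 / l) / pi * (\<alpha> powr (r / l + 4) / Gamma \<sigma>)) * (1 - t) powr (\<sigma> - 1)
      * ((\<alpha> * t) ^ (m div l - 4) / fact (m div l - 4))) has_integral (1 / power_moment l \<alpha> m)) {0..1}"
proof -
  let ?i = "m div l - 4"
  let ?k = "real l * \<alpha> powr (1 / l) / pi"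
  have s0: "\<sigma> > 0" by (simp add: \<sigma>_def add_pos_nonneg)
  have G: "Gamma \<sigma> > 0" using s0 by (rule Gamma_real_pos)
  have meq: "real m = real l * (real ?i + 4) + real r"
    using arg_cong[OF tail_class_index[OF m], of real] by simp
  have "((\<lambda>t. (?k * (\<alpha> powr (r / l + 4) / Gamma \<sigma>) * (\<alpha> ^ ?i / fact ?i)) * (t ^ ?i * (1 - t) powr (\<sigma> - 1)))
      has_integral (?k * (\<alpha> powr (r / l + 4) / Gamma \<sigma>) * (\<alpha> ^ ?i / fact ?i)) * (fact ?i * Gamma \<sigma> / Gamma (real ?i + 1 + \<sigma>))) {0..1}"
    by (intro has_integral_mult_right has_integral_power_Beta s0)
  moreover have "(?k * (\<alpha> powr (r / l + 4) / Gamma \<sigma>) * (\<alpha> ^ ?i / fact ?i)) * (fact ?i * Gamma \<sigma> / Gamma (real ?i + 1 + \<sigma>))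
      = 1 / power_moment l \<alpha> m"
  proof -
    have 1: "real ?i + 1 + \<sigma> = (real m + 1) / l"
      unfolding meq \<sigma>_def using l by (simp add: field_simps)
    have 2: "\<alpha> powr (r / l + 4) * \<alpha> ^ ?i = \<alpha> powr (m / l)"
    proof -
      have "\<alpha> ^ ?i = \<alpha> powr real ?i" using \<alpha> by (simp add: powr_realpow)
      moreover have "r / l + 4 + real ?i = m / l" unfolding meq using l by (simp add: field_simps)
      ultimately show ?thesis by (simp only: powr_add[symmetric])
    qed
    have "(?k * (\<alpha> powr (r / l + 4) / Gamma \<sigma>) * (\<alpha> ^ ?i / fact ?i)) * (fact ?i * Gamma \<sigma> / Gamma (real ?i + 1 + \<sigma>))
      = ?k * ((\<alpha> powr (r / l + 4) * \<alpha> ^ ?i) / Gamma (real ?i + 1 + \<sigma>))"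
      using G by (simp add: field_simps)
    then show ?thesis unfolding inverse_power_moment[OF l \<alpha>] 1 2 by simp
  qed
  ultimately show ?thesis by (simp add: power_mult_distrib mult_ac)
qed

text \<open>The product of the norms of the atoms and the power of \<open>z\<close> in front of them is of order
\<open>\<mu> ^ (6 * l + 2 * r + 2)\<close> with \<open>\<mu> = max 1 (cmod z)\<close>. The integral over
\<open>t\<close> gains the factor \<open>\<Lambda> powr (- \<sigma>)\<close> with
\<open>\<Lambda>\<close> of order \<open>\<mu> ^ (2 * l)\<close>, and \<open>2 * l * \<sigma> = 6 * l + 2
* r + 2\<close>: the powers cancel.\<close>
lemma kernel_part_bound:
  assumes r: "r < l"
  shows "\<exists>C\<ge>0. \<forall>N M z. controlled_seminorm N M \<longrightarrow>
    (\<exists>h\<in>E_class l. power_sum (\<lambda>m. if in_tail_class r m then cnj z ^ m / of_real (power_moment l \<alpha> m) else 0) h \<and>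
      N h \<le> C * M * exp (\<alpha> / 4 * cmod z ^ (2 * l)))"
proof -
  obtain C0 where C0: "\<And>z t r. 0 \<le> t \<Longrightarrow> t \<le> 1 \<Longrightarrow> r < l \<Longrightarrow>
      nrm X (atom l \<alpha> (2 * l) t z) * nrm Y (atom l \<alpha> (2 * l + r) t z)
        \<le> C0 * max 1 (cmod z) ^ (2 * l + r + 2) * exp (\<alpha> * t\<^sup>2 * cmod z ^ (2 * l) / 4)"
    using atoms_bounded by blast
  define \<sigma> where "\<sigma> = 3 + (real r + 1) / real l"
  have \<sigma>: "\<sigma> > 1" "\<sigma> > 0" by (simp_all add: \<sigma>_def add_pos_nonneg)
  define A where "A = real l * \<alpha> powr (1 / l) / pi * (\<alpha> powr (r / l + 4) / Gamma \<sigma>)"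
  have G0: "Gamma \<sigma> > 0" using \<sigma>(2) by (rule Gamma_real_pos)
  have A0: "A \<ge> 0" using G0 by (simp add: A_def)
  define C where "C = A * \<bar>C0\<bar> * (Gamma \<sigma> * (\<alpha> / 4) powr (- \<sigma>) * exp (\<alpha> / 4))"
  have "\<exists>h\<in>E_class l. power_sum (\<lambda>m. if in_tail_class r m then cnj z ^ m / of_real (power_moment l \<alpha> m) else 0) h \<and>
      N h \<le> C * M * exp (\<alpha> / 4 * cmod z ^ (2 * l))" if N: "controlled_seminorm N M" for N M z
  proof -
    let ?b = "\<lambda>m. if in_tail_class r m then cnj z ^ m / of_real (power_moment l \<alpha> m) else 0"
    define h where "h = (\<lambda>w. \<Sum>m. ?b m * w ^ m)"
    have h: "h \<in> E_class l" "power_sum ?b h"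
      using E_class_subseries[OF kernel_at_in_E_class[OF l \<alpha>] kernel_at_power_sum[OF l \<alpha>], of ?b 1 z]
      by (auto simp: h_def)
    have M0: "M \<ge> 0" by (rule controlled_nonneg[OF N])
    define \<mu> where "\<mu> = max 1 (cmod z)"
    have mu: "\<mu> \<ge> 1" "cmod z \<le> \<mu>" by (auto simp: \<mu>_def)
    define \<Lambda> where "\<Lambda> = \<alpha> / 4 * \<mu> ^ (2 * l)"
    have Lam: "\<Lambda> > 0" using mu \<alpha> by (simp add: \<Lambda>_def)
    define c where "c t = A * M * \<bar>C0\<bar> * \<mu> ^ (6 * l + 2 * r + 2) * ((1 - t) powr (\<sigma> - 1) * exp (\<Lambda> * t))" for t
    let ?G = "\<lambda>t m. if in_tail_class r m then of_real ((\<alpha> * t) ^ (m div l - 4) / fact (m div l - 4)) * cnj z ^ m else 0"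
    let ?q = "\<lambda>t w. cnj z ^ (4 * l + r) * (atom l \<alpha> (2 * l) t z w * atom l \<alpha> (2 * l + r) t z w)"
    have qE: "?q t \<in> E_class l" for t by (intro E_class_cmult E_class_mult atom_in_E_class l)
    have qG: "power_sum (?G t) (?q t)" for t by (rule product_atom_power_sum[OF r])
    define F where "F m t = of_real (A * (1 - t) powr (\<sigma> - 1)) * ?G t m" for m t
    define f where "f t w = of_real (A * (1 - t) powr (\<sigma> - 1)) * ?q t w" for t w
    have F_int: "(F m has_integral ?b m) (cbox 0 1)" for m
    proof (cases "in_tail_class r m")
      case True
      have "((\<lambda>t. A * (1 - t) powr (\<sigma> - 1) * ((\<alpha> * t) ^ (m div l - 4) / fact (m div l - 4)))
        has_integral (1 / power_moment l \<alpha> m)) {0..1}"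
        unfolding A_def \<sigma>_def by (rule kernel_part_coefficient[OF r True])
      from has_integral_mult_left[OF has_integral_of_real[OF this], of "cnj z ^ m"]
      show ?thesis using True by (simp add: F_def[abs_def] mult.assoc del: of_real_power)
    next
      case False
      then show ?thesis by (simp add: F_def[abs_def])
    qed
    have "N h \<le> integral (cbox 0 1) c"
    proof (rule controlled_integral[where F = F and f = f and B = "\<lambda>m. A * cmod (?G 1 m)", OF N])
      show "F m integrable_on cbox 0 1" for m using F_int by (rule has_integral_integrable)
      show "c integrable_on cbox 0 1"
        unfolding c_def[abs_def] using integrable_endpoint_Laplace[OF \<sigma>(1) Lam]
        by (intro integrable_on_mult_right) simp
      show "cmod (F m t) \<le> A * cmod (?G 1 m)" if "t \<in> cbox 0 1" for m t
      proof (cases "in_tail_class r m")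
        case True
        let ?i = "m div l - 4"
        have t: "0 \<le> t" "t \<le> 1" using that by auto
        have "(1 - t) powr (\<sigma> - 1) \<le> 1" using t \<sigma> by (intro powr_le1) auto
        moreover have "(\<alpha> * t) ^ ?i / fact ?i \<le> (\<alpha> * 1) ^ ?i / fact ?i"
          using t \<alpha> by (intro divide_right_mono power_mono mult_left_mono) auto
        ultimately have "A * (1 - t) powr (\<sigma> - 1) * ((\<alpha> * t) ^ ?i / fact ?i * cmod z ^ m)
          \<le> A * 1 * ((\<alpha> * 1) ^ ?i / fact ?i * cmod z ^ m)"
          using A0 t \<alpha> by (intro mult_mono) auto
        moreover have "cmod (F m t) = A * (1 - t) powr (\<sigma> - 1) * ((\<alpha> * t) ^ ?i / fact ?i * cmod z ^ m)"
          unfolding F_def if_P[OF True] norm_mult norm_power norm_of_real complex_mod_cnj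
          using A0 t \<alpha> by (simp add: abs_mult)
        moreover have "A * cmod (?G 1 m) = A * 1 * ((\<alpha> * 1) ^ ?i / fact ?i * cmod z ^ m)"
          unfolding if_P[OF True] norm_mult norm_power norm_of_real complex_mod_cnj using \<alpha> by simp
        ultimately show ?thesis by simp
      qed (simp add: F_def)
      show "summable (\<lambda>m. A * cmod (?G 1 m) * monomial_cost m)"
        using summable_mult[OF monomial_cost_summable[OF qE qG], of A 1] by (simp only: mult.assoc)
      show "f t \<in> E_class l" for t unfolding f_def[abs_def] by (intro E_class_cmult qE)
      show "power_sum (\<lambda>m. F m t) (f t)" for t
        using qG[of t] unfolding power_sum_def F_def f_def mult.assoc by (auto intro!: sums_mult simp only:)
      show "N (f t) \<le> c t" if "t \<in> cbox 0 1" for t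
      proof -
        have t: "0 \<le> t" "t \<le> 1" using that by auto
        let ?e = "A * (1 - t) powr (\<sigma> - 1)"
        have e0: "?e \<ge> 0" using A0 by simp
        let ?P = "\<lambda>w. atom l \<alpha> (2 * l) t z w * atom l \<alpha> (2 * l + r) t z w"
        have PE: "?P \<in> E_class l" by (intro E_class_mult atom_in_E_class l)
        have nn: "nrm X (atom l \<alpha> (2 * l) t z) * nrm Y (atom l \<alpha> (2 * l + r) t z)
          \<le> \<bar>C0\<bar> * \<mu> ^ (2 * l + r + 2) * exp (\<Lambda> * t)"
        proof -
          have "nrm X (atom l \<alpha> (2 * l) t z) * nrm Y (atom l \<alpha> (2 * l + r) t z)
            \<le> C0 * \<mu> ^ (2 * l + r + 2) * exp (\<alpha> * t\<^sup>2 * cmod z ^ (2 * l) / 4)"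
            using C0[OF t r] unfolding \<mu>_def .
          also have "\<dots> \<le> \<bar>C0\<bar> * \<mu> ^ (2 * l + r + 2) * exp (\<Lambda> * t)"
          proof (intro mult_mono)
            \<comment> \<open>Nothing essential is lost, because the integral over \<open>t\<close> is dominated by \<open>t\<close> close to \<open>1\<close>.\<close>
            have "t\<^sup>2 \<le> t" using t by (simp add: power2_eq_square mult_left_le)
            moreover have "cmod z ^ (2 * l) \<le> \<mu> ^ (2 * l)" using mu by (intro power_mono) auto
            ultimately have "\<alpha> * (t\<^sup>2 * cmod z ^ (2 * l)) \<le> \<alpha> * (t * \<mu> ^ (2 * l))"
              using t \<alpha> by (intro mult_left_mono mult_mono) auto
            then show "exp (\<alpha> * t\<^sup>2 * cmod z ^ (2 * l) / 4) \<le> exp (\<Lambda> * t)" by (simp add: \<Lambda>_def field_simps)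
          qed (use mu in auto)
          finally show ?thesis .
        qed
        have zp: "0 \<le> \<mu> ^ (4 * l + r)" using mu by simp
        have zq: "0 \<le> M * (nrm X (atom l \<alpha> (2 * l) t z) * nrm Y (atom l \<alpha> (2 * l + r) t z))"
          using atom_in_E_class[OF l] E_X E_Y M0
          by (intro mult_nonneg_nonneg nrm_X_nonneg nrm_Y_nonneg) auto
        have "N (f t) \<le> cmod (of_real ?e) * N (?q t)"
          unfolding f_def[abs_def] by (rule controlled_cmult[OF N qE])
        also have "\<dots> = ?e * N (?q t)" using e0 by (simp only: norm_of_real abs_of_nonneg)
        also have "\<dots> \<le> ?e * (cmod (cnj z ^ (4 * l + r)) * N ?P)"
          by (intro mult_left_mono controlled_cmult[OF N PE] e0)
        also have "\<dots> \<le> ?e * (cmod z ^ (4 * l + r) * (M * (nrm X (atom l \<alpha> (2 * l) t z) * nrm Y (atom l \<alpha> (2 * l + r) t z))))"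
          unfolding norm_power complex_mod_cnj
          by (intro mult_left_mono controlled_product[OF N] atom_in_E_class l e0) auto
        also have "\<dots> \<le> ?e * (\<mu> ^ (4 * l + r) * (M * (\<bar>C0\<bar> * \<mu> ^ (2 * l + r + 2) * exp (\<Lambda> * t))))"
          by (rule mult_left_mono[OF mult_mono[OF power_mono[OF mu(2) norm_ge_zero] mult_left_mono[OF nn M0] zp zq] e0])
        also have "\<dots> = c t"
        proof -
          have "\<mu> ^ (4 * l + r) * \<mu> ^ (2 * l + r + 2) = \<mu> ^ (6 * l + 2 * r + 2)"
            unfolding power_add[symmetric] by (intro arg_cong[of _ _ "\<lambda>n. \<mu> ^ n"]) simp
          then have "A * p * (\<mu> ^ (4 * l + r) * (M * (\<bar>C0\<bar> * \<mu> ^ (2 * l + r + 2) * x)))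
             = A * M * \<bar>C0\<bar> * \<mu> ^ (6 * l + 2 * r + 2) * (p * x)" for p x
            unfolding \<open>\<mu> ^ (4 * l + r) * \<mu> ^ (2 * l + r + 2) = \<mu> ^ (6 * l + 2 * r + 2)\<close>[symmetric]
            by (simp only: mult_ac)
          then show ?thesis unfolding c_def .
        qed
        finally show ?thesis .
      qed
      show "h \<in> E_class l" by (rule h)
      show "power_sum (\<lambda>m. integral (cbox 0 1) (F m)) h"
        using h(2) unfolding integral_unique[OF F_int] .
    qed
    also have "integral (cbox 0 1) c = A * M * \<bar>C0\<bar> * \<mu> ^ (6 * l + 2 * r + 2) * integral {0..1} (\<lambda>t. (1 - t) powr (\<sigma> - 1) * exp (\<Lambda> * t))"
      unfolding c_def[abs_def] by simp
    also have "\<dots> \<le> A * M * \<bar>C0\<bar> * \<mu> ^ (6 * l + 2 * r + 2) * (exp \<Lambda> * Gamma \<sigma> * \<Lambda> powr (- \<sigma>))"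
      using A0 M0 mu by (intro mult_left_mono integral_endpoint_Laplace[OF \<sigma>(1) Lam]) auto
    also have "\<Lambda> powr (- \<sigma>) = (\<alpha> / 4) powr (- \<sigma>) / \<mu> ^ (6 * l + 2 * r + 2)"
    proof -
      have "(\<mu> ^ (2 * l)) powr (- \<sigma>) = \<mu> powr (- real (6 * l + 2 * r + 2))"
      proof -
        have "real (2 * l) * (- \<sigma>) = - real (6 * l + 2 * r + 2)"
          using l by (simp add: \<sigma>_def field_simps)
        then show ?thesis using mu by (simp only: powr_realpow[symmetric] powr_powr)
      qed
      also have "\<dots> = 1 / \<mu> ^ (6 * l + 2 * r + 2)"
        using mu by (simp only: powr_minus powr_realpow) (simp add: field_simps)
      finally have e: "(\<mu> ^ (2 * l)) powr (- \<sigma>) = 1 / \<mu> ^ (6 * l + 2 * r + 2)" .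
      have "(\<alpha> / 4 * \<mu> ^ (2 * l)) powr (- \<sigma>) = (\<alpha> / 4) powr (- \<sigma>) * (\<mu> ^ (2 * l)) powr (- \<sigma>)"
        by (rule powr_mult)
      then show ?thesis unfolding \<Lambda>_def e by (simp only: times_divide_eq_right mult_1_right)
    qed
    also have "A * M * \<bar>C0\<bar> * \<mu> ^ (6 * l + 2 * r + 2) * (exp \<Lambda> * Gamma \<sigma> * ((\<alpha> / 4) powr (- \<sigma>) / \<mu> ^ (6 * l + 2 * r + 2)))
      = A * M * \<bar>C0\<bar> * (Gamma \<sigma> * (\<alpha> / 4) powr (- \<sigma>)) * exp \<Lambda>"
      using mu by simp
    also have "\<dots> \<le> A * M * \<bar>C0\<bar> * (Gamma \<sigma> * (\<alpha> / 4) powr (- \<sigma>)) * (exp (\<alpha> / 4) * exp (\<alpha> / 4 * cmod z ^ (2 * l)))"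
    proof (intro mult_left_mono)
      have "\<mu> ^ (2 * l) \<le> 1 + cmod z ^ (2 * l)" by (auto simp: \<mu>_def max_def)
      then have "\<Lambda> \<le> \<alpha> / 4 * (1 + cmod z ^ (2 * l))" unfolding \<Lambda>_def using \<alpha> by (intro mult_left_mono) auto
      then show "exp \<Lambda> \<le> exp (\<alpha> / 4) * exp (\<alpha> / 4 * cmod z ^ (2 * l))"
        by (simp add: exp_add[symmetric] distrib_left)
    qed (use A0 M0 G0 in auto)
    also have "\<dots> = C * M * exp (\<alpha> / 4 * cmod z ^ (2 * l))" by (simp add: C_def mult_ac)
    finally show ?thesis using h by blast
  qed
  moreover have "C \<ge> 0" using A0 G0 by (simp add: C_def)
  ultimately show ?thesis by blast
qed

end

lemma has_integral_UNIV_vanishing_outside: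
  fixes f :: "'a::euclidean_space \<Rightarrow> 'b::banach"
  assumes "(f has_integral I) UNIV" and "\<And>x. x \<notin> S \<Longrightarrow> f x = 0"
  shows "(f has_integral I) S"
proof -
  have "(\<lambda>x. if x \<in> S then f x else 0) = f" using assms(2) by auto
  then show ?thesis using has_integral_restrict_UNIV[of S f I] assms(1) by (simp only:)
qed

lemma power_moment_double:
  assumes l: "l \<ge> 1" and \<alpha>: "\<alpha> > 0"
  shows "power_moment l (2 * \<alpha>) m = power_moment l \<alpha> m / (2 powr (1 / real l)) ^ (m + 1)"
proof -
  have "(2 powr (1 / real l)) ^ (m + 1) = (2::real) powr ((real m + 1) / l)"
    by (subst powr_power_eq) (simp_all add: add.commute)
  moreover have "(2 * \<alpha>) powr (- (real m + 1) / l) = \<alpha> powr (- (real m + 1) / l) / 2 powr ((real m + 1) / l)"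
    by (simp only: powr_mult minus_divide_left[symmetric] powr_minus) (simp add: field_simps)
  moreover have "2 * \<alpha> > 0" using \<alpha> by simp
  ultimately show ?thesis
    by (simp only: power_moment_eq[OF l \<alpha>] power_moment_eq[OF l]) simp
qed

context hankel_pair
begin

lemma monomial_norm_controlled:
  assumes "controlled_seminorm N M"
  shows "N (\<lambda>w. c * w ^ m) \<le> cmod c * (M * monomial_cost m)"
proof -
  have E: "(\<lambda>w. w ^ m) \<in> E_class l" using monomial_in_E_class[OF l, of 1 m] by simp
  have "N (\<lambda>w. c * w ^ m) \<le> cmod c * N (\<lambda>w. w ^ m)"
    by (rule controlled_cmult[OF assms E])
  also have "\<dots> \<le> cmod c * (M * monomial_cost m)"
    using controlled_product[OF assms E one_in_E] by (intro mult_left_mono) (auto simp: monomial_cost_def)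
  finally show ?thesis .
qed

text \<open>Sum the preceding bound over the residue classes. The finitely many monomials of degree below \<open>4 *
l\<close> that are left are estimated one by one.\<close>
proposition kernel_bound:
  "\<exists>C\<ge>0. \<forall>N M z. controlled_seminorm N M \<longrightarrow>
    N (kernel_at l \<alpha> z) \<le> C * M * exp (\<alpha> / 4 * cmod z ^ (2 * l))"
proof -
  let ?c = "\<lambda>z m. cnj z ^ m / complex_of_real (power_moment l \<alpha> m)"
  define Q where "Q r C \<longleftrightarrow> C \<ge> 0 \<and> (\<forall>N M z. controlled_seminorm N M \<longrightarrow>
    (\<exists>h\<in>E_class l. power_sum (\<lambda>m. if in_tail_class r m then ?c z m else 0) h \<and>
      N h \<le> C * M * exp (\<alpha> / 4 * cmod z ^ (2 * l))))" for r C
  have "\<forall>r. \<exists>C. r < l \<longrightarrow> Q r C"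
    unfolding Q_def using kernel_part_bound by blast
  then obtain C where Q: "\<And>r. r < l \<Longrightarrow> Q r (C r)" by metis
  have C: "C r \<ge> 0" if "r < l" for r using Q[OF that] by (simp add: Q_def)
  have "\<exists>D\<ge>0. \<forall>z. cmod z ^ m \<le> D * exp (\<alpha> / 4 * cmod z ^ (2 * l))" for m
  proof -
    have E: "(\<lambda>z. 1 * z ^ m) \<in> E_class l" by (rule monomial_in_E_class[OF l])
    have "\<alpha> / 4 > 0" using \<alpha> by simp
    from E_class_growth[OF E this] obtain D where "D \<ge> 0" "\<And>z. cmod (1 * z ^ m) \<le> D * exp (\<alpha> / 4 * cmod z ^ (2 * l))"
      by blast
    then show ?thesis by (auto simp: norm_power)
  qed
  then obtain D where D: "\<And>m. D m \<ge> 0" "\<And>m z. cmod z ^ m \<le> D m * exp (\<alpha> / 4 * cmod z ^ (2 * l))"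
    by metis
  define K where "K = (\<Sum>m<4 * l. D m / power_moment l \<alpha> m * monomial_cost m) + (\<Sum>r<l. C r)"
  have K0: "K \<ge> 0" unfolding K_def
    using D(1) C power_moment_pos[OF l \<alpha>] monomial_cost_nonneg
    by (intro add_nonneg_nonneg sum_nonneg mult_nonneg_nonneg divide_nonneg_nonneg) (auto intro: less_imp_le)
  have "N (kernel_at l \<alpha> z) \<le> K * M * exp (\<alpha> / 4 * cmod z ^ (2 * l))" if N: "controlled_seminorm N M" for N M z
  proof -
    let ?e = "exp (\<alpha> / 4 * cmod z ^ (2 * l))"
    have M0: "M \<ge> 0" by (rule controlled_nonneg[OF N])
    define P where "P r h \<longleftrightarrow> h \<in> E_class l \<and> power_sum (\<lambda>m. if in_tail_class r m then ?c z m else 0) h \<and> N h \<le> C r * M * ?e" for r h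
    have "\<exists>h. P r h" if "r < l" for r
      using Q[OF that] N unfolding Q_def P_def by blast
    then obtain h where "\<And>r. r < l \<Longrightarrow> P r (h r)" by metis
    then have h: "\<And>r. r < l \<Longrightarrow> h r \<in> E_class l"
      "\<And>r. r < l \<Longrightarrow> power_sum (\<lambda>m. if in_tail_class r m then ?c z m else 0) (h r)"
      "\<And>r. r < l \<Longrightarrow> N (h r) \<le> C r * M * ?e"
      by (simp_all add: P_def)
    let ?p = "\<lambda>m w. ?c z m * w ^ m"
    have pE: "?p m \<in> E_class l" for m by (rule monomial_in_E_class[OF l])
    have s1: "(\<lambda>w. \<Sum>m<4 * l. ?p m w) \<in> E_class l \<and> N (\<lambda>w. \<Sum>m<4 * l. ?p m w) \<le> (\<Sum>m<4 * l. N (?p m))"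
      by (rule controlled_sum[OF N]) (use pE in auto)
    have s2: "(\<lambda>w. \<Sum>r<l. h r w) \<in> E_class l \<and> N (\<lambda>w. \<Sum>r<l. h r w) \<le> (\<Sum>r<l. N (h r))"
      by (rule controlled_sum[OF N]) (use h(1) in auto)
    have "kernel_at l \<alpha> z w = (\<Sum>m<4 * l. ?p m w) + (\<Sum>r<l. h r w)" for w
    proof -
      have "(\<lambda>m. if m \<in> {..<4 * l} then ?p m w else 0) sums (\<Sum>m<4 * l. ?p m w)"
        by (rule sums_If_finite_set) simp
      moreover have "(\<lambda>m. \<Sum>r<l. (if in_tail_class r m then ?c z m else 0) * w ^ m) sums (\<Sum>r<l. h r w)"
        by (rule sums_sum) (use h(2) in \<open>auto simp: power_sum_def\<close>)
      ultimately have "(\<lambda>m. (if m \<in> {..<4 * l} then ?p m w else 0) + (\<Sum>r<l. (if in_tail_class r m then ?c z m else 0) * w ^ m))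
        sums ((\<Sum>m<4 * l. ?p m w) + (\<Sum>r<l. h r w))" by (rule sums_add)
      moreover have "(if m \<in> {..<4 * l} then ?p m w else 0) + (\<Sum>r<l. (if in_tail_class r m then ?c z m else 0) * w ^ m) = ?p m w" for m
      proof (cases "m < 4 * l")
        case True
        then show ?thesis by (simp add: in_tail_class_def)
      next
        case False
        have "(\<Sum>r<l. (if in_tail_class r m then ?c z m else 0) * w ^ m) = (\<Sum>r<l. if r = m mod l then ?p m w else 0)"
          using False by (intro sum.cong) (auto simp: in_tail_class_def)
        also have "\<dots> = ?p m w" using l by (simp add: sum.delta')
        finally show ?thesis using False by simp
      qed
      ultimately have "?p m w = ?p m w \<Longrightarrow> (\<lambda>m. ?p m w) sums ((\<Sum>m<4 * l. ?p m w) + (\<Sum>r<l. h r w))" for m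
        by (simp only:)
      moreover have "(\<lambda>m. ?p m w) sums kernel_at l \<alpha> z w"
        using kernel_at_power_sum[OF l \<alpha>, of z] by (simp add: power_sum_def)
      ultimately show ?thesis using sums_unique2 by blast
    qed
    then have eq: "kernel_at l \<alpha> z = (\<lambda>w. (\<Sum>m<4 * l. ?p m w) + (\<Sum>r<l. h r w))" by (rule ext)
    have "N (kernel_at l \<alpha> z) \<le> N (\<lambda>w. \<Sum>m<4 * l. ?p m w) + N (\<lambda>w. \<Sum>r<l. h r w)"
      unfolding eq by (rule controlled_add[OF N]) (use s1 s2 in auto)
    also have "\<dots> \<le> (\<Sum>m<4 * l. N (?p m)) + (\<Sum>r<l. N (h r))" using s1 s2 by (intro add_mono) auto
    also have "\<dots> \<le> (\<Sum>m<4 * l. (D m / power_moment l \<alpha> m * monomial_cost m) * (M * ?e)) + (\<Sum>r<l. C r * (M * ?e))"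
    proof (intro add_mono sum_mono)
      fix m
      have k: "power_moment l \<alpha> m > 0" by (rule power_moment_pos[OF l \<alpha>])
      have "N (?p m) \<le> cmod (?c z m) * (M * monomial_cost m)" by (rule monomial_norm_controlled[OF N])
      also have "cmod (?c z m) = cmod z ^ m / power_moment l \<alpha> m" using k by (simp add: norm_divide norm_power)
      also have "cmod z ^ m / power_moment l \<alpha> m * (M * monomial_cost m) \<le> D m * ?e / power_moment l \<alpha> m * (M * monomial_cost m)"
        using D(2)[of z m] k M0 monomial_cost_nonneg[of m] by (intro mult_right_mono divide_right_mono) auto
      also have "\<dots> = (D m / power_moment l \<alpha> m * monomial_cost m) * (M * ?e)" by (simp add: mult_ac)
      finally show "N (?p m) \<le> (D m / power_moment l \<alpha> m * monomial_cost m) * (M * ?e)" .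
    next
      fix r assume "r \<in> {..<l}"
      then show "N (h r) \<le> C r * (M * ?e)" using h(3)[of r] by (simp add: mult.assoc)
    qed
    also have "\<dots> = K * M * ?e" unfolding K_def by (simp only: mult.assoc distrib_right sum_distrib_right)
    finally show ?thesis .
  qed
  then show ?thesis using K0 by blast
qed

section \<open>Polynomials as averages of kernels\<close>

text \<open>By the reproducing property and \<open>power_moment_double\<close>, a polynomial \<open>h\<close> is
\<open>s = 2 powr (1 / l)\<close> times the average of the kernels at \<open>s * z\<close> with density
\<open>h z * exp (- (2 * \<alpha>) * cmod z ^ (2 * l))\<close>. The bound \<open>exp (\<alpha> / 4 * cmod
(s * z) ^ (2 * l)) = exp (\<alpha> * cmod z ^ (2 * l))\<close> for these kernels turns the density into
the integrand of the norm of \<open>h\<close>. To stay on a bounded domain, the average is restricted to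
a disc of radius \<open>R\<close>; by orthogonality this only multiplies the \<open>m\<close>-th
coefficient by a number \<open>\<rho> R m\<close>, which tends to \<open>1\<close>.\<close>
proposition polynomial_bound:
  "\<exists>C\<ge>0. \<forall>N M a n. controlled_seminorm N M \<longrightarrow>
    N (\<lambda>w. \<Sum>m<n. a m * w ^ m) \<le> C * M * nrm (F_space 1 l (2 * \<alpha>)) (\<lambda>w. \<Sum>m<n. a m * w ^ m)"
proof -
  obtain C where C: "C \<ge> 0" "\<And>N M z. controlled_seminorm N M \<Longrightarrow>
    N (kernel_at l \<alpha> z) \<le> C * M * exp (\<alpha> / 4 * cmod z ^ (2 * l))"
    using kernel_bound by blast
  define s where "s = (2::real) powr (1 / l)"
  have s: "s > 0" by (simp add: s_def)
  have sl: "s ^ l = 2" using l by (simp add: s_def powr_power_eq)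
  have a2: "2 * \<alpha> > 0" using \<alpha> by simp
  have "N (\<lambda>w. \<Sum>m<n. a m * w ^ m) \<le> (s * C) * M * nrm (F_space 1 l (2 * \<alpha>)) (\<lambda>w. \<Sum>m<n. a m * w ^ m)"
    if N: "controlled_seminorm N M" for N M n and a :: "nat \<Rightarrow> complex"
  proof -
    have M0: "M \<ge> 0" by (rule controlled_nonneg[OF N])
    define h where "h = (\<lambda>w. \<Sum>m<n. a m * w ^ m)"
    have hE: "h \<in> E_class l" unfolding h_def by (rule polynomial_in_E_class[OF l])
    have h_ent: "h \<in> entire" by (rule E_class_entire[OF hE])
    have [measurable]: "h \<in> borel_measurable borel" by (rule entire_measurable[OF h_ent])
    define b where "b m = (if m < n then a m else 0)" for m
    have hb: "power_sum b h"
      unfolding power_sum_def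
    proof
      fix w
      have "(\<lambda>m. if m \<in> {..<n} then a m * w ^ m else 0) sums (\<Sum>m<n. a m * w ^ m)"
        by (rule sums_If_finite_set) simp
      then show "(\<lambda>m. b m * w ^ m) sums h w"
        by (simp add: b_def h_def if_distrib[of "\<lambda>x. x * _"] cong: if_cong)
    qed
    define \<psi> where "\<psi> R r = exp (- (2 * \<alpha>) * r ^ (2 * l)) * indicator {..real R} r" for R :: nat and r :: real
    have [measurable]: "\<psi> R \<in> borel_measurable borel" for R unfolding \<psi>_def by measurable
    define \<rho> where "\<rho> R m = s ^ (m + 1) / power_moment l \<alpha> m * (LINT z|lborel. cmod z ^ (2 * m) * \<psi> R (cmod z))" for R m
    have hint: "integrable lborel (weighted l (2 * \<alpha>) h)"
      using E_class_subset_F_space[OF l a2, of 1] hE by (auto simp: one_ereal_def[symmetric] F_one_elts)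
    have nrmh: "nrm (F_space 1 l (2 * \<alpha>)) h = (LINT z|lborel. weighted l (2 * \<alpha>) h z)"
      by (rule F_one_nrm[OF h_ent])
    have psi_le: "\<psi> R (cmod z) \<le> exp (- (2 * \<alpha>) * cmod z ^ (2 * l))" "0 \<le> \<psi> R (cmod z)" for R z
      by (auto simp: \<psi>_def indicator_def)
    note psi_le' = psi_le[simplified]
    have ip: "integrable lborel (\<lambda>z. cmod z ^ k * \<psi> R (cmod z))" for k R
      by (rule Bochner_Integration.integrable_bound[OF integrable_norm_power_exp[OF l a2, of k]])
        (auto intro!: AE_I2 mult_left_mono psi_le' simp: abs_mult psi_le)
    have rho_lim: "(\<lambda>R. \<rho> R m) \<longlonglongrightarrow> 1" for m
    proof -
      have "(\<lambda>R. LINT z|lborel. cmod z ^ (2 * m) * \<psi> R (cmod z)) \<longlonglongrightarrow> (LINT z|lborel. cmod z ^ (2 * m) * exp (- (2 * \<alpha>) * cmod z ^ (2 * l)))"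
      proof (rule integral_dominated_convergence[where w = "\<lambda>z. cmod z ^ (2 * m) * exp (- (2 * \<alpha>) * cmod z ^ (2 * l))"])
        show "integrable lborel (\<lambda>z. cmod z ^ (2 * m) * exp (- (2 * \<alpha>) * cmod z ^ (2 * l)))"
          by (rule integrable_norm_power_exp[OF l a2])
        show "AE z in lborel. (\<lambda>R. cmod z ^ (2 * m) * \<psi> R (cmod z)) \<longlonglongrightarrow> cmod z ^ (2 * m) * exp (- (2 * \<alpha>) * cmod z ^ (2 * l))"
        proof (rule AE_I2)
          fix z :: complex
          obtain k where k: "cmod z \<le> real k" using real_arch_simple by blast
          show "(\<lambda>R. cmod z ^ (2 * m) * \<psi> R (cmod z)) \<longlonglongrightarrow> cmod z ^ (2 * m) * exp (- (2 * \<alpha>) * cmod z ^ (2 * l))"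
            by (rule tendsto_eventually)
              (use k in \<open>auto simp: \<psi>_def eventually_sequentially intro!: exI[of _ k]\<close>)
        qed
        show "AE z in lborel. norm (cmod z ^ (2 * m) * \<psi> R (cmod z)) \<le> cmod z ^ (2 * m) * exp (- (2 * \<alpha>) * cmod z ^ (2 * l))" for R
          by (auto intro!: AE_I2 mult_left_mono psi_le' simp: abs_mult psi_le)
      qed auto
      then have "(\<lambda>R. \<rho> R m) \<longlonglongrightarrow> s ^ (m + 1) / power_moment l \<alpha> m * power_moment l (2 * \<alpha>) m"
        unfolding \<rho>_def power_moment_def[of l "2 * \<alpha>" m] by (rule tendsto_mult_left)
      also have "power_moment l (2 * \<alpha>) m = power_moment l \<alpha> m / s ^ (m + 1)"
        unfolding s_def by (rule power_moment_double[OF l \<alpha>])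
      finally show ?thesis using s power_moment_pos[OF l \<alpha>, of m] by simp
    qed
    define hR where "hR R = (\<lambda>w. \<Sum>m<n. (\<rho> R m * a m) * w ^ m)" for R
    have hRE: "hR R \<in> E_class l" for R unfolding hR_def by (rule polynomial_in_E_class[OF l])
    have hRb: "power_sum (\<lambda>m. \<rho> R m * b m) (hR R)" for R
      unfolding power_sum_def
    proof
      fix w
      have "(\<lambda>m. if m \<in> {..<n} then (\<rho> R m * a m) * w ^ m else 0) sums (\<Sum>m<n. (\<rho> R m * a m) * w ^ m)"
        by (rule sums_If_finite_set) simp
      also have "(\<lambda>m. if m \<in> {..<n} then (\<rho> R m * a m) * w ^ m else 0) = (\<lambda>m. \<rho> R m * b m * w ^ m)"
        by (auto simp: b_def)
      finally show "(\<lambda>m. \<rho> R m * b m * w ^ m) sums hR R w" by (simp add: hR_def)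
    qed
    have NhR: "N (hR R) \<le> s * C * M * nrm (F_space 1 l (2 * \<alpha>)) h" for R :: nat
    proof -
      define u where "u = Complex (- real R) (- real R)"
      define v where "v = Complex (real R) (real R)"
      have disc: "z \<in> cbox u v" if "cmod z \<le> real R" for z
        using abs_Re_le_cmod[of z] abs_Im_le_cmod[of z] that
        by (auto simp: u_def v_def in_cbox_complex_iff)
      define F where "F m z = of_real s * (h z * of_real (\<psi> R (cmod z))) * (cnj (of_real s * z) ^ m / of_real (power_moment l \<alpha> m))" for m z
      define f where "f z w = of_real s * (h z * of_real (\<psi> R (cmod z))) * kernel_at l \<alpha> (of_real s * z) w" for z w
      define c where "c z = s * C * M * (indicator {..real R} (cmod z) * weighted l (2 * \<alpha>) h z)" for z
      have F_int: "(F m has_integral (\<rho> R m * b m)) (cbox u v)" for m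
      proof -
        have i1: "integrable lborel (\<lambda>z. h z * cnj z ^ m * of_real (\<psi> R (cmod z)))"
        proof -
          have "(\<lambda>z. 1 * z ^ m) \<in> E_class l" by (rule monomial_in_E_class[OF l])
          from E_class_mult[OF hE this] have E: "(\<lambda>z. h z * (1 * z ^ m)) \<in> E_class l" .
          obtain D where D: "D \<ge> 0" "\<And>z. cmod (h z * (1 * z ^ m)) \<le> D * exp (\<alpha> * cmod z ^ (2 * l))"
            by (rule E_class_growth[OF E \<alpha>]) blast
          have "integrable lborel (\<lambda>z. (h z * cnj z ^ m) * of_real (exp (- (2 * \<alpha>) * cmod z ^ (2 * l))))"
            using \<alpha> D(2) by (intro growth_integrable[OF l, of \<alpha>]) (auto simp: norm_mult norm_power)
          then have i: "integrable lborel (\<lambda>z. norm ((h z * cnj z ^ m) * of_real (exp (- (2 * \<alpha>) * cmod z ^ (2 * l)))))"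
            by (rule integrable_norm)
          show ?thesis
            by (rule Bochner_Integration.integrable_bound[OF i])
              (auto intro!: AE_I2 mult_left_mono psi_le' simp: norm_mult psi_le abs_of_nonneg)
        qed
        have e: "(LINT z|lborel. h z * cnj z ^ m * of_real (\<psi> R (cmod z))) = b m * of_real (LINT z|lborel. cmod z ^ (2 * m) * \<psi> R (cmod z))"
          by (rule radial_integral_extracts_coefficient[OF hb _ i1 ip ip]) measurable
        let ?k = "of_real (s ^ (m + 1) / power_moment l \<alpha> m) :: complex"
        have Fe: "F m = (\<lambda>z. ?k * (h z * cnj z ^ m * of_real (\<psi> R (cmod z))))"
          by (auto simp: F_def power_mult_distrib)
        have "integrable lborel (F m)" unfolding Fe using i1 by (rule integrable_mult_right)
        then have "(F m has_integral (LINT z|lborel. F m z)) UNIV" by (rule has_integral_integral_lborel)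
        also have "(LINT z|lborel. F m z) = \<rho> R m * b m"
          unfolding Fe integral_mult_right_zero e by (simp add: \<rho>_def)
        finally have "(F m has_integral \<rho> R m * b m) UNIV" .
        moreover have "F m z = 0" if "z \<notin> cbox u v" for z
          using disc[of z] that by (auto simp: F_def \<psi>_def indicator_def)
        ultimately show ?thesis by (rule has_integral_UNIV_vanishing_outside)
      qed
      have c_int: "(c has_integral (LINT z|lborel. c z)) (cbox u v)" "(LINT z|lborel. c z) \<le> s * C * M * nrm (F_space 1 l (2 * \<alpha>)) h"
      proof -
        have i: "integrable lborel (\<lambda>z. indicator {..real R} (cmod z) * weighted l (2 * \<alpha>) h z)"
          by (rule Bochner_Integration.integrable_bound[OF hint]) (auto intro!: AE_I2 simp: indicator_def)
        then have "integrable lborel c" unfolding c_def[abs_def] by (rule integrable_mult_right)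
        then have "(c has_integral (LINT z|lborel. c z)) UNIV" by (rule has_integral_integral_lborel)
        moreover have "c z = 0" if "z \<notin> cbox u v" for z
          using disc[of z] that by (auto simp: c_def indicator_def)
        ultimately show "(c has_integral (LINT z|lborel. c z)) (cbox u v)"
          by (rule has_integral_UNIV_vanishing_outside)
        have "(LINT z|lborel. indicator {..real R} (cmod z) * weighted l (2 * \<alpha>) h z) \<le> (LINT z|lborel. weighted l (2 * \<alpha>) h z)"
          by (intro integral_mono i hint) (auto simp: indicator_def)
        then show "(LINT z|lborel. c z) \<le> s * C * M * nrm (F_space 1 l (2 * \<alpha>)) h"
          unfolding c_def nrmh integral_mult_right_zero using s C(1) M0 by (intro mult_left_mono) auto
      qed
      obtain H where H: "\<And>z. z \<in> cbox u v \<Longrightarrow> cmod (h z) \<le> H"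
      proof -
        have "compact (h ` cbox u v)"
          by (intro compact_continuous_image continuous_on_subset[OF entire_continuous[OF h_ent]]) auto
        then have "bounded (h ` cbox u v)" by (rule compact_imp_bounded)
        then show ?thesis using that unfolding bounded_iff by blast
      qed
      let ?z0 = "of_real (s * real R) :: complex"
      let ?B = "\<lambda>m. (s * \<bar>H\<bar>) * cmod (cnj ?z0 ^ m / of_real (power_moment l \<alpha> m))"
      have "N (hR R) \<le> integral (cbox u v) c"
      proof (rule controlled_integral[where F = F and f = f and B = ?B, OF N])
        show "F m integrable_on cbox u v" for m using F_int by (rule has_integral_integrable)
        show "c integrable_on cbox u v" using c_int(1) by (rule has_integral_integrable)
        show "cmod (F m z) \<le> ?B m" if z: "z \<in> cbox u v" for m z
        proof (cases "cmod z \<le> real R")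
          case True
          have k: "power_moment l \<alpha> m > 0" by (rule power_moment_pos[OF l \<alpha>])
          have "\<psi> R (cmod z) \<le> 1" using \<alpha> by (auto simp: \<psi>_def indicator_def)
          then have hb': "cmod (h z) * \<psi> R (cmod z) \<le> \<bar>H\<bar> * 1"
            using H[OF z] psi_le(2)[of R z] by (intro mult_mono) auto
          have "s * (cmod (h z) * \<psi> R (cmod z)) * ((s * cmod z) ^ m / power_moment l \<alpha> m)
             \<le> s * (\<bar>H\<bar> * 1) * ((s * real R) ^ m / power_moment l \<alpha> m)"
          proof (rule mult_mono)
            show "s * (cmod (h z) * \<psi> R (cmod z)) \<le> s * (\<bar>H\<bar> * 1)"
              using s by (intro mult_left_mono hb') auto
            show "(s * cmod z) ^ m / power_moment l \<alpha> m \<le> (s * real R) ^ m / power_moment l \<alpha> m"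
              using s k True by (intro divide_right_mono power_mono mult_left_mono) auto
          qed (use s k in auto)
          then show ?thesis using s k psi_le(2)[of R z]
            by (simp add: F_def norm_mult norm_divide norm_power)
        next
          case False
          then show ?thesis using s by (simp add: F_def \<psi>_def)
        qed
        show "summable (\<lambda>m. ?B m * monomial_cost m)"
          using summable_mult[OF monomial_cost_summable[OF kernel_at_in_E_class[OF l \<alpha>] kernel_at_power_sum[OF l \<alpha>]], of "s * \<bar>H\<bar>" ?z0]
          by (simp only: mult.assoc)
        show "f z \<in> E_class l" for z unfolding f_def[abs_def] by (intro E_class_cmult kernel_at_in_E_class l \<alpha>)
        show "power_sum (\<lambda>m. F m z) (f z)" for z
          using kernel_at_power_sum[OF l \<alpha>, of "of_real s * z"]
          unfolding power_sum_def F_def f_def mult.assoc by (auto intro!: sums_mult simp only:)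
        show "N (f z) \<le> c z" for z
        proof -
          let ?y = "of_real s * (h z * of_real (\<psi> R (cmod z)))"
          have "N (f z) \<le> cmod ?y * N (kernel_at l \<alpha> (of_real s * z))"
            unfolding f_def[abs_def] by (rule controlled_cmult[OF N kernel_at_in_E_class[OF l \<alpha>]])
          also have "\<dots> \<le> cmod ?y * (C * M * exp (\<alpha> / 4 * cmod (of_real s * z) ^ (2 * l)))"
            by (intro mult_left_mono C(2)[OF N]) auto
          also have "\<alpha> / 4 * cmod (of_real s * z) ^ (2 * l) = \<alpha> * cmod z ^ (2 * l)"
          proof -
            have "s ^ (2 * l) = 4" using sl by (simp add: mult.commute[of 2] power_mult)
            then show ?thesis using s by (simp add: norm_mult power_mult_distrib)
          qed
          also have "cmod ?y * (C * M * exp (\<alpha> * cmod z ^ (2 * l))) = c z"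
          proof -
            have "\<psi> R (cmod z) * exp (\<alpha> * cmod z ^ (2 * l)) = indicator {..real R} (cmod z) * exp (- (2 * \<alpha>) * cmod z ^ (2 * l) / 2)"
              by (simp add: \<psi>_def exp_add[symmetric] indicator_def)
            then have "s * (cmod (h z) * \<psi> R (cmod z)) * (C * M * exp (\<alpha> * cmod z ^ (2 * l)))
              = s * C * M * (cmod (h z) * (indicator {..real R} (cmod z) * exp (- (2 * \<alpha>) * cmod z ^ (2 * l) / 2)))"
              unfolding \<open>\<psi> R (cmod z) * exp (\<alpha> * cmod z ^ (2 * l)) = indicator {..real R} (cmod z) * exp (- (2 * \<alpha>) * cmod z ^ (2 * l) / 2)\<close>[symmetric]
              by (simp only: mult_ac)
            then show ?thesis using s psi_le(2)[of R z] by (simp add: c_def weighted_def norm_mult mult_ac)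
          qed
          finally show ?thesis .
        qed
        show "hR R \<in> E_class l" by (rule hRE)
        show "power_sum (\<lambda>m. integral (cbox u v) (F m)) (hR R)"
          using hRb unfolding integral_unique[OF F_int] .
      qed
      also have "integral (cbox u v) c = (LINT z|lborel. c z)" by (rule integral_unique[OF c_int(1)])
      finally show ?thesis using c_int(2) by linarith
    qed
    have bound: "N h \<le> s * C * M * nrm (F_space 1 l (2 * \<alpha>)) h + (\<Sum>m<n. cmod (1 - \<rho> R m) * (cmod (a m) * (M * monomial_cost m)))" for R
    proof -
      let ?p = "\<lambda>m w. ((1 - \<rho> R m) * a m) * w ^ m"
      have s1: "(\<lambda>w. \<Sum>m<n. ?p m w) \<in> E_class l \<and> N (\<lambda>w. \<Sum>m<n. ?p m w) \<le> (\<Sum>m<n. N (?p m))"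
        by (rule controlled_sum[OF N]) (use monomial_in_E_class[OF l] in auto)
      have "h w = hR R w + (\<Sum>m<n. ?p m w)" for w
        by (simp add: h_def hR_def sum.distrib[symmetric] algebra_simps)
      then have "h = (\<lambda>w. hR R w + (\<Sum>m<n. ?p m w))" by (rule ext)
      then have "N h \<le> N (hR R) + N (\<lambda>w. \<Sum>m<n. ?p m w)"
        using controlled_add[OF N hRE, of "\<lambda>w. \<Sum>m<n. ?p m w" R] s1 by simp
      also have "\<dots> \<le> s * C * M * nrm (F_space 1 l (2 * \<alpha>)) h + (\<Sum>m<n. N (?p m))"
        using NhR s1 by (intro add_mono) auto
      also have "(\<Sum>m<n. N (?p m)) \<le> (\<Sum>m<n. cmod (1 - \<rho> R m) * (cmod (a m) * (M * monomial_cost m)))"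
        by (intro sum_mono order_trans[OF monomial_norm_controlled[OF N]]) (simp add: norm_mult mult.assoc)
      finally show ?thesis by simp
    qed
    have "(\<lambda>R. s * C * M * nrm (F_space 1 l (2 * \<alpha>)) h + (\<Sum>m<n. cmod (1 - \<rho> R m) * (cmod (a m) * (M * monomial_cost m))))
      \<longlonglongrightarrow> s * C * M * nrm (F_space 1 l (2 * \<alpha>)) h + (\<Sum>m<n. cmod (complex_of_real (1 - 1)) * (cmod (a m) * (M * monomial_cost m)))"
      by (intro tendsto_intros rho_lim)
    then have "N h \<le> s * C * M * nrm (F_space 1 l (2 * \<alpha>)) h + (\<Sum>m<n. cmod (complex_of_real (1 - 1)) * (cmod (a m) * (M * monomial_cost m)))"
      by (rule LIMSEQ_le_const) (use bound in blast)
    then show ?thesis by (simp add: h_def)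
  qed
  then show ?thesis using s C(1) by (intro exI[of _ "s * C"]) auto
qed

end

section \<open>Density of polynomials\<close>

lemma F_one_add:
  assumes f: "f \<in> elts (F_space 1 l \<beta>)" and g: "g \<in> elts (F_space 1 l \<beta>)"
  shows "(\<lambda>z. f z + g z) \<in> elts (F_space 1 l \<beta>)"
    and "nrm (F_space 1 l \<beta>) (\<lambda>z. f z + g z) \<le> nrm (F_space 1 l \<beta>) f + nrm (F_space 1 l \<beta>) g"
proof -
  have e: "f \<in> entire" "g \<in> entire" and i: "integrable lborel (weighted l \<beta> f)" "integrable lborel (weighted l \<beta> g)"
    using f g by (auto simp: F_one_elts)
  have ent: "(\<lambda>z. f z + g z) \<in> entire" using e by (auto simp: entire_def intro: holomorphic_intros)
  have [measurable]: "(\<lambda>z. f z + g z) \<in> borel_measurable borel" by (rule entire_measurable[OF ent])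
  have le: "weighted l \<beta> (\<lambda>z. f z + g z) z \<le> weighted l \<beta> f z + weighted l \<beta> g z" for z
    unfolding weighted_def distrib_right[symmetric] by (intro mult_right_mono norm_triangle_ineq) simp
  have iS: "integrable lborel (\<lambda>z. weighted l \<beta> f z + weighted l \<beta> g z)"
    using i by (rule Bochner_Integration.integrable_add)
  have ii: "integrable lborel (weighted l \<beta> (\<lambda>z. f z + g z))"
    by (rule Bochner_Integration.integrable_bound[OF iS])
      (use le in \<open>auto intro!: AE_I2 order_trans[OF _ abs_ge_self]\<close>)
  then show "(\<lambda>z. f z + g z) \<in> elts (F_space 1 l \<beta>)" using ent by (simp add: F_one_elts)
  have "(LINT z|lborel. weighted l \<beta> (\<lambda>z. f z + g z) z) \<le> (LINT z|lborel. weighted l \<beta> f z + weighted l \<beta> g z)"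
    by (intro integral_mono ii iS le)
  then show "nrm (F_space 1 l \<beta>) (\<lambda>z. f z + g z) \<le> nrm (F_space 1 l \<beta>) f + nrm (F_space 1 l \<beta>) g"
    using i by (simp add: F_one_nrm e ent)
qed

lemma F_one_cmult:
  assumes f: "f \<in> elts (F_space 1 l \<beta>)"
  shows "(\<lambda>z. c * f z) \<in> elts (F_space 1 l \<beta>)"
    and "nrm (F_space 1 l \<beta>) (\<lambda>z. c * f z) = cmod c * nrm (F_space 1 l \<beta>) f"
  using F_space_cmult[of 1 f l \<beta> c] f by (auto simp: one_ereal_def[symmetric])

lemma F_one_diff:
  assumes f: "f \<in> elts (F_space 1 l \<beta>)" and g: "g \<in> elts (F_space 1 l \<beta>)"
  shows "(\<lambda>z. f z - g z) \<in> elts (F_space 1 l \<beta>)"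
    and "nrm (F_space 1 l \<beta>) (\<lambda>z. f z - g z) \<le> nrm (F_space 1 l \<beta>) f + nrm (F_space 1 l \<beta>) g"
  using F_one_add[OF f F_one_cmult(1)[OF g, of "-1"]] F_one_cmult(2)[OF g, of "-1"] by auto

lemma F_one_nrm_nonneg: "f \<in> elts (F_space 1 l \<beta>) \<Longrightarrow> nrm (F_space 1 l \<beta>) f \<ge> 0"
  by (auto simp: F_one_elts F_one_nrm)

lemma E_class_subset_F_one: "l \<ge> 1 \<Longrightarrow> \<beta> > 0 \<Longrightarrow> E_class l \<subseteq> elts (F_space 1 l \<beta>)"
  using E_class_subset_F_space[of l \<beta> 1] by (simp add: one_ereal_def[symmetric])

lemma monomial_in_F_one: "l \<ge> 1 \<Longrightarrow> \<beta> > 0 \<Longrightarrow> (\<lambda>z. c * z ^ m) \<in> elts (F_space 1 l \<beta>)"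
  using E_class_subset_F_one monomial_in_E_class by blast

lemma F_one_series:
  assumes l: "l \<ge> 1" and b: "\<beta> > 0" and c: "power_sum c g"
    and s: "summable (\<lambda>m. cmod (c m) * nrm (F_space 1 l \<beta>) (\<lambda>z. z ^ m))"
  shows "g \<in> elts (F_space 1 l \<beta>)"
    and "nrm (F_space 1 l \<beta>) g \<le> (\<Sum>m. cmod (c m) * nrm (F_space 1 l \<beta>) (\<lambda>z. z ^ m))"
proof -
  have g: "g \<in> entire" by (rule power_sum_entire[OF c])
  have [measurable]: "g \<in> borel_measurable borel" by (rule entire_measurable[OF g])
  let ?f = "\<lambda>m z. cmod (c m) * weighted l \<beta> (\<lambda>z. z ^ m) z"
  have mon: "(\<lambda>z. z ^ m) \<in> elts (F_space 1 l \<beta>)" for m using monomial_in_F_one[OF l b, of 1 m] by simp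
  have i: "integrable lborel (?f m)" for m
    using mon by (intro integrable_mult_right) (simp add: F_one_elts)
  have If: "(LINT z|lborel. ?f m z) = cmod (c m) * nrm (F_space 1 l \<beta>) (\<lambda>z. z ^ m)" for m
    using mon by (simp add: F_one_elts F_one_nrm)
  have fz: "?f m z = cmod (c m) * cmod z ^ m * exp (- \<beta> * cmod z ^ (2 * l) / 2)" for m z
    by (simp add: weighted_def norm_power)
  have s1: "summable (\<lambda>m. ?f m z)" for z
    unfolding fz by (intro summable_mult2 power_sum_summable_norm[OF c])
  have s1': "AE z in lborel. summable (\<lambda>m. norm (?f m z))" using s1 by simp
  have s2: "summable (\<lambda>m. LINT z|lborel. norm (?f m z))"
  proof -
    have "norm (?f m z) = ?f m z" for m z by simp
    then show ?thesis using s by (simp only: If)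
  qed
  have le: "weighted l \<beta> g z \<le> (\<Sum>m. ?f m z)" for z
  proof -
    have sn: "summable (\<lambda>m. norm (c m * z ^ m))"
      using power_sum_summable_norm[OF c, of "cmod z"] by (simp add: norm_mult norm_power)
    have "g z = (\<Sum>m. c m * z ^ m)" using c by (simp add: power_sum_def sums_iff)
    then have "cmod (g z) \<le> (\<Sum>m. norm (c m * z ^ m))" using summable_norm[OF sn] by simp
    then have "weighted l \<beta> g z \<le> (\<Sum>m. norm (c m * z ^ m)) * exp (- \<beta> * cmod z ^ (2 * l) / 2)"
      unfolding weighted_def by (intro mult_right_mono) auto
    also have "\<dots> = (\<Sum>m. norm (c m * z ^ m) * exp (- \<beta> * cmod z ^ (2 * l) / 2))"
      by (rule suminf_mult2[OF sn])
    also have "\<dots> = (\<Sum>m. ?f m z)" unfolding fz by (simp add: norm_mult norm_power)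
    finally show ?thesis .
  qed
  have iS: "integrable lborel (\<lambda>z. \<Sum>m. ?f m z)" by (rule integrable_suminf[OF i s1' s2])
  have ig: "integrable lborel (weighted l \<beta> g)"
    by (rule Bochner_Integration.integrable_bound[OF iS])
      (use le in \<open>auto intro!: AE_I2 order_trans[OF _ abs_ge_self]\<close>)
  then show "g \<in> elts (F_space 1 l \<beta>)" using g by (simp add: F_one_elts)
  have "nrm (F_space 1 l \<beta>) g = (LINT z|lborel. weighted l \<beta> g z)" by (rule F_one_nrm[OF g])
  also have "\<dots> \<le> (LINT z|lborel. (\<Sum>m. ?f m z))" by (intro integral_mono ig iS le)
  also have "\<dots> = (\<Sum>m. LINT z|lborel. ?f m z)" by (rule integral_suminf[OF i s1' s2])
  finally show "nrm (F_space 1 l \<beta>) g \<le> (\<Sum>m. cmod (c m) * nrm (F_space 1 l \<beta>) (\<lambda>z. z ^ m))"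
    unfolding If .
qed

lemma power_sum_tail:
  assumes "power_sum c g"
  shows "power_sum (\<lambda>m. if m < n then 0 else c m) (\<lambda>z. g z - (\<Sum>m<n. c m * z ^ m))"
  unfolding power_sum_def
proof
  fix z
  have "(\<lambda>m. c m * z ^ m - (if m \<in> {..<n} then c m * z ^ m else 0)) sums (g z - (\<Sum>m<n. c m * z ^ m))"
    by (intro sums_diff sums_If_finite_set) (use assms in \<open>auto simp: power_sum_def\<close>)
  also have "(\<lambda>m. c m * z ^ m - (if m \<in> {..<n} then c m * z ^ m else 0)) = (\<lambda>m. (if m < n then 0 else c m) * z ^ m)"
    by auto
  finally show "(\<lambda>m. (if m < n then 0 else c m) * z ^ m) sums (g z - (\<Sum>m<n. c m * z ^ m))" .
qed

lemma F_one_partial_sums_converge: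
  assumes l: "l \<ge> 1" and b: "\<beta> > 0" and c: "power_sum c g"
    and s: "summable (\<lambda>m. cmod (c m) * nrm (F_space 1 l \<beta>) (\<lambda>z. z ^ m))"
  shows "(\<lambda>n. nrm (F_space 1 l \<beta>) (\<lambda>z. g z - (\<Sum>m<n. c m * z ^ m))) \<longlonglongrightarrow> 0"
proof (rule tendsto_sandwich[OF _ _ tendsto_const])
  let ?w = "\<lambda>m. nrm (F_space 1 l \<beta>) (\<lambda>z. z ^ m)"
  let ?c = "\<lambda>n m. if m < n then 0 else c m"
  have w0: "?w m \<ge> 0" for m
    using F_one_nrm_nonneg monomial_in_F_one[OF l b, of 1 m] by simp
  have sn: "summable (\<lambda>m. cmod (?c n m) * ?w m)" for n
    by (rule summable_comparison_test'[OF s, of 0]) (use w0 in auto)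
  note T = F_one_series[OF l b power_sum_tail[OF c] sn]
  show "\<forall>\<^sub>F n in sequentially. 0 \<le> nrm (F_space 1 l \<beta>) (\<lambda>z. g z - (\<Sum>m<n. c m * z ^ m))"
    by (intro always_eventually allI F_one_nrm_nonneg T(1))
  have "(\<Sum>m. cmod (?c n m) * ?w m) = (\<Sum>m. cmod (c (m + n)) * ?w (m + n))" for n
    using suminf_split_initial_segment[OF sn, of n n] by simp
  then have "nrm (F_space 1 l \<beta>) (\<lambda>z. g z - (\<Sum>m<n. c m * z ^ m)) \<le> (\<Sum>m. cmod (c (m + n)) * ?w (m + n))" for n
    using T(2)[of n] by (simp only:)
  then show "\<forall>\<^sub>F n in sequentially. nrm (F_space 1 l \<beta>) (\<lambda>z. g z - (\<Sum>m<n. c m * z ^ m)) \<le> (\<Sum>m. cmod (c (m + n)) * ?w (m + n))"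
    by (intro always_eventually allI)
  show "(\<lambda>n. \<Sum>m. cmod (c (m + n)) * ?w (m + n)) \<longlonglongrightarrow> 0"
    using suminf_exist_split2[OF s] by simp
qed

text \<open>Integrate against \<open>cnj z ^ m\<close> with the radial weight \<open>\<psi>\<close> for which
\<open>cmod z ^ m * \<psi> (cmod z)\<close> is the weight of the norm.\<close>
lemma F_one_coefficient:
  assumes l: "l \<ge> 1" and b: "\<beta> > 0" and f: "f \<in> elts (F_space 1 l \<beta>)" and a: "power_sum a f"
  shows "cmod (a m) * nrm (F_space 1 l \<beta>) (\<lambda>z. z ^ m) \<le> nrm (F_space 1 l \<beta>) f"
proof -
  have e: "f \<in> entire" and fi: "integrable lborel (weighted l \<beta> f)" using f by (auto simp: F_one_elts)
  have [measurable]: "f \<in> borel_measurable borel" by (rule entire_measurable[OF e])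
  define \<psi> where "\<psi> r = exp (- (\<beta> / 2) * r ^ (2 * l)) / r ^ m" for r :: real
  have [measurable]: "\<psi> \<in> borel_measurable borel" unfolding \<psi>_def by measurable
  have psi0: "\<psi> r \<ge> 0" if "r \<ge> 0" for r using that by (simp add: \<psi>_def)
  have b2: "\<beta> / 2 > 0" using b by simp
  have psi1: "cmod z ^ m * \<psi> (cmod z) \<le> exp (- (\<beta> / 2) * cmod z ^ (2 * l))" for z
    by (cases "z = 0") (auto simp: \<psi>_def power_0_left)
  have psi2: "cmod z ^ (2 * m) * \<psi> (cmod z) = cmod z ^ m * exp (- (\<beta> / 2) * cmod z ^ (2 * l))" for z
    by (cases "z = 0") (auto simp: \<psi>_def power_0_left mult_2 power_add)
  have nb: "norm (f z * cnj z ^ m * of_real (\<psi> (cmod z))) \<le> weighted l \<beta> f z" for z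
  proof -
    have "norm (f z * cnj z ^ m * of_real (\<psi> (cmod z))) = cmod (f z) * (cmod z ^ m * \<psi> (cmod z))"
      using psi0[of "cmod z"] by (simp add: norm_mult norm_power)
    also have "\<dots> \<le> cmod (f z) * exp (- (\<beta> / 2) * cmod z ^ (2 * l))"
      by (intro mult_left_mono psi1) auto
    finally show ?thesis by (simp add: weighted_def)
  qed
  have i1: "integrable lborel (\<lambda>z. f z * cnj z ^ m * of_real (\<psi> (cmod z)))"
    by (rule Bochner_Integration.integrable_bound[OF fi])
      (use nb in \<open>auto intro!: AE_I2 order_trans[OF _ abs_ge_self]\<close>)
  have i2: "integrable lborel (\<lambda>z. cmod z ^ m * \<psi> (cmod z))"
  proof (rule Bochner_Integration.integrable_bound[OF integrable_norm_exp[OF l b2]])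
    show "AE z in lborel. norm (cmod z ^ m * \<psi> (cmod z)) \<le> norm (exp (- (\<beta> / 2) * cmod z ^ (2 * l)))"
      using psi1 psi0 by (intro AE_I2) (simp add: abs_mult)
  qed measurable
  have i3: "integrable lborel (\<lambda>z. cmod z ^ (2 * m) * \<psi> (cmod z))"
    unfolding psi2 by (rule integrable_norm_power_exp[OF l b2])
  have "(LINT z|lborel. f z * cnj z ^ m * of_real (\<psi> (cmod z))) = a m * of_real (LINT z|lborel. cmod z ^ (2 * m) * \<psi> (cmod z))"
    by (rule radial_integral_extracts_coefficient[OF a _ i1 i2 i3]) measurable
  also have "(LINT z|lborel. cmod z ^ (2 * m) * \<psi> (cmod z)) = nrm (F_space 1 l \<beta>) (\<lambda>z. z ^ m)"
  proof -
    have "(\<lambda>z. z ^ m) \<in> entire" by (auto simp: entire_def intro!: holomorphic_intros)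
    then show ?thesis unfolding psi2 by (simp add: F_one_nrm weighted_def norm_power)
  qed
  finally have "cmod (a m) * \<bar>nrm (F_space 1 l \<beta>) (\<lambda>z. z ^ m)\<bar> = norm (LINT z|lborel. f z * cnj z ^ m * of_real (\<psi> (cmod z)))"
    by (simp add: norm_mult)
  also have "\<dots> \<le> (LINT z|lborel. weighted l \<beta> f z)"
    by (rule Bochner_Integration.integral_norm_bound_integral[OF i1 fi]) (use nb in auto)
  also have "\<dots> = nrm (F_space 1 l \<beta>) f" by (rule F_one_nrm[OF e, symmetric])
  finally show ?thesis by (meson abs_ge_self mult_left_mono norm_ge_zero order_trans)
qed

text \<open>The dilations \<open>r\<^sup>2 * f (r * z)\<close> with \<open>r < 1\<close> converge to \<open>f\<close>
in norm by Scheffe's lemma, and their Taylor series converge absolutely in norm. The factor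
\<open>r\<^sup>2\<close> compensates the change of variables, so that the norm does not exceed that of
\<open>f\<close>.\<close>
lemma polynomials_dense_F_one:
  assumes l: "l \<ge> 1" and b: "\<beta> > 0" and f: "f \<in> elts (F_space 1 l \<beta>)" and e: "e > 0"
  shows "\<exists>n a. nrm (F_space 1 l \<beta>) (\<lambda>z. f z - (\<Sum>m<n. a m * z ^ m)) < e"
proof -
  have fe: "f \<in> entire" and fi: "integrable lborel (weighted l \<beta> f)" using f by (auto simp: F_one_elts)
  have [measurable]: "f \<in> borel_measurable borel" by (rule entire_measurable[OF fe])
  have fa: "power_sum (taylor f) f" by (rule entire_power_sum[OF fe])
  define r where "r n = 1 - inverse (real (Suc n) + 1)" for n
  have r: "0 < r n" "r n < 1" for n by (auto simp: r_def field_simps)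
  have rlim: "r \<longlonglongrightarrow> 1"
  proof -
    have "(\<lambda>n. 1 - inverse (real (Suc (Suc n)))) \<longlonglongrightarrow> 1 - 0"
      by (intro tendsto_diff tendsto_const LIMSEQ_Suc[OF LIMSEQ_inverse_real_of_nat])
    moreover have "r = (\<lambda>n. 1 - inverse (real (Suc (Suc n))))" by (auto simp: r_def)
    ultimately show ?thesis by (simp only: diff_zero)
  qed
  let ?g = "\<lambda>n z. of_real ((r n)\<^sup>2) * f (of_real (r n) * z)"
  let ?e = "\<lambda>z. complex_of_real (exp (- \<beta> * cmod z ^ (2 * l) / 2))"
  have em [measurable]: "?e \<in> borel_measurable borel"
    by (intro borel_measurable_continuous_onI continuous_intros) auto
  have nw: "norm (h z * ?e z) = weighted l \<beta> h z" for h z by (simp add: weighted_def norm_mult)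
  have gbound: "integrable lborel (weighted l \<beta> (?g n)) \<and> (LINT z|lborel. weighted l \<beta> (?g n) z) \<le> (LINT z|lborel. weighted l \<beta> f z)" for n
  proof -
    define h where "h z = (r n)\<^sup>2 * (cmod (f z) * exp (- \<beta> * (cmod z / r n) ^ (2 * l) / 2))" for z
    have [measurable]: "h \<in> borel_measurable borel"
    proof -
      have [measurable]: "(\<lambda>z::complex. exp (- \<beta> * (cmod z / r n) ^ (2 * l) / 2)) \<in> borel_measurable borel"
        using r(1)[of n] by (intro borel_measurable_continuous_onI continuous_intros) auto
      show ?thesis unfolding h_def[abs_def] by measurable
    qed
    have hle: "h z \<le> (r n)\<^sup>2 * weighted l \<beta> f z" "h z \<ge> 0" for z
    proof -
      have "cmod z * r n \<le> cmod z * 1" using r[of n] by (intro mult_left_mono) auto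
      then have "cmod z \<le> cmod z / r n" using r[of n] by (simp add: pos_le_divide_eq)
      then have "cmod z ^ (2 * l) \<le> (cmod z / r n) ^ (2 * l)" by (intro power_mono) auto
      then have "exp (- \<beta> * (cmod z / r n) ^ (2 * l) / 2) \<le> exp (- \<beta> * cmod z ^ (2 * l) / 2)"
        using b by simp
      then show "h z \<le> (r n)\<^sup>2 * weighted l \<beta> f z"
        unfolding h_def weighted_def by (intro mult_left_mono) auto
      show "h z \<ge> 0" by (simp add: h_def)
    qed
    have hi: "integrable lborel h"
      by (rule Bochner_Integration.integrable_bound[OF integrable_mult_right[OF fi, of "(r n)\<^sup>2"]])
        (use hle in \<open>auto intro!: AE_I2 order_trans[OF _ abs_ge_self]\<close>)
    have hg: "h (of_real (r n) * z) = weighted l \<beta> (?g n) z" for z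
      using r[of n] by (simp add: h_def weighted_def norm_mult norm_power)
    have "integrable lborel (\<lambda>z. h (of_real (r n) * z))" using hi by (subst integrable_dilate[OF r(1)]) auto
    then have 1: "integrable lborel (weighted l \<beta> (?g n))" unfolding hg .
    have "(LINT z|lborel. weighted l \<beta> (?g n) z) = (1 / (r n)\<^sup>2) * (LINT z|lborel. h z)"
      using integral_dilate[OF r(1), of h n] by (simp add: hg)
    also have "\<dots> \<le> (1 / (r n)\<^sup>2) * (LINT z|lborel. (r n)\<^sup>2 * weighted l \<beta> f z)"
      by (intro mult_left_mono integral_mono hi integrable_mult_right fi hle) auto
    also have "\<dots> = (LINT z|lborel. weighted l \<beta> f z)" using r(1)[of n] by simp
    finally show ?thesis using 1 by simp
  qed
  have gent: "?g n \<in> entire" for n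
  proof -
    have "(\<lambda>z. f (of_real (r n) * z)) holomorphic_on UNIV"
    proof -
      have "(\<lambda>z. complex_of_real (r n) * z) holomorphic_on UNIV" by (intro holomorphic_intros)
      then show ?thesis
        using holomorphic_on_compose_gen[of "\<lambda>z. of_real (r n) * z" UNIV f UNIV] fe
        by (simp add: entire_def o_def)
    qed
    then show ?thesis by (auto simp: entire_def intro!: holomorphic_intros)
  qed
  have gF: "?g n \<in> elts (F_space 1 l \<beta>)" for n using gent gbound[of n] by (simp add: F_one_elts)
  have conv: "(\<lambda>n. \<integral>\<^sup>+z. norm (?g n z * ?e z - f z * ?e z) \<partial>lborel) \<longlonglongrightarrow> 0"
  proof (rule Scheffe_lemma2)
    show "(\<lambda>z. ?g n z * ?e z) \<in> borel_measurable lborel" for n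
    proof -
      have [measurable]: "?g n \<in> borel_measurable borel" by (rule entire_measurable[OF gent])
      show ?thesis by measurable
    qed
    show "integrable lborel (\<lambda>z. f z * ?e z)"
    proof (rule Bochner_Integration.integrable_bound[OF fi])
      show "AE z in lborel. norm (f z * ?e z) \<le> norm (weighted l \<beta> f z)"
        unfolding nw by (intro AE_I2) simp
    qed measurable
    show "AE z in lborel. (\<lambda>n. ?g n z * ?e z) \<longlonglongrightarrow> f z * ?e z"
    proof (rule AE_I2)
      fix z :: complex
      have "(\<lambda>n. of_real (r n) * z) \<longlonglongrightarrow> of_real 1 * z" by (intro tendsto_intros rlim)
      moreover have "isCont f z" using entire_continuous[OF fe] by (simp add: continuous_on_eq_continuous_at)
      ultimately have "(\<lambda>n. f (of_real (r n) * z)) \<longlonglongrightarrow> f z"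
        using isCont_tendsto_compose[of z f "\<lambda>n. of_real (r n) * z" sequentially] by simp
      then have "(\<lambda>n. ?g n z * ?e z) \<longlonglongrightarrow> of_real (1\<^sup>2) * f z * ?e z"
        by (intro tendsto_intros rlim)
      then show "(\<lambda>n. ?g n z * ?e z) \<longlonglongrightarrow> f z * ?e z" by simp
    qed
    show "(\<integral>\<^sup>+z. norm (?g n z * ?e z) \<partial>lborel) \<le> (\<integral>\<^sup>+z. norm (f z * ?e z) \<partial>lborel)" for n
    proof -
      have "(\<integral>\<^sup>+z. norm (?g n z * ?e z) \<partial>lborel) = ennreal (LINT z|lborel. weighted l \<beta> (?g n) z)"
        unfolding nw[of "?g n"] using gbound[of n] by (intro nn_integral_eq_integral) simp_all
      moreover have "(\<integral>\<^sup>+z. norm (f z * ?e z) \<partial>lborel) = ennreal (LINT z|lborel. weighted l \<beta> f z)"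
        unfolding nw[of f] using fi by (intro nn_integral_eq_integral) simp_all
      ultimately show ?thesis using gbound[of n] by (simp only: ennreal_leI)
    qed
  qed
  have "(\<lambda>n. nrm (F_space 1 l \<beta>) (\<lambda>z. ?g n z - f z)) \<longlonglongrightarrow> 0"
  proof -
    have "(\<integral>\<^sup>+z. norm (?g n z * ?e z - f z * ?e z) \<partial>lborel) = ennreal (nrm (F_space 1 l \<beta>) (\<lambda>z. ?g n z - f z))" for n
    proof -
      have d: "(\<lambda>z. ?g n z - f z) \<in> elts (F_space 1 l \<beta>)" by (rule F_one_diff(1)[OF gF f])
      have "(\<integral>\<^sup>+z. norm (?g n z * ?e z - f z * ?e z) \<partial>lborel) = (\<integral>\<^sup>+z. weighted l \<beta> (\<lambda>z. ?g n z - f z) z \<partial>lborel)"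
        unfolding left_diff_distrib[symmetric] nw[of "\<lambda>z. ?g n z - f z"] ..
      also have "\<dots> = ennreal (LINT z|lborel. weighted l \<beta> (\<lambda>z. ?g n z - f z) z)"
        using d by (intro nn_integral_eq_integral) (auto simp: F_one_elts)
      finally show ?thesis using d by (simp add: F_one_elts F_one_nrm)
    qed
    then have "(\<lambda>n. ennreal (nrm (F_space 1 l \<beta>) (\<lambda>z. ?g n z - f z))) \<longlonglongrightarrow> ennreal 0" using conv by simp
    then show ?thesis
      by (subst (asm) tendsto_ennreal_iff) (simp_all only: F_one_nrm_nonneg[OF F_one_diff(1)[OF gF f]] always_eventually order_refl simp_thms)
  qed
  then have "eventually (\<lambda>n. nrm (F_space 1 l \<beta>) (\<lambda>z. ?g n z - f z) < e / 2) sequentially"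
    using e by (intro order_tendstoD(2)) auto
  then obtain n where n: "nrm (F_space 1 l \<beta>) (\<lambda>z. ?g n z - f z) < e / 2"
    using eventually_happens'[OF sequentially_bot] by blast
  define c where "c m = of_real ((r n)\<^sup>2 * r n ^ m) * taylor f m" for m
  have c: "power_sum c (?g n)"
    unfolding power_sum_def
  proof
    fix z
    have "(\<lambda>m. of_real ((r n)\<^sup>2) * (taylor f m * (of_real (r n) * z) ^ m)) sums ?g n z"
      by (intro sums_mult) (use fa in \<open>simp add: power_sum_def\<close>)
    then show "(\<lambda>m. c m * z ^ m) sums ?g n z" by (simp add: c_def power_mult_distrib mult_ac)
  qed
  have w0: "nrm (F_space 1 l \<beta>) (\<lambda>z. z ^ m) \<ge> 0" for m
    using F_one_nrm_nonneg monomial_in_F_one[OF l b, of 1 m] by simp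
  have "summable (\<lambda>m. cmod (c m) * nrm (F_space 1 l \<beta>) (\<lambda>z. z ^ m))"
  proof (rule summable_comparison_test'[of "\<lambda>m. (r n)\<^sup>2 * nrm (F_space 1 l \<beta>) f * r n ^ m" 0])
    show "summable (\<lambda>m. (r n)\<^sup>2 * nrm (F_space 1 l \<beta>) f * r n ^ m)"
      using r[of n] by (intro summable_mult summable_geometric) auto
    fix m
    have "(r n)\<^sup>2 * r n ^ m * (cmod (taylor f m) * nrm (F_space 1 l \<beta>) (\<lambda>z. z ^ m)) \<le> (r n)\<^sup>2 * r n ^ m * nrm (F_space 1 l \<beta>) f"
      using r[of n] by (intro mult_left_mono F_one_coefficient[OF l b f fa]) auto
    moreover have "norm (cmod (c m) * nrm (F_space 1 l \<beta>) (\<lambda>z. z ^ m)) = (r n)\<^sup>2 * r n ^ m * (cmod (taylor f m) * nrm (F_space 1 l \<beta>) (\<lambda>z. z ^ m))"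
      using r[of n] w0[of m] by (simp add: c_def norm_mult norm_power mult.assoc)
    ultimately show "norm (cmod (c m) * nrm (F_space 1 l \<beta>) (\<lambda>z. z ^ m)) \<le> (r n)\<^sup>2 * nrm (F_space 1 l \<beta>) f * r n ^ m"
      by (simp add: mult_ac)
  qed
  from F_one_partial_sums_converge[OF l b c this]
  have "eventually (\<lambda>k. nrm (F_space 1 l \<beta>) (\<lambda>z. ?g n z - (\<Sum>m<k. c m * z ^ m)) < e / 2) sequentially"
    using e by (intro order_tendstoD(2)) auto
  then obtain k where k: "nrm (F_space 1 l \<beta>) (\<lambda>z. ?g n z - (\<Sum>m<k. c m * z ^ m)) < e / 2"
    using eventually_happens'[OF sequentially_bot] by blast
  have P: "(\<lambda>z. \<Sum>m<k. c m * z ^ m) \<in> elts (F_space 1 l \<beta>)"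
    using polynomial_in_E_class[OF l] E_class_subset_F_one[OF l b] by blast
  have "nrm (F_space 1 l \<beta>) (\<lambda>z. (?g n z - (\<Sum>m<k. c m * z ^ m)) - (?g n z - f z)) < e"
    using F_one_diff(2)[OF F_one_diff(1)[OF gF P] F_one_diff(1)[OF gF f], of n n] n k by linarith
  then have "nrm (F_space 1 l \<beta>) (\<lambda>z. f z - (\<Sum>m<k. c m * z ^ m)) < e" by (simp add: algebra_simps)
  then show ?thesis by blast
qed

text \<open>The mean value property on the unit disc around \<open>z\<close>.\<close>
lemma F_one_pointwise:
  assumes l: "l \<ge> 1" and b: "\<beta> > 0"
  obtains C where "C \<ge> 0" "\<And>f. f \<in> elts (F_space 1 l \<beta>) \<Longrightarrow> cmod (f z) \<le> C * nrm (F_space 1 l \<beta>) f"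
proof -
  define D where "D = exp (\<beta> * (cmod z + 1) ^ (2 * l) / 2)"
  have "cmod (f z) \<le> D / pi * nrm (F_space 1 l \<beta>) f" if f: "f \<in> elts (F_space 1 l \<beta>)" for f
  proof -
    have fe: "f \<in> entire" and fi: "integrable lborel (weighted l \<beta> f)" using f by (auto simp: F_one_elts)
    have [measurable]: "f \<in> borel_measurable borel" by (rule entire_measurable[OF fe])
    define g where "g w = f (w + z)" for w
    have ge: "g \<in> entire"
    proof -
      have "(\<lambda>w. w + z) holomorphic_on UNIV" by (intro holomorphic_intros)
      then show ?thesis
        using holomorphic_on_compose_gen[of "\<lambda>w. w + z" UNIV f UNIV] fe
        by (simp add: entire_def g_def[abs_def] o_def)
    qed
    have [measurable]: "g \<in> borel_measurable borel" by (rule entire_measurable[OF ge])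
    have ga: "power_sum (taylor g) g" by (rule entire_power_sum[OF ge])
    let ?w = "\<lambda>w. weighted l \<beta> f (w + z)"
    have wi: "integrable lborel ?w" using integrable_translate[of "weighted l \<beta> f" "-z"] fi by simp
    let ?\<psi> = "\<lambda>r::real. indicator {..1} r :: real"
    have nb: "norm (g w * cnj w ^ 0 * of_real (?\<psi> (cmod w))) \<le> D * ?w w" for w
    proof (cases "cmod w \<le> 1")
      case True
      have "cmod (w + z) \<le> cmod z + 1" using norm_triangle_ineq[of w z] True by linarith
      then have "cmod (w + z) ^ (2 * l) \<le> (cmod z + 1) ^ (2 * l)" by (intro power_mono) auto
      then have "exp (- \<beta> * cmod (w + z) ^ (2 * l) / 2) * D \<ge> 1"
        unfolding D_def exp_add[symmetric] using b by simp
      then have "cmod (f (w + z)) * 1 \<le> cmod (f (w + z)) * (exp (- \<beta> * cmod (w + z) ^ (2 * l) / 2) * D)"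
        by (intro mult_left_mono) auto
      then show ?thesis using True by (simp add: g_def weighted_def mult_ac)
    qed (simp add: D_def)
    have i1: "integrable lborel (\<lambda>w. g w * cnj w ^ 0 * of_real (?\<psi> (cmod w)))"
      by (rule Bochner_Integration.integrable_bound[OF integrable_mult_right[OF wi, of D]])
        (use nb in \<open>auto intro!: AE_I2 order_trans[OF _ abs_ge_self]\<close>)
    have psi: "(\<lambda>w::complex. ?\<psi> (cmod w)) = indicator (cball 0 1)" by (auto simp: indicator_def)
    have ip: "integrable lborel (\<lambda>w::complex. ?\<psi> (cmod w))"
      unfolding psi by (intro integrable_real_indicator emeasure_lborel_cball_finite) simp
    have "(LINT w|lborel. ?\<psi> (cmod w)) = pi"
      unfolding psi by (simp add: content_cball unit_ball_vol_2)
    moreover have "(LINT w|lborel. g w * cnj w ^ 0 * of_real (?\<psi> (cmod w)))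
        = taylor g 0 * of_real (LINT w|lborel. cmod w ^ (2 * 0) * ?\<psi> (cmod w))"
      by (rule radial_integral_extracts_coefficient[OF ga _ i1]) (use ip in auto)
    moreover have "taylor g 0 = f z" by (simp add: taylor_def g_def)
    ultimately have "f z * of_real pi = (LINT w|lborel. g w * cnj w ^ 0 * of_real (?\<psi> (cmod w)))" by simp
    then have "cmod (f z) * pi = norm (LINT w|lborel. g w * cnj w ^ 0 * of_real (?\<psi> (cmod w)))"
      by (metis abs_of_pos norm_mult norm_of_real pi_gt_zero)
    also have "\<dots> \<le> (LINT w|lborel. D * ?w w)"
      by (rule Bochner_Integration.integral_norm_bound_integral[OF i1 integrable_mult_right[OF wi]]) (use nb in auto)
    also have "\<dots> = D * nrm (F_space 1 l \<beta>) f"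
      using integral_translate[of "weighted l \<beta> f" "-z"] by (simp add: F_one_nrm[OF fe])
    finally show ?thesis by (simp add: field_simps)
  qed
  then show ?thesis by (intro that[of "D / pi"]) (auto simp: D_def)
qed

section \<open>Weak products\<close>

lemma weak_product_enorm_le:
  assumes "\<And>j. f j \<in> elts X" "\<And>j. g j \<in> elts Y" "\<And>z. (\<lambda>j::nat. f j z * g j z) sums h z"
  shows "weak_product_enorm X Y h \<le> (\<Sum>j. ennreal (nrm X (f j) * nrm Y (g j)))"
  unfolding weak_product_enorm_def by (rule Inf_lower) (use assms in blast)

lemma weak_product_enorm_lessD:
  assumes "weak_product_enorm X Y h < c"
  shows "\<exists>f g. (\<forall>j. f j \<in> elts X) \<and> (\<forall>j. g j \<in> elts Y) \<and>
    (\<forall>z. (\<lambda>j::nat. f j z * g j z) sums h z) \<and> (\<Sum>j. ennreal (nrm X (f j) * nrm Y (g j))) < c"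
  using assms unfolding weak_product_enorm_def Inf_less_iff by blast

context hankel_pair
begin

lemma \<alpha>2: "2 * \<alpha> > 0" using \<alpha> by simp

lemma E_F_one: "f \<in> E_class l \<Longrightarrow> f \<in> elts (F_space 1 l (2 * \<alpha>))"
  using E_class_subset_F_one[OF l \<alpha>2] by blast

lemma monomial_F_one_le_cost: "nrm (F_space 1 l (2 * \<alpha>)) (\<lambda>z. z ^ m) \<le> monomial_cost m"
  using Hoelder_le[of "\<lambda>z. z ^ m" "\<lambda>z. 1"] monomial_in_E_class[OF l, of 1 m] one_in_E E_X E_Y
  by (auto simp: monomial_cost_def)

lemma controlled_F_one: "controlled_seminorm (nrm (F_space 1 l (2 * \<alpha>))) 1"
  unfolding controlled_seminorm_def
proof (intro conjI ballI allI impI)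
  let ?n = "nrm (F_space 1 l (2 * \<alpha>))"
  show "?n (\<lambda>z. f z + g z) \<le> ?n f + ?n g" if "f \<in> E_class l" "g \<in> E_class l" for f g
    using that by (intro F_one_add E_F_one)
  show "?n (\<lambda>z. c * f z) \<le> cmod c * ?n f" if "f \<in> E_class l" for c f
    using F_one_cmult(2)[OF E_F_one[OF that]] by simp
  show "?n f \<le> 1 * (\<Sum>m. cmod (a m) * monomial_cost m)" if f: "f \<in> E_class l" and a: "power_sum a f" for f a
  proof -
    have s: "summable (\<lambda>m. cmod (a m) * ?n (\<lambda>z. z ^ m))"
      using E_class_monomial_norms_summable[OF l \<alpha>2, of 1, OF _ f a] by (simp add: one_ereal_def[symmetric])
    have "?n f \<le> (\<Sum>m. cmod (a m) * ?n (\<lambda>z. z ^ m))" by (rule F_one_series(2)[OF l \<alpha>2 a s])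
    also have "\<dots> \<le> (\<Sum>m. cmod (a m) * monomial_cost m)"
      by (intro suminf_le s monomial_cost_summable[OF f a] mult_left_mono monomial_F_one_le_cost) auto
    finally show ?thesis by simp
  qed
  show "?n (\<lambda>z. f z * g z) \<le> 1 * (nrm X f * nrm Y g)" if "f \<in> E_class l" "g \<in> E_class l" for f g
    using Hoelder_le[of f g] that E_X E_Y by auto
qed simp

lemma kernel_norm_bound:
  obtains C where "C > 0"
    "\<And>z. nrm (F_space 1 l (2 * \<alpha>)) (kernel_at l \<alpha> z) \<le> C * exp (\<alpha> / 4 * cmod z ^ (2 * l))"
proof -
  obtain C where C: "C \<ge> 0" "\<And>N M z. controlled_seminorm N M \<Longrightarrow>
    N (kernel_at l \<alpha> z) \<le> C * M * exp (\<alpha> / 4 * cmod z ^ (2 * l))"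
    using kernel_bound by blast
  have "nrm (F_space 1 l (2 * \<alpha>)) (kernel_at l \<alpha> z) \<le> (C + 1) * exp (\<alpha> / 4 * cmod z ^ (2 * l))" for z
    using C(2)[OF controlled_F_one, of z] by (simp add: distrib_right add_increasing2)
  then show ?thesis using C(1) by (intro that[of "C + 1"]) auto
qed

abbreviation wpn :: "(complex \<Rightarrow> complex) \<Rightarrow> ennreal" where
  "wpn \<equiv> weak_product_enorm X Y"

lemma weak_product_in_F_one:
  assumes h: "h \<in> entire" and fg: "\<And>j. f j \<in> elts X" "\<And>j. g j \<in> elts Y"
    "\<And>z. (\<lambda>j::nat. f j z * g j z) sums h z"
    and S: "(\<Sum>j. ennreal (nrm X (f j) * nrm Y (g j))) \<le> ennreal c" and c: "c \<ge> 0"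
  shows "h \<in> elts (F_space 1 l (2 * \<alpha>))" and "nrm (F_space 1 l (2 * \<alpha>)) h \<le> c"
proof -
  have [measurable]: "h \<in> borel_measurable borel" by (rule entire_measurable[OF h])
  let ?w = "\<lambda>j. weighted l (2 * \<alpha>) (\<lambda>z. f j z * g j z)"
  have mem: "(\<lambda>z. f j z * g j z) \<in> elts (F_space 1 l (2 * \<alpha>))" for j by (rule Hoelder_mem[OF fg(1,2)])
  then have wi: "integrable lborel (?w j)" for j by (simp add: F_one_elts)
  have [measurable]: "?w j \<in> borel_measurable lborel" for j using wi by (rule borel_measurable_integrable)
  have le: "ennreal (weighted l (2 * \<alpha>) h z) \<le> (\<Sum>j. ennreal (?w j z))" for z
  proof (cases "summable (\<lambda>j. ?w j z)")
    case True
    then have s: "summable (\<lambda>j. norm (f j z * g j z))"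
      by (subst (asm) weighted_def) (simp add: summable_cmult_iff mult.commute[of _ "exp _"])
    have "weighted l (2 * \<alpha>) h z \<le> (\<Sum>j. norm (f j z * g j z)) * exp (- (2 * \<alpha>) * cmod z ^ (2 * l) / 2)"
      unfolding weighted_def using summable_norm[OF s] fg(3)[of z]
      by (intro mult_right_mono) (auto simp: sums_iff)
    also have "\<dots> = (\<Sum>j. ?w j z)" unfolding suminf_mult2[OF s] by (simp add: weighted_def)
    finally show ?thesis using True by (subst suminf_ennreal2) (auto intro: ennreal_leI)
  next
    case False
    then have "(\<Sum>j. ennreal (?w j z)) = top"
      using summable_suminf_not_top[of "\<lambda>j. ?w j z", OF weighted_nonneg] by blast
    then show ?thesis by simp
  qed
  have "(\<integral>\<^sup>+z. ennreal (weighted l (2 * \<alpha>) h z) \<partial>lborel) \<le> (\<integral>\<^sup>+z. (\<Sum>j. ennreal (?w j z)) \<partial>lborel)"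
    by (intro nn_integral_mono le)
  also have "\<dots> = (\<Sum>j. \<integral>\<^sup>+z. ennreal (?w j z) \<partial>lborel)" by (rule nn_integral_suminf) measurable
  also have "\<dots> \<le> (\<Sum>j. ennreal (nrm X (f j) * nrm Y (g j)))"
  proof (intro suminf_le)
    fix j
    have "(\<integral>\<^sup>+z. ennreal (?w j z) \<partial>lborel) = ennreal (nrm (F_space 1 l (2 * \<alpha>)) (\<lambda>z. f j z * g j z))"
      using mem[of j] wi[of j] by (subst nn_integral_eq_integral) (auto simp: F_one_elts F_one_nrm)
    also have "\<dots> \<le> ennreal (nrm X (f j) * nrm Y (g j))" by (intro ennreal_leI Hoelder_le fg)
    finally show "(\<integral>\<^sup>+z. ennreal (?w j z) \<partial>lborel) \<le> ennreal (nrm X (f j) * nrm Y (g j))" .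
  qed auto
  also note S
  finally have nn: "(\<integral>\<^sup>+z. ennreal (weighted l (2 * \<alpha>) h z) \<partial>lborel) \<le> ennreal c" .
  have hi: "integrable lborel (weighted l (2 * \<alpha>) h)"
    by (rule integrableI_bounded) (use nn in \<open>auto simp: le_less_trans[OF _ ennreal_less_top]\<close>)
  then show "h \<in> elts (F_space 1 l (2 * \<alpha>))" using h by (simp add: F_one_elts)
  show "nrm (F_space 1 l (2 * \<alpha>)) h \<le> c"
    using nn nn_integral_eq_integral[OF hi] c by (simp add: F_one_nrm[OF h])
qed

text \<open>Concatenate representations of the \<open>h n\<close> that are optimal up to \<open>\<epsilon> / 2 ^ Suc
n\<close>, enumerated by \<open>prod_decode\<close>. The double series converges absolutely at each point
since the norm of \<open>F_space 1 l (2 * \<alpha>)\<close> controls point evaluations.\<close>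
lemma weak_product_countably_subadditive:
  assumes hn: "\<And>n. wpn (h n) \<le> ennreal (e n)" "\<And>n. e n \<ge> 0" and se: "summable e"
    and H: "\<And>z. (\<lambda>n. h n z) sums H z"
  shows "wpn H \<le> ennreal (suminf e)"
proof (rule ennreal_le_epsilon)
  fix \<epsilon> :: real assume eps: "\<epsilon> > 0"
  define e' where "e' n = e n + \<epsilon> * (1/2) ^ Suc n" for n
  have e'0: "e' n > e n" "e' n \<ge> 0" for n using eps hn(2)[of n] by (auto simp: e'_def)
  have geo: "(\<lambda>n. \<epsilon> * (1/2) ^ Suc n) sums (\<epsilon> * 1)" using power_half_series by (rule sums_mult)
  have e'sums: "e' sums (suminf e + \<epsilon>)"
    unfolding e'_def using sums_add[OF summable_sums[OF se] geo] by simp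
  define R where "R n f g \<longleftrightarrow> (\<forall>j. f j \<in> elts X) \<and> (\<forall>j. g j \<in> elts Y) \<and> (\<forall>z. (\<lambda>j::nat. f j z * g j z) sums h n z) \<and>
    (\<Sum>j. ennreal (nrm X (f j) * nrm Y (g j))) < ennreal (e' n)" for n f g
  have "\<exists>f g. R n f g" for n
  proof -
    have "wpn (h n) < ennreal (e' n)"
      using hn[of n] e'0[of n] by (intro le_less_trans[OF hn(1)]) (simp add: ennreal_less_iff)
    then show ?thesis unfolding R_def by (rule weak_product_enorm_lessD)
  qed
  then obtain f g where "\<And>n. R n (f n) (g n)" by metis
  then have fg: "\<And>n j. f n j \<in> elts X" "\<And>n j. g n j \<in> elts Y"
    "\<And>n z. (\<lambda>j::nat. f n j z * g n j z) sums h n z"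
    "\<And>n. (\<Sum>j. ennreal (nrm X (f n j) * nrm Y (g n j))) < ennreal (e' n)"
    by (simp_all add: R_def)
  define c where "c = (\<lambda>(n, j). nrm X (f n j) * nrm Y (g n j))"
  have c0: "c x \<ge> 0" for x
    by (cases x) (auto simp: c_def intro!: mult_nonneg_nonneg nrm_X_nonneg nrm_Y_nonneg fg)
  define F where "F k = (case prod_decode k of (n, j) \<Rightarrow> f n j)" for k
  define G where "G k = (case prod_decode k of (n, j) \<Rightarrow> g n j)" for k
  have FX: "F k \<in> elts X" and GY: "G k \<in> elts Y" for k
    by (auto simp: F_def G_def fg split: prod.split)
  have ck: "nrm X (F k) * nrm Y (G k) = c (prod_decode k)" for k
    by (simp add: F_def G_def c_def split: prod.split)
  have "(\<Sum>k. ennreal (c (prod_decode k))) = (\<Sum>n. \<Sum>j. ennreal (c (n, j)))"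
    by (rule suminf_ennreal_2dimen) simp
  also have "\<dots> \<le> (\<Sum>n. ennreal (e' n))"
    by (intro suminf_le) (use fg(4) in \<open>auto simp: c_def intro: less_imp_le\<close>)
  also have "\<dots> = ennreal (suminf e + \<epsilon>)"
    using e'sums e'0 by (simp add: suminf_ennreal2 sums_iff)
  finally have Ssum: "(\<Sum>k. ennreal (c (prod_decode k))) \<le> ennreal (suminf e + \<epsilon>)" .
  then have sc: "summable (\<lambda>k. c (prod_decode k))"
    by (intro summable_suminf_not_top c0) (auto simp: top_unique)
  have conv: "(\<lambda>k. F k z * G k z) sums H z" for z
  proof -
    obtain D where D: "D \<ge> 0" "\<And>f. f \<in> elts (F_space 1 l (2 * \<alpha>)) \<Longrightarrow> cmod (f z) \<le> D * nrm (F_space 1 l (2 * \<alpha>)) f"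
      by (rule F_one_pointwise[OF l \<alpha>2]) blast
    define u where "u = (\<lambda>(n, j). f n j z * g n j z)"
    have ub: "norm (u x) \<le> D * c x" for x
    proof (cases x)
      case (Pair n j)
      have "norm (f n j z * g n j z) \<le> D * nrm (F_space 1 l (2 * \<alpha>)) (\<lambda>z. f n j z * g n j z)"
        by (rule D(2)[OF Hoelder_mem[OF fg(1,2)]])
      also have "\<dots> \<le> D * (nrm X (f n j) * nrm Y (g n j))"
        by (intro mult_left_mono Hoelder_le fg D(1))
      finally show ?thesis by (simp add: Pair u_def c_def)
    qed
    have uk: "F k z * G k z = u (prod_decode k)" for k
      by (simp add: F_def G_def u_def split: prod.split)
    have su: "summable (\<lambda>k. norm (u (prod_decode k)))"
      by (rule summable_comparison_test'[OF summable_mult[OF sc, of D], of 0]) (use ub in auto)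
    define S where "S = (\<Sum>k. u (prod_decode k))"
    have "(\<lambda>k. u (prod_decode k)) sums S"
      unfolding S_def by (rule summable_sums[OF summable_norm_cancel[OF su]])
    from norm_summable_imp_has_sum[OF su this]
    have "((\<lambda>k. u (prod_decode k)) has_sum S) UNIV" .
    then have hs: "(u has_sum S) (UNIV \<times> UNIV)"
      using has_sum_reindex_bij_betw[OF bij_prod_decode, of u S] by simp
    have "((\<lambda>j. u (n, j)) has_sum h n z) UNIV" for n
    proof (rule norm_summable_imp_has_sum)
      have "(\<Sum>j. ennreal (c (n, j))) < top"
        using order.strict_trans[OF fg(4)[of n] ennreal_less_top] by (simp add: c_def)
      then have "summable (\<lambda>j. c (n, j))" by (intro summable_suminf_not_top c0) auto
      from summable_mult[OF this, of D] show "summable (\<lambda>j. norm (u (n, j)))"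
        by (rule summable_comparison_test') (use ub in auto)
      show "(\<lambda>j. u (n, j)) sums h n z" using fg(3)[of n z] by (simp add: u_def)
    qed
    then have "((\<lambda>n. h n z) has_sum S) UNIV" by (intro has_sum_SigmaD[OF hs]) auto
    then have "S = H z" using has_sum_imp_sums H sums_unique2 by blast
    then show ?thesis using \<open>(\<lambda>k. u (prod_decode k)) sums S\<close> by (simp add: uk)
  qed
  have "wpn H \<le> (\<Sum>k. ennreal (nrm X (F k) * nrm Y (G k)))"
    by (rule weak_product_enorm_le[OF FX GY conv])
  also have "\<dots> \<le> ennreal (suminf e + \<epsilon>)" using Ssum by (simp only: ck)
  also have "\<dots> = ennreal (suminf e) + ennreal \<epsilon>"
    using eps suminf_nonneg[OF se hn(2)] by (intro ennreal_plus) auto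
  finally show "wpn H \<le> ennreal (suminf e) + ennreal \<epsilon>" .
qed

lemma weak_product_enorm_product:
  assumes f: "f \<in> elts X" and g: "g \<in> elts Y"
  shows "wpn (\<lambda>z. f z * g z) \<le> ennreal (nrm X f * nrm Y g)"
proof -
  let ?f = "\<lambda>j::nat. if j = 0 then f else (\<lambda>z. 0 * f z)"
  have nf: "nrm X (\<lambda>z. 0 * f z) = 0" using nrm_X_cmult[OF f, of 0] by simp
  have "(\<lambda>j. ?f j z * g z) sums (f z * g z)" for z
    using sums_single[of 0 "\<lambda>j. f z * g z"] by (simp add: if_distrib[of "\<lambda>x. x z * g z"] cong: if_cong)
  then have "wpn (\<lambda>z. f z * g z) \<le> (\<Sum>j. ennreal (nrm X (?f j) * nrm Y g))"
    by (intro weak_product_enorm_le) (use f g X_cmult[OF f, of 0] in auto)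
  also have "(\<lambda>j. ennreal (nrm X (?f j) * nrm Y g)) = (\<lambda>j. if j = 0 then ennreal (nrm X f * nrm Y g) else 0)"
    using nf by auto
  also have "(\<Sum>j::nat. if j = 0 then ennreal (nrm X f * nrm Y g) else 0) = ennreal (nrm X f * nrm Y g)"
    using sums_single[of 0 "\<lambda>_. ennreal (nrm X f * nrm Y g)"] by (simp add: sums_iff)
  finally show ?thesis .
qed

lemma weak_product_finite_on_E:
  assumes "f \<in> E_class l" shows "wpn f < top"
proof -
  have "wpn (\<lambda>z. f z * 1) \<le> ennreal (nrm X f * nrm Y (\<lambda>z. 1))"
    by (rule weak_product_enorm_product) (use assms one_in_E E_X E_Y in auto)
  then show ?thesis by (simp add: le_less_trans)
qed

lemma weak_product_enorm_eq: "f \<in> E_class l \<Longrightarrow> wpn f = ennreal (enn2real (wpn f))"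
  using weak_product_finite_on_E by simp

lemma weak_product_zero: "wpn (\<lambda>z. 0) = 0"
proof -
  have "wpn (\<lambda>z. (0 * 1) * 1) \<le> ennreal (nrm X (\<lambda>z. 0 * 1) * nrm Y (\<lambda>z. 1))"
    by (rule weak_product_enorm_product) (use one_in_E zero_in_E E_X E_Y in auto)
  also have "nrm X (\<lambda>z. 0 * 1) = 0" using nrm_X_cmult[of "\<lambda>z. 1" 0] one_in_E E_X by auto
  finally show ?thesis by simp
qed

lemma controlled_weak_product: "controlled_seminorm (\<lambda>h. enn2real (wpn h)) 1"
  unfolding controlled_seminorm_def
proof (intro conjI ballI allI impI)
  let ?n = "\<lambda>h. enn2real (wpn h)"
  show "?n (\<lambda>z. f z + g z) \<le> ?n f + ?n g" if f: "f \<in> E_class l" and g: "g \<in> E_class l" for f g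
  proof -
    let ?h = "\<lambda>n::nat. if n = 0 then f else if n = 1 then g else (\<lambda>z. 0)"
    let ?e = "\<lambda>n::nat. if n = 0 then ?n f else if n = 1 then ?n g else 0"
    have e: "?e sums (?n f + ?n g)" using sums_finite[of "{0, 1}" ?e] by simp
    have hs: "(\<lambda>n. ?h n z) sums (f z + g z)" for z
      using sums_finite[of "{0, 1}" "\<lambda>n. ?h n z"] by simp
    have "wpn (\<lambda>z. f z + g z) \<le> ennreal (suminf ?e)"
    proof (rule weak_product_countably_subadditive[OF _ _ _ hs])
      show "wpn (?h n) \<le> ennreal (?e n)" for n
        using weak_product_enorm_eq[OF f] weak_product_enorm_eq[OF g] by (simp add: weak_product_zero)
    qed (use e in \<open>auto simp: sums_iff\<close>)
    also have "suminf ?e = ?n f + ?n g" using e by (simp add: sums_iff)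
    finally show ?thesis by (intro enn2real_leI) auto
  qed
  show "?n (\<lambda>z. c * f z) \<le> cmod c * ?n f" if f: "f \<in> E_class l" for c f
  proof (rule field_le_epsilon)
    fix e :: real assume e: "e > 0"
    define d where "d = e / (cmod c + 1)"
    have d: "d > 0" "cmod c * d \<le> e"
      using e by (auto simp: d_def field_simps add_pos_nonneg add_nonneg_pos)
    have "wpn f < ennreal (?n f + d)"
      using d(1) by (subst weak_product_enorm_eq[OF f]) (simp add: ennreal_less_iff)
    then obtain u v where uv: "\<And>j. u j \<in> elts X" "\<And>j. v j \<in> elts Y"
      "\<And>z. (\<lambda>j::nat. u j z * v j z) sums f z" "(\<Sum>j. ennreal (nrm X (u j) * nrm Y (v j))) < ennreal (?n f + d)"
      using weak_product_enorm_lessD by blast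
    have "wpn (\<lambda>z. c * f z) \<le> (\<Sum>j. ennreal (nrm X (\<lambda>z. c * u j z) * nrm Y (v j)))"
      by (rule weak_product_enorm_le) (use uv X_cmult sums_mult[OF uv(3), of c] in \<open>auto simp: mult.assoc\<close>)
    also have "\<dots> = (\<Sum>j. ennreal (cmod c) * ennreal (nrm X (u j) * nrm Y (v j)))"
      using uv(1,2) nrm_X_nonneg nrm_Y_nonneg by (simp add: nrm_X_cmult ennreal_mult' mult.assoc)
    also have "\<dots> = ennreal (cmod c) * (\<Sum>j. ennreal (nrm X (u j) * nrm Y (v j)))"
      by (rule ennreal_suminf_cmult)
    also have "\<dots> \<le> ennreal (cmod c) * ennreal (?n f + d)"
      using uv(4) by (intro mult_left_mono) auto
    also have "\<dots> = ennreal (cmod c * (?n f + d))" using d by (simp add: ennreal_mult')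
    finally have "?n (\<lambda>z. c * f z) \<le> cmod c * (?n f + d)" using d by (intro enn2real_leI) auto
    then show "?n (\<lambda>z. c * f z) \<le> cmod c * ?n f + e" using d(2) by (simp add: distrib_left)
  qed
  show "?n f \<le> 1 * (\<Sum>m. cmod (a m) * monomial_cost m)" if f: "f \<in> E_class l" and a: "power_sum a f" for f a
  proof -
    let ?u = "\<lambda>m z. a m * z ^ m"
    have mX: "(\<lambda>z. z ^ m) \<in> elts X" for m using monomial_in_E_class[OF l, of 1 m] E_X by auto
    have oneY: "(\<lambda>z. 1) \<in> elts Y" using one_in_E E_Y by auto
    have "wpn f \<le> (\<Sum>m. ennreal (nrm X (?u m) * nrm Y (\<lambda>z. 1)))"
      by (rule weak_product_enorm_le) (use a oneY X_cmult[OF mX] in \<open>auto simp: power_sum_def\<close>)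
    also have "\<dots> = (\<Sum>m. ennreal (cmod (a m) * monomial_cost m))"
      by (simp add: nrm_X_cmult[OF mX] monomial_cost_def mult.assoc)
    also have "\<dots> = ennreal (\<Sum>m. cmod (a m) * monomial_cost m)"
      by (intro suminf_ennreal2 monomial_cost_summable[OF f a] mult_nonneg_nonneg monomial_cost_nonneg) auto
    finally show ?thesis
      by (auto intro!: enn2real_leI suminf_nonneg monomial_cost_summable[OF f a] mult_nonneg_nonneg monomial_cost_nonneg)
  qed
  show "?n (\<lambda>z. f z * g z) \<le> 1 * (nrm X f * nrm Y g)" if "f \<in> E_class l" "g \<in> E_class l" for f g
  proof -
    have m: "f \<in> elts X" "g \<in> elts Y" using that E_X E_Y by auto
    have "0 \<le> nrm X f * nrm Y g" using m by (intro mult_nonneg_nonneg nrm_X_nonneg nrm_Y_nonneg)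
    then show ?thesis using weak_product_enorm_product[OF m] by (simp add: enn2real_leI)
  qed
qed simp

text \<open>Density writes \<open>h\<close> as a series of polynomials whose norms decay geometrically; each of them
is estimated by \<open>polynomial_bound\<close>.\<close>
lemma F_one_in_weak_product:
  obtains C where "C > 0" "\<And>h. h \<in> elts (F_space 1 l (2 * \<alpha>)) \<Longrightarrow>
    wpn h \<le> ennreal (C * nrm (F_space 1 l (2 * \<alpha>)) h)"
proof -
  let ?n = "nrm (F_space 1 l (2 * \<alpha>))"
  obtain C where C: "C \<ge> 0" "\<And>N M a n. controlled_seminorm N M \<Longrightarrow>
    N (\<lambda>w. \<Sum>m<n. a m * w ^ m) \<le> C * M * ?n (\<lambda>w. \<Sum>m<n. a m * w ^ m)"
    using polynomial_bound by blast
  have wpoly: "wpn (\<lambda>w. \<Sum>m<n. a m * w ^ m) \<le> ennreal (C * ?n (\<lambda>w. \<Sum>m<n. a m * w ^ m))" for a n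
    using C(2)[OF controlled_weak_product, where a = a and n = n]
    by (subst weak_product_enorm_eq[OF polynomial_in_E_class[OF l]]) (auto intro: ennreal_leI)
  have "wpn h \<le> ennreal ((C * 8 + 1) * ?n h)" if h: "h \<in> elts (F_space 1 l (2 * \<alpha>))" for h
  proof (cases "?n h = 0")
    case True
    have "h z = 0" for z
    proof -
      obtain D where "D \<ge> 0" "\<And>f. f \<in> elts (F_space 1 l (2 * \<alpha>)) \<Longrightarrow> cmod (f z) \<le> D * ?n f"
        by (rule F_one_pointwise[OF l \<alpha>2]) blast
      from this(2)[OF h] show ?thesis using True by simp
    qed
    then have "h = (\<lambda>z. 0)" by auto
    then show ?thesis by (simp add: weak_product_zero)
  next
    case False
    define \<delta> where "\<delta> = ?n h"
    have d0: "\<delta> > 0" using False F_one_nrm_nonneg[OF h] by (simp add: \<delta>_def)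
    have "\<exists>n a. ?n (\<lambda>z. h z - (\<Sum>m<n. a m * z ^ m)) < \<delta> * (1/2) ^ k" for k :: nat
      by (rule polynomials_dense_F_one[OF l \<alpha>2 h]) (use d0 in simp)
    then obtain n a where na: "\<And>k::nat. ?n (\<lambda>z. h z - (\<Sum>m<n k. a k m * z ^ m)) < \<delta> * (1/2) ^ k"
      by metis
    define Q where "Q k = (\<lambda>z. \<Sum>m<n k. a k m * z ^ m)" for k
    have QE: "Q k \<in> E_class l" for k unfolding Q_def by (rule polynomial_in_E_class[OF l])
    have QF: "Q k \<in> elts (F_space 1 l (2 * \<alpha>))" for k by (rule E_F_one[OF QE])
    have hQ: "?n (\<lambda>z. h z - Q k z) < \<delta> * (1/2) ^ k" for k using na[of k] by (simp add: Q_def)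
    define P where "P k = (if k = 0 then Q 0 else (\<lambda>z. Q k z - Q (k - 1) z))" for k
    have Ppoly: "\<exists>N b. P k = (\<lambda>w. \<Sum>m<N. b m * w ^ m)" for k
    proof (cases "k = 0")
      case False
      let ?N = "max (n k) (n (k - 1))"
      have pad: "(\<Sum>m<j. b m * w ^ m) = (\<Sum>m<?N. (if m < j then b m else 0) * w ^ m)" if "j \<le> ?N" for j b and w :: complex
        using that by (intro sum.mono_neutral_cong_left) auto
      have "P k w = (\<Sum>m<?N. ((if m < n k then a k m else 0) - (if m < n (k - 1) then a (k - 1) m else 0)) * w ^ m)" for w
        using False pad[of "n k" "a k" w] pad[of "n (k - 1)" "a (k - 1)" w]
        by (simp add: P_def Q_def left_diff_distrib sum_subtractf)
      then have "P k = (\<lambda>w. \<Sum>m<?N. ((if m < n k then a k m else 0) - (if m < n (k - 1) then a (k - 1) m else 0)) * w ^ m)"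
        by (rule ext)
      then show ?thesis
        by (intro exI[of _ ?N] exI[of _ "\<lambda>m. (if m < n k then a k m else 0) - (if m < n (k - 1) then a (k - 1) m else 0)"])
    qed (auto simp: P_def Q_def)
    have nP: "?n (P k) \<le> 4 * \<delta> * (1/2) ^ k" for k
    proof (cases "k = 0")
      case True
      have "?n (\<lambda>z. h z - (h z - Q 0 z)) \<le> ?n h + ?n (\<lambda>z. h z - Q 0 z)"
        by (rule F_one_diff(2)[OF h F_one_diff(1)[OF h QF]])
      then show ?thesis using hQ[of 0] True d0 by (simp add: P_def \<delta>_def)
    next
      case False
      have "?n (\<lambda>z. (h z - Q (k - 1) z) - (h z - Q k z)) \<le> ?n (\<lambda>z. h z - Q (k - 1) z) + ?n (\<lambda>z. h z - Q k z)"
        by (rule F_one_diff(2)[OF F_one_diff(1)[OF h QF] F_one_diff(1)[OF h QF]])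
      moreover have "(1/2::real) ^ (k - 1) = 2 * (1/2) ^ k" using False by (cases k) auto
      ultimately have "?n (\<lambda>z. (h z - Q (k - 1) z) - (h z - Q k z)) \<le> 3 * \<delta> * (1/2) ^ k"
        using hQ[of k] hQ[of "k - 1"] by simp
      also have "\<dots> \<le> 4 * \<delta> * (1/2) ^ k" using d0 by (intro mult_right_mono) auto
      finally show ?thesis using False by (simp add: P_def)
    qed
    have wP: "wpn (P k) \<le> ennreal (C * (4 * \<delta> * (1/2) ^ k))" for k
    proof -
      obtain N b where "P k = (\<lambda>w. \<Sum>m<N. b m * w ^ m)" using Ppoly by blast
      then have "wpn (P k) \<le> ennreal (C * ?n (P k))" using wpoly by simp
      also have "\<dots> \<le> ennreal (C * (4 * \<delta> * (1/2) ^ k))" by (intro ennreal_leI mult_left_mono nP C(1))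
      finally show ?thesis .
    qed
    have Psum: "(\<lambda>k. P k z) sums h z" for z
    proof -
      obtain D where D: "D \<ge> 0" "\<And>f. f \<in> elts (F_space 1 l (2 * \<alpha>)) \<Longrightarrow> cmod (f z) \<le> D * ?n f"
        by (rule F_one_pointwise[OF l \<alpha>2]) blast
      have part: "(\<Sum>k<Suc K. P k z) = Q K z" for K
        by (induction K) (auto simp: P_def)
      have "(\<lambda>K. Q K z) \<longlonglongrightarrow> h z"
      proof (rule Lim_null_comparison[THEN LIM_zero_cancel])
        show "\<forall>\<^sub>F K in sequentially. norm (Q K z - h z) \<le> D * (\<delta> * (1/2) ^ K)"
        proof (intro always_eventually allI)
          fix K
          have "norm (h z - Q K z) \<le> D * ?n (\<lambda>z. h z - Q K z)" by (rule D(2)[OF F_one_diff(1)[OF h QF]])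
          also have "\<dots> \<le> D * (\<delta> * (1/2) ^ K)" using hQ[of K] D(1) by (intro mult_left_mono) auto
          finally show "norm (Q K z - h z) \<le> D * (\<delta> * (1/2) ^ K)" by (simp add: norm_minus_commute)
        qed
        have "(\<lambda>K. D * (\<delta> * (1/2) ^ K)) \<longlonglongrightarrow> D * (\<delta> * 0)"
          by (intro tendsto_intros LIMSEQ_realpow_zero) auto
        then show "(\<lambda>K. D * (\<delta> * (1/2) ^ K)) \<longlonglongrightarrow> 0" by simp
      qed
      then have "(\<lambda>K. \<Sum>k<Suc K. P k z) \<longlonglongrightarrow> h z" by (simp only: part)
      then show ?thesis unfolding sums_def by (rule LIMSEQ_imp_Suc)
    qed
    have geo: "(\<lambda>k. C * (4 * \<delta> * (1/2) ^ k)) sums (C * (4 * \<delta> * 2))"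
      using geometric_sums[of "1/2::real"] by (intro sums_mult) simp
    have "wpn h \<le> ennreal (\<Sum>k. C * (4 * \<delta> * (1/2) ^ k))"
      by (rule weak_product_countably_subadditive[OF wP _ sums_summable[OF geo] Psum])
        (use C(1) d0 in auto)
    also have "(\<Sum>k. C * (4 * \<delta> * (1/2) ^ k)) = C * (4 * \<delta> * 2)" using geo by (simp only: sums_iff)
    also have "ennreal (C * (4 * \<delta> * 2)) \<le> ennreal ((C * 8 + 1) * ?n h)"
      using d0 by (intro ennreal_leI) (simp add: \<delta>_def algebra_simps)
    finally show ?thesis .
  qed
  then show ?thesis using C(1) by (intro that[of "C * 8 + 1"]) auto
qed

theorem weak_product_eq_F_one: "X \<odot> Y \<doteq> F_space 1 l (2 * \<alpha>)"
proof -
  let ?n = "nrm (F_space 1 l (2 * \<alpha>))"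
  obtain C where C: "C > 0" "\<And>h. h \<in> elts (F_space 1 l (2 * \<alpha>)) \<Longrightarrow> wpn h \<le> ennreal (C * ?n h)"
    by (rule F_one_in_weak_product) blast
  have up: "h \<in> elts (F_space 1 l (2 * \<alpha>)) \<and> ?n h \<le> enn2real (wpn h)" if h: "h \<in> entire" and fin: "wpn h < \<infinity>" for h
  proof -
    have eq: "wpn h = ennreal (enn2real (wpn h))" using fin by (simp add: less_top)
    have *: "h \<in> elts (F_space 1 l (2 * \<alpha>)) \<and> ?n h \<le> enn2real (wpn h) + e" if e: "e > 0" for e
    proof -
      have "wpn h < ennreal (enn2real (wpn h) + e)" using e by (subst eq) (simp add: ennreal_less_iff)
      then obtain u v where uv: "\<And>j. u j \<in> elts X" "\<And>j. v j \<in> elts Y"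
        "\<And>z. (\<lambda>j::nat. u j z * v j z) sums h z"
        "(\<Sum>j. ennreal (nrm X (u j) * nrm Y (v j))) < ennreal (enn2real (wpn h) + e)"
        using weak_product_enorm_lessD by blast
      from weak_product_in_F_one[OF h uv(1,2,3) less_imp_le[OF uv(4)]] e
      show ?thesis by simp
    qed
    then show ?thesis using *[of 1] by (auto intro: field_le_epsilon)
  qed
  have down: "wpn h < \<infinity> \<and> enn2real (wpn h) \<le> C * ?n h" if "h \<in> elts (F_space 1 l (2 * \<alpha>))" for h
    using C(2)[OF that] C(1) F_one_nrm_nonneg[OF that] by (auto intro!: enn2real_leI le_less_trans[OF C(2)[OF that]])
  have ent: "h \<in> entire" if "h \<in> elts (F_space 1 l (2 * \<alpha>))" for h
    using that by (simp add: F_one_elts)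
  have "elts (X \<odot> Y) = elts (F_space 1 l (2 * \<alpha>))"
    using up down ent by (auto simp: weak_product_def)
  have bounds: "1 / C * nrm (X \<odot> Y) h \<le> ?n h \<and> ?n h \<le> 1 * nrm (X \<odot> Y) h"
    if "h \<in> elts (X \<odot> Y)" for h
  proof -
    have h: "h \<in> entire" "wpn h < \<infinity>" using that by (auto simp: weak_product_def)
    from up[OF h] have m: "h \<in> elts (F_space 1 l (2 * \<alpha>))" and le: "?n h \<le> enn2real (wpn h)" by auto
    have "1 / C * nrm (X \<odot> Y) h \<le> ?n h" using down[OF m] C(1) by (simp add: weak_product_def field_simps)
    moreover have "?n h \<le> 1 * nrm (X \<odot> Y) h" using le by (simp add: weak_product_def)
    ultimately show ?thesis ..
  qed
  have "\<exists>D>0. \<forall>h\<in>elts (X \<odot> Y). 1 / C * nrm (X \<odot> Y) h \<le> ?n h \<and> ?n h \<le> D * nrm (X \<odot> Y) h"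
    using bounds by (intro exI[of _ "1 :: real"]) simp
  moreover have "1 / C > 0" using C(1) by simp
  ultimately have "\<exists>c>0. \<exists>D>0. \<forall>h\<in>elts (X \<odot> Y). c * nrm (X \<odot> Y) h \<le> ?n h \<and> ?n h \<le> D * nrm (X \<odot> Y) h"
    by blast
  with \<open>elts (X \<odot> Y) = elts (F_space 1 l (2 * \<alpha>))\<close> show ?thesis
    unfolding same_space_def by blast
qed

end

section \<open>Symbols of bounded Hankel forms\<close>

text \<open>The polynomial factor is absorbed by a small Gaussian. The constant \<open>3 / 4\<close> is an arbitrary
number between \<open>1 / 2\<close> and \<open>1\<close>; being below \<open>1\<close>, it makes the
pairing with \<open>E\<close> absolutely convergent.\<close>
lemma H_inf_growth:
  assumes l: "l \<ge> 1" and a: "\<alpha> > 0" and b: "b \<in> H_inf l \<alpha>"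
  obtains C where "C \<ge> 0" "\<And>z. cmod (b z) \<le> C * exp (3 / 4 * \<alpha> * cmod z ^ (2 * l))"
proof -
  have be: "b \<in> entire" using b by (simp add: H_inf_def)
  have "\<exists>C\<ge>0. \<forall>z. cmod (b z) \<le> C * ((1 + cmod z) ^ (2 * l - 2) * exp (\<alpha> * cmod z ^ (2 * l) / 2))"
  proof (rule bigo_at_infinity_global_bound)
    show "continuous_on UNIV b" by (rule entire_continuous[OF be])
    show "continuous_on UNIV (\<lambda>z::complex. (1 + cmod z) ^ (2 * l - 2) * exp (\<alpha> * cmod z ^ (2 * l) / 2))"
      by (intro continuous_intros) auto
    show "0 < (1 + cmod z) ^ (2 * l - 2) * exp (\<alpha> * cmod z ^ (2 * l) / 2)" for z :: complex
      by (intro mult_pos_pos zero_less_power) (auto intro: add_pos_nonneg)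
    show "(\<lambda>z. cmod (b z)) \<in> O[at_infinity](\<lambda>z. (1 + cmod z) ^ (2 * l - 2) * exp (\<alpha> * cmod z ^ (2 * l) / 2))"
      using b by (simp add: H_inf_def)
  qed
  then obtain C where C: "C \<ge> 0" "\<And>z. cmod (b z) \<le> C * ((1 + cmod z) ^ (2 * l - 2) * exp (\<alpha> * cmod z ^ (2 * l) / 2))" by blast
  define K :: real where "K = fact (2 * l - 2) * exp 2 * exp (1 / \<alpha>)"
  have "cmod (b z) \<le> (C * K) * exp (3 / 4 * \<alpha> * cmod z ^ (2 * l))" for z
  proof -
    let ?x = "cmod z"
    have "?x \<le> 1 + ?x ^ l"
    proof (cases "?x \<le> 1")
      case False
      then have "?x \<le> ?x ^ l" using l by (intro self_le_power) auto
      then show ?thesis by simp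
    qed (simp add: add_increasing2)
    then have "exp (1 + ?x) \<le> exp (2 + ?x ^ l)" by simp
    also have "\<dots> = exp 2 * exp (1 * ?x ^ l)" by (simp add: exp_add)
    also have "\<dots> \<le> exp 2 * (exp (1\<^sup>2 / (4 * (\<alpha> / 4))) * exp (\<alpha> / 4 * (?x ^ l)\<^sup>2))"
      using a by (intro mult_left_mono exp_power_le) auto
    finally have "exp (1 + ?x) \<le> exp 2 * exp (1 / \<alpha>) * exp (\<alpha> / 4 * ?x ^ (2 * l))"
      by (simp add: power_mult[symmetric] mult.commute)
    then have "(1 + ?x) ^ (2 * l - 2) \<le> fact (2 * l - 2) * (exp 2 * exp (1 / \<alpha>) * exp (\<alpha> / 4 * ?x ^ (2 * l)))"
      by (intro order_trans[OF power_le_fact_mult_exp] mult_left_mono) auto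
    then have "(1 + ?x) ^ (2 * l - 2) * exp (\<alpha> * ?x ^ (2 * l) / 2)
      \<le> fact (2 * l - 2) * (exp 2 * exp (1 / \<alpha>) * exp (\<alpha> / 4 * ?x ^ (2 * l))) * exp (\<alpha> * ?x ^ (2 * l) / 2)"
      by (intro mult_right_mono) auto
    also have "\<dots> = K * (exp (\<alpha> / 4 * ?x ^ (2 * l)) * exp (\<alpha> * ?x ^ (2 * l) / 2))"
      by (simp add: K_def)
    also have "exp (\<alpha> / 4 * ?x ^ (2 * l)) * exp (\<alpha> * ?x ^ (2 * l) / 2) = exp (3 / 4 * \<alpha> * ?x ^ (2 * l))"
      by (simp add: exp_add[symmetric])
    finally have "C * ((1 + ?x) ^ (2 * l - 2) * exp (\<alpha> * ?x ^ (2 * l) / 2)) \<le> C * (K * exp (3 / 4 * \<alpha> * ?x ^ (2 * l)))"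
      using C(1) by (rule mult_left_mono)
    with C(2)[of z] show ?thesis by (simp add: mult.assoc)
  qed
  then show ?thesis using C(1) by (intro that[of "C * K"]) (auto simp: K_def)
qed

context hankel_pair
begin

text \<open>The modulus of \<open>f \<mapsto> pairing l \<alpha> f b\<close> is a controlled seminorm, hence bounded
at the kernels, where it equals \<open>cmod (b z)\<close>.\<close>
theorem bounded_Hankel_form_symbol:
  assumes b: "b \<in> H_inf l \<alpha>"
    and ext: "extends_to_bounded_bilinear_form (E_class l) (hankel_form l \<alpha> b) X Y"
  shows "b \<in> elts (F_space \<infinity> l (\<alpha> / 2))"
proof -
  obtain G where G: "G \<ge> 0" "\<And>z. cmod (b z) \<le> G * exp (3 / 4 * \<alpha> * cmod z ^ (2 * l))"
    by (rule H_inf_growth[OF l \<alpha> b]) blast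
  have g: "3 / 4 * \<alpha> < \<alpha>" using \<alpha> by simp
  have be: "b \<in> entire" using b by (simp add: H_inf_def)
  have bt: "power_sum (taylor b) b" by (rule entire_power_sum[OF be])
  have [measurable]: "b \<in> borel_measurable borel" by (rule entire_measurable[OF be])
  obtain B C where BC: "bounded_bilinear_form X Y B" "\<And>f g. f \<in> E_class l \<Longrightarrow> g \<in> E_class l \<Longrightarrow> B f g = hankel_form l \<alpha> b f g"
    "\<And>f g. f \<in> elts X \<Longrightarrow> g \<in> elts Y \<Longrightarrow> cmod (B f g) \<le> C * nrm X f * nrm Y g"
    using ext unfolding extends_to_bounded_bilinear_form_def bounded_bilinear_form_def by blast
  have prod: "cmod (pairing l \<alpha> (\<lambda>z. f z * g z) b) \<le> \<bar>C\<bar> * (nrm X f * nrm Y g)" if f: "f \<in> E_class l" and g: "g \<in> E_class l" for f g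
  proof -
    have m: "f \<in> elts X" "g \<in> elts Y" using f g E_X E_Y by auto
    have "cmod (pairing l \<alpha> (\<lambda>z. f z * g z) b) \<le> C * (nrm X f * nrm Y g)"
      using BC(2)[OF f g] BC(3)[OF m] by (simp add: hankel_form_def mult.assoc)
    also have "\<dots> \<le> \<bar>C\<bar> * (nrm X f * nrm Y g)"
      using nrm_X_nonneg[OF m(1)] nrm_Y_nonneg[OF m(2)] by (intro mult_right_mono) auto
    finally show ?thesis .
  qed
  define N where "N h = cmod (pairing l \<alpha> h b)" for h
  have ps: "(\<lambda>m. a m * (cnj (taylor b m) * of_real (power_moment l \<alpha> m))) sums pairing l \<alpha> f b"
    "integrable lborel (\<lambda>z. f z * cnj (b z) * of_real (exp (- \<alpha> * cmod z ^ (2 * l))))"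
    if "f \<in> E_class l" "power_sum a f" for f a
    using pairing_sums[OF l \<alpha> that bt g G(2)] by auto
  have Eint: "integrable lborel (\<lambda>z. f z * cnj (b z) * of_real (exp (- \<alpha> * cmod z ^ (2 * l))))" if "f \<in> E_class l" for f
    using ps(2)[OF that entire_power_sum[OF E_class_entire[OF that]]] .
  have Em: "f \<in> borel_measurable borel" if "f \<in> E_class l" for f by (rule entire_measurable[OF E_class_entire[OF that]])
  have mono: "cmod (cnj (taylor b m) * of_real (power_moment l \<alpha> m)) \<le> \<bar>C\<bar> * monomial_cost m" for m
    using prod[of "\<lambda>z. z ^ m" "\<lambda>z. 1"] monomial_in_E_class[OF l, of 1 m] one_in_E
      pairing_monomial[OF l \<alpha> bt g G(2), of m] by (simp add: monomial_cost_def)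
  have "controlled_seminorm N \<bar>C\<bar>"
    unfolding controlled_seminorm_def
  proof (intro conjI ballI allI impI)
    show "N (\<lambda>z. f z + g z) \<le> N f + N g" if f: "f \<in> E_class l" and g: "g \<in> E_class l" for f g
    proof -
      have "pairing l \<alpha> (\<lambda>z. f z + g z) b = pairing l \<alpha> f b + pairing l \<alpha> g b"
        using Eint[OF f] Eint[OF g] Em[OF f] Em[OF g] Em[OF E_class_add[OF f g]]
        by (simp add: pairing_lborel distrib_right)
      then show ?thesis by (simp add: N_def norm_triangle_ineq)
    qed
    show "N (\<lambda>z. c * f z) \<le> cmod c * N f" if f: "f \<in> E_class l" for c f
      using Em[OF f] Em[OF E_class_cmult[OF f, of c]]
      by (simp add: N_def pairing_lborel mult.assoc norm_mult)
    show "N f \<le> \<bar>C\<bar> * (\<Sum>m. cmod (a m) * monomial_cost m)" if f: "f \<in> E_class l" and a: "power_sum a f" for f a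
    proof -
      let ?t = "\<lambda>m. a m * (cnj (taylor b m) * of_real (power_moment l \<alpha> m))"
      have le: "norm (?t m) \<le> \<bar>C\<bar> * (cmod (a m) * monomial_cost m)" for m
        using mult_left_mono[OF mono[of m], of "cmod (a m)"] by (simp add: norm_mult mult_ac)
      have s: "summable (\<lambda>m. \<bar>C\<bar> * (cmod (a m) * monomial_cost m))"
        by (intro summable_mult monomial_cost_summable[OF f a])
      have "N f = norm (\<Sum>m. ?t m)" using ps(1)[OF f a] by (simp add: N_def sums_iff)
      also have "\<dots> \<le> (\<Sum>m. \<bar>C\<bar> * (cmod (a m) * monomial_cost m))" by (rule norm_suminf_le[OF le s])
      also have "\<dots> = \<bar>C\<bar> * (\<Sum>m. cmod (a m) * monomial_cost m)"
        by (rule suminf_mult[OF monomial_cost_summable[OF f a]])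
      finally show ?thesis .
    qed
    show "N (\<lambda>z. f z * g z) \<le> \<bar>C\<bar> * (nrm X f * nrm Y g)" if "f \<in> E_class l" "g \<in> E_class l" for f g
      unfolding N_def by (rule prod[OF that])
  qed simp
  then obtain K where K: "\<And>z. N (kernel_at l \<alpha> z) \<le> K * \<bar>C\<bar> * exp (\<alpha> / 4 * cmod z ^ (2 * l))"
    using kernel_bound by blast
  have "cmod (b z) \<le> K * \<bar>C\<bar> * exp (\<alpha> / 2 / 2 * cmod z ^ (2 * l))" for z
    using K[of z] pairing_kernel_at[OF l \<alpha> be g G(2), of z] by (simp add: N_def)
  then show ?thesis by (intro F_inf_I(1)[OF be]) (simp only: weighted_le_iff)
qed

end

section \<open>Conjugate exponents\<close>

lemma hankel_pair_finite_exponents: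
  assumes l: "l \<ge> 1" and a: "\<alpha> > 0" and pq: "1 < p" "1 / p + 1 / q = 1"
  shows "hankel_pair l \<alpha> (F_space (ereal p) l \<alpha>) (F_space (ereal q) l \<alpha>)"
proof -
  have q: "1 < q"
  proof -
    have "1 / q = 1 - 1 / p" "1 / p < 1" "0 < 1 / p" using pq by auto
    then have "0 < 1 / q" "1 / q < 1" by linarith+
    then show ?thesis by (simp add: divide_less_eq split: if_splits)
  qed
  have p1: "p \<ge> 1" and q1: "q \<ge> 1" using pq q by auto
  have mem: "(\<lambda>z. f z * g z) \<in> elts (F_space 1 l (2 * \<alpha>)) \<and>
      nrm (F_space 1 l (2 * \<alpha>)) (\<lambda>z. f z * g z) \<le> nrm (F_space (ereal p) l \<alpha>) f * nrm (F_space (ereal q) l \<alpha>) g"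
    if f: "f \<in> elts (F_space (ereal p) l \<alpha>)" and g: "g \<in> elts (F_space (ereal q) l \<alpha>)" for f g
  proof -
    have fe: "f \<in> entire" "integrable lborel (\<lambda>z. weighted l \<alpha> f z powr p)"
      and ge: "g \<in> entire" "integrable lborel (\<lambda>z. weighted l \<alpha> g z powr q)"
      using f g by (auto simp: F_space_elts)
    have [measurable]: "f \<in> borel_measurable borel" "g \<in> borel_measurable borel"
      using fe(1) ge(1) by (auto intro: entire_measurable)
    have "weighted l \<alpha> f \<in> borel_measurable lborel" "weighted l \<alpha> g \<in> borel_measurable lborel" by auto
    note H = Hoelder_inequality[OF pq this weighted_nonneg weighted_nonneg fe(2) ge(2)]
    have w: "weighted l (2 * \<alpha>) (\<lambda>z. f z * g z) = (\<lambda>z. weighted l \<alpha> f z * weighted l \<alpha> g z)"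
      by (rule HOL.ext) (rule weighted_mult)
    show ?thesis using H fe ge by (simp add: F_one_elts F_one_nrm F_space_nrm entire_mult w)
  qed
  have atoms: "\<exists>C. \<forall>z t r. 0 \<le> t \<longrightarrow> t \<le> 1 \<longrightarrow> r < l \<longrightarrow>
      nrm (F_space (ereal p) l \<alpha>) (atom l \<alpha> (2 * l) t z) * nrm (F_space (ereal q) l \<alpha>) (atom l \<alpha> (2 * l + r) t z)
        \<le> C * max 1 (cmod z) ^ (2 * l + r + 2) * exp (\<alpha> * t\<^sup>2 * cmod z ^ (2 * l) / 4)"
  proof -
    obtain C1 where C1: "C1 > 0" "\<And>t z. 0 \<le> t \<Longrightarrow> t \<le> 1 \<Longrightarrow>
      nrm (F_space (ereal p) l \<alpha>) (atom l \<alpha> (2 * l) t z)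
        \<le> C1 * max 1 (cmod z) powr (real (2 * l) - 2 * (real l - 1) / p) * exp (\<alpha> * t\<^sup>2 * cmod z ^ (2 * l) / 8)"
      by (rule atom_norm_bound[OF l a p1, of "2 * l"]) auto
    define Q where "Q r C \<longleftrightarrow> C > 0 \<and> (\<forall>t z. 0 \<le> t \<longrightarrow> t \<le> 1 \<longrightarrow>
      nrm (F_space (ereal q) l \<alpha>) (atom l \<alpha> (2 * l + r) t z)
        \<le> C * max 1 (cmod z) powr (real (2 * l + r) - 2 * (real l - 1) / q) * exp (\<alpha> * t\<^sup>2 * cmod z ^ (2 * l) / 8))" for r C
    have "\<exists>C. Q r C" for r
      unfolding Q_def by (rule atom_norm_bound[OF l a q1, of "2 * l + r"]) auto
    then obtain C2 where Q: "\<And>r. Q r (C2 r)" by metis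
    show ?thesis
    proof (intro exI[of _ "C1 * (\<Sum>r<l. C2 r)"] allI impI)
      fix z :: complex and t :: real and r assume t: "0 \<le> t" "t \<le> 1" and r: "r < l"
      let ?\<mu> = "max 1 (cmod z)"
      let ?e = "exp (\<alpha> * t\<^sup>2 * cmod z ^ (2 * l) / 8)"
      have C2: "C2 r \<le> (\<Sum>r<l. C2 r)"
        using Q r unfolding Q_def by (intro member_le_sum) (auto intro: less_imp_le)
      have n0: "nrm (F_space (ereal q) l \<alpha>) (atom l \<alpha> (2 * l + r) t z) \<ge> 0"
        using E_class_entire[OF atom_in_E_class[OF l]] by (simp add: F_space_nrm)
      have "nrm (F_space (ereal p) l \<alpha>) (atom l \<alpha> (2 * l) t z) * nrm (F_space (ereal q) l \<alpha>) (atom l \<alpha> (2 * l + r) t z)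
        \<le> (C1 * ?\<mu> powr (real (2 * l) - 2 * (real l - 1) / p) * ?e) * (C2 r * ?\<mu> powr (real (2 * l + r) - 2 * (real l - 1) / q) * ?e)"
        using C1(1) n0 Q[of r] t unfolding Q_def by (intro mult_mono C1(2)) auto
      also have "\<dots> = C1 * C2 r * (?\<mu> powr (real (2 * l) - 2 * (real l - 1) / p) * ?\<mu> powr (real (2 * l + r) - 2 * (real l - 1) / q)) * (?e * ?e)"
        by (simp only: mult_ac)
      also have "?\<mu> powr (real (2 * l) - 2 * (real l - 1) / p) * ?\<mu> powr (real (2 * l + r) - 2 * (real l - 1) / q) = ?\<mu> ^ (2 * l + r + 2)"
      proof -
        \<comment> \<open>Only the sum of the reciprocals of the exponents enters.\<close>
        have "(real (2 * l) - 2 * (real l - 1) / p) + (real (2 * l + r) - 2 * (real l - 1) / q)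
          = real (4 * l + r) - 2 * (real l - 1) * (1 / p + 1 / q)"
          by (simp add: algebra_simps diff_divide_distrib)
        also have "\<dots> = real (2 * l + r + 2)" unfolding pq(2) by simp
        finally have e: "(real (2 * l) - 2 * (real l - 1) / p) + (real (2 * l + r) - 2 * (real l - 1) / q) = real (2 * l + r + 2)" .
        show ?thesis unfolding powr_add[symmetric] e by (rule powr_realpow) simp
      qed
      also have "?e * ?e = exp (\<alpha> * t\<^sup>2 * cmod z ^ (2 * l) / 4)" by (simp add: exp_add[symmetric])
      also have "C1 * C2 r * ?\<mu> ^ (2 * l + r + 2) * exp (\<alpha> * t\<^sup>2 * cmod z ^ (2 * l) / 4)
        \<le> C1 * (\<Sum>r<l. C2 r) * ?\<mu> ^ (2 * l + r + 2) * exp (\<alpha> * t\<^sup>2 * cmod z ^ (2 * l) / 4)"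
        using C1(1) C2 by (intro mult_right_mono mult_left_mono) auto
      finally show "nrm (F_space (ereal p) l \<alpha>) (atom l \<alpha> (2 * l) t z) * nrm (F_space (ereal q) l \<alpha>) (atom l \<alpha> (2 * l + r) t z)
        \<le> C1 * (\<Sum>r<l. C2 r) * ?\<mu> ^ (2 * l + r + 2) * exp (\<alpha> * t\<^sup>2 * cmod z ^ (2 * l) / 4)" .
    qed
  qed
  show ?thesis
  proof
    show "E_class l \<subseteq> elts (F_space (ereal p) l \<alpha>)" "E_class l \<subseteq> elts (F_space (ereal q) l \<alpha>)"
      by (intro E_class_subset_F_space l a p1 q1)+
    show "0 \<le> nrm (F_space (ereal p) l \<alpha>) f" if "f \<in> elts (F_space (ereal p) l \<alpha>)" for f
      using that by (simp add: F_space_elts F_space_nrm)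
    show "0 \<le> nrm (F_space (ereal q) l \<alpha>) f" if "f \<in> elts (F_space (ereal q) l \<alpha>)" for f
      using that by (simp add: F_space_elts F_space_nrm)
    show "summable (\<lambda>m. cmod (c m) * nrm (F_space (ereal p) l \<alpha>) (\<lambda>z. z ^ m))" if "f \<in> E_class l" "power_sum c f" for f c
      by (rule E_class_monomial_norms_summable[OF l a p1 that])
  qed (use l a mem F_space_cmult[OF p1] atoms in auto)
qed

text \<open>The space \<open>Y\<close> stands for \<open>F_space \<infinity> l \<alpha>\<close> and for
\<open>f_inf_space l \<alpha>\<close>, which have the same norm.\<close>
lemma hankel_pair_endpoint:
  assumes l: "l \<ge> 1" and a: "\<alpha> > 0"
    and Y: "elts Y \<subseteq> elts (F_space \<infinity> l \<alpha>)" "nrm Y = nrm (F_space \<infinity> l \<alpha>)" "E_class l \<subseteq> elts Y"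
  shows "hankel_pair l \<alpha> (F_space 1 l \<alpha>) Y"
proof -
  let ?N = "nrm (F_space \<infinity> l \<alpha>)"
  have N0: "0 \<le> ?N g" if "g \<in> elts (F_space \<infinity> l \<alpha>)" for g
    using F_inf_D(2)[OF that, of 0] weighted_nonneg order_trans by blast
  have mem: "(\<lambda>z. f z * g z) \<in> elts (F_space 1 l (2 * \<alpha>)) \<and>
      nrm (F_space 1 l (2 * \<alpha>)) (\<lambda>z. f z * g z) \<le> nrm (F_space 1 l \<alpha>) f * ?N g"
    if f: "f \<in> elts (F_space 1 l \<alpha>)" and g: "g \<in> elts (F_space \<infinity> l \<alpha>)" for f g
  proof -
    have fe: "f \<in> entire" "integrable lborel (weighted l \<alpha> f)" using f by (auto simp: F_one_elts)
    have ge: "g \<in> entire" by (rule F_inf_D(1)[OF g])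
    have fg: "(\<lambda>z. f z * g z) \<in> entire" by (rule entire_mult[OF fe(1) ge])
    have [measurable]: "(\<lambda>z. f z * g z) \<in> borel_measurable borel" by (rule entire_measurable[OF fg])
    have le: "weighted l (2 * \<alpha>) (\<lambda>z. f z * g z) z \<le> weighted l \<alpha> f z * ?N g" for z
      unfolding weighted_mult by (intro mult_left_mono F_inf_D(2)[OF g]) simp
    have i: "integrable lborel (\<lambda>z. weighted l \<alpha> f z * ?N g)" using fe(2) by (rule integrable_mult_left)
    have ii: "integrable lborel (weighted l (2 * \<alpha>) (\<lambda>z. f z * g z))"
    proof (rule Bochner_Integration.integrable_bound[OF i])
      show "AE z in lborel. norm (weighted l (2 * \<alpha>) (\<lambda>z. f z * g z) z) \<le> norm (weighted l \<alpha> f z * ?N g)"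
        using le by (intro AE_I2) (simp add: order_trans[OF _ abs_ge_self])
    qed measurable
    have "(LINT z|lborel. weighted l (2 * \<alpha>) (\<lambda>z. f z * g z) z) \<le> (LINT z|lborel. weighted l \<alpha> f z * ?N g)"
      by (intro integral_mono ii i le)
    then show ?thesis using fg ii fe by (simp add: F_one_elts F_one_nrm)
  qed
  have atoms: "\<exists>C. \<forall>z t r. 0 \<le> t \<longrightarrow> t \<le> 1 \<longrightarrow> r < l \<longrightarrow>
      nrm (F_space 1 l \<alpha>) (atom l \<alpha> (2 * l) t z) * ?N (atom l \<alpha> (2 * l + r) t z)
        \<le> C * max 1 (cmod z) ^ (2 * l + r + 2) * exp (\<alpha> * t\<^sup>2 * cmod z ^ (2 * l) / 4)"
  proof -
    obtain C1 where C1: "C1 > 0" "\<And>t z. 0 \<le> t \<Longrightarrow> t \<le> 1 \<Longrightarrow>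
      nrm (F_space (ereal 1) l \<alpha>) (atom l \<alpha> (2 * l) t z)
        \<le> C1 * max 1 (cmod z) powr (real (2 * l) - 2 * (real l - 1) / 1) * exp (\<alpha> * t\<^sup>2 * cmod z ^ (2 * l) / 8)"
      by (rule atom_norm_bound[OF l a order_refl, of "2 * l"]) auto
    define Q where "Q r C \<longleftrightarrow> C > 0 \<and> (\<forall>t z w. 0 \<le> t \<longrightarrow> t \<le> 1 \<longrightarrow>
      weighted l \<alpha> (atom l \<alpha> (2 * l + r) t z) w
        \<le> C * max 1 (cmod z) ^ (2 * l + r) * exp (\<alpha> * t\<^sup>2 * cmod z ^ (2 * l) / 8))" for r C
    have "\<exists>C. Q r C" for r
      unfolding Q_def by (rule atom_weighted_bound[OF l a, of "2 * l + r"]) auto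
    then obtain C2 where Q: "\<And>r. Q r (C2 r)" by metis
    show ?thesis
    proof (intro exI[of _ "C1 * (\<Sum>r<l. C2 r)"] allI impI)
      fix z :: complex and t :: real and r assume t: "0 \<le> t" "t \<le> 1" and r: "r < l"
      let ?\<mu> = "max 1 (cmod z)"
      let ?e = "exp (\<alpha> * t\<^sup>2 * cmod z ^ (2 * l) / 8)"
      have C2: "C2 r \<le> (\<Sum>r<l. C2 r)"
        using Q r unfolding Q_def by (intro member_le_sum) (auto intro: less_imp_le)
      have at: "atom l \<alpha> (2 * l + r) t z \<in> elts (F_space \<infinity> l \<alpha>)" using atom_in_E_class[OF l] Y by blast
      have two: "?\<mu> powr (real (2 * l) - 2 * (real l - 1) / 1) = ?\<mu> ^ 2"
        by (simp add: powr_numeral)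
      have 1: "nrm (F_space 1 l \<alpha>) (atom l \<alpha> (2 * l) t z) \<le> C1 * ?\<mu> ^ 2 * ?e"
        using C1(2)[OF t, of z] unfolding two by (simp add: one_ereal_def[symmetric])
      have 2: "?N (atom l \<alpha> (2 * l + r) t z) \<le> C2 r * ?\<mu> ^ (2 * l + r) * ?e"
        using Q[of r] t unfolding Q_def
        by (intro F_inf_I(2) E_class_entire[OF atom_in_E_class[OF l]]) auto
      have "nrm (F_space 1 l \<alpha>) (atom l \<alpha> (2 * l) t z) * ?N (atom l \<alpha> (2 * l + r) t z)
        \<le> (C1 * ?\<mu> ^ 2 * ?e) * (C2 r * ?\<mu> ^ (2 * l + r) * ?e)"
        using C1(1) by (intro mult_mono 1 2 N0[OF at]) auto
      also have "\<dots> = C1 * C2 r * (?\<mu> ^ 2 * ?\<mu> ^ (2 * l + r)) * (?e * ?e)" by (simp only: mult_ac)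
      also have "?\<mu> ^ 2 * ?\<mu> ^ (2 * l + r) = ?\<mu> ^ (2 * l + r + 2)" by (simp add: power_add[symmetric] add.commute)
      also have "?e * ?e = exp (\<alpha> * t\<^sup>2 * cmod z ^ (2 * l) / 4)" by (simp add: exp_add[symmetric])
      also have "C1 * C2 r * ?\<mu> ^ (2 * l + r + 2) * exp (\<alpha> * t\<^sup>2 * cmod z ^ (2 * l) / 4)
        \<le> C1 * (\<Sum>r<l. C2 r) * ?\<mu> ^ (2 * l + r + 2) * exp (\<alpha> * t\<^sup>2 * cmod z ^ (2 * l) / 4)"
        using C1(1) C2 by (intro mult_right_mono mult_left_mono) auto
      finally show "nrm (F_space 1 l \<alpha>) (atom l \<alpha> (2 * l) t z) * ?N (atom l \<alpha> (2 * l + r) t z)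
        \<le> C1 * (\<Sum>r<l. C2 r) * ?\<mu> ^ (2 * l + r + 2) * exp (\<alpha> * t\<^sup>2 * cmod z ^ (2 * l) / 4)" .
    qed
  qed
  show ?thesis
  proof
    show "E_class l \<subseteq> elts (F_space 1 l \<alpha>)" by (rule E_class_subset_F_one[OF l a])
    show "summable (\<lambda>m. cmod (c m) * nrm (F_space 1 l \<alpha>) (\<lambda>z. z ^ m))" if "f \<in> E_class l" "power_sum c f" for f c
      using E_class_monomial_norms_summable[OF l a order_refl that] by (simp add: one_ereal_def[symmetric])
  qed (use l a Y mem N0 F_one_cmult F_one_nrm_nonneg atoms in \<open>auto simp: subset_iff\<close>)
qed

lemma hankel_pair_f_inf: "l \<ge> 1 \<Longrightarrow> \<alpha> > 0 \<Longrightarrow> hankel_pair l \<alpha> (F_space 1 l \<alpha>) (f_inf_space l \<alpha>)"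
  by (intro hankel_pair_endpoint f_inf_space_subset f_inf_space_nrm E_class_subset_f_inf_space)

lemma hankel_pair_F_inf: "l \<ge> 1 \<Longrightarrow> \<alpha> > 0 \<Longrightarrow> hankel_pair l \<alpha> (F_space 1 l \<alpha>) (F_space \<infinity> l \<alpha>)"
  using E_class_subset_f_inf_space[of l \<alpha>] f_inf_space_subset[of l \<alpha>]
  by (intro hankel_pair_endpoint) auto

section \<open>The dual space\<close>

text \<open>An extension of \<open>f \<mapsto> pairing l \<alpha> f g\<close> from \<open>E\<close> to \<open>F_space
1 l (2 * \<alpha>)\<close>: after the dilation of \<open>g\<close> the weight at \<open>2 *
\<alpha>\<close> replaces the one at \<open>\<alpha>\<close>, and the integral converges absolutely.\<close>
definition dual_functional :: "nat \<Rightarrow> real \<Rightarrow> (complex \<Rightarrow> complex) \<Rightarrow> (complex \<Rightarrow> complex) \<Rightarrow> complex" where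
  "dual_functional l \<alpha> g f = of_real (2 powr (1 / l)) *
    (LINT z|lborel. f z * cnj (g (of_real (2 powr (1 / l)) * z)) * of_real (exp (- (2 * \<alpha>) * cmod z ^ (2 * l))))"

lemma F_inf_growth:
  assumes "g \<in> elts (F_space \<infinity> l (\<alpha> / 2))"
  shows "cmod (g z) \<le> nrm (F_space \<infinity> l (\<alpha> / 2)) g * exp (\<alpha> / 4 * cmod z ^ (2 * l))"
  using F_inf_D(2)[OF assms, of z] unfolding weighted_le_iff by simp

lemma F_inf_nrm_nonneg: "g \<in> elts (F_space \<infinity> l \<alpha>) \<Longrightarrow> 0 \<le> nrm (F_space \<infinity> l \<alpha>) g"
  using F_inf_D(2)[of g l \<alpha> 0] weighted_nonneg order_trans by blast

lemma dilated_F_inf_growth: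
  assumes l: "l \<ge> 1" and g: "g \<in> elts (F_space \<infinity> l (\<alpha> / 2))"
  shows "cmod (g (of_real (2 powr (1 / l)) * z)) \<le> nrm (F_space \<infinity> l (\<alpha> / 2)) g * exp (\<alpha> * cmod z ^ (2 * l))"
proof -
  have "(2 powr (1 / real l)) ^ (2 * l) = 4" using l by (simp add: powr_power_eq powr_numeral)
  then show ?thesis
    using F_inf_growth[OF g, of "of_real (2 powr (1 / l)) * z"] by (simp add: norm_mult power_mult_distrib)
qed

lemma
  assumes l: "l \<ge> 1" and g: "g \<in> elts (F_space \<infinity> l (\<alpha> / 2))" and f: "f \<in> elts (F_space 1 l (2 * \<alpha>))"
  shows dual_functional_integrable: "integrable lborel
      (\<lambda>z. f z * cnj (g (of_real (2 powr (1 / l)) * z)) * of_real (exp (- (2 * \<alpha>) * cmod z ^ (2 * l))))" (is "integrable lborel ?F")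
    and dual_functional_bound: "cmod (dual_functional l \<alpha> g f)
      \<le> 2 powr (1 / l) * nrm (F_space \<infinity> l (\<alpha> / 2)) g * nrm (F_space 1 l (2 * \<alpha>)) f"
proof -
  let ?G = "nrm (F_space \<infinity> l (\<alpha> / 2)) g"
  have fe: "f \<in> entire" and fi: "integrable lborel (weighted l (2 * \<alpha>) f)" using f by (auto simp: F_one_elts)
  have [measurable]: "f \<in> borel_measurable borel" "g \<in> borel_measurable borel"
    using fe F_inf_D(1)[OF g] by (auto intro: entire_measurable)
  have bnd: "norm (?F z) \<le> ?G * weighted l (2 * \<alpha>) f z" for z
  proof -
    have "norm (?F z) = cmod (f z) * cmod (g (of_real (2 powr (1 / l)) * z)) * exp (- (2 * \<alpha>) * cmod z ^ (2 * l))"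
      by (simp add: norm_mult)
    also have "\<dots> \<le> cmod (f z) * (?G * exp (\<alpha> * cmod z ^ (2 * l))) * exp (- (2 * \<alpha>) * cmod z ^ (2 * l))"
      by (intro mult_right_mono mult_left_mono dilated_F_inf_growth[OF l g]) auto
    also have "\<dots> = ?G * (cmod (f z) * (exp (\<alpha> * cmod z ^ (2 * l)) * exp (- (2 * \<alpha>) * cmod z ^ (2 * l))))"
      by (simp only: mult_ac)
    also have "exp (\<alpha> * cmod z ^ (2 * l)) * exp (- (2 * \<alpha>) * cmod z ^ (2 * l)) = exp (- (2 * \<alpha>) * cmod z ^ (2 * l) / 2)"
      by (simp add: exp_add[symmetric])
    finally show ?thesis by (simp add: weighted_def)
  qed
  show i: "integrable lborel ?F"
  proof (rule Bochner_Integration.integrable_bound[OF integrable_mult_right[OF fi, of ?G]])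
    show "AE z in lborel. norm (?F z) \<le> norm (?G * weighted l (2 * \<alpha>) f z)"
      using bnd by (intro AE_I2 order_trans[OF bnd]) simp
  qed measurable
  have "norm (LINT z|lborel. ?F z) \<le> (LINT z|lborel. ?G * weighted l (2 * \<alpha>) f z)"
    by (rule Bochner_Integration.integral_norm_bound_integral[OF i integrable_mult_right[OF fi]]) (rule bnd)
  also have "\<dots> = ?G * nrm (F_space 1 l (2 * \<alpha>)) f" by (simp add: F_one_nrm[OF fe])
  finally show "cmod (dual_functional l \<alpha> g f) \<le> 2 powr (1 / l) * ?G * nrm (F_space 1 l (2 * \<alpha>)) f"
    by (simp add: dual_functional_def norm_mult mult.assoc)
qed

lemma dual_functional_linear:
  assumes l: "l \<ge> 1" and g: "g \<in> elts (F_space \<infinity> l (\<alpha> / 2))"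
  shows "linear_form_on (elts (F_space 1 l (2 * \<alpha>))) (dual_functional l \<alpha> g)"
  unfolding linear_form_on_def
proof (intro conjI ballI allI)
  fix f h assume f: "f \<in> elts (F_space 1 l (2 * \<alpha>))" and h: "h \<in> elts (F_space 1 l (2 * \<alpha>))"
  show "dual_functional l \<alpha> g (\<lambda>z. f z + h z) = dual_functional l \<alpha> g f + dual_functional l \<alpha> g h"
    using dual_functional_integrable[OF l g f] dual_functional_integrable[OF l g h]
    by (simp add: dual_functional_def distrib_right distrib_left)
next
  fix c f
  show "dual_functional l \<alpha> g (\<lambda>z. c * f z) = c * dual_functional l \<alpha> g f"
    unfolding dual_functional_def mult.assoc by (simp only: integral_mult_right_zero mult.left_commute)
qed

text \<open>Compare the two series in Taylor coefficients: dilation multiplies the coefficients of \<open>g\<close>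
by powers of \<open>2 powr (1 / l)\<close>, which \<open>power_moment_double\<close> converts into the
change of weight.\<close>
lemma dual_functional_eq_pairing:
  assumes l: "l \<ge> 1" and a: "\<alpha> > 0" and g: "g \<in> elts (F_space \<infinity> l (\<alpha> / 2))" and f: "f \<in> E_class l"
  shows "dual_functional l \<alpha> g f = pairing l \<alpha> f g"
proof -
  let ?s = "2 powr (1 / real l)"
  have ge: "g \<in> entire" by (rule F_inf_D(1)[OF g])
  have gb: "power_sum (taylor g) g" by (rule entire_power_sum[OF ge])
  have fa: "power_sum (taylor f) f" by (rule entire_power_sum[OF E_class_entire[OF f]])
  have [measurable]: "f \<in> borel_measurable borel" "g \<in> borel_measurable borel"
    using ge E_class_entire[OF f] by (auto intro: entire_measurable)
  define gs where "gs z = g (of_real ?s * z)" for z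
  have gsm: "gs \<in> borel_measurable borel" unfolding gs_def[abs_def] by measurable
  have gsb: "power_sum (\<lambda>m. of_real (?s ^ m) * taylor g m) gs"
    unfolding power_sum_def
  proof
    fix z
    have "(\<lambda>m. taylor g m * (of_real ?s * z) ^ m) sums gs z" using gb by (simp add: power_sum_def gs_def)
    then show "(\<lambda>m. of_real (?s ^ m) * taylor g m * z ^ m) sums gs z"
      by (simp add: power_mult_distrib mult_ac)
  qed
  have gr: "cmod (gs z) \<le> nrm (F_space \<infinity> l (\<alpha> / 2)) g * exp (\<alpha> * cmod z ^ (2 * l))" for z
    unfolding gs_def by (rule dilated_F_inf_growth[OF l g])
  have a2: "2 * \<alpha> > 0" "\<alpha> < 2 * \<alpha>" "\<alpha> / 4 < \<alpha>" using a by auto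
  have "(\<lambda>m. taylor f m * (cnj (of_real (?s ^ m) * taylor g m) * of_real (power_moment l (2 * \<alpha>) m))) sums pairing l (2 * \<alpha>) f gs"
    by (rule pairing_sums(1)[OF l a2(1) f fa gsb a2(2) gr])
  then have "(\<lambda>m. of_real ?s * (taylor f m * (cnj (of_real (?s ^ m) * taylor g m) * of_real (power_moment l (2 * \<alpha>) m)))) sums (of_real ?s * pairing l (2 * \<alpha>) f gs)"
    by (rule sums_mult)
  moreover have "of_real ?s * (taylor f m * (cnj (of_real (?s ^ m) * taylor g m) * of_real (power_moment l (2 * \<alpha>) m)))
    = taylor f m * (cnj (taylor g m) * of_real (power_moment l \<alpha> m))" for m
    unfolding power_moment_double[OF l a] by simp
  moreover have "(\<lambda>m. taylor f m * (cnj (taylor g m) * of_real (power_moment l \<alpha> m))) sums pairing l \<alpha> f g"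
    by (rule pairing_sums(1)[OF l a f fa gb a2(3) F_inf_growth[OF g]])
  ultimately have "of_real ?s * pairing l (2 * \<alpha>) f gs = pairing l \<alpha> f g" by (simp only: sums_unique2)
  moreover have "pairing l (2 * \<alpha>) f gs = (LINT z|lborel. f z * cnj (gs z) * of_real (exp (- (2 * \<alpha>) * cmod z ^ (2 * l))))"
    by (rule pairing_lborel[OF _ gsm]) measurable
  ultimately show ?thesis by (simp only: dual_functional_def gs_def)
qed

lemma (in hankel_pair) Hankel_form_extends:
  assumes b: "b \<in> elts (F_space \<infinity> l (\<alpha> / 2))"
  shows "extends_to_bounded_bilinear_form (E_class l) (hankel_form l \<alpha> b) X Y"
proof -
  define B where "B f g = dual_functional l \<alpha> b (\<lambda>z. f z * g z)" for f g
  note lin = dual_functional_linear[OF l b, unfolded linear_form_on_def]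
  have add: "dual_functional l \<alpha> b (\<lambda>z. f z + h z) = dual_functional l \<alpha> b f + dual_functional l \<alpha> b h"
    if "f \<in> elts (F_space 1 l (2 * \<alpha>))" "h \<in> elts (F_space 1 l (2 * \<alpha>))" for f h
    using lin that by blast
  have cm: "dual_functional l \<alpha> b (\<lambda>z. c * f z) = c * dual_functional l \<alpha> b f"
    if "f \<in> elts (F_space 1 l (2 * \<alpha>))" for c f
    using lin that by blast
  have "bounded_bilinear_form X Y B"
    unfolding bounded_bilinear_form_def
  proof (intro conjI ballI)
    show "linear_form_on (elts X) (\<lambda>f. B f g)" if g: "g \<in> elts Y" for g
      unfolding linear_form_on_def B_def using add[OF Hoelder_mem Hoelder_mem, OF _ g _ g] cm[OF Hoelder_mem, OF _ g]
      by (simp add: distrib_right mult.assoc)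
    show "linear_form_on (elts Y) (B f)" if f: "f \<in> elts X" for f
      unfolding linear_form_on_def B_def using add[OF Hoelder_mem[OF f] Hoelder_mem[OF f]] cm[OF Hoelder_mem[OF f]]
      by (simp add: distrib_left mult.left_commute)
    let ?K = "2 powr (1 / l) * nrm (F_space \<infinity> l (\<alpha> / 2)) b"
    have K0: "?K \<ge> 0" using F_inf_nrm_nonneg[OF b] by simp
    have "cmod (B f g) \<le> ?K * nrm X f * nrm Y g" if f: "f \<in> elts X" and g: "g \<in> elts Y" for f g
    proof -
      have "cmod (B f g) \<le> ?K * nrm (F_space 1 l (2 * \<alpha>)) (\<lambda>z. f z * g z)"
        unfolding B_def by (rule dual_functional_bound[OF l b Hoelder_mem[OF f g]])
      also have "\<dots> \<le> ?K * (nrm X f * nrm Y g)" by (intro mult_left_mono Hoelder_le[OF f g] K0)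
      finally show ?thesis by (simp add: mult.assoc)
    qed
    then show "\<exists>C. \<forall>f\<in>elts X. \<forall>g\<in>elts Y. cmod (B f g) \<le> C * nrm X f * nrm Y g" by blast
  qed
  moreover have "\<forall>f\<in>E_class l. \<forall>g\<in>E_class l. B f g = hankel_form l \<alpha> b f g"
    by (simp add: B_def hankel_form_def dual_functional_eq_pairing[OF l \<alpha> b] E_class_mult)
  ultimately show ?thesis unfolding extends_to_bounded_bilinear_form_def by blast
qed

lemma (in hankel_pair) Hankel_form_bounded_iff:
  "b \<in> H_inf l \<alpha> \<Longrightarrow> extends_to_bounded_bilinear_form (E_class l) (hankel_form l \<alpha> b) X Y
    \<longleftrightarrow> b \<in> elts (F_space \<infinity> l (\<alpha> / 2))"
  using bounded_Hankel_form_symbol Hankel_form_extends by blast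

lemma kernel_F_one_bound:
  assumes l: "l \<ge> 1" and a: "\<alpha> > 0"
  obtains C where "C > 0"
    "\<And>z. nrm (F_space 1 l (2 * \<alpha>)) (kernel_at l \<alpha> z) \<le> C * exp (\<alpha> / 4 * cmod z ^ (2 * l))"
proof -
  interpret hankel_pair l \<alpha> "F_space 1 l \<alpha>" "f_inf_space l \<alpha>" by (rule hankel_pair_f_inf[OF l a])
  show ?thesis using kernel_norm_bound that by blast
qed

lemma linear_form_on_add: "linear_form_on V u \<Longrightarrow> f \<in> V \<Longrightarrow> g \<in> V \<Longrightarrow> u (\<lambda>z. f z + g z) = u f + u g"
  and linear_form_on_cmult: "linear_form_on V u \<Longrightarrow> f \<in> V \<Longrightarrow> u (\<lambda>z. c * f z) = c * u f"
  unfolding linear_form_on_def by blast+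

lemma bounded_functional_diff:
  assumes u: "linear_form_on (elts (F_space 1 l \<beta>)) u"
    and f: "f \<in> elts (F_space 1 l \<beta>)" and g: "g \<in> elts (F_space 1 l \<beta>)"
  shows "u (\<lambda>z. f z - g z) = u f - u g"
proof -
  have g': "(\<lambda>z. - 1 * g z) \<in> elts (F_space 1 l \<beta>)" by (rule F_one_cmult(1)[OF g])
  have "u (\<lambda>z. f z + - 1 * g z) = u f + u (\<lambda>z. - 1 * g z)"
    by (rule linear_form_on_add[OF u f g'])
  also have "u (\<lambda>z. - 1 * g z) = - 1 * u g" by (rule linear_form_on_cmult[OF u g])
  finally show ?thesis by simp
qed

lemma bounded_functional_sums:
  assumes l: "l \<ge> 1" and b: "\<beta> > 0" and u: "linear_form_on (elts (F_space 1 l \<beta>)) u"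
    and C: "\<And>f. f \<in> elts (F_space 1 l \<beta>) \<Longrightarrow> cmod (u f) \<le> C * nrm (F_space 1 l \<beta>) f"
    and f: "f \<in> E_class l" and a: "power_sum a f"
  shows "(\<lambda>m. a m * u (\<lambda>z. z ^ m)) sums u f"
proof -
  let ?V = "elts (F_space 1 l \<beta>)"
  have mon: "(\<lambda>z. c * z ^ m) \<in> ?V" for c m by (rule monomial_in_F_one[OF l b])
  have poly: "(\<lambda>z. \<Sum>m<n. a m * z ^ m) \<in> ?V" for n
    using polynomial_in_E_class[OF l] E_class_subset_F_one[OF l b] by blast
  have fV: "f \<in> ?V" using f E_class_subset_F_one[OF l b] by blast
  have umon: "u (\<lambda>z. a m * z ^ m) = a m * u (\<lambda>z. z ^ m)" for m
    using linear_form_on_cmult[OF u mon[of 1 m], of "a m"] by simp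
  have up: "u (\<lambda>z. \<Sum>m<n. a m * z ^ m) = (\<Sum>m<n. a m * u (\<lambda>z. z ^ m))" for n
  proof (induction n)
    case 0
    have "u (\<lambda>z. 0 * (1 * z ^ 0)) = 0 * u (\<lambda>z. 1 * z ^ 0)" by (rule linear_form_on_cmult[OF u mon])
    then show ?case by simp
  next
    case (Suc n)
    have "u (\<lambda>z. (\<Sum>m<n. a m * z ^ m) + a n * z ^ n) = u (\<lambda>z. \<Sum>m<n. a m * z ^ m) + u (\<lambda>z. a n * z ^ n)"
      by (rule linear_form_on_add[OF u poly mon])
    then show ?case by (simp add: Suc umon)
  qed
  have "summable (\<lambda>m. cmod (a m) * nrm (F_space 1 l \<beta>) (\<lambda>z. z ^ m))"
    using E_class_monomial_norms_summable[OF l b order_refl f a] by (simp add: one_ereal_def[symmetric])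
  from F_one_partial_sums_converge[OF l b a this]
  have "(\<lambda>n. C * nrm (F_space 1 l \<beta>) (\<lambda>z. f z - (\<Sum>m<n. a m * z ^ m))) \<longlonglongrightarrow> C * 0" by (rule tendsto_mult_left)
  then have lim: "(\<lambda>n. C * nrm (F_space 1 l \<beta>) (\<lambda>z. f z - (\<Sum>m<n. a m * z ^ m))) \<longlonglongrightarrow> 0" by simp
  have "(\<lambda>n. (\<Sum>m<n. a m * u (\<lambda>z. z ^ m)) - u f) \<longlonglongrightarrow> 0"
  proof (rule Lim_null_comparison[OF _ lim], intro always_eventually allI)
    fix n
    have "u (\<lambda>z. f z - (\<Sum>m<n. a m * z ^ m)) = u f - (\<Sum>m<n. a m * u (\<lambda>z. z ^ m))"
      unfolding up[symmetric] by (rule bounded_functional_diff[OF u fV poly])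
    then show "norm ((\<Sum>m<n. a m * u (\<lambda>z. z ^ m)) - u f) \<le> C * nrm (F_space 1 l \<beta>) (\<lambda>z. f z - (\<Sum>m<n. a m * z ^ m))"
      using C[OF F_one_diff(1)[OF fV poly], of n] by (simp only: norm_minus_commute)
  qed
  then show ?thesis unfolding sums_def by (rule LIM_zero_cancel)
qed

text \<open>If \<open>u\<close> is represented by \<open>g\<close>, then \<open>u\<close> at the kernels is
\<open>cnj g\<close>; so there is only one candidate. It is entire because \<open>u\<close> may be
applied to the Taylor series of the kernels, its growth is that of the norms of the kernels, and it
represents \<open>u\<close> by comparison of Taylor series.\<close>
lemma bounded_functional_symbol:
  assumes l: "l \<ge> 1" and a: "\<alpha> > 0" and u: "bounded_functional (F_space 1 l (2 * \<alpha>)) u"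
  shows "(\<lambda>z. cnj (u (kernel_at l \<alpha> z))) \<in> elts (F_space \<infinity> l (\<alpha> / 2))"
    and "represents (E_class l) (pairing l \<alpha>) u (\<lambda>z. cnj (u (kernel_at l \<alpha> z)))"
proof -
  let ?X = "F_space 1 l (2 * \<alpha>)"
  let ?g = "\<lambda>z. cnj (u (kernel_at l \<alpha> z))"
  have a2: "2 * \<alpha> > 0" using a by simp
  obtain C where lin: "linear_form_on (elts ?X) u" and C: "\<And>f. f \<in> elts ?X \<Longrightarrow> cmod (u f) \<le> C * nrm ?X f"
    using u unfolding bounded_functional_def by blast
  obtain K where K: "K > 0" "\<And>z. nrm ?X (kernel_at l \<alpha> z) \<le> K * exp (\<alpha> / 4 * cmod z ^ (2 * l))"
    by (rule kernel_F_one_bound[OF l a]) blast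
  have KX: "kernel_at l \<alpha> z \<in> elts ?X" for z
    using kernel_at_in_E_class[OF l a] E_class_subset_F_one[OF l a2] by blast
  have sums: "(\<lambda>m. c m * u (\<lambda>z. z ^ m)) sums u f" if "f \<in> E_class l" "power_sum c f" for c f
    by (rule bounded_functional_sums[OF l a2 lin _ that]) (rule C)
  define b where "b m = cnj (u (\<lambda>z. z ^ m)) / of_real (power_moment l \<alpha> m)" for m
  have gb: "power_sum b ?g"
    unfolding power_sum_def
  proof
    fix z
    have "(\<lambda>m. cnj z ^ m / of_real (power_moment l \<alpha> m) * u (\<lambda>z. z ^ m)) sums u (kernel_at l \<alpha> z)"
      by (rule sums[OF kernel_at_in_E_class[OF l a] kernel_at_power_sum[OF l a]])
    then have "(\<lambda>m. cnj (cnj z ^ m / of_real (power_moment l \<alpha> m) * u (\<lambda>z. z ^ m))) sums ?g z"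
      unfolding sums_cnj .
    then show "(\<lambda>m. b m * z ^ m) sums ?g z" by (simp add: b_def mult.commute)
  qed
  have ge: "?g \<in> entire" by (rule power_sum_entire[OF gb])
  have gr: "cmod (?g z) \<le> \<bar>C\<bar> * K * exp (\<alpha> / 4 * cmod z ^ (2 * l))" for z
  proof -
    have "cmod (?g z) \<le> C * nrm ?X (kernel_at l \<alpha> z)" using C[OF KX[of z]] by simp
    also have "\<dots> \<le> \<bar>C\<bar> * nrm ?X (kernel_at l \<alpha> z)" using F_one_nrm_nonneg[OF KX[of z]] by (intro mult_right_mono) auto
    also have "\<dots> \<le> \<bar>C\<bar> * (K * exp (\<alpha> / 4 * cmod z ^ (2 * l)))" by (intro mult_left_mono K) auto
    finally show ?thesis by (simp add: mult.assoc)
  qed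
  show "?g \<in> elts (F_space \<infinity> l (\<alpha> / 2))"
    by (rule F_inf_I(1)[OF ge, of _ _ "\<bar>C\<bar> * K"]) (use gr in \<open>simp add: weighted_le_iff\<close>)
  show "represents (E_class l) (pairing l \<alpha>) u ?g"
    unfolding represents_def
  proof
    fix f assume f: "f \<in> E_class l"
    have fa: "power_sum (taylor f) f" by (rule entire_power_sum[OF E_class_entire[OF f]])
    have "\<alpha> / 4 < \<alpha>" using a by simp
    from pairing_sums(1)[OF l a f fa gb this gr]
    have "(\<lambda>m. taylor f m * (cnj (b m) * of_real (power_moment l \<alpha> m))) sums pairing l \<alpha> f ?g" .
    moreover have "taylor f m * (cnj (b m) * of_real (power_moment l \<alpha> m)) = taylor f m * u (\<lambda>z. z ^ m)" for m
      using power_moment_pos[OF l a, of m] by (simp add: b_def)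
    ultimately have "(\<lambda>m. taylor f m * u (\<lambda>z. z ^ m)) sums pairing l \<alpha> f ?g" by (simp only:)
    then show "u f = pairing l \<alpha> f ?g" using sums[OF f fa] sums_unique2 by blast
  qed
qed

lemma represents_symbol_eq:
  assumes l: "l \<ge> 1" and a: "\<alpha> > 0" and g: "g \<in> elts (F_space \<infinity> l (\<alpha> / 2))"
    and r: "represents (E_class l) (pairing l \<alpha>) u g"
  shows "g = (\<lambda>z. cnj (u (kernel_at l \<alpha> z)))"
proof
  fix z
  have "\<alpha> / 4 < \<alpha>" using a by simp
  from pairing_kernel_at[OF l a F_inf_D(1)[OF g] this F_inf_growth[OF g], of z]
  have "u (kernel_at l \<alpha> z) = cnj (g z)" using r kernel_at_in_E_class[OF l a] by (simp add: represents_def)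
  then show "g z = cnj (u (kernel_at l \<alpha> z))" by simp
qed

lemma
  assumes u: "bounded_functional X u" and nn: "\<And>f. f \<in> elts X \<Longrightarrow> nrm X f \<ge> 0"
    and sc: "\<And>c f. f \<in> elts X \<Longrightarrow> (\<lambda>z. c * f z) \<in> elts X \<and> nrm X (\<lambda>z. c * f z) = cmod c * nrm X f"
    and f: "f \<in> elts X"
  shows functional_norm_bound: "cmod (u f) \<le> functional_norm X u * nrm X f"
proof -
  obtain C where lin: "linear_form_on (elts X) u" and C: "\<And>f. f \<in> elts X \<Longrightarrow> cmod (u f) \<le> C * nrm X f"
    using u unfolding bounded_functional_def by blast
  have bdd: "bdd_above ((\<lambda>f. cmod (u f)) ` {f \<in> elts X. nrm X f \<le> 1})"
  proof (rule bdd_aboveI2)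
    fix f assume "f \<in> {f \<in> elts X. nrm X f \<le> 1}"
    then have f: "f \<in> elts X" "nrm X f \<le> 1" by auto
    have "cmod (u f) \<le> C * nrm X f" by (rule C[OF f(1)])
    also have "\<dots> \<le> \<bar>C\<bar> * 1" using f nn[OF f(1)] by (intro mult_mono) auto
    finally show "cmod (u f) \<le> \<bar>C\<bar>" by simp
  qed
  show ?thesis
  proof (cases "nrm X f = 0")
    case True
    then show ?thesis using C[OF f] by simp
  next
    case False
    then have p: "nrm X f > 0" using nn[OF f] by simp
    let ?c = "of_real (1 / nrm X f) :: complex"
    have "(\<lambda>z. ?c * f z) \<in> {f \<in> elts X. nrm X f \<le> 1}" using sc[OF f, of ?c] p by (simp add: norm_divide)
    then have "cmod (u (\<lambda>z. ?c * f z)) \<le> functional_norm X u"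
      unfolding functional_norm_def by (rule cSUP_upper[OF _ bdd])
    moreover have "u (\<lambda>z. ?c * f z) = ?c * u f" by (rule linear_form_on_cmult[OF lin f])
    ultimately have "cmod ?c * cmod (u f) \<le> functional_norm X u" by (simp only: norm_mult)
    moreover have "cmod ?c = 1 / nrm X f" using p by (simp only: norm_of_real) simp
    ultimately have "1 / nrm X f * cmod (u f) \<le> functional_norm X u" by (simp only:)
    then show ?thesis using p by (simp add: field_simps)
  qed
qed

text \<open>Both sides are continuous in \<open>f\<close> and agree on polynomials, which are dense.\<close>
lemma bounded_functional_eq_dual_functional:
  assumes l: "l \<ge> 1" and a: "\<alpha> > 0" and g: "g \<in> elts (F_space \<infinity> l (\<alpha> / 2))"
    and u: "bounded_functional (F_space 1 l (2 * \<alpha>)) u"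
    and r: "represents (E_class l) (pairing l \<alpha>) u g" and f: "f \<in> elts (F_space 1 l (2 * \<alpha>))"
  shows "u f = dual_functional l \<alpha> g f"
proof -
  let ?X = "F_space 1 l (2 * \<alpha>)"
  have a2: "2 * \<alpha> > 0" using a by simp
  obtain C where lin: "linear_form_on (elts ?X) u" and C: "\<And>f. f \<in> elts ?X \<Longrightarrow> cmod (u f) \<le> C * nrm ?X f"
    using u unfolding bounded_functional_def by blast
  let ?d = "dual_functional l \<alpha> g"
  define D where "D = 2 powr (1 / l) * nrm (F_space \<infinity> l (\<alpha> / 2)) g"
  have D0: "D \<ge> 0" using F_inf_nrm_nonneg[OF g] by (simp add: D_def)
  have "cmod (u f - ?d f) \<le> 0 + e" if e: "e > 0" for e
  proof -
    define \<epsilon> where "\<epsilon> = e / (\<bar>C\<bar> + D + 1)"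
    have K: "\<bar>C\<bar> + D + 1 > 0" using D0 by simp
    have eps: "\<epsilon> > 0" using e K by (simp add: \<epsilon>_def)
    obtain n c where Q: "nrm ?X (\<lambda>z. f z - (\<Sum>m<n. c m * z ^ m)) < \<epsilon>"
      using polynomials_dense_F_one[OF l a2 f eps] by blast
    define q where "q = (\<lambda>z. \<Sum>m<n. c m * z ^ m)"
    have qE: "q \<in> E_class l" unfolding q_def by (rule polynomial_in_E_class[OF l])
    then have qX: "q \<in> elts ?X" using E_class_subset_F_one[OF l a2] by blast
    have fq: "(\<lambda>z. f z - q z) \<in> elts ?X" by (rule F_one_diff(1)[OF f qX])
    have "u q = ?d q" using r qE dual_functional_eq_pairing[OF l a g qE] by (simp add: represents_def)
    then have "u f - ?d f = u (\<lambda>z. f z - q z) - ?d (\<lambda>z. f z - q z)"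
      using bounded_functional_diff[OF lin f qX] bounded_functional_diff[OF dual_functional_linear[OF l g] f qX] by simp
    also have "cmod \<dots> \<le> cmod (u (\<lambda>z. f z - q z)) + cmod (?d (\<lambda>z. f z - q z))" by (rule norm_triangle_ineq4)
    also have "\<dots> \<le> \<bar>C\<bar> * nrm ?X (\<lambda>z. f z - q z) + D * nrm ?X (\<lambda>z. f z - q z)"
    proof (rule add_mono)
      have "C * nrm ?X (\<lambda>z. f z - q z) \<le> \<bar>C\<bar> * nrm ?X (\<lambda>z. f z - q z)"
        using F_one_nrm_nonneg[OF fq] by (intro mult_right_mono) auto
      then show "cmod (u (\<lambda>z. f z - q z)) \<le> \<bar>C\<bar> * nrm ?X (\<lambda>z. f z - q z)" using C[OF fq] by linarith
      show "cmod (?d (\<lambda>z. f z - q z)) \<le> D * nrm ?X (\<lambda>z. f z - q z)"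
        unfolding D_def by (rule dual_functional_bound[OF l g fq])
    qed
    also have "\<dots> = (\<bar>C\<bar> + D) * nrm ?X (\<lambda>z. f z - q z)" by (simp add: distrib_right)
    also have "\<dots> \<le> (\<bar>C\<bar> + D + 1) * \<epsilon>"
      using Q D0 F_one_nrm_nonneg[OF fq] by (intro mult_mono) (auto simp: q_def)
    also have "\<dots> = e" using K by (simp add: \<epsilon>_def)
    finally show ?thesis by simp
  qed
  then have "cmod (u f - ?d f) \<le> 0" by (rule field_le_epsilon)
  then show ?thesis by simp
qed

theorem F_inf_is_dual:
  assumes l: "l \<ge> 1" and a: "\<alpha> > 0"
  shows "is_dual_wrt (E_class l) (pairing l \<alpha>) (F_space \<infinity> l (\<alpha> / 2)) (F_space 1 l (2 * \<alpha>))"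
proof -
  let ?X = "F_space 1 l (2 * \<alpha>)"
  let ?Y = "F_space \<infinity> l (\<alpha> / 2)"
  let ?s = "2 powr (1 / real l)"
  have a2: "2 * \<alpha> > 0" using a by simp
  obtain K where K: "K > 0" "\<And>z. nrm ?X (kernel_at l \<alpha> z) \<le> K * exp (\<alpha> / 4 * cmod z ^ (2 * l))"
    by (rule kernel_F_one_bound[OF l a]) blast
  have KX: "kernel_at l \<alpha> z \<in> elts ?X" for z
    using kernel_at_in_E_class[OF l a] E_class_subset_F_one[OF l a2] by blast
  have 1: "\<exists>u. bounded_functional ?X u \<and> represents (E_class l) (pairing l \<alpha>) u g" if g: "g \<in> elts ?Y" for g
  proof (intro exI conjI)
    show "bounded_functional ?X (dual_functional l \<alpha> g)"
      unfolding bounded_functional_def using dual_functional_linear[OF l g] dual_functional_bound[OF l g] by blast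
    show "represents (E_class l) (pairing l \<alpha>) (dual_functional l \<alpha> g) g"
      unfolding represents_def using dual_functional_eq_pairing[OF l a g] by blast
  qed
  have 2: "\<exists>!g. g \<in> elts ?Y \<and> represents (E_class l) (pairing l \<alpha>) u g" if u: "bounded_functional ?X u" for u
  proof (rule ex1I)
    show "(\<lambda>z. cnj (u (kernel_at l \<alpha> z))) \<in> elts ?Y \<and> represents (E_class l) (pairing l \<alpha>) u (\<lambda>z. cnj (u (kernel_at l \<alpha> z)))"
      using bounded_functional_symbol[OF l a u] by blast
    show "g = (\<lambda>z. cnj (u (kernel_at l \<alpha> z)))" if "g \<in> elts ?Y \<and> represents (E_class l) (pairing l \<alpha>) u g" for g
      using represents_symbol_eq[OF l a] that by blast
  qed
  have 3: "1 / K * nrm ?Y g \<le> functional_norm ?X u \<and> functional_norm ?X u \<le> ?s * nrm ?Y g"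
    if g: "g \<in> elts ?Y" and u: "bounded_functional ?X u" and r: "represents (E_class l) (pairing l \<alpha>) u g" for u g
  proof
    let ?n = "functional_norm ?X u"
    have ub: "cmod (u f) \<le> ?n * nrm ?X f" if "f \<in> elts ?X" for f
      by (rule functional_norm_bound[OF u F_one_nrm_nonneg _ that]) (auto simp: F_one_cmult)
    have "nrm ?X (\<lambda>z. 1) > 0"
    proof -
      have "(\<lambda>z. 1) \<in> elts ?X" using monomial_in_F_one[OF l a2, of 1 0] by simp
      obtain D where D: "D \<ge> 0" "\<And>f. f \<in> elts ?X \<Longrightarrow> cmod (f 0) \<le> D * nrm ?X f"
        by (rule F_one_pointwise[OF l a2, of 0]) blast
      from D(2)[OF \<open>(\<lambda>z. 1) \<in> elts ?X\<close>] show ?thesis using F_one_nrm_nonneg[OF \<open>(\<lambda>z. 1) \<in> elts ?X\<close>]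
        by (cases "nrm ?X (\<lambda>z. 1) = 0") auto
    qed
    moreover have "0 \<le> ?n * nrm ?X (\<lambda>z. 1)"
      using ub[of "\<lambda>z. 1"] monomial_in_F_one[OF l a2, of 1 0] order_trans[OF norm_ge_zero] by simp
    ultimately have n0: "?n \<ge> 0" by (simp add: zero_le_mult_iff)
    have ge: "g \<in> entire" by (rule F_inf_D(1)[OF g])
    have "nrm ?Y g \<le> ?n * K"
    proof (rule F_inf_I(2)[OF ge])
      fix z
      have "cmod (g z) = cmod (u (kernel_at l \<alpha> z))" by (subst represents_symbol_eq[OF l a g r]) simp
      also have "\<dots> \<le> ?n * nrm ?X (kernel_at l \<alpha> z)" by (rule ub[OF KX])
      also have "\<dots> \<le> ?n * (K * exp (\<alpha> / 4 * cmod z ^ (2 * l)))" by (intro mult_left_mono K n0)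
      finally show "weighted l (\<alpha> / 2) g z \<le> ?n * K" by (simp add: weighted_le_iff mult.assoc)
    qed
    then show "1 / K * nrm ?Y g \<le> ?n" using K(1) by (simp add: field_simps)
    show "?n \<le> ?s * nrm ?Y g"
      unfolding functional_norm_def
    proof (rule cSUP_least)
      have "(\<lambda>z. 0 * z ^ 0) \<in> elts ?X" by (rule monomial_in_F_one[OF l a2])
      moreover have "nrm ?X (\<lambda>z. 0 * 1) = cmod 0 * nrm ?X (\<lambda>z. 1)"
        using monomial_in_F_one[OF l a2, of 1 0] by (intro F_one_cmult(2)) simp
      ultimately show "{f \<in> elts ?X. nrm ?X f \<le> 1} \<noteq> {}" by (auto intro!: exI[of _ "\<lambda>z. 0"])
      fix f assume "f \<in> {f \<in> elts ?X. nrm ?X f \<le> 1}"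
      then have f: "f \<in> elts ?X" "nrm ?X f \<le> 1" by auto
      have "cmod (u f) \<le> ?s * nrm ?Y g * nrm ?X f"
        unfolding bounded_functional_eq_dual_functional[OF l a g u r f(1)] by (rule dual_functional_bound[OF l g f(1)])
      also have "\<dots> \<le> ?s * nrm ?Y g * 1"
        using f(2) F_inf_nrm_nonneg[OF g] by (intro mult_left_mono) auto
      finally show "cmod (u f) \<le> ?s * nrm ?Y g" by simp
    qed
  qed
  have "\<exists>C>0. \<forall>u. \<forall>g\<in>elts ?Y. bounded_functional ?X u \<and> represents (E_class l) (pairing l \<alpha>) u g \<longrightarrow>
    1 / K * nrm ?Y g \<le> functional_norm ?X u \<and> functional_norm ?X u \<le> C * nrm ?Y g"
    by (rule exI[of _ ?s]) (use 3 in simp)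
  moreover have "1 / K > 0" using K(1) by simp
  ultimately have "\<exists>c>0. \<exists>C>0. \<forall>u. \<forall>g\<in>elts ?Y. bounded_functional ?X u \<and> represents (E_class l) (pairing l \<alpha>) u g \<longrightarrow>
    c * nrm ?Y g \<le> functional_norm ?X u \<and> functional_norm ?X u \<le> C * nrm ?Y g"
    by blast
  then show ?thesis unfolding is_dual_wrt_def using 1 2 by blast
qed

section \<open>The Bergman projection\<close>

lemma bergman_kernel_cnj:
  assumes l: "l \<ge> 1" and a: "\<alpha> > 0"
  shows "bergman_kernel l \<alpha> z w = cnj (kernel_at l \<alpha> z w)"
proof -
  have "(\<lambda>m. cnj z ^ m / of_real (power_moment l \<alpha> m) * w ^ m) sums kernel_at l \<alpha> z w"
    using kernel_at_power_sum[OF l a, of z] by (simp add: power_sum_def)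
  then have "(\<lambda>m. cnj (cnj z ^ m / of_real (power_moment l \<alpha> m) * w ^ m)) sums cnj (kernel_at l \<alpha> z w)"
    unfolding sums_cnj .
  moreover have "(\<lambda>m. cnj w ^ m / of_real (power_moment l \<alpha> m) * z ^ m) sums kernel_at l \<alpha> w z"
    using kernel_at_power_sum[OF l a, of w] by (simp add: power_sum_def)
  then have "(\<lambda>m. cnj (cnj z ^ m / of_real (power_moment l \<alpha> m) * w ^ m)) sums kernel_at l \<alpha> w z"
    by (simp add: mult.commute)
  ultimately have "cnj (kernel_at l \<alpha> z w) = kernel_at l \<alpha> w z" by (rule sums_unique2)
  then show ?thesis by (simp add: kernel_at_def)
qed

lemma lebesgue_id_measurable: "(\<lambda>z. z) \<in> borel_measurable lebesgue"
  by (rule measurable_completion) simp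

lemma bergman_proj_eq:
  assumes l: "l \<ge> 1" and a: "\<alpha> > 0"
  shows "bergman_proj l \<alpha> \<phi> z
    = cnj (LINT w|lebesgue. kernel_at l \<alpha> z w * (cnj (\<phi> w) * of_real (exp (- \<alpha> * cmod w ^ (2 * l)))))"
proof -
  have "bergman_proj l \<alpha> \<phi> z
    = (LINT w|lebesgue. cnj (kernel_at l \<alpha> z w * (cnj (\<phi> w) * of_real (exp (- \<alpha> * cmod w ^ (2 * l))))))"
    by (simp add: bergman_proj_def bergman_kernel_cnj[OF l a] mult.assoc)
  then show ?thesis by (simp only: Bochner_Integration.integral_cnj)
qed

text \<open>The modulus of the kernel times the weight in the projection is exactly the integrand of the norm of the
kernel in \<open>F_space 1 l (2 * \<alpha>)\<close>.\<close>
lemma bergman_proj_L_inf: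
  assumes l: "l \<ge> 1" and a: "\<alpha> > 0" and \<phi>: "\<phi> \<in> L_inf"
  shows "bergman_proj l \<alpha> \<phi> \<in> elts (F_space \<infinity> l (\<alpha> / 2))"
proof -
  let ?X = "F_space 1 l (2 * \<alpha>)"
  have a2: "2 * \<alpha> > 0" using a by simp
  have \<phi>m [measurable]: "\<phi> \<in> borel_measurable lebesgue" using \<phi> by (simp add: L_inf_def)
  have s: "esssup lebesgue (\<lambda>z. ereal (cmod (\<phi> z))) < \<infinity>" using \<phi> by (simp add: L_inf_def)
  have "AE z in lebesgue. ereal (cmod (\<phi> z)) \<le> esssup lebesgue (\<lambda>z. ereal (cmod (\<phi> z)))" by (rule esssup_AE)
  moreover obtain B where B: "B \<ge> 0" "esssup lebesgue (\<lambda>z. ereal (cmod (\<phi> z))) \<le> ereal B"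
  proof (cases "esssup lebesgue (\<lambda>z. ereal (cmod (\<phi> z)))")
    case (real r)
    then show ?thesis using that[of "\<bar>r\<bar>"] by simp
  next
    case PInf
    then show ?thesis using s by simp
  next
    case MInf
    then show ?thesis using that[of 0] by simp
  qed
  ultimately have AE: "AE z in lebesgue. cmod (\<phi> z) \<le> B"
    by (auto elim!: eventually_mono dest: order_trans)
  define h where "h w = cnj (\<phi> w) * of_real (exp (- \<alpha> * cmod w ^ (2 * l)))" for w
  have idm [measurable]: "(\<lambda>z::complex. z) \<in> borel_measurable lebesgue" by (rule lebesgue_id_measurable)
  have cb [measurable]: "k \<in> borel_measurable lebesgue" if "k \<in> borel_measurable borel" for k :: "complex \<Rightarrow> complex"
    using that by (intro measurable_completion) simp
  have cbr [measurable]: "k \<in> borel_measurable lebesgue" if "k \<in> borel_measurable borel" for k :: "complex \<Rightarrow> real"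
    using that by (intro measurable_completion) simp
  have cnjphi [measurable]: "(\<lambda>w. cnj (\<phi> w)) \<in> borel_measurable lebesgue"
    by (rule measurable_compose[OF \<phi>m borel_measurable_cnj])
  have em [measurable]: "(\<lambda>w::complex. exp (c * cmod w ^ (2 * l))) \<in> borel_measurable lebesgue" for c
    by (rule cbr) measurable
  have emc [measurable]: "(\<lambda>w::complex. complex_of_real (exp (c * cmod w ^ (2 * l)))) \<in> borel_measurable lebesgue" for c
    by (rule measurable_compose[OF em borel_measurable_complex_of_real])
  have hm: "h \<in> borel_measurable lebesgue"
    unfolding h_def[abs_def] by (intro borel_measurable_times cnjphi emc)
  have dom: "integrable lebesgue (\<lambda>w::complex. B * exp (- (\<alpha> / 2) * cmod w ^ (2 * l)))"
  proof -
    have "integrable lborel (\<lambda>w::complex. B * exp (- (\<alpha> / 2) * cmod w ^ (2 * l)))"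
      by (intro integrable_mult_right integrable_norm_exp l) (use a in simp)
    then show ?thesis by (subst integrable_completion) auto
  qed
  have hi: "integrable lebesgue (\<lambda>w. exp (\<alpha> / 2 * cmod w ^ (2 * l)) * cmod (h w))"
  proof (rule Bochner_Integration.integrable_bound[OF dom])
    show "(\<lambda>w. exp (\<alpha> / 2 * cmod w ^ (2 * l)) * cmod (h w)) \<in> borel_measurable lebesgue"
      by (intro borel_measurable_times em measurable_compose[OF hm borel_measurable_norm])
    show "AE w in lebesgue. norm (exp (\<alpha> / 2 * cmod w ^ (2 * l)) * cmod (h w)) \<le> norm (B * exp (- (\<alpha> / 2) * cmod w ^ (2 * l)))"
      using AE
    proof eventually_elim
      case (elim w)
      have "exp (\<alpha> / 2 * cmod w ^ (2 * l)) * cmod (h w) = cmod (\<phi> w) * (exp (\<alpha> / 2 * cmod w ^ (2 * l)) * exp (- \<alpha> * cmod w ^ (2 * l)))"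
        by (simp add: h_def norm_mult)
      also have "exp (\<alpha> / 2 * cmod w ^ (2 * l)) * exp (- \<alpha> * cmod w ^ (2 * l)) = exp (- (\<alpha> / 2) * cmod w ^ (2 * l))"
        by (simp add: exp_add[symmetric])
      also have "cmod (\<phi> w) * exp (- (\<alpha> / 2) * cmod w ^ (2 * l)) \<le> B * exp (- (\<alpha> / 2) * cmod w ^ (2 * l))"
        using elim by (intro mult_right_mono) auto
      finally show ?case using B(1) by simp
    qed
  qed
  have ah: "\<alpha> / 2 > 0" using a by simp
  note K = E_class_integral_sums[OF kernel_at_in_E_class[OF l a] kernel_at_power_sum[OF l a] ah hm idm hi]
  define d where "d m = cnj (LINT w|lebesgue. w ^ m * h w) / of_real (power_moment l \<alpha> m)" for m
  have ps: "power_sum d (bergman_proj l \<alpha> \<phi>)"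
    unfolding power_sum_def
  proof
    fix z
    have "(\<lambda>m. cnj (cnj z ^ m / of_real (power_moment l \<alpha> m) * (LINT w|lebesgue. w ^ m * h w))) sums bergman_proj l \<alpha> \<phi> z"
      unfolding bergman_proj_eq[OF l a] sums_cnj h_def[symmetric] by (rule K(1))
    then show "(\<lambda>m. d m * z ^ m) sums bergman_proj l \<alpha> \<phi> z" by (simp add: d_def mult.commute)
  qed
  obtain C where C: "C > 0" "\<And>z. nrm ?X (kernel_at l \<alpha> z) \<le> C * exp (\<alpha> / 4 * cmod z ^ (2 * l))"
    by (rule kernel_F_one_bound[OF l a]) blast
  show ?thesis
  proof (rule F_inf_I(1)[OF power_sum_entire[OF ps], of _ _ "B * C"])
    fix z
    have KE: "kernel_at l \<alpha> z \<in> E_class l" by (rule kernel_at_in_E_class[OF l a])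
    then have KX: "kernel_at l \<alpha> z \<in> elts ?X" using E_class_subset_F_one[OF l a2] by blast
    have i: "integrable lborel (weighted l (2 * \<alpha>) (kernel_at l \<alpha> z))" using KX by (simp add: F_one_elts)
    have i': "integrable lebesgue (weighted l (2 * \<alpha>) (kernel_at l \<alpha> z))"
      using i by (subst integrable_completion) auto
    have "cmod (bergman_proj l \<alpha> \<phi> z) = norm (LINT w|lebesgue. kernel_at l \<alpha> z w * h w)"
      unfolding bergman_proj_eq[OF l a] h_def[symmetric] by simp
    also have "\<dots> \<le> (LINT w|lebesgue. norm (kernel_at l \<alpha> z w * h w))" by (rule integral_norm_bound)
    also have "\<dots> \<le> (LINT w|lebesgue. B * weighted l (2 * \<alpha>) (kernel_at l \<alpha> z) w)"
    proof (rule integral_mono_AE)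
      show "integrable lebesgue (\<lambda>w. norm (kernel_at l \<alpha> z w * h w))" using K(2) by (rule integrable_norm)
      show "integrable lebesgue (\<lambda>w. B * weighted l (2 * \<alpha>) (kernel_at l \<alpha> z) w)" using i' by (rule integrable_mult_right)
      show "AE w in lebesgue. norm (kernel_at l \<alpha> z w * h w) \<le> B * weighted l (2 * \<alpha>) (kernel_at l \<alpha> z) w"
        using AE
      proof eventually_elim
        case (elim w)
        have "norm (kernel_at l \<alpha> z w * h w) = cmod (\<phi> w) * (cmod (kernel_at l \<alpha> z w) * exp (- \<alpha> * cmod w ^ (2 * l)))"
          by (simp add: h_def norm_mult)
        also have "\<dots> \<le> B * (cmod (kernel_at l \<alpha> z w) * exp (- \<alpha> * cmod w ^ (2 * l)))"
          using elim by (intro mult_right_mono) auto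
        finally show ?case by (simp add: weighted_def)
      qed
    qed
    also have "\<dots> = B * (LINT w|lborel. weighted l (2 * \<alpha>) (kernel_at l \<alpha> z) w)"
      using i by (simp add: integral_completion)
    also have "\<dots> = B * nrm ?X (kernel_at l \<alpha> z)" by (simp add: F_one_nrm[OF E_class_entire[OF KE]])
    also have "\<dots> \<le> B * (C * exp (\<alpha> / 4 * cmod z ^ (2 * l)))" by (intro mult_left_mono C B)
    finally show "weighted l (\<alpha> / 2) (bergman_proj l \<alpha> \<phi>) z \<le> B * C"
      by (simp add: weighted_le_iff mult.assoc)
  qed
qed

text \<open>The preimage is \<open>g\<close>, dilated and damped, chosen so that its projection at \<open>z\<close>
is the conjugate of the dual functional of \<open>g\<close> at the kernel.\<close>
lemma F_inf_subset_bergman_proj: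
  assumes l: "l \<ge> 1" and a: "\<alpha> > 0" and g: "g \<in> elts (F_space \<infinity> l (\<alpha> / 2))"
  shows "g \<in> bergman_proj l \<alpha> ` L_inf"
proof
  let ?s = "2 powr (1 / real l)"
  define \<phi> where "\<phi> w = of_real ?s * g (of_real ?s * w) * of_real (exp (- \<alpha> * cmod w ^ (2 * l)))" for w
  have ge: "g \<in> entire" by (rule F_inf_D(1)[OF g])
  have gm [measurable]: "g \<in> borel_measurable borel" by (rule entire_measurable[OF ge])
  have \<phi>m [measurable]: "\<phi> \<in> borel_measurable borel" unfolding \<phi>_def[abs_def] by measurable
  let ?B = "?s * nrm (F_space \<infinity> l (\<alpha> / 2)) g"
  have bnd: "cmod (\<phi> w) \<le> ?B" for w
  proof -
    have "cmod (\<phi> w) = ?s * (cmod (g (of_real ?s * w)) * exp (- \<alpha> * cmod w ^ (2 * l)))"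
      by (simp add: \<phi>_def norm_mult)
    also have "\<dots> \<le> ?s * ((nrm (F_space \<infinity> l (\<alpha> / 2)) g * exp (\<alpha> * cmod w ^ (2 * l))) * exp (- \<alpha> * cmod w ^ (2 * l)))"
      by (intro mult_left_mono mult_right_mono dilated_F_inf_growth[OF l g]) auto
    also have "\<dots> = ?B" by (simp add: exp_minus)
    finally show ?thesis .
  qed
  have \<phi>L: "\<phi> \<in> borel_measurable lebesgue" by (rule measurable_completion) simp
  have "(\<lambda>z. ereal (cmod (\<phi> z))) \<in> borel_measurable lebesgue" by (rule measurable_completion) measurable
  then have "esssup lebesgue (\<lambda>z. ereal (cmod (\<phi> z))) \<le> ereal ?B"
    by (rule esssup_I) (use bnd in auto)
  then have "esssup lebesgue (\<lambda>z. ereal (cmod (\<phi> z))) < \<infinity>" by (rule le_less_trans) simp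
  then show "\<phi> \<in> L_inf" using \<phi>L by (simp add: L_inf_def)
  show "g = bergman_proj l \<alpha> \<phi>"
  proof
    fix z
    let ?K = "kernel_at l \<alpha> z"
    have KE: "?K \<in> E_class l" by (rule kernel_at_in_E_class[OF l a])
    have Km [measurable]: "?K \<in> borel_measurable borel" by (rule entire_measurable[OF E_class_entire[OF KE]])
    have "bergman_proj l \<alpha> \<phi> z = cnj (LINT w|lborel. ?K w * (cnj (\<phi> w) * of_real (exp (- \<alpha> * cmod w ^ (2 * l)))))"
      unfolding bergman_proj_eq[OF l a] by (subst integral_completion) measurable
    also have "(\<lambda>w. ?K w * (cnj (\<phi> w) * of_real (exp (- \<alpha> * cmod w ^ (2 * l)))))
      = (\<lambda>w. of_real ?s * (?K w * cnj (g (of_real ?s * w)) * of_real (exp (- (2 * \<alpha>) * cmod w ^ (2 * l)))))"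
    proof
      fix w
      have "exp (- \<alpha> * cmod w ^ (2 * l)) * exp (- \<alpha> * cmod w ^ (2 * l)) = exp (- (2 * \<alpha>) * cmod w ^ (2 * l))"
        by (simp add: exp_add[symmetric])
      then have "complex_of_real (exp (- \<alpha> * cmod w ^ (2 * l))) * of_real (exp (- \<alpha> * cmod w ^ (2 * l))) = of_real (exp (- (2 * \<alpha>) * cmod w ^ (2 * l)))"
        by (simp only: of_real_mult[symmetric])
      then show "?K w * (cnj (\<phi> w) * of_real (exp (- \<alpha> * cmod w ^ (2 * l))))
        = of_real ?s * (?K w * cnj (g (of_real ?s * w)) * of_real (exp (- (2 * \<alpha>) * cmod w ^ (2 * l))))"
        unfolding \<phi>_def complex_cnj_mult complex_cnj_complex_of_real by (simp only: mult_ac)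
    qed
    also have "cnj (LINT w|lborel. of_real ?s * (?K w * cnj (g (of_real ?s * w)) * of_real (exp (- (2 * \<alpha>) * cmod w ^ (2 * l)))))
      = cnj (dual_functional l \<alpha> g ?K)"
      by (simp only: dual_functional_def integral_mult_right_zero)
    also have "dual_functional l \<alpha> g ?K = pairing l \<alpha> ?K g" by (rule dual_functional_eq_pairing[OF l a g KE])
    also have "\<dots> = cnj (g z)"
      by (rule pairing_kernel_at[OF l a ge _ F_inf_growth[OF g]]) (use a in simp)
    finally show "g z = bergman_proj l \<alpha> \<phi> z" by simp
  qed
qed

theorem F_inf_eq_bergman_proj_L_inf:
  assumes l: "l \<ge> 1" and a: "\<alpha> > 0"
  shows "elts (F_space \<infinity> l (\<alpha> / 2)) = bergman_proj l \<alpha> ` L_inf"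
  using F_inf_subset_bergman_proj[OF l a] bergman_proj_L_inf[OF l a] by blast

section \<open>Hankel forms, duality and weak products\<close>

lemma same_space_sym:
  assumes "X \<doteq> Y" shows "Y \<doteq> X"
proof -
  obtain c C where c: "c > 0" "C > 0" "\<And>h. h \<in> elts X \<Longrightarrow> c * nrm X h \<le> nrm Y h \<and> nrm Y h \<le> C * nrm X h"
    and e: "elts X = elts Y" using assms unfolding same_space_def by blast
  have "\<forall>h\<in>elts Y. 1 / C * nrm Y h \<le> nrm X h \<and> nrm X h \<le> 1 / c * nrm Y h"
    using c e by (auto simp: field_simps)
  moreover have "1 / C > 0" "1 / c > 0" using c by auto
  ultimately show ?thesis unfolding same_space_def using e by blast
qed

lemma same_space_trans:
  assumes "X \<doteq> Y" "Y \<doteq> Z" shows "X \<doteq> Z"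
proof -
  obtain c C where c: "c > 0" "C > 0" "\<And>h. h \<in> elts X \<Longrightarrow> c * nrm X h \<le> nrm Y h \<and> nrm Y h \<le> C * nrm X h"
    and e: "elts X = elts Y" using assms(1) unfolding same_space_def by blast
  obtain d D where d: "d > 0" "D > 0" "\<And>h. h \<in> elts Y \<Longrightarrow> d * nrm Y h \<le> nrm Z h \<and> nrm Z h \<le> D * nrm Y h"
    and e': "elts Y = elts Z" using assms(2) unfolding same_space_def by blast
  have "d * c * nrm X h \<le> nrm Z h \<and> nrm Z h \<le> D * C * nrm X h" if h: "h \<in> elts X" for h
  proof
    have "d * (c * nrm X h) \<le> d * nrm Y h" using c(3)[OF h] d(1) by (intro mult_left_mono) auto
    then show "d * c * nrm X h \<le> nrm Z h" using d(3)[of h] h e by (simp add: mult.assoc)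
    have "D * nrm Y h \<le> D * (C * nrm X h)" using c(3)[OF h] d(2) by (intro mult_left_mono) auto
    then show "nrm Z h \<le> D * C * nrm X h" using d(3)[of h] h e by (simp add: mult.assoc)
  qed
  moreover have "d * c > 0" "D * C > 0" using c d by auto
  ultimately show ?thesis unfolding same_space_def using e e' by blast
qed

theorem theorem1p2:
  fixes p q \<alpha> :: real and l :: nat and b :: "complex \<Rightarrow> complex"
  assumes "1 < p" and "1 / p + 1 / q = 1" and "l \<ge> 1" and "\<alpha> > 0" and "b \<in> H_inf l \<alpha>"
  shows
    "((extends_to_bounded_bilinear_form (E_class l) (hankel_form l \<alpha> b)
          (F_space (ereal p) l \<alpha>) (F_space (ereal q) l \<alpha>)
        \<longleftrightarrow> b \<in> elts (F_space \<infinity> l (\<alpha> / 2))) \<and>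
      (extends_to_bounded_bilinear_form (E_class l) (hankel_form l \<alpha> b)
          (F_space 1 l \<alpha>) (f_inf_space l \<alpha>)
        \<longleftrightarrow> b \<in> elts (F_space \<infinity> l (\<alpha> / 2)))) \<and>
     (elts (F_space \<infinity> l (\<alpha> / 2)) = bergman_proj l \<alpha> ` L_inf \<and>
      is_dual_wrt (E_class l) (pairing l \<alpha>) (F_space \<infinity> l (\<alpha> / 2)) (F_space 1 l (2 * \<alpha>))) \<and>
     (F_space (ereal p) l \<alpha> \<odot> F_space (ereal q) l \<alpha> \<doteq> F_space 1 l \<alpha> \<odot> f_inf_space l \<alpha> \<and>
      F_space 1 l \<alpha> \<odot> f_inf_space l \<alpha> \<doteq> F_space 1 l \<alpha> \<odot> F_space \<infinity> l \<alpha> \<and>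
      F_space 1 l \<alpha> \<odot> F_space \<infinity> l \<alpha> \<doteq> F_space 1 l (2 * \<alpha>))"
proof -
  interpret pq: hankel_pair l \<alpha> "F_space (ereal p) l \<alpha>" "F_space (ereal q) l \<alpha>"
    using assms by (intro hankel_pair_finite_exponents)
  interpret f: hankel_pair l \<alpha> "F_space 1 l \<alpha>" "f_inf_space l \<alpha>"
    using assms by (intro hankel_pair_f_inf)
  interpret inf: hankel_pair l \<alpha> "F_space 1 l \<alpha>" "F_space \<infinity> l \<alpha>"
    using assms by (intro hankel_pair_F_inf)
  note pq_eq = pq.weak_product_eq_F_one
  note f_eq = f.weak_product_eq_F_one
  note inf_eq = inf.weak_product_eq_F_one
  show ?thesis
    using pq.Hankel_form_bounded_iff[OF assms(5)] f.Hankel_form_bounded_iff[OF assms(5)]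
      F_inf_eq_bergman_proj_L_inf[OF assms(3,4)] F_inf_is_dual[OF assms(3,4)]
      same_space_trans[OF pq_eq same_space_sym[OF f_eq]] same_space_trans[OF f_eq same_space_sym[OF inf_eq]] inf_eq
    by blast
qed

end
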